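(* Below $\mathcal F_0(t)=\sum_{n\ge1}f_nt^n$ is the planar limit of the indicated formal potential, $\mathcal G_0=\mathcal F_0'$, $f_0=0$, and the recursions hold for all $n\ge0$. (1) For $\mathcal V_1(x)=\frac{(1+t)x^2}{2}+\frac12\log(1-tx^2)=\frac{x^2}2-\sum_{n\ge2}\frac{t^nx^{2n}}{2n}$: $$-2t+13t^2+16t^3+2(1-9t+3t^2+45t^3+32t^4)\mathcal G_0+64t^3(1+t)^2\mathcal G_0^2=0,$$ $$t(8+7t)-2(3-4t-21t^2-14t^3)\mathcal F_0'-2t(1-5t-13t^2-7t^3)\mathcal F_0''=0,\quad\mathcal F_0(0)=\mathcal F_0'(0)=0,$$ $$49n^2(1+n)f_n+7(1+n)^2(32+21n)f_{n+1}+(2+n)(544+543n+139n^2)f_{n+2}+(3+n)(224+157n+33n^2)f_{n+3}-8(2+n)(4+n)(6+n)f_{n+4}=0$$ with $f_1=0,f_2=\frac12,f_3=\frac56$. For large $n$, $$f_n=\frac{147}{512}\sqrt{\frac{7}{2\pi}}\,\frac{7^n}{n^{7/2}}\Big(1-\frac{105}{32n}+\frac{16065}{2048n^2}-\frac{1109115}{65536n^3}+O\Big(\frac1{n^4}\Big)\Big).$$ (2) For $\mathcal V_2(x)=\frac{x^2}{2}+\sqrt t\,x+\log(1-\sqrt t\,x)=\frac{x^2}{2}-\sum_{n\ge2}\frac{t^{n/2}x^n}{n}$: $$1-13t+22t^2-9t^3-t^4+(-2+32t-108t^2+76t^3+2t^4)\mathcal G_0-108t^3\mathcal G_0^2=0,$$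 $$3-5t+t^2+t^3-2(3-17t+5t^2+t^3)\mathcal F_0'-2t(1-11t+11t^2-t^3)\mathcal F_0''=0,\quad\mathcal F_0(0)=0,\ \mathcal F_0'(0)=\tfrac12,$$ $$(n-2)(n-1)nf_n-2(n-1)(n+1)(2+5n)f_{n+1}-(2+n)(44+25n+5n^2)f_{n+2}+4(3+n)(116+91n+17n^2)f_{n+3}$$ $$-(4+n)(1326+701n+89n^2)f_{n+4}+2(5+n)(6+n)(85+19n)f_{n+5}-3(5+n)(6+n)(8+n)f_{n+6}=0$$ with $f_1=\frac12,f_2=\frac34,f_3=\frac83,f_4=12,f_5=\frac{312}5$. For large $n$, $$f_n=\frac{2}{3\sqrt\pi}\sqrt[4]{\frac23}\,\frac{(5+2\sqrt6)^n}{n^{7/2}}\Big(1-\frac{45\sqrt6}{32n}+\frac{8435}{1024n^2}-\frac{238805\sqrt6}{32768n^3}+O\Big(\frac1{n^4}\Big)\Big).$$ (3) For $\mathcal V_3(x)=\frac{(1+t)x^2}{2}+\sqrt t\,x+\log(1-\sqrt t\,x)=\frac{x^2}2-\sum_{n\ge3}\frac{t^{n/2}x^n}{n}$: $$-2t+11t^2+65t^3+107t^4+81t^5+27t^6+(2-20t-22t^2+184t^3+560t^4+700t^5+432t^6+108t^7)\mathcal G_0$$ $$+(108t^3+540t^4+1080t^5+1080t^6+540t^7+108t^8)\mathcal G_0^2=0,$$ $$-8t-35t^2-44t^3-16t^4-6(-1+15t^2+34t^3+28t^4+8t^5)\mathcal F_0'-2(-t+5t^2+29t^3+47t^4+32t^5+8t^6)\mathcal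 F_0''=0,\quad\mathcal F_0(0)=\mathcal F_0'(0)=0,$$ $$128n^2(2+n)f_n+32(1+n)(66+97n+27n^2)f_{n+1}+8(2+n)(1836+1568n+305n^2)f_{n+2}$$ $$+4(3+n)(9972+6193n+929n^2)f_{n+3}+(4+n)(54276+26661n+3257n^2)f_{n+4}$$ $$+(5+n)(38220+15479n+1595n^2)f_{n+5}+3(6+n)(3972+1349n+121n^2)f_{n+6}$$ $$+5(7+n)(36+5n+n^2)f_{n+7}-8(6+n)(8+n)(10+n)f_{n+8}=0$$ with $f_1=0,f_2=\frac12,f_3=\frac32,f_4=\frac{47}8,f_5=\frac{139}5,f_6=\frac{430}3,f_7=\frac{11175}{14}$. For large $n$, $$f_n=c\,\frac{(4+2\sqrt6)^n}{n^{7/2}}\Big(1-\frac{5(62-23\sqrt6)}{8n}+\frac{35(4567-1858\sqrt6)}{64n^2}-\frac{35(2608410-1064767\sqrt6)}{512n^3}+O\Big(\frac1{n^4}\Big)\Big),\quad c=\frac{32}{3\sqrt{(267+109\sqrt6)\pi}}.$$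
   Context: For a formal potential $\frac{x^2}2-\sum_{n\ge1}\frac{a_n}{n}x^n$ with indeterminate $a_n$, let $\mathcal A=\mathbb Q[[a_1,a_2,\dots]]$. With $\mathcal H_N$ the $N\times N$ Hermitian matrices, put $$\mathcal Z=\frac{\int_{\mathcal H_N}\exp\!\big(-N\,\mathrm{Tr}(M^2/2)+N\sum_{n\ge1}\frac{a_n}{n}\mathrm{Tr}(M^n)\big)dM}{\int_{\mathcal H_N}\exp(-N\,\mathrm{Tr}(M^2/2))dM},$$ expanded in powers of the $a_n$ and integrated coefficient by coefficient against the normalized Gaussian; $\log\mathcal Z=\sum_{g\ge0}N^{2-2g}\mathcal F_g$ with $\mathcal F_g\in\mathcal A$, and $\mathcal F_0$ is the formal planar limit. For a specific potential whose coefficients $a_n$ depend on $t$, the planar limit $\mathcal F_0(t)\in\mathbb Q[[t]]$ is obtained by substituting those coefficients: in (1), $a_{2n}=t^n$ for $n\ge2$ and all other $a_n=0$; in (2), $a_n=t^{n/2}$ for $n\ge2$ and $a_1=0$; in (3), $a_n=t^{n/2}$ for $n\ge3$ and $a_1=a_2=0$. Primes denote $d/dt$. *)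

theory Defs
  imports
    Complex_Main
    "HOL-Library.Multiset"
    "HOL-Library.Landau_Symbols"
    "HOL-Computational_Algebra.Formal_Power_Series"
    "HOL-Computational_Algebra.Formal_Laurent_Series"
    "HOL-Analysis.Lebesgue_Measure"
    "HOL-Analysis.Finite_Product_Measure"
    "HOL-Analysis.Bochner_Integration"
    "Jordan_Normal_Form.Matrix"
begin

section \<open>Formal power series in the indeterminates \<open>a\<^sub>1, a\<^sub>2, \<dots>\<close>\<close>

text \<open>
  A series is given by its coefficients; the multiset \<open>m\<close> stands for the monomial that is the
  product of the indeterminates indexed by its elements, counted with multiplicity. The index
  \<open>0\<close> is not used: every series below has coefficient \<open>0\<close> at monomials containing it.
\<close>

type_synonym 'a mseries = "nat multiset \<Rightarrow> 'a"

definition mone :: "'a::comm_ring_1 mseries" where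
  "mone = (\<lambda>m. if m = {#} then 1 else 0)"

definition mtimes :: "'a::comm_ring_1 mseries \<Rightarrow> 'a mseries \<Rightarrow> 'a mseries" where
  "mtimes f g = (\<lambda>m. \<Sum>k | k \<subseteq># m. f k * g (m - k))"

primrec mpower :: "'a::comm_ring_1 mseries \<Rightarrow> nat \<Rightarrow> 'a mseries" where
  "mpower f 0 = mone"
| "mpower f (Suc k) = mtimes f (mpower f k)"

text \<open>
  The exponential of a series with constant term \<open>0\<close> and the logarithm of a series with constant
  term \<open>1\<close>. If \<open>f\<close> has constant term \<open>0\<close>, then \<open>f\<^sup>k\<close> has no monomial of degree less than \<open>k\<close>, so
  truncating at \<open>k = size m\<close> omits only zero terms.
\<close>

definition mexp :: "'a::field_char_0 mseries \<Rightarrow> 'a mseries" where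
  "mexp f = (\<lambda>m. \<Sum>k\<le>size m. mpower f k m / fact k)"

definition mlog :: "'a::field_char_0 mseries \<Rightarrow> 'a mseries" where
  "mlog f = (\<lambda>m. \<Sum>k=1..size m. (- 1) ^ (k + 1) / of_nat k * mpower (\<lambda>m. f m - mone m) k m)"

text \<open>
  Substitution of power series in one variable for the indeterminates. Only the nonzero terms are
  summed; in the uses below there are finitely many of them for each power of the variable.
\<close>

definition msubst :: "rat mseries \<Rightarrow> (nat \<Rightarrow> rat fps) \<Rightarrow> rat fps" where
  "msubst f a = Abs_fps (\<lambda>d.
     \<Sum>m | f m * fps_nth (\<Prod>n\<in>#m. a n) d \<noteq> 0. f m * fps_nth (\<Prod>n\<in>#m. a n) d)"


section \<open>The Gaussian Hermitian matrix integral\<close>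

definition mat_trace :: "complex mat \<Rightarrow> complex" where
  "mat_trace M = (\<Sum>i<dim_row M. M $$ (i, i))"

text \<open>
  Linear coordinates on the space of \<open>N \<times> N\<close> Hermitian matrices: for \<open>i < j\<close>, the entry at
  \<open>(i, j)\<close> has real part \<open>x (i, j)\<close> and imaginary part \<open>x (j, i)\<close>. The measure \<open>dM\<close> is Lebesgue
  measure in these coordinates; its normalization cancels in \<open>gaussian_mean\<close>.
\<close>

definition hermitian_mat :: "nat \<Rightarrow> (nat \<times> nat \<Rightarrow> real) \<Rightarrow> complex mat" where
  "hermitian_mat N x = mat N N (\<lambda>(i, j).
     if i < j then Complex (x (i, j)) (x (j, i))
     else if j < i then Complex (x (j, i)) (- x (i, j))
     else complex_of_real (x (i, i)))"

definition hermitian_coords :: "nat \<Rightarrow> (nat \<times> nat \<Rightarrow> real) measure" where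
  "hermitian_coords N = PiM ({..<N} \<times> {..<N}) (\<lambda>_. lborel)"

definition gaussian_weight :: "nat \<Rightarrow> complex mat \<Rightarrow> complex" where
  "gaussian_weight N M = exp (- of_nat N * mat_trace (M ^\<^sub>m 2) / 2)"

definition gaussian_mean :: "nat \<Rightarrow> (complex mat \<Rightarrow> complex) \<Rightarrow> complex" where
  "gaussian_mean N f =
     (LINT x|hermitian_coords N. gaussian_weight N (hermitian_mat N x) * f (hermitian_mat N x)) /
     (LINT x|hermitian_coords N. gaussian_weight N (hermitian_mat N x))"

text \<open>The linear series \<open>N \<cdot> (\<Sum>n\<ge>1. a\<^sub>n / n \<cdot> Tr M\<^sup>n)\<close>.\<close>

definition interaction :: "nat \<Rightarrow> complex mat \<Rightarrow> complex mseries" where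
  "interaction N M = (\<lambda>m. \<Sum>n\<in>set_mset m.
     if n \<ge> 1 \<and> m = {#n#} then of_nat N / of_nat n * mat_trace (M ^\<^sub>m n) else 0)"

definition partition_function :: "nat \<Rightarrow> complex mseries" where
  "partition_function N = (\<lambda>m. gaussian_mean N (\<lambda>M. mexp (interaction N M) m))"


section \<open>Genus expansion and planar limit\<close>

text \<open>
  \<open>F g\<close> is the genus \<open>g\<close> free energy. At each monomial only finitely many genera contribute, and
  the expansion holds for every matrix size \<open>N\<close>; this determines \<open>F\<close>.
\<close>

definition is_genus_expansion :: "(nat \<Rightarrow> rat mseries) \<Rightarrow> bool" where
  "is_genus_expansion F \<longleftrightarrow>
     (\<forall>m. finite {g. F g m \<noteq> 0}) \<and>
     (\<forall>N\<ge>1. \<forall>m. mlog (partition_function N) m =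
        (\<Sum>g | F g m \<noteq> 0. of_nat N powi (2 - 2 * int g) * of_rat (F g m)))"

definition genus_free_energy :: "nat \<Rightarrow> rat mseries" where
  "genus_free_energy = (THE F. is_genus_expansion F)"

definition formal_planar_limit :: "rat mseries" where
  "formal_planar_limit = genus_free_energy 0"

text \<open>
  The values of the \<open>a\<^sub>n\<close> involve half-integer powers of \<open>t\<close>. They are therefore given as power
  series in the variable \<open>s\<close> with \<open>t = s\<^sup>2\<close>; the planar limit is a series in \<open>t\<close> itself.
\<close>

definition planar_limit :: "(nat \<Rightarrow> rat fps) \<Rightarrow> rat fps" where
  "planar_limit a = (THE f. fps_compose f (fps_X ^ 2) = msubst formal_planar_limit a)"


section \<open>Three potentials\<close>

text \<open>
  Potentials are series in \<open>x\<close> (\<open>fps_X\<close>) over Laurent series in \<open>s\<close> (\<open>fls_X\<close>), a field, so that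
  \<open>fps_ln 1\<close>, the series of \<open>log (1 + x)\<close>, is available.
\<close>

definition formal_potential :: "(nat \<Rightarrow> rat fps) \<Rightarrow> rat fls fps" where
  "formal_potential a = fps_const (1/2) * fps_X ^ 2
     - Abs_fps (\<lambda>n. if n = 0 then 0 else fps_to_fls (a n) / of_nat n)"

definition coeffs1 :: "nat \<Rightarrow> rat fps" where
  "coeffs1 n = (if even n \<and> n \<ge> 4 then fps_X ^ n else 0)"

definition coeffs2 :: "nat \<Rightarrow> rat fps" where
  "coeffs2 n = (if n \<ge> 2 then fps_X ^ n else 0)"

definition coeffs3 :: "nat \<Rightarrow> rat fps" where
  "coeffs3 n = (if n \<ge> 3 then fps_X ^ n else 0)"

definition potential1 :: "rat fls fps" where
  "potential1 = (let t = fls_X ^ 2 in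
     fps_const ((1 + t) / 2) * fps_X ^ 2
     + fps_const (1/2) * fps_compose (fps_ln 1) (- (fps_const t * fps_X ^ 2)))"

definition potential2 :: "rat fls fps" where
  "potential2 = (let s = fls_X in
     fps_const (1/2) * fps_X ^ 2 + fps_const s * fps_X
     + fps_compose (fps_ln 1) (- (fps_const s * fps_X)))"

definition potential3 :: "rat fls fps" where
  "potential3 = (let s = fls_X; t = s ^ 2 in
     fps_const ((1 + t) / 2) * fps_X ^ 2 + fps_const s * fps_X
     + fps_compose (fps_ln 1) (- (fps_const s * fps_X)))"

end

theory Submission
  imports
    Defs
    "HOL-Probability.Distributions"
    "HOL-Analysis.FPS_Convergence"
    "HOL-Analysis.Generalised_Binomial_Theorem"
    "HOL-Analysis.Gamma_Function"
    "HOL-Real_Asymp.Real_Asymp"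
begin

text \<open>
  Integration by parts against the Gaussian weight gives the Schwinger-Dyson equations, that is, the
  loop equations for \<open>k \<partial>/\<partial>a\<^sub>k log Z\<close>. They determine the coefficients of \<open>log Z\<close> recursively, which yields
  the genus expansion and, at leading order, \<open>W\<^sub>k = \<Sum>\<^sub>i\<^sub>+\<^sub>j\<^sub>=\<^sub>k\<^sub>-\<^sub>2 W\<^sub>i W\<^sub>j + \<Sum>\<^sub>n a\<^sub>n W\<^sub>k\<^sub>+\<^sub>n\<^sub>-\<^sub>2\<close>.

  For \<open>a\<^sub>n = t\<^bsup>n/2\<^esup>\<close> the last sum telescopes up to boundary terms, so the generating function of the \<open>W\<^sub>k\<close> satisfies a
  quadratic equation with one catalytic variable and one unknown boundary series. The quadratic method gives a
  rational parametrization, whose elimination is the quadratic equation \<open>\<alpha> G\<^sup>2 + \<beta> G + \<gamma> = 0\<close>.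

  The discriminant \<open>(2 \<alpha> G + \<beta>)\<^sup>2\<close> is a product of powers of a few small factors, so \<open>2 \<alpha> G + \<beta>\<close> solves a
  first-order linear equation; this is the differential equation, and its coefficients give the recursion. It also shows
  that the dominant singularity is \<open>(1 - \<lambda> t)\<^bsup>3/2\<^esup>\<close> times an analytic factor. The coefficient asymptotics
  follow by expanding that factor at the singularity and from Wallis' product.
\<close>

section \<open>Differentiation, exponential and logarithm of multivariate series\<close>

text \<open>No derivative is taken in the integration by parts: all functions that occur are
  polynomials in the matrix entries, so moment identities in one variable, tested against monomials,
  suffice and boundary terms never arise. At finite N the loop equations involve second derivatives
  of log Z and are not closed. What turns them into a recursion is the weight of a monomial, the sum
  of its indices: it drops by two at each use, even where the degree grows. The same drop gives
  parity, hence a planar limit in integer powers of t. At genus zero the second derivatives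
  disappear, being of order \<open>N^2\<close> but divided by \<open>N^4\<close>. The sum over n in
  the planar equation becomes infinite after substitution. Each moment therefore carries its factor
  \<open>s^k\<close> with \<open>t = s^2\<close>; its order in t is then at least k/2, and all sums
  over k are finite in each degree. An error \<open>O(1/n^4)\<close> requires four Taylor terms at
  the singularity. Coefficients of half-integer powers of 1 - x are rational multiples of those of
  the power -1/2, so a single asymptotic series has to be established.\<close>

lemma sum_mset_eq_sum_count:
  fixes f :: "'b \<Rightarrow> 'a::comm_semiring_1"
  shows "(\<Sum>n\<in>#A. f n) = (\<Sum>n\<in>set_mset A. of_nat (count A n) * f n)"
proof (induction A)
  case (add a A)
  have "(\<Sum>n\<in>set_mset (add_mset a A). of_nat (count (add_mset a A) n) * f n)
      = (\<Sum>n\<in>insert a (set_mset A). (if n = a then f n else 0) + of_nat (count A n) * f n)"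
    by (intro sum.cong) (auto simp: algebra_simps)
  also have "\<dots> = f a + (\<Sum>n\<in>insert a (set_mset A). of_nat (count A n) * f n)"
    by (simp add: sum.distrib sum.delta)
  also have "(\<Sum>n\<in>insert a (set_mset A). of_nat (count A n) * f n) = (\<Sum>n\<in>set_mset A. of_nat (count A n) * f n)"
    by (rule sum.mono_neutral_right) (auto simp: not_in_iff)
  finally show ?case using add by simp
qed simp

lemma finite_submultisets: "finite {k. k \<subseteq># (m :: 'a multiset)}"
proof -
  have "{k. k \<subseteq># m} \<subseteq> (\<Union>n\<le>size m. {k. set_mset k \<subseteq> set_mset m \<and> size k = n})"
  proof
    fix k assume "k \<in> {k. k \<subseteq># m}"
    hence "set_mset k \<subseteq> set_mset m" "size k \<le> size m"
      by (simp_all add: set_mset_mono size_mset_mono)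
    thus "k \<in> (\<Union>n\<le>size m. {k. set_mset k \<subseteq> set_mset m \<and> size k = n})" by blast
  qed
  moreover have "finite (\<Union>n\<le>size m. {k. set_mset k \<subseteq> set_mset m \<and> size k = n})"
  proof (rule finite_UN_I)
    fix n
    have "{k. set_mset k \<subseteq> set_mset m \<and> size k = n}
        \<subseteq> mset ` {xs. set xs \<subseteq> set_mset m \<and> length xs = n}"
    proof
      fix k assume "k \<in> {k. set_mset k \<subseteq> set_mset m \<and> size k = n}"
      moreover obtain xs where "k = mset xs" using ex_mset by metis
      ultimately show "k \<in> mset ` {xs. set xs \<subseteq> set_mset m \<and> length xs = n}"
        by (intro image_eqI[of _ _ xs]) simp_all
    qed
    thus "finite {k. set_mset k \<subseteq> set_mset m \<and> size k = n}"
      by (rule finite_subset) (intro finite_imageI finite_lists_length_eq finite_set_mset)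
  qed simp
  ultimately show ?thesis by (rule finite_subset)
qed

lemma mtimes_comm: "mtimes f g = mtimes g f"
proof
  fix m
  show "mtimes f g m = mtimes g f m"
    unfolding mtimes_def
  proof (rule sum.reindex_bij_witness[where i = "\<lambda>k. m - k" and j = "\<lambda>k. m - k"])
    fix k assume "k \<in> {k. k \<subseteq># m}"
    then obtain j where "m = k + j" by (metis mem_Collect_eq subset_mset.add_diff_inverse)
    thus "m - (m - k) = k" "m - k \<in> {k. k \<subseteq># m}" "g (m - k) * f (m - (m - k)) = f k * g (m - k)"
      by (simp_all add: mult.commute)
    thus "m - (m - k) = k" "m - k \<in> {k. k \<subseteq># m}" by simp_all
  qed
qed

lemma mtimes_assoc: "mtimes (mtimes f g) h = mtimes f (mtimes g h)"
proof
  fix m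
  have "mtimes (mtimes f g) h m
      = (\<Sum>(k, l)\<in>(SIGMA k:{k. k \<subseteq># m}. {l. l \<subseteq># k}). f l * g (k - l) * h (m - k))"
    by (simp add: mtimes_def sum_distrib_right sum.Sigma finite_submultisets)
  also have "\<dots> = (\<Sum>(l, j)\<in>(SIGMA l:{l. l \<subseteq># m}. {j. j \<subseteq># m - l}). f l * (g j * h (m - l - j)))"
  proof (rule sum.reindex_bij_witness[where i = "\<lambda>(l, j). (l + j, l)" and j = "\<lambda>(k, l). (l, k - l)"])
    fix p assume "p \<in> (SIGMA k:{k. k \<subseteq># m}. {l. l \<subseteq># k})"
    then obtain k l where p: "p = (k, l)" "k \<subseteq># m" "l \<subseteq># k" by blast
    then obtain j where j: "k = l + j" by (metis subset_mset.add_diff_inverse)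
    then obtain i where i: "m = l + j + i" using p(2) by (metis subset_mset.add_diff_inverse)
    show "(case case p of (k, l) \<Rightarrow> (l, k - l) of (l, j) \<Rightarrow> (l + j, l)) = p"
      "(case p of (k, l) \<Rightarrow> (l, k - l)) \<in> (SIGMA l:{l. l \<subseteq># m}. {j. j \<subseteq># m - l})"
      "(case case p of (k, l) \<Rightarrow> (l, k - l) of (l, j) \<Rightarrow> f l * (g j * h (m - l - j)))
        = (case p of (k, l) \<Rightarrow> f l * g (k - l) * h (m - k))"
      by (simp_all add: p(1) i j mult.assoc ac_simps)
  next
    fix q assume "q \<in> (SIGMA l:{l. l \<subseteq># m}. {j. j \<subseteq># m - l})"
    then obtain l j where q: "q = (l, j)" "l \<subseteq># m" "j \<subseteq># m - l" by blast
    then obtain r where r: "m = l + r" by (metis subset_mset.add_diff_inverse)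
    then obtain i where i: "r = j + i" using q(3) by (metis add_diff_cancel_left' subset_mset.add_diff_inverse)
    show "(case case q of (l, j) \<Rightarrow> (l + j, l) of (k, l) \<Rightarrow> (l, k - l)) = q"
      "(case q of (l, j) \<Rightarrow> (l + j, l)) \<in> (SIGMA k:{k. k \<subseteq># m}. {l. l \<subseteq># k})"
      by (simp_all add: q(1) i r)
  qed
  also have "\<dots> = mtimes f (mtimes g h) m"
    by (simp add: mtimes_def sum_distrib_left sum.Sigma finite_submultisets)
  finally show "mtimes (mtimes f g) h m = mtimes f (mtimes g h) m" .
qed

lemma mtimes_mone_right [simp]: "mtimes f mone = f"
proof
  fix m
  have "mtimes f mone m = (\<Sum>k | k \<subseteq># m. if k = m then f m else 0)"
    unfolding mtimes_def mone_def
    by (intro sum.cong) (auto simp: Diff_eq_empty_iff_mset subset_mset.antisym)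
  thus "mtimes f mone m = f m" by (simp add: finite_submultisets)
qed

lemma mtimes_mone_left [simp]: "mtimes mone f = f"
  by (subst mtimes_comm) simp

lemma mtimes_add_right: "mtimes f (\<lambda>m. g m + h m) m = mtimes f g m + mtimes f h m"
  by (simp add: mtimes_def distrib_left sum.distrib)

lemma mtimes_scale_right: "mtimes f (\<lambda>m. c * g m) m = c * mtimes f g m"
  by (simp add: mtimes_def sum_distrib_left algebra_simps)

lemma mtimes_scale_left: "mtimes (\<lambda>m. c * f m) g m = c * mtimes f g m"
  by (simp add: mtimes_def sum_distrib_left algebra_simps)

lemma mtimes_add_left: "mtimes (\<lambda>m. f m + g m) h m = mtimes f h m + mtimes g h m"
  by (simp add: mtimes_def distrib_right sum.distrib)

lemma mtimes_sum_right: "mtimes f (\<lambda>m. \<Sum>i\<in>I. g i m) m = (\<Sum>i\<in>I. mtimes f (g i) m)"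
  by (simp add: mtimes_def sum_distrib_left, subst sum.swap) simp

lemma mtimes_cong:
  assumes "\<And>k. k \<subseteq># m \<Longrightarrow> f k = f' k" "\<And>k. k \<subseteq># m \<Longrightarrow> g k = g' k"
  shows "mtimes f g m = mtimes f' g' m"
  unfolding mtimes_def using assms by (intro sum.cong) auto

section \<open>Partial derivatives, and the derivatives of exponential and logarithm\<close>

definition mderiv :: "nat \<Rightarrow> 'a::comm_ring_1 mseries \<Rightarrow> 'a mseries" where
  "mderiv k f = (\<lambda>m. of_nat (count m k + 1) * f (add_mset k m))"

lemma mderiv_mone [simp]: "mderiv k mone m = 0"
  by (simp add: mderiv_def mone_def)

text \<open>The exponent of the variable \<open>k\<close> in a monomial is the sum of its exponents
  in two complementary factors, so the factor \<open>count m k + 1\<close> splits inside each term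
  of the convolution. Each half is reindexed by removing one copy of \<open>k\<close>; terms without
  \<open>k\<close> carry the factor zero.\<close>

lemma mderiv_mtimes:
  "mderiv k (mtimes f g) m = mtimes (mderiv k f) g m + mtimes f (mderiv k g) m"
proof -
  have *: "(\<Sum>j | j \<subseteq># add_mset k m. of_nat (count j k) * f j * g (add_mset k m - j))
      = mtimes (mderiv k f) g m" for f g :: "'a mseries"
  proof -
    have "(\<Sum>j | j \<subseteq># add_mset k m. of_nat (count j k) * f j * g (add_mset k m - j))
       = (\<Sum>j | j \<subseteq># add_mset k m \<and> k \<in># j. of_nat (count j k) * f j * g (add_mset k m - j))"
      by (rule sum.mono_neutral_right) (auto simp: finite_submultisets not_in_iff)
    also have "\<dots> = mtimes (mderiv k f) g m"
      unfolding mtimes_def mderiv_def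
    proof (rule sum.reindex_bij_witness[where i = "add_mset k" and j = "\<lambda>j. j - {#k#}"])
      fix j assume "j \<in> {j. j \<subseteq># add_mset k m \<and> k \<in># j}"
      then obtain i where "j = add_mset k i" "j \<subseteq># add_mset k m" by (auto dest: multi_member_split)
      thus "add_mset k (j - {#k#}) = j" "j - {#k#} \<in> {k. k \<subseteq># m}"
        "of_nat (count (j - {#k#}) k + 1) * f (add_mset k (j - {#k#})) * g (m - (j - {#k#}))
         = of_nat (count j k) * f j * g (add_mset k m - j)"
        by simp_all
    qed simp_all
    finally show ?thesis .
  qed
  have "mderiv k (mtimes f g) m = (\<Sum>j | j \<subseteq># add_mset k m.
      of_nat (count j k) * f j * g (add_mset k m - j)
      + of_nat (count (add_mset k m - j) k) * f j * g (add_mset k m - j))"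
    unfolding mderiv_def mtimes_def sum_distrib_left
  proof (intro sum.cong refl)
    fix j assume "j \<in> {j. j \<subseteq># add_mset k m}"
    hence "count m k + 1 = count j k + count (add_mset k m - j) k"
      using mset_subset_eq_count[of j "add_mset k m" k] by simp
    thus "of_nat (count m k + 1) * (f j * g (add_mset k m - j)) =
        of_nat (count j k) * f j * g (add_mset k m - j)
        + of_nat (count (add_mset k m - j) k) * f j * g (add_mset k m - j)"
      by (simp only: of_nat_add distrib_right mult.assoc)
  qed
  also have "\<dots> = mtimes (mderiv k f) g m
      + (\<Sum>j | j \<subseteq># add_mset k m. of_nat (count (add_mset k m - j) k) * f j * g (add_mset k m - j))"
    by (simp add: sum.distrib *)
  also have "(\<Sum>j | j \<subseteq># add_mset k m. of_nat (count (add_mset k m - j) k) * f j * g (add_mset k m - j))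
     = (\<Sum>j | j \<subseteq># add_mset k m. of_nat (count j k) * g j * f (add_mset k m - j))"
    using fun_cong[OF mtimes_comm[of "\<lambda>j. f j" "\<lambda>j. of_nat (count j k) * g j"], of "add_mset k m"]
    by (simp add: mtimes_def mult_ac)
  also have "\<dots> = mtimes f (mderiv k g) m" by (simp add: * mtimes_comm)
  finally show ?thesis .
qed

lemma mderiv_mpower:
  "mderiv k (mpower u (Suc n)) m = of_nat (Suc n) * mtimes (mpower u n) (mderiv k u) m"
proof (induction n arbitrary: m)
  case (Suc n)
  have "mderiv k (mpower u (Suc (Suc n))) m
      = mtimes (mderiv k u) (mpower u (Suc n)) m + mtimes u (mderiv k (mpower u (Suc n))) m"
    by (simp only: mpower.simps(2)[of u "Suc n"] mderiv_mtimes)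
  also have "mtimes u (mderiv k (mpower u (Suc n))) m
      = of_nat (Suc n) * mtimes (mpower u (Suc n)) (mderiv k u) m"
    unfolding ext[OF Suc.IH] mtimes_scale_right by (simp add: mtimes_assoc)
  finally show ?case by (simp add: mtimes_comm[of "mderiv k u"] algebra_simps)
qed (simp add: mtimes_comm)

lemma mpower_eq_0:
  assumes "u {#} = 0" "size m < n"
  shows "mpower u n m = 0"
  using assms(2)
proof (induction n arbitrary: m)
  case (Suc n)
  have "u k * mpower u n (m - k) = 0" if "k \<subseteq># m" for k
  proof (cases "k = {#}")
    case False
    hence "size k > 0" "size m = size k + size (m - k)"
      using size_mset_mono[OF that] size_Diff_submset[OF that] by (auto simp: nonempty_has_size)
    hence "size (m - k) < n" using Suc.prems by linarith
    thus ?thesis using Suc.IH by simp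
  qed (simp add: assms)
  thus ?case by (simp add: mtimes_def)
qed simp

lemma mexp_cutoff:
  assumes "f {#} = 0" "size m \<le> K"
  shows "mexp f m = (\<Sum>k\<le>K. mpower f k m / fact k)"
  unfolding mexp_def using assms
  by (intro sum.mono_neutral_left) (auto simp: mpower_eq_0)

lemma mexp_empty [simp]: "mexp f {#} = 1"
  by (simp add: mexp_def mone_def)

lemma mlog_empty [simp]: "mlog f {#} = 0"
  by (simp add: mlog_def)

text \<open>The truncation order of the exponential depends on the monomial. All submonomials of
  \<open>m\<close> are therefore given the common cutoff \<open>size m\<close>, which makes the
  truncated sum a fixed linear combination of powers that passes through the product.\<close>

lemma mderiv_mexp:
  fixes f :: "'a::field_char_0 mseries"
  assumes "f {#} = 0"
  shows "mderiv k (mexp f) m = mtimes (mexp f) (mderiv k f) m"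
proof -
  let ?n = "size m"
  have "mderiv k (mexp f) m = (\<Sum>j\<le>Suc ?n. mderiv k (mpower f j) m / fact j)"
    by (simp add: mderiv_def mexp_def sum_distrib_left del: sum.atMost_Suc)
  also have "\<dots> = (\<Sum>j\<le>?n. mtimes (mpower f j) (mderiv k f) m / fact j)"
    by (simp add: sum.atMost_Suc_shift mderiv_mpower del: sum.atMost_Suc mpower.simps(2) of_nat_Suc)
  also have "\<dots> = mtimes (mderiv k f) (\<lambda>m'. \<Sum>j\<le>?n. (1 / fact j) * mpower f j m') m"
    by (simp only: mtimes_sum_right mtimes_scale_right) (simp add: mtimes_comm[of "mderiv k f"])
  also have "\<dots> = mtimes (mderiv k f) (mexp f) m"
    by (intro mtimes_cong refl)
       (simp add: mexp_cutoff[of f _ ?n] assms size_mset_mono)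
  finally show ?thesis by (simp add: mtimes_comm)
qed

text \<open>The derivative of the logarithm is \<open>mderiv k f\<close> times the geometric series
  \<open>v\<close> in 1 - f, and \<open>v\<close> is inverse to \<open>f\<close>. Keeping the factor
  \<open>f\<close> on the left avoids a division of series.\<close>

lemma mderiv_mlog:
  fixes f :: "'a::field_char_0 mseries"
  assumes "f {#} = 1"
  shows "mtimes f (mderiv k (mlog f)) m = mderiv k f m"
proof -
  define u where "u = (\<lambda>m. f m - mone m)"
  define v where "v = (\<lambda>m :: nat multiset. \<Sum>j\<le>size m. (- 1) ^ j * mpower u j m)"
  have u0: "u {#} = 0" by (simp add: u_def assms mone_def)
  have v_cutoff: "v k = (\<Sum>j\<le>K. (- 1) ^ j * mpower u j k)" if "size k \<le> K" for k K
    unfolding v_def using that by (intro sum.mono_neutral_left) (auto simp: mpower_eq_0 u0)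
  have du: "mderiv k u = mderiv k f"
    by (auto simp: u_def mderiv_def mone_def)
  have log: "mderiv k (mlog f) = mtimes v (mderiv k f)"
  proof
    fix m :: "nat multiset"
    let ?n = "size m"
    have "mderiv k (mlog f) m
        = (\<Sum>j=1..Suc ?n. (- 1) ^ (j + 1) / of_nat j * mderiv k (mpower u j) m)"
      unfolding mderiv_def mlog_def u_def[symmetric] size_add_mset sum_distrib_left
      by (intro sum.cong refl) (simp only: mult.left_commute)
    also have "\<dots> = (\<Sum>j=0..?n. (- 1) ^ j * mtimes (mpower u j) (mderiv k f) m)"
      using sum.shift_bounds_cl_Suc_ivl[of "\<lambda>j. (- 1) ^ (j + 1) / of_nat j * mderiv k (mpower u j) m" 0 ?n]
      by (simp add: mderiv_mpower du del: sum.cl_ivl_Suc mpower.simps(2) of_nat_Suc)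
    also have "\<dots> = mtimes (mderiv k f) (\<lambda>m'. \<Sum>j\<le>?n. (- 1) ^ j * mpower u j m') m"
      by (simp only: mtimes_sum_right mtimes_scale_right atMost_atLeast0)
         (simp add: mtimes_comm[of "mderiv k f"])
    also have "\<dots> = mtimes (mderiv k f) v m"
      by (intro mtimes_cong refl) (simp add: v_cutoff[where K = ?n] size_mset_mono)
    finally show "mderiv k (mlog f) m = mtimes v (mderiv k f) m" by (simp add: mtimes_comm)
  qed
  have "mtimes f v = mone"
  proof
    fix m :: "nat multiset"
    let ?n = "size m"
    have f: "f = (\<lambda>m. u m + mone m)" by (simp add: u_def)
    have "mtimes f v m = mtimes f (\<lambda>m'. \<Sum>j\<le>?n. (- 1) ^ j * mpower u j m') m"
      by (intro mtimes_cong refl) (simp add: v_cutoff[where K = ?n] size_mset_mono)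
    also have "\<dots> = (\<Sum>j\<le>?n. (- 1) ^ j * mtimes f (mpower u j) m)"
      by (simp only: mtimes_sum_right mtimes_scale_right)
    also have "\<dots> = (\<Sum>j\<le>?n. (- 1) ^ j * mpower u j m - (- 1) ^ Suc j * mpower u (Suc j) m)"
      by (subst f) (simp add: mtimes_add_left algebra_simps)
    also have "\<dots> = (- 1) ^ 0 * mpower u 0 m - (- 1) ^ Suc ?n * mpower u (Suc ?n) m"
      by (rule sum_telescope)
    \<comment> \<open>The remainder of the telescoped geometric sum contains only monomials larger
      than \<open>m\<close>.\<close>
    also have "mpower u (Suc ?n) m = 0" by (rule mpower_eq_0[of u, OF u0]) simp
    finally show "mtimes f v m = mone m" by simp
  qed
  thus ?thesis by (simp add: log mtimes_assoc[symmetric])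
qed

section \<open>Gaussian integration by parts\<close>

definition gauss_moment :: "real \<Rightarrow> nat \<Rightarrow> real" where
  "gauss_moment \<alpha> k = (LINT x|lborel. exp (- \<alpha> * x\<^sup>2) * x ^ k)"

lemma gauss_moment_has_integral:
  assumes "\<alpha> > 0"
  shows "has_bochner_integral lborel (\<lambda>x. exp (- \<alpha> * x\<^sup>2) * x ^ (2 * k))
           (sqrt (pi / \<alpha>) * (fact (2 * k) / ((4 * \<alpha>) ^ k * fact k)))"
    and "has_bochner_integral lborel (\<lambda>x. exp (- \<alpha> * x\<^sup>2) * x ^ (2 * k + 1)) 0"
proof -
  define \<sigma> where "\<sigma> = 1 / sqrt (2 * \<alpha>)"
  have \<sigma>: "\<sigma> > 0" "\<sigma>\<^sup>2 = 1 / (2 * \<alpha>)"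
    using assms by (simp_all add: \<sigma>_def power_divide)
  have e: "exp (- \<alpha> * x\<^sup>2) = sqrt (pi / \<alpha>) * normal_density 0 \<sigma> x" for x
    using assms by (simp add: normal_density_def \<sigma>(2) field_simps real_sqrt_divide)
  show "has_bochner_integral lborel (\<lambda>x. exp (- \<alpha> * x\<^sup>2) * x ^ (2 * k))
           (sqrt (pi / \<alpha>) * (fact (2 * k) / ((4 * \<alpha>) ^ k * fact k)))"
    using has_bochner_integral_mult_right[of "sqrt (pi / \<alpha>)", OF normal_moment_even[OF \<sigma>(1), of 0 k]]
    unfolding e \<sigma>(2) by (simp add: mult.assoc)
  show "has_bochner_integral lborel (\<lambda>x. exp (- \<alpha> * x\<^sup>2) * x ^ (2 * k + 1)) 0"
    using has_bochner_integral_mult_right[of "sqrt (pi / \<alpha>)", OF normal_moment_odd[OF \<sigma>(1), of 0 k]]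
    unfolding e by (simp add: mult.assoc)
qed

lemma gauss_moment_integrable:
  fixes \<alpha> :: real
  assumes "\<alpha> > 0"
  shows "integrable lborel (\<lambda>x. exp (- \<alpha> * x\<^sup>2) * x ^ k)"
  using gauss_moment_has_integral(1)[OF assms, of "k div 2"] gauss_moment_has_integral(2)[OF assms, of "k div 2"]
  by (cases "even k") (auto elim!: evenE oddE dest: integrable.intros)

lemma gauss_moment_even:
  assumes "\<alpha> > 0"
  shows "gauss_moment \<alpha> (2 * k) = sqrt (pi / \<alpha>) * (fact (2 * k) / ((4 * \<alpha>) ^ k * fact k))"
  unfolding gauss_moment_def
  using gauss_moment_has_integral(1)[OF assms] by (rule has_bochner_integral_integral_eq)

lemma gauss_moment_odd:
  assumes "\<alpha> > 0"
  shows "gauss_moment \<alpha> (2 * k + 1) = 0"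
  unfolding gauss_moment_def
  using gauss_moment_has_integral(2)[OF assms] by (rule has_bochner_integral_integral_eq)

lemma gauss_moment_0_pos: "\<alpha> > 0 \<Longrightarrow> gauss_moment \<alpha> 0 > 0"
  using gauss_moment_even[of \<alpha> 0] by simp

text \<open>Integration by parts in one variable, read off from the closed form of the moments. At
  \<open>k = 0\<close> the truncated index \<open>k - 1\<close> does no harm, as its factor
  vanishes.\<close>

lemma gauss_moment_Suc:
  assumes "\<alpha> > 0"
  shows "gauss_moment \<alpha> (Suc k) = of_nat k / (2 * \<alpha>) * gauss_moment \<alpha> (k - 1)"
proof (cases "even k")
  case True
  then obtain j where "k = 2 * j" by blast
  thus ?thesis using gauss_moment_odd[OF assms, of j] gauss_moment_odd[OF assms, of "j - 1"]
    by (cases j) auto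
next
  case False
  then obtain j where k: "k = 2 * j + 1" by (blast elim: oddE)
  have f: "(fact (2 * Suc j) :: real) = 2 * real (Suc j) * ((2 * real j + 1) * fact (2 * j))"
    by (simp add: algebra_simps)
  have "(fact (2 * Suc j) / ((4 * \<alpha>) ^ Suc j * fact (Suc j)) :: real)
      = (2 * real j + 1) / (2 * \<alpha>) * (fact (2 * j) / ((4 * \<alpha>) ^ j * fact j))"
    unfolding f fact_Suc power_Suc of_nat_mult using assms by (simp add: divide_simps del: of_nat_Suc)
  hence "gauss_moment \<alpha> (2 * Suc j) = (2 * real j + 1) / (2 * \<alpha>) * gauss_moment \<alpha> (2 * j)"
    unfolding gauss_moment_even[OF assms] by (simp only: mult.left_commute)
  thus ?thesis by (simp add: k)
qed

section \<open>Gaussian integrals in finitely many real coordinates\<close>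

definition gweight :: "'i set \<Rightarrow> ('i \<Rightarrow> real) \<Rightarrow> ('i \<Rightarrow> real) \<Rightarrow> complex" where
  "gweight I \<alpha> x = (\<Prod>c\<in>I. complex_of_real (exp (- \<alpha> c * (x c)\<^sup>2)))"

definition gmono :: "'i multiset \<Rightarrow> ('i \<Rightarrow> real) \<Rightarrow> complex" where
  "gmono m x = (\<Prod>c\<in>#m. complex_of_real (x c))"

lemma gmono_empty [simp]: "gmono {#} x = 1"
  and gmono_add [simp]: "gmono (add_mset c m) x = complex_of_real (x c) * gmono m x"
  by (simp_all add: gmono_def)

lemma gmono_eq_prod:
  assumes "finite I" "set_mset m \<subseteq> I"
  shows "gmono m x = (\<Prod>c\<in>I. complex_of_real (x c) ^ count m c)"
  using assms(2)
proof (induction m)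
  case (add d m)
  have "(\<Prod>c\<in>I. complex_of_real (x c) ^ count (add_mset d m) c)
      = (\<Prod>c\<in>I. (if c = d then complex_of_real (x c) else 1) * complex_of_real (x c) ^ count m c)"
    by (intro prod.cong) auto
  also have "\<dots> = (\<Prod>c\<in>I. if c = d then complex_of_real (x c) else 1)
      * (\<Prod>c\<in>I. complex_of_real (x c) ^ count m c)"
    by (rule prod.distrib)
  finally show ?case using add assms(1) by simp
qed simp

locale gaussian_integral =
  fixes I :: "'i set" and \<alpha> :: "'i \<Rightarrow> real"
  assumes finite_I: "finite I" and \<alpha>_pos: "\<And>c. c \<in> I \<Longrightarrow> \<alpha> c > 0"
begin

abbreviation "PM \<equiv> PiM I (\<lambda>_. lborel :: real measure)"

definition gint :: "(('i \<Rightarrow> real) \<Rightarrow> complex) \<Rightarrow> complex" where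
  "gint f = (LINT x|PM. gweight I \<alpha> x * f x)"

definition gable :: "(('i \<Rightarrow> real) \<Rightarrow> complex) \<Rightarrow> bool" where
  "gable f \<longleftrightarrow> integrable PM (\<lambda>x. gweight I \<alpha> x * f x)"

lemma gable_add: "gable f \<Longrightarrow> gable g \<Longrightarrow> gable (\<lambda>x. f x + g x)"
  and gint_add: "gable f \<Longrightarrow> gable g \<Longrightarrow> gint (\<lambda>x. f x + g x) = gint f + gint g"
  by (auto simp: gable_def gint_def distrib_left)

lemma gable_scale: "gable f \<Longrightarrow> gable (\<lambda>x. a * f x)"
  and gint_scale: "gable f \<Longrightarrow> gint (\<lambda>x. a * f x) = a * gint f"
proof -
  have *: "(\<lambda>x. gweight I \<alpha> x * (a * f x)) = (\<lambda>x. a * (gweight I \<alpha> x * f x))" by (simp add: mult_ac)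
  show "gable f \<Longrightarrow> gable (\<lambda>x. a * f x)" unfolding gable_def * by simp
  show "gable f \<Longrightarrow> gint (\<lambda>x. a * f x) = a * gint f" unfolding gable_def gint_def * by simp
qed

lemma gable_sum: "(\<And>i. i \<in> A \<Longrightarrow> gable (f i)) \<Longrightarrow> gable (\<lambda>x. \<Sum>i\<in>A. f i x)"
  and gint_sum: "(\<And>i. i \<in> A \<Longrightarrow> gable (f i)) \<Longrightarrow> gint (\<lambda>x. \<Sum>i\<in>A. f i x) = (\<Sum>i\<in>A. gint (f i))"
  by (auto simp: gable_def gint_def sum_distrib_left)

lemma
  assumes "set_mset m \<subseteq> I"
  shows gable_gmono: "gable (gmono m)"
    and gint_gmono: "gint (gmono m) = of_real (\<Prod>c\<in>I. gauss_moment (\<alpha> c) (count m c))"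
proof -
  interpret product_sigma_finite "\<lambda>_::'i. lborel :: real measure" ..
  let ?f = "\<lambda>c x. complex_of_real (exp (- \<alpha> c * x\<^sup>2) * x ^ count m c)"
  have eq: "(\<lambda>x. gweight I \<alpha> x * gmono m x) = (\<lambda>x. \<Prod>c\<in>I. ?f c (x c))"
    by (simp add: gweight_def gmono_eq_prod[OF finite_I assms] prod.distrib)
  have int: "integrable lborel (?f c)" if "c \<in> I" for c
    using gauss_moment_integrable[OF \<alpha>_pos[OF that]] by (rule integrable_of_real)
  show "gable (gmono m)"
    unfolding gable_def eq by (rule product_integrable_prod[OF finite_I int])
  have "gint (gmono m) = (\<Prod>c\<in>I. LINT x|lborel. ?f c x)"
    unfolding gint_def eq by (rule product_integral_prod[OF finite_I int])
  also have "\<dots> = of_real (\<Prod>c\<in>I. gauss_moment (\<alpha> c) (count m c))"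
    by (simp only: gauss_moment_def of_real_prod integral_complex_of_real)
  finally show "gint (gmono m) = of_real (\<Prod>c\<in>I. gauss_moment (\<alpha> c) (count m c))" .
qed

lemma gint_one_nonzero: "gint (\<lambda>_. 1) \<noteq> 0"
proof -
  have "gint (gmono {#}) = of_real (\<Prod>c\<in>I. gauss_moment (\<alpha> c) 0)" by (subst gint_gmono) auto
  moreover have "(\<Prod>c\<in>I. gauss_moment (\<alpha> c) 0) > 0" by (intro prod_pos) (simp add: gauss_moment_0_pos \<alpha>_pos)
  ultimately have "gint (\<lambda>x. gmono {#} x) \<noteq> 0" by (metis less_irrefl of_real_eq_0_iff)
  thus ?thesis unfolding gmono_empty .
qed

text \<open>After factorization only the coordinate \<open>c\<close> matters. If \<open>c\<close>
  does not occur in \<open>m\<close>, then \<open>m - {#c#}\<close> is \<open>m\<close> itself and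
  the count makes the right-hand side zero, in accordance with the vanishing first moment.\<close>

lemma gint_gmono_add:
  assumes "set_mset m \<subseteq> I" "c \<in> I"
  shows "gint (gmono (add_mset c m)) = of_nat (count m c) / (2 * of_real (\<alpha> c)) * gint (gmono (m - {#c#}))"
proof -
  have sub: "set_mset (m - {#c#}) \<subseteq> I" "set_mset (add_mset c m) \<subseteq> I"
    using assms by (auto dest: in_diffD)
  have "(\<Prod>d\<in>I. gauss_moment (\<alpha> d) (count (add_mset c m) d))
      = gauss_moment (\<alpha> c) (Suc (count m c)) * (\<Prod>d\<in>I - {c}. gauss_moment (\<alpha> d) (count m d))"
    unfolding prod.remove[OF finite_I assms(2)] by (intro arg_cong2[where f = "(*)"] prod.cong) auto
  moreover have "(\<Prod>d\<in>I. gauss_moment (\<alpha> d) (count (m - {#c#}) d))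
      = gauss_moment (\<alpha> c) (count m c - 1) * (\<Prod>d\<in>I - {c}. gauss_moment (\<alpha> d) (count m d))"
    unfolding prod.remove[OF finite_I assms(2)] by (intro arg_cong2[where f = "(*)"] prod.cong) auto
  ultimately show ?thesis
    unfolding gint_gmono[OF sub(1)] gint_gmono[OF sub(2)]
    by (simp add: gauss_moment_Suc[OF \<alpha>_pos[OF assms(2)]])
qed

section \<open>Covariance and integration by parts\<close>

definition lin :: "('i \<Rightarrow> complex) \<Rightarrow> ('i \<Rightarrow> real) \<Rightarrow> complex" where
  "lin u x = (\<Sum>c\<in>I. u c * complex_of_real (x c))"

text \<open>A coordinate has variance \<open>1 / (2 * \<alpha> c)\<close>, so this is the normalized
  mean of \<open>lin u x * lin v x\<close>. There is no conjugation: the entries of a Hermitian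
  matrix are complex linear forms in the real coordinates, and products of entries are
  wanted.\<close>

definition cov :: "('i \<Rightarrow> complex) \<Rightarrow> ('i \<Rightarrow> complex) \<Rightarrow> complex" where
  "cov u v = (\<Sum>c\<in>I. u c * v c / (2 * of_real (\<alpha> c)))"

text \<open>The derivative of a monomial along the vector dual to \<open>lin u\<close> under the covariance form.\<close>

definition dmono :: "('i \<Rightarrow> complex) \<Rightarrow> 'i multiset \<Rightarrow> ('i \<Rightarrow> real) \<Rightarrow> complex" where
  "dmono u m x = (\<Sum>c\<in>I. u c / (2 * of_real (\<alpha> c)) * (of_nat (count m c) * gmono (m - {#c#}) x))"

lemma dmono_add:
  assumes "c \<in> I"
  shows "dmono u (add_mset c m) x = u c / (2 * of_real (\<alpha> c)) * gmono m x + of_real (x c) * dmono u m x"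
proof -
  have "of_nat (count (add_mset c m) d) * gmono (add_mset c m - {#d#}) x
      = (if d = c then gmono m x else 0) + of_real (x c) * (of_nat (count m d) * gmono (m - {#d#}) x)" for d
  proof (cases "d \<in># m")
    case True
    then obtain m' where "m = add_mset d m'" by (auto dest: multi_member_split)
    thus ?thesis by (auto simp: algebra_simps)
  qed (auto simp: not_in_iff)
  hence "dmono u (add_mset c m) x = (\<Sum>d\<in>I. (if d = c then u d / (2 * of_real (\<alpha> d)) * gmono m x else 0)
      + of_real (x c) * (u d / (2 * of_real (\<alpha> d)) * (of_nat (count m d) * gmono (m - {#d#}) x)))"
    unfolding dmono_def by (intro sum.cong) (auto simp: algebra_simps)
  also have "\<dots> = (\<Sum>d\<in>I. if d = c then u d / (2 * of_real (\<alpha> d)) * gmono m x else 0) + of_real (x c) * dmono u m x"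
    by (simp add: sum.distrib dmono_def sum_distrib_left)
  finally show ?thesis using assms by (simp add: sum.delta[OF finite_I])
qed

text \<open>
  \<open>g\<close> is the derivative of \<open>f\<close> along the vector dual to \<open>lin u\<close>. Testing against all monomials makes the
  relation stable under multiplication by coordinates.
\<close>

definition stein :: "('i \<Rightarrow> complex) \<Rightarrow> (('i \<Rightarrow> real) \<Rightarrow> complex) \<Rightarrow> (('i \<Rightarrow> real) \<Rightarrow> complex) \<Rightarrow> bool" where
  "stein u f g \<longleftrightarrow> (\<forall>m. set_mset m \<subseteq> I \<longrightarrow>
     gable (\<lambda>x. f x * gmono m x) \<and> gable (\<lambda>x. g x * gmono m x) \<and>
     gint (\<lambda>x. lin u x * (f x * gmono m x)) = gint (\<lambda>x. g x * gmono m x + f x * dmono u m x))"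

lemma stein_gable:
  assumes "stein u f g"
  shows "gable f" "gable g"
  using assms unfolding stein_def by (auto dest!: spec[of _ "{#}"])

lemma stein_gable_gmono:
  assumes "stein u f g" "set_mset m \<subseteq> I"
  shows "gable (\<lambda>x. f x * gmono m x)" "gable (\<lambda>x. g x * gmono m x)"
    "gable (\<lambda>x. lin v x * (f x * gmono m x))" "gable (\<lambda>x. f x * dmono v m x)"
proof -
  show a: "gable (\<lambda>x. f x * gmono m x)" "gable (\<lambda>x. g x * gmono m x)" using assms unfolding stein_def by auto
  have "gable (\<lambda>x. \<Sum>c\<in>I. v c * (f x * gmono (add_mset c m) x))"
    using assms by (intro gable_sum gable_scale) (auto simp: stein_def simp del: gmono_add)
  thus "gable (\<lambda>x. lin v x * (f x * gmono m x))" by (simp add: lin_def sum_distrib_right sum_distrib_left mult_ac)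
  have "gable (\<lambda>x. \<Sum>c\<in>I. (v c / (2 * of_real (\<alpha> c)) * of_nat (count m c)) * (f x * gmono (m - {#c#}) x))"
    using assms unfolding stein_def by (intro gable_sum gable_scale) (blast dest: in_diffD)
  thus "gable (\<lambda>x. f x * dmono v m x)" by (simp add: dmono_def sum_distrib_left mult_ac)
qed

lemma gint_stein:
  assumes "stein u f g"
  shows "gint (\<lambda>x. lin u x * f x) = gint g" "gable (\<lambda>x. lin v x * f x)"
  using assms stein_gable_gmono(3)[OF assms, of "{#}" v] unfolding stein_def
  by (auto dest!: spec[of _ "{#}"] simp: dmono_def)

text \<open>The Gaussian moments enter the relation \<open>stein\<close> here, through
  \<open>gint_gmono_add\<close>; further instances follow from closure under sums, scaling and
  multiplication by linear forms.\<close>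

lemma stein_one: "stein u (\<lambda>_. 1) (\<lambda>_. 0)"
  unfolding stein_def
proof (intro allI impI conjI)
  fix m assume m: "set_mset m \<subseteq> I"
  show "gable (\<lambda>x. 1 * gmono m x)" using gable_gmono[OF m] by simp
  show "gable (\<lambda>x. 0 * gmono m x)" by (simp add: gable_def)
  have "gint (\<lambda>x. lin u x * (1 * gmono m x)) = gint (\<lambda>x. \<Sum>c\<in>I. u c * gmono (add_mset c m) x)"
    by (simp add: lin_def sum_distrib_right mult.assoc)
  also have "\<dots> = (\<Sum>c\<in>I. u c * gint (gmono (add_mset c m)))"
    using m by (subst gint_sum) (auto intro!: gable_scale gable_gmono sum.cong gint_scale simp del: gmono_add)
  also have "\<dots> = (\<Sum>c\<in>I. (u c / (2 * of_real (\<alpha> c)) * of_nat (count m c)) * gint (gmono (m - {#c#})))"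
    using m by (intro sum.cong refl) (simp add: gint_gmono_add)
  also have "\<dots> = gint (\<lambda>x. \<Sum>c\<in>I. (u c / (2 * of_real (\<alpha> c)) * of_nat (count m c)) * gmono (m - {#c#}) x)"
    using m by (subst gint_sum) (blast intro!: gable_scale gable_gmono sum.cong gint_scale[symmetric] dest: in_diffD)+
  finally show "gint (\<lambda>x. lin u x * (1 * gmono m x)) = gint (\<lambda>x. 0 * gmono m x + 1 * dmono u m x)"
    by (simp add: dmono_def mult.assoc)
qed

lemma stein_add:
  assumes "stein u f g" "stein u f' g'"
  shows "stein u (\<lambda>x. f x + f' x) (\<lambda>x. g x + g' x)"
  unfolding stein_def
proof (intro allI impI conjI)
  fix m assume m: "set_mset m \<subseteq> I"
  note a = stein_gable_gmono[OF assms(1) m] and b = stein_gable_gmono[OF assms(2) m]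
  show "gable (\<lambda>x. (f x + f' x) * gmono m x)" "gable (\<lambda>x. (g x + g' x) * gmono m x)"
    using a b gable_add by (simp_all add: distrib_right)
  have "gint (\<lambda>x. lin u x * ((f x + f' x) * gmono m x))
      = gint (\<lambda>x. lin u x * (f x * gmono m x) + lin u x * (f' x * gmono m x))"
    by (simp add: algebra_simps)
  also have "\<dots> = gint (\<lambda>x. g x * gmono m x + f x * dmono u m x) + gint (\<lambda>x. g' x * gmono m x + f' x * dmono u m x)"
    using assms m unfolding gint_add[OF a(3) b(3)] by (simp add: stein_def)
  also have "\<dots> = gint (\<lambda>x. (g x * gmono m x + f x * dmono u m x) + (g' x * gmono m x + f' x * dmono u m x))"
    by (intro gint_add[symmetric] gable_add a b)
  finally show "gint (\<lambda>x. lin u x * ((f x + f' x) * gmono m x))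
      = gint (\<lambda>x. (g x + g' x) * gmono m x + (f x + f' x) * dmono u m x)"
    by (simp add: algebra_simps)
qed

lemma stein_scale:
  assumes "stein u f g"
  shows "stein u (\<lambda>x. a * f x) (\<lambda>x. a * g x)"
  unfolding stein_def
proof (intro allI impI conjI)
  fix m assume m: "set_mset m \<subseteq> I"
  note b = stein_gable_gmono[OF assms(1) m]
  show "gable (\<lambda>x. a * f x * gmono m x)" "gable (\<lambda>x. a * g x * gmono m x)"
    using gable_scale[OF b(1)] gable_scale[OF b(2)] by (simp_all add: mult.assoc)
  have "gint (\<lambda>x. a * (lin u x * (f x * gmono m x)))
      = gint (\<lambda>x. a * (g x * gmono m x + f x * dmono u m x))"
    using assms m by (simp add: gint_scale gable_add b stein_def)
  thus "gint (\<lambda>x. lin u x * (a * f x * gmono m x)) = gint (\<lambda>x. a * g x * gmono m x + a * f x * dmono u m x)"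
    by (simp add: algebra_simps)
qed

lemma stein_sum:
  assumes "\<And>i. i \<in> A \<Longrightarrow> stein u (f i) (g i)"
  shows "stein u (\<lambda>x. \<Sum>i\<in>A. f i x) (\<lambda>x. \<Sum>i\<in>A. g i x)"
  using assms
proof (induction A rule: infinite_finite_induct)
  case (insert i A)
  thus ?case using stein_add[of u "f i" "g i"] by simp
qed (use stein_scale[OF stein_one, of _ 0] in auto)

text \<open>The new coordinate is moved into the test monomial, so that \<open>m\<close> becomes
  \<open>add_mset c m\<close>; the Leibniz rule \<open>dmono_add\<close> then splits off the
  derivative of \<open>x c\<close>, which is \<open>u c / (2 * \<alpha> c)\<close>.\<close>

lemma stein_coord:
  assumes "stein u f g" "c \<in> I"
  shows "stein u (\<lambda>x. of_real (x c) * f x) (\<lambda>x. u c / (2 * of_real (\<alpha> c)) * f x + of_real (x c) * g x)"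
  unfolding stein_def
proof (intro allI impI conjI)
  fix m assume m: "set_mset m \<subseteq> I"
  hence m': "set_mset (add_mset c m) \<subseteq> I" using assms(2) by auto
  note a = stein_gable_gmono[OF assms(1) m] and b = stein_gable_gmono[OF assms(1) m']
  show "gable (\<lambda>x. of_real (x c) * f x * gmono m x)" using b(1) by (simp add: mult_ac)
  have "gable (\<lambda>x. u c / (2 * of_real (\<alpha> c)) * (f x * gmono m x) + g x * gmono (add_mset c m) x)"
    by (intro gable_add gable_scale a b)
  thus "gable (\<lambda>x. (u c / (2 * of_real (\<alpha> c)) * f x + of_real (x c) * g x) * gmono m x)"
    by (simp add: algebra_simps)
  have "gint (\<lambda>x. lin u x * (f x * gmono (add_mset c m) x))
      = gint (\<lambda>x. g x * gmono (add_mset c m) x + f x * dmono u (add_mset c m) x)"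
    using assms(1) m' by (simp add: stein_def del: gmono_add)
  thus "gint (\<lambda>x. lin u x * (of_real (x c) * f x * gmono m x)) =
     gint (\<lambda>x. (u c / (2 * of_real (\<alpha> c)) * f x + of_real (x c) * g x) * gmono m x
            + of_real (x c) * f x * dmono u m x)"
    by (simp add: dmono_add[OF assms(2)] algebra_simps)
qed

lemma stein_lin:
  assumes "stein u f g"
  shows "stein u (\<lambda>x. lin v x * f x) (\<lambda>x. cov u v * f x + lin v x * g x)"
proof -
  have "stein u (\<lambda>x. \<Sum>c\<in>I. v c * (of_real (x c) * f x))
     (\<lambda>x. \<Sum>c\<in>I. v c * (u c / (2 * of_real (\<alpha> c)) * f x + of_real (x c) * g x))"
    by (intro stein_sum stein_scale stein_coord assms)
  thus ?thesis by (simp add: lin_def cov_def sum_distrib_left sum.distrib distrib_left mult_ac)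
qed

end

section \<open>The Hermitian Gaussian measure\<close>

definition entry :: "nat \<Rightarrow> nat \<Rightarrow> nat \<times> nat \<Rightarrow> complex" where
  "entry i j c = (if i = j then (if c = (i, i) then 1 else 0)
     else if i < j then (if c = (i, j) then 1 else 0) + (if c = (j, i) then \<i> else 0)
     else (if c = (j, i) then 1 else 0) + (if c = (i, j) then - \<i> else 0))"

text \<open>In these coordinates Tr M^2 is the sum of the squares of the diagonal coordinates plus
  twice the squares of the others, and the weight is exp(- N Tr M^2 / 2).\<close>

definition hrate :: "nat \<Rightarrow> nat \<times> nat \<Rightarrow> real" where
  "hrate N c = (if fst c = snd c then real N / 2 else real N)"

locale hermitian_integral =
  fixes N :: nat
  assumes N_pos: "N \<ge> 1"
begin

sublocale gaussian_integral "{..<N} \<times> {..<N}" "hrate N"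
  by unfold_locales (use N_pos in \<open>auto simp: hrate_def\<close>)

abbreviation H :: "(nat \<times> nat \<Rightarrow> real) \<Rightarrow> complex mat" where
  "H \<equiv> hermitian_mat N"

lemma H_carrier [simp]: "H x \<in> carrier_mat N N"
  by (simp add: hermitian_mat_def)

lemma sum_entry_mult:
  assumes "i < N" "j < N"
  shows "(\<Sum>c\<in>{..<N} \<times> {..<N}. entry i j c * f c) =
    (if i = j then f (i, i) else if i < j then f (i, j) + \<i> * f (j, i) else f (j, i) - \<i> * f (i, j))"
proof -
  have d: "(\<Sum>c\<in>{..<N} \<times> {..<N}. (if c = d then a else 0) * f c) = a * f d"
    if "d \<in> {..<N} \<times> {..<N}" for d a
  proof -
    have "(\<Sum>c\<in>{..<N} \<times> {..<N}. (if c = d then a else 0) * f c)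
        = (\<Sum>c\<in>{..<N} \<times> {..<N}. if c = d then a * f d else 0)"
      by (intro sum.cong) auto
    thus ?thesis using that by (subst (asm) sum.delta) auto
  qed
  consider "i = j" | "i < j" | "j < i" by linarith
  thus ?thesis
  proof cases
    case 1
    thus ?thesis using assms d[of "(i, i)" 1] by (simp add: entry_def)
  next
    case 2
    thus ?thesis using assms d[of "(i, j)" 1] d[of "(j, i)" \<i>]
      by (simp add: entry_def distrib_right sum.distrib)
  next
    case 3
    thus ?thesis using assms d[of "(j, i)" 1] d[of "(i, j)" "- \<i>"]
      by (simp add: entry_def distrib_right sum.distrib)
  qed
qed

lemma H_entry:
  assumes "i < N" "j < N"
  shows "H x $$ (i, j) = lin (entry i j) x"
  unfolding lin_def sum_entry_mult[OF assms]
  using assms by (simp add: hermitian_mat_def complex_eq_iff)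

text \<open>The propagator of the Gaussian Hermitian ensemble. The real and imaginary parts of an
  off-diagonal entry both have variance 1/(2N): in the square of the entry they cancel, in its
  product with the transposed entry they add up.\<close>

lemma cov_entry:
  assumes "i < N" "j < N" "k < N" "l < N"
  shows "cov (entry i j) (entry k l) = (if i = l \<and> j = k then 1 / of_nat N else 0)"
proof -
  have "cov (entry i j) (entry k l)
      = (\<Sum>c\<in>{..<N} \<times> {..<N}. entry i j c * (entry k l c / (2 * of_real (hrate N c))))"
    by (simp add: cov_def)
  also have "\<dots> = (if i = l \<and> j = k then 1 / of_nat N else 0)"
  proof -
    have 0: "entry k l c = 0" if "c \<noteq> (k, l)" "c \<noteq> (l, k)" for c
      using that by (auto simp: entry_def)
    consider "i = j" | "i < j" | "j < i" by linarith
    note ord = this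
    consider "k = i" "l = j" | "k = j" "l = i" "i \<noteq> j" | "(i, j) \<noteq> (k, l)" "(i, j) \<noteq> (l, k)" by blast
    thus ?thesis
    proof cases
      case 1
      show ?thesis unfolding sum_entry_mult[OF assms(1,2)] 1
        by (cases rule: ord) (use N_pos in \<open>simp_all add: entry_def hrate_def\<close>)
    next
      case 2
      show ?thesis unfolding sum_entry_mult[OF assms(1,2)] 2(1,2)
        by (cases rule: ord) (use N_pos 2(3) in \<open>simp_all add: entry_def hrate_def\<close>)
    next
      case 3
      hence "entry k l (i, j) = 0" "entry k l (j, i) = 0" by (auto intro!: 0)
      thus ?thesis unfolding sum_entry_mult[OF assms(1,2)] using 3 by auto
    qed
  qed
  finally show ?thesis .
qed

lemma gaussian_weight_H: "gaussian_weight N (H x) = gweight ({..<N} \<times> {..<N}) (hrate N) x"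
proof -
  \<comment> \<open>\<open>p i j\<close> is the share of the coordinate \<open>(i, j)\<close> in Tr
    M^2. The product of the entries \<open>(i, j)\<close> and \<open>(j, i)\<close> involves both
    coordinates, hence the symmetrized half sum below.\<close>
  define p where "p i j = (if i = j then (x (i, j))\<^sup>2 else 2 * (x (i, j))\<^sup>2)" for i j
  have e: "H x $$ (i, j) * H x $$ (j, i) = of_real ((p i j + p j i) / 2)" if "i < N" "j < N" for i j
    using that by (auto simp: hermitian_mat_def p_def complex_eq_iff power2_eq_square)
  have "mat_trace (H x ^\<^sub>m 2) = (\<Sum>i<N. (H x * H x) $$ (i, i))"
    by (simp add: mat_trace_def numeral_2_eq_2 hermitian_mat_def)
  also have "\<dots> = (\<Sum>i<N. \<Sum>j<N. H x $$ (i, j) * H x $$ (j, i))"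
    by (intro sum.cong refl) (simp add: scalar_prod_def hermitian_mat_def lessThan_atLeast0)
  also have "\<dots> = (\<Sum>i<N. \<Sum>j<N. of_real ((p i j + p j i) / 2))"
    by (intro sum.cong refl) (simp only: e lessThan_iff)
  also have "\<dots> = of_real ((\<Sum>i<N. \<Sum>j<N. p i j) + (\<Sum>i<N. \<Sum>j<N. p j i)) / 2"
    by (simp add: sum.distrib add_divide_distrib sum_divide_distrib)
  also have "(\<Sum>i<N. \<Sum>j<N. p j i) = (\<Sum>i<N. \<Sum>j<N. p i j)"
    by (rule sum.swap)
  finally have t: "mat_trace (H x ^\<^sub>m 2) = of_real (\<Sum>i<N. \<Sum>j<N. p i j)" by simp
  have "gweight ({..<N} \<times> {..<N}) (hrate N) x
      = of_real (exp (\<Sum>c\<in>{..<N} \<times> {..<N}. - hrate N c * (x c)\<^sup>2))"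
    by (simp add: gweight_def exp_sum)
  also have "(\<Sum>c\<in>{..<N} \<times> {..<N}. - hrate N c * (x c)\<^sup>2) = (\<Sum>i<N. \<Sum>j<N. - real N / 2 * p i j)"
    unfolding sum.cartesian_product by (intro sum.cong) (auto simp: hrate_def p_def)
  also have "\<dots> = - real N / 2 * (\<Sum>i<N. \<Sum>j<N. p i j)" by (simp add: sum_distrib_left)
  finally show ?thesis
    by (simp add: gaussian_weight_def t exp_of_real[symmetric])
qed

lemma gaussian_mean_eq: "gaussian_mean N f = gint (\<lambda>x. f (H x)) / gint (\<lambda>_. 1)"
  by (simp add: gaussian_mean_def gint_def gaussian_weight_H hermitian_coords_def)

section \<open>Matrix powers, traces and the Schwinger-Dyson equations\<close>

lemma pow_entry_Suc:
  assumes "a < N" "b < N"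
  shows "(H x ^\<^sub>m Suc k) $$ (a, b) = (\<Sum>c<N. (H x ^\<^sub>m k) $$ (a, c) * H x $$ (c, b))"
proof -
  have "(H x ^\<^sub>m Suc k) $$ (a, b) = (H x ^\<^sub>m k * H x) $$ (a, b)" by simp
  also have "\<dots> = scalar_prod (row (H x ^\<^sub>m k) a) (col (H x) b)"
    using assms by (intro index_mult_mat) (simp_all add: hermitian_mat_def)
  also have "\<dots> = (\<Sum>c<N. (H x ^\<^sub>m k) $$ (a, c) * H x $$ (c, b))"
    using assms by (simp add: scalar_prod_def hermitian_mat_def lessThan_atLeast0)
  finally show ?thesis .
qed

lemma pow_entry_add:
  assumes "a < N" "b < N"
  shows "(H x ^\<^sub>m (k + l)) $$ (a, b) = (\<Sum>c<N. (H x ^\<^sub>m k) $$ (a, c) * (H x ^\<^sub>m l) $$ (c, b))"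
  using assms(2)
proof (induction l arbitrary: b)
  case 0
  have "(\<Sum>c<N. (H x ^\<^sub>m k) $$ (a, c) * (H x ^\<^sub>m 0) $$ (c, b))
      = (\<Sum>c<N. if c = b then (H x ^\<^sub>m k) $$ (a, c) else 0)"
    using 0 by (intro sum.cong) (auto simp: hermitian_mat_def)
  thus ?case using 0 by simp
next
  case (Suc l)
  have "(H x ^\<^sub>m (k + Suc l)) $$ (a, b)
      = (\<Sum>d<N. \<Sum>c<N. (H x ^\<^sub>m k) $$ (a, c) * (H x ^\<^sub>m l) $$ (c, d) * H x $$ (d, b))"
    unfolding add_Suc_right pow_entry_Suc[OF assms(1) Suc.prems]
    by (intro sum.cong refl) (simp add: Suc.IH sum_distrib_right)
  also have "\<dots> = (\<Sum>c<N. \<Sum>d<N. (H x ^\<^sub>m k) $$ (a, c) * (H x ^\<^sub>m l) $$ (c, d) * H x $$ (d, b))"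
    by (rule sum.swap)
  also have "\<dots> = (\<Sum>c<N. (H x ^\<^sub>m k) $$ (a, c) * (H x ^\<^sub>m Suc l) $$ (c, b))"
    using Suc.prems by (intro sum.cong refl) (simp only: pow_entry_Suc sum_distrib_left mult.assoc lessThan_iff)
  finally show ?case .
qed

lemma pow_entry_0: "a < N \<Longrightarrow> b < N \<Longrightarrow> (H x ^\<^sub>m 0) $$ (a, b) = (if a = b then 1 else 0)"
  by (auto simp: hermitian_mat_def)

text \<open>By \<open>cov_entry\<close>, the derivative dual to the entry \<open>(i, j)\<close>
  replaces one factor of the matrix power by the matrix unit in row \<open>j\<close> and column
  \<open>i\<close>, divided by \<open>N\<close>. Cutting after \<open>r\<close> factors leaves the
  entry \<open>(a, j)\<close> of the \<open>r\<close>-th power and the entry \<open>(i, b)\<close>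
  of the remaining one.\<close>

lemma stein_pow_entry:
  assumes "stein (entry i j) f g" "i < N" "j < N" "a < N" "b < N"
  shows "stein (entry i j) (\<lambda>x. (H x ^\<^sub>m k) $$ (a, b) * f x)
    (\<lambda>x. 1 / of_nat N * (\<Sum>r<k. (H x ^\<^sub>m r) $$ (a, j) * (H x ^\<^sub>m (k - 1 - r)) $$ (i, b)) * f x
       + (H x ^\<^sub>m k) $$ (a, b) * g x)"
  using assms(1,5)
proof (induction k arbitrary: f g b)
  case 0
  show ?case
  proof (cases "a = b")
    case True
    thus ?thesis using 0 assms by (simp add: pow_entry_0 del: pow_mat.simps)
  next
    case False
    thus ?thesis using 0 assms stein_scale[OF 0(1), of 0] by (simp add: pow_entry_0 del: pow_mat.simps)
  qed
next
  case (Suc k)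
  let ?M = "\<lambda>r a b x. (H x ^\<^sub>m r) $$ (a, b)"
  \<comment> \<open>The last matrix factor is absorbed into \<open>f\<close>: the induction
    hypothesis is applied to \<open>lin (entry c b) x * f x\<close>.\<close>
  have "stein (entry i j) (\<lambda>x. \<Sum>c<N. ?M k a c x * (lin (entry c b) x * f x))
    (\<lambda>x. \<Sum>c<N. 1 / of_nat N * (\<Sum>r<k. ?M r a j x * ?M (k - 1 - r) i c x) * (lin (entry c b) x * f x)
       + ?M k a c x * (cov (entry i j) (entry c b) * f x + lin (entry c b) x * g x))"
    by (intro stein_sum Suc.IH stein_lin Suc.prems) simp
  also have "(\<lambda>x. \<Sum>c<N. ?M k a c x * (lin (entry c b) x * f x)) = (\<lambda>x. ?M (Suc k) a b x * f x)"
    using Suc.prems(2) assms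
    by (intro ext) (simp add: pow_entry_Suc H_entry sum_distrib_right mult.assoc del: pow_mat.simps)
  also have "(\<lambda>x. \<Sum>c<N. 1 / of_nat N * (\<Sum>r<k. ?M r a j x * ?M (k - 1 - r) i c x) * (lin (entry c b) x * f x)
       + ?M k a c x * (cov (entry i j) (entry c b) * f x + lin (entry c b) x * g x))
     = (\<lambda>x. 1 / of_nat N * (\<Sum>r<Suc k. ?M r a j x * ?M (Suc k - 1 - r) i b x) * f x + ?M (Suc k) a b x * g x)"
    (is "?l = ?r")
  proof
    fix x
    have 1: "(\<Sum>c<N. (\<Sum>r<k. ?M r a j x * ?M (k - 1 - r) i c x) * lin (entry c b) x)
        = (\<Sum>r<k. ?M r a j x * ?M (k - r) i b x)"
    proof -
      have "(\<Sum>c<N. (\<Sum>r<k. ?M r a j x * ?M (k - 1 - r) i c x) * lin (entry c b) x)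
          = (\<Sum>r<k. \<Sum>c<N. ?M r a j x * (?M (k - 1 - r) i c x * H x $$ (c, b)))"
        using Suc.prems(2) by (subst sum.swap) (simp add: H_entry sum_distrib_right mult.assoc)
      also have "\<dots> = (\<Sum>r<k. ?M r a j x * ?M (k - r) i b x)"
      proof (intro sum.cong refl)
        fix r assume "r \<in> {..<k}"
        hence "k - r = Suc (k - 1 - r)" by auto
        thus "(\<Sum>c<N. ?M r a j x * (?M (k - 1 - r) i c x * H x $$ (c, b))) = ?M r a j x * ?M (k - r) i b x"
          using pow_entry_Suc[OF assms(2) Suc.prems(2), of x "k - 1 - r"] by (simp only: sum_distrib_left)
      qed
      finally show ?thesis .
    qed
    have 2: "(\<Sum>c<N. ?M k a c x * cov (entry i j) (entry c b)) = 1 / of_nat N * (?M k a j x * ?M 0 i b x)"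
    proof -
      have "(\<Sum>c<N. ?M k a c x * cov (entry i j) (entry c b))
          = (\<Sum>c<N. if c = j then ?M k a j x * (if i = b then 1 / of_nat N else 0) else 0)"
        using assms Suc.prems(2) by (intro sum.cong) (auto simp: cov_entry)
      thus ?thesis using assms Suc.prems(2) by (simp add: pow_entry_0 del: pow_mat.simps)
    qed
    have 3: "(\<Sum>c<N. ?M k a c x * lin (entry c b) x) = ?M (Suc k) a b x"
      using Suc.prems(2) assms by (simp add: pow_entry_Suc H_entry del: pow_mat.simps)
    have "?l x = 1 / of_nat N * (\<Sum>c<N. (\<Sum>r<k. ?M r a j x * ?M (k - 1 - r) i c x) * lin (entry c b) x) * f x
       + ((\<Sum>c<N. ?M k a c x * cov (entry i j) (entry c b)) * f x
         + (\<Sum>c<N. ?M k a c x * lin (entry c b) x) * g x)"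
      by (simp only: sum.distrib distrib_left sum_distrib_left sum_distrib_right mult.assoc)
    also have "\<dots> = ?r x"
      unfolding 1 2 3 by (simp add: algebra_simps del: pow_mat.simps)
    finally show "?l x = ?r x" .
  qed
  finally show ?case .
qed

definition Tr :: "nat \<Rightarrow> (nat \<times> nat \<Rightarrow> real) \<Rightarrow> complex" where
  "Tr k x = mat_trace (H x ^\<^sub>m k)"

lemma Tr_eq: "Tr k x = (\<Sum>a<N. (H x ^\<^sub>m k) $$ (a, a))"
  by (simp add: Tr_def mat_trace_def hermitian_mat_def)

lemma Tr_0: "Tr 0 x = of_nat N"
  by (simp add: Tr_eq pow_entry_0 del: pow_mat.simps)

text \<open>On the diagonal sum the two pieces left by a cut recombine cyclically, so each of the
  \<open>k\<close> cuts yields the same power \<open>k - 1\<close>. For \<open>k = 0\<close> the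
  truncated exponent is multiplied by zero.\<close>

lemma stein_Tr:
  assumes "stein (entry i j) f g" "i < N" "j < N"
  shows "stein (entry i j) (\<lambda>x. Tr k x * f x)
    (\<lambda>x. of_nat k / of_nat N * (H x ^\<^sub>m (k - 1)) $$ (i, j) * f x + Tr k x * g x)"
proof -
  let ?M = "\<lambda>r a b x. (H x ^\<^sub>m r) $$ (a, b)"
  have "stein (entry i j) (\<lambda>x. \<Sum>a<N. ?M k a a x * f x)
    (\<lambda>x. \<Sum>a<N. 1 / of_nat N * (\<Sum>r<k. ?M r a j x * ?M (k - 1 - r) i a x) * f x + ?M k a a x * g x)"
    by (intro stein_sum stein_pow_entry assms) auto
  also have "(\<lambda>x. \<Sum>a<N. ?M k a a x * f x) = (\<lambda>x. Tr k x * f x)"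
    by (simp add: Tr_eq sum_distrib_right)
  also have "(\<lambda>x. \<Sum>a<N. 1 / of_nat N * (\<Sum>r<k. ?M r a j x * ?M (k - 1 - r) i a x) * f x + ?M k a a x * g x)
     = (\<lambda>x. of_nat k / of_nat N * ?M (k - 1) i j x * f x + Tr k x * g x)"
  proof
    fix x
    have "(\<Sum>a<N. \<Sum>r<k. ?M r a j x * ?M (k - 1 - r) i a x)
        = (\<Sum>r<k. \<Sum>a<N. ?M (k - 1 - r) i a x * ?M r a j x)"
      by (subst sum.swap) (simp add: mult.commute)
    also have "\<dots> = (\<Sum>r<k. ?M (k - 1) i j x)"
    proof (intro sum.cong refl)
      fix r assume "r \<in> {..<k}"
      hence "k - 1 = (k - 1 - r) + r" by auto
      thus "(\<Sum>a<N. ?M (k - 1 - r) i a x * ?M r a j x) = ?M (k - 1) i j x"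
        using pow_entry_add[OF assms(2,3), of x "k - 1 - r" r] by simp
    qed
    finally have 1: "(\<Sum>a<N. \<Sum>r<k. ?M r a j x * ?M (k - 1 - r) i a x) = of_nat k * ?M (k - 1) i j x" by simp
    have "(\<Sum>a<N. 1 / of_nat N * (\<Sum>r<k. ?M r a j x * ?M (k - 1 - r) i a x) * f x + ?M k a a x * g x)
        = 1 / of_nat N * (\<Sum>a<N. \<Sum>r<k. ?M r a j x * ?M (k - 1 - r) i a x) * f x + Tr k x * g x"
      by (simp only: sum.distrib sum_distrib_left sum_distrib_right Tr_eq mult.assoc)
    thus "(\<Sum>a<N. 1 / of_nat N * (\<Sum>r<k. ?M r a j x * ?M (k - 1 - r) i a x) * f x + ?M k a a x * g x)
        = of_nat k / of_nat N * ?M (k - 1) i j x * f x + Tr k x * g x"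
      unfolding 1 by simp
  qed
  finally show ?thesis .
qed

definition Trs :: "nat multiset \<Rightarrow> (nat \<times> nat \<Rightarrow> real) \<Rightarrow> complex" where
  "Trs m x = (\<Prod>k\<in>#m. Tr k x)"

lemma Trs_empty [simp]: "Trs {#} x = 1"
  and Trs_add [simp]: "Trs (add_mset k m) x = Tr k x * Trs m x"
  by (simp_all add: Trs_def)

lemma stein_Trs:
  assumes "i < N" "j < N"
  shows "stein (entry i j) (Trs m)
    (\<lambda>x. \<Sum>n\<in>#m. of_nat n / of_nat N * (H x ^\<^sub>m (n - 1)) $$ (i, j) * Trs (m - {#n#}) x)"
proof (induction m)
  case empty
  show ?case using stein_one by (simp add: Trs_def[abs_def])
next
  case (add k m)
  have "stein (entry i j) (\<lambda>x. Tr k x * Trs m x)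
    (\<lambda>x. of_nat k / of_nat N * (H x ^\<^sub>m (k - 1)) $$ (i, j) * Trs m x
      + Tr k x * (\<Sum>n\<in>#m. of_nat n / of_nat N * (H x ^\<^sub>m (n - 1)) $$ (i, j) * Trs (m - {#n#}) x))"
    by (intro stein_Tr add.IH assms)
  moreover have "Tr k x * (\<Sum>n\<in>#m. of_nat n / of_nat N * (H x ^\<^sub>m (n - 1)) $$ (i, j) * Trs (m - {#n#}) x)
     = (\<Sum>n\<in>#m. of_nat n / of_nat N * (H x ^\<^sub>m (n - 1)) $$ (i, j) * Trs (add_mset k m - {#n#}) x)" for x
    unfolding sum_mset_distrib_left
    by (intro arg_cong[where f = sum_mset] image_mset_cong) (auto dest!: multi_member_split simp: ac_simps)
  ultimately show ?case by (simp add: Trs_def[abs_def])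
qed

lemma gable_Trs: "gable (Trs m)"
  using stein_gable(1)[OF stein_Trs[of 0 0 m]] N_pos by simp

text \<open>One factor of the trace of the power \<open>Suc k\<close> is split off as an entry
  \<open>(i, j)\<close> and integrated by parts. If the derivative hits the rest of the same trace,
  that trace splits into two; if it hits another trace of a power \<open>n\<close>, the two traces
  merge into one.\<close>

lemma schwinger_dyson:
  "gint (Trs (add_mset (Suc k) m)) =
     1 / of_nat N * ((\<Sum>r<k. gint (Trs (add_mset r (add_mset (k - 1 - r) m))))
       + (\<Sum>n\<in>#m. of_nat n * gint (Trs (add_mset (k + n - 1) (m - {#n#})))))"
proof -
  let ?M = "\<lambda>r a b x. (H x ^\<^sub>m r) $$ (a, b)"
  define D where "D i j x = (\<Sum>n\<in>#m. of_nat n / of_nat N * ?M (n - 1) i j x * Trs (m - {#n#}) x)" for i j x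
  define G where "G i j x = 1 / of_nat N * (\<Sum>r<k. ?M r j j x * ?M (k - 1 - r) i i x) * Trs m x
       + ?M k j i x * D i j x" for i j x
  have st: "stein (entry i j) (\<lambda>x. ?M k j i x * Trs m x) (G i j)" if "i < N" "j < N" for i j
    unfolding G_def D_def using that by (intro stein_pow_entry stein_Trs)
  have "Trs (add_mset (Suc k) m) = (\<lambda>x. \<Sum>i<N. \<Sum>j<N. lin (entry i j) x * (?M k j i x * Trs m x))"
  proof
    fix x
    have "Tr (1 + k) x = (\<Sum>i<N. \<Sum>j<N. H x $$ (i, j) * ?M k j i x)"
      unfolding Tr_eq by (intro sum.cong refl) (subst pow_entry_add, auto)
    thus "Trs (add_mset (Suc k) m) x = (\<Sum>i<N. \<Sum>j<N. lin (entry i j) x * (?M k j i x * Trs m x))"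
      by (simp add: sum_distrib_right H_entry mult.assoc)
  qed
  moreover have swap: "gint (\<lambda>x. \<Sum>i<N. \<Sum>j<N. F i j x) = (\<Sum>i<N. \<Sum>j<N. gint (F i j))"
    if "\<And>i j. i < N \<Longrightarrow> j < N \<Longrightarrow> gable (F i j)" for F
    by (subst gint_sum) (use that in \<open>auto intro!: gable_sum sum.cong gint_sum\<close>)
  ultimately have "gint (Trs (add_mset (Suc k) m))
      = (\<Sum>i<N. \<Sum>j<N. gint (\<lambda>x. lin (entry i j) x * (?M k j i x * Trs m x)))"
    using gint_stein(2)[OF st] by simp
  also have "\<dots> = (\<Sum>i<N. \<Sum>j<N. gint (G i j))"
    by (intro sum.cong refl gint_stein(1) st) auto
  also have "\<dots> = gint (\<lambda>x. \<Sum>i<N. \<Sum>j<N. G i j x)"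
    by (intro swap[symmetric] stein_gable(2)[OF st])
  also have "(\<lambda>x. \<Sum>i<N. \<Sum>j<N. G i j x) =
      (\<lambda>x. 1 / of_nat N * ((\<Sum>r<k. Trs (add_mset r (add_mset (k - 1 - r) m)) x)
       + (\<Sum>n\<in>#m. of_nat n * Trs (add_mset (k + n - 1) (m - {#n#})) x)))"
  proof
    fix x
    have 1: "(\<Sum>i<N. \<Sum>j<N. 1 / of_nat N * (\<Sum>r<k. ?M r j j x * ?M (k - 1 - r) i i x) * Trs m x)
        = 1 / of_nat N * (\<Sum>r<k. Trs (add_mset r (add_mset (k - 1 - r) m)) x)"
    proof -
      have "(\<Sum>i<N. \<Sum>j<N. (\<Sum>r<k. ?M r j j x * ?M (k - 1 - r) i i x))
          = (\<Sum>r<k. Tr r x * Tr (k - 1 - r) x)"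
      proof -
        have "(\<Sum>i<N. \<Sum>j<N. \<Sum>r<k. ?M r j j x * ?M (k - 1 - r) i i x)
            = (\<Sum>i<N. \<Sum>r<k. \<Sum>j<N. ?M r j j x * ?M (k - 1 - r) i i x)"
          by (intro sum.cong refl sum.swap)
        also have "\<dots> = (\<Sum>r<k. \<Sum>i<N. \<Sum>j<N. ?M r j j x * ?M (k - 1 - r) i i x)"
          by (rule sum.swap)
        also have "\<dots> = (\<Sum>r<k. Tr (k - 1 - r) x * Tr r x)"
          unfolding Tr_eq sum_product by (simp add: mult.commute)
        finally show ?thesis by (simp add: mult.commute)
      qed
      hence "1 / of_nat N * (\<Sum>i<N. \<Sum>j<N. (\<Sum>r<k. ?M r j j x * ?M (k - 1 - r) i i x)) * Trs m x
          = 1 / of_nat N * (\<Sum>r<k. Tr r x * Tr (k - 1 - r) x) * Trs m x" by simp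
      thus ?thesis by (simp add: sum_distrib_left sum_distrib_right mult.assoc)
    qed
    have 2: "(\<Sum>i<N. \<Sum>j<N. ?M k j i x * D i j x)
        = 1 / of_nat N * (\<Sum>n\<in>#m. of_nat n * Trs (add_mset (k + n - 1) (m - {#n#})) x)"
    proof -
      have "(\<Sum>i<N. \<Sum>j<N. ?M k j i x * D i j x)
          = (\<Sum>n\<in>#m. \<Sum>i<N. \<Sum>j<N. of_nat n / of_nat N * (?M (n - 1) i j x * ?M k j i x) * Trs (m - {#n#}) x)"
      proof -
        have "(\<Sum>i<N. \<Sum>j<N. c i j * (\<Sum>n\<in>#A. F n i j)) = (\<Sum>n\<in>#A. \<Sum>i<N. \<Sum>j<N. c i j * F n i j)"
          for A and c :: "nat \<Rightarrow> nat \<Rightarrow> complex" and F :: "nat \<Rightarrow> nat \<Rightarrow> nat \<Rightarrow> complex"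
          by (induction A) (simp_all add: sum.distrib distrib_left)
        thus ?thesis unfolding D_def by (simp add: mult_ac)
      qed
      also have "\<dots> = (\<Sum>n\<in>#m. 1 / of_nat N * (of_nat n * Trs (add_mset (k + n - 1) (m - {#n#})) x))"
      proof (intro arg_cong[where f = sum_mset] image_mset_cong)
        fix n
        show "(\<Sum>i<N. \<Sum>j<N. of_nat n / of_nat N * (?M (n - 1) i j x * ?M k j i x) * Trs (m - {#n#}) x)
          = 1 / of_nat N * (of_nat n * Trs (add_mset (k + n - 1) (m - {#n#})) x)"
        proof (cases n)
          case (Suc n')
          have "(\<Sum>i<N. \<Sum>j<N. ?M (n - 1) i j x * ?M k j i x) = Tr (k + n - 1) x"
            unfolding Tr_eq using pow_entry_add[of _ _ x n' k] by (simp add: Suc add.commute)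
          moreover have "(\<Sum>i<N. \<Sum>j<N. of_nat n / of_nat N * (?M (n - 1) i j x * ?M k j i x) * Trs (m - {#n#}) x)
             = of_nat n / of_nat N * (\<Sum>i<N. \<Sum>j<N. ?M (n - 1) i j x * ?M k j i x) * Trs (m - {#n#}) x"
            by (simp add: sum_distrib_left sum_distrib_right)
          ultimately show ?thesis by simp
        qed simp
      qed
      also have "\<dots> = 1 / of_nat N * (\<Sum>n\<in>#m. of_nat n * Trs (add_mset (k + n - 1) (m - {#n#})) x)"
        by (simp only: sum_mset_distrib_left image_mset.compositionality comp_def)
      finally show ?thesis .
    qed
    show "(\<Sum>i<N. \<Sum>j<N. G i j x) = 1 / of_nat N * ((\<Sum>r<k. Trs (add_mset r (add_mset (k - 1 - r) m)) x)
       + (\<Sum>n\<in>#m. of_nat n * Trs (add_mset (k + n - 1) (m - {#n#})) x))"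
      unfolding G_def sum.distrib 1 2 by (simp add: distrib_left)
  qed
  also have "gint (\<lambda>x. 1 / of_nat N * ((\<Sum>r<k. Trs (add_mset r (add_mset (k - 1 - r) m)) x)
       + (\<Sum>n\<in>#m. of_nat n * Trs (add_mset (k + n - 1) (m - {#n#})) x)))
     = 1 / of_nat N * ((\<Sum>r<k. gint (Trs (add_mset r (add_mset (k - 1 - r) m))))
       + (\<Sum>n\<in>#m. of_nat n * gint (Trs (add_mset (k + n - 1) (m - {#n#})))))"
  proof -
    have *: "gable (\<lambda>x. \<Sum>n\<in>#A. of_nat n * Trs (B n) x) \<and>
       gint (\<lambda>x. \<Sum>n\<in>#A. of_nat n * Trs (B n) x) = (\<Sum>n\<in>#A. of_nat n * gint (Trs (B n)))"
      for A :: "nat multiset" and B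
    proof (induction A)
      case (add n A)
      thus ?case
        using gable_add[OF gable_scale[OF gable_Trs[of "B n"], of "of_nat n"], of "\<lambda>x. \<Sum>n\<in>#A. of_nat n * Trs (B n) x"]
          gint_add[OF gable_scale[OF gable_Trs[of "B n"], of "of_nat n"], of "\<lambda>x. \<Sum>n\<in>#A. of_nat n * Trs (B n) x"]
        by (simp add: gint_scale[OF gable_Trs])
    qed (simp add: gable_def gint_def)
    have **: "gable (\<lambda>x. \<Sum>r<k. Trs (add_mset r (add_mset (k - 1 - r) m)) x)"
      by (intro gable_sum gable_Trs)
    note a = *[where A = m and B = "\<lambda>n. add_mset (k + n - 1) (m - {#n#})"]
    show ?thesis
      by (simp only: gint_scale[OF gable_add[OF ** conjunct1[OF a]]] gint_add[OF ** conjunct1[OF a]]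
          gint_sum[OF gable_Trs] conjunct2[OF a])
  qed
  finally show ?thesis .
qed

end

section \<open>Loop equations\<close>

text \<open>A constant term 1 makes \<open>Z\<close> a unit: the coefficient of the product at
  \<open>m\<close> is \<open>f m\<close> plus terms in \<open>f\<close> at smaller monomials. This
  replaces division by the partition function.\<close>

lemma mtimes_cancel:
  assumes "Z {#} = 1" "mtimes Z f = mtimes Z g"
  shows "f = g"
proof
  fix m
  show "f m = g m"
  proof (induction m rule: measure_induct_rule[of size])
    case (less m)
    have split: "mtimes Z h m = h m + (\<Sum>k\<in>{k. k \<subseteq># m} - {{#}}. Z k * h (m - k))" for h
      unfolding mtimes_def by (subst sum.remove[of _ "{#}"]) (simp_all add: finite_submultisets assms(1))
    have "(\<Sum>k\<in>{k. k \<subseteq># m} - {{#}}. Z k * f (m - k)) = (\<Sum>k\<in>{k. k \<subseteq># m} - {{#}}. Z k * g (m - k))"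
    proof (intro sum.cong refl)
      fix k assume k: "k \<in> {k. k \<subseteq># m} - {{#}}"
      hence "size m = size k + size (m - k)" "size k > 0"
        using size_mset_mono[of k m] size_Diff_submset[of k m] by (auto simp: nonempty_has_size)
      thus "Z k * f (m - k) = Z k * g (m - k)" using less[of "m - k"] by simp
    qed
    thus "f m = g m" using fun_cong[OF assms(2), of m] split[of f] split[of g] by simp
  qed
qed

section \<open>Multiplication by the indeterminates\<close>

definition mul_var :: "nat \<Rightarrow> 'a::comm_ring_1 mseries \<Rightarrow> 'a mseries" where
  "mul_var n f m = (if n \<in># m then f (m - {#n#}) else 0)"

lemma mtimes_mul_var: "mtimes f (mul_var n g) = mul_var n (mtimes f g)"
proof
  fix m
  show "mtimes f (mul_var n g) m = mul_var n (mtimes f g) m"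
  proof (cases "n \<in># m")
    case False
    hence "n \<notin># m - k" for k by (auto dest: in_diffD)
    thus ?thesis using False by (simp add: mtimes_def mul_var_def)
  next
    case True
    have "mtimes f (mul_var n g) m = (\<Sum>k | k \<subseteq># m \<and> n \<in># m - k. f k * g (m - k - {#n#}))"
      unfolding mtimes_def mul_var_def
      by (rule sum.mono_neutral_cong_right) (auto simp: finite_submultisets)
    also have "\<dots> = (\<Sum>k | k \<subseteq># m - {#n#}. f k * g (m - {#n#} - k))"
    proof (intro sum.cong)
      have "k \<subseteq># m \<and> n \<in># m - k \<longleftrightarrow> k \<subseteq># m - {#n#}" for k
      proof
        assume "k \<subseteq># m \<and> n \<in># m - k"
        then obtain j where "m = k + add_mset n j" by (metis multi_member_split subset_mset.add_diff_inverse)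
        thus "k \<subseteq># m - {#n#}" by simp
      next
        assume "k \<subseteq># m - {#n#}"
        then obtain j where "m - {#n#} = k + j" by (metis subset_mset.add_diff_inverse)
        hence "m = k + add_mset n j" using True by (metis insert_DiffM union_mset_add_mset_right)
        thus "k \<subseteq># m \<and> n \<in># m - k" by simp
      qed
      thus "{k. k \<subseteq># m \<and> n \<in># m - k} = {k. k \<subseteq># m - {#n#}}" by blast
    qed (simp add: diff_right_commute)
    finally show ?thesis using True by (simp add: mtimes_def mul_var_def)
  qed
qed

text \<open>Multiplication of \<open>f n\<close> by the \<open>n\<close>-th indeterminate, summed over \<open>n \<ge> 1\<close>.\<close>

definition var_sum :: "(nat \<Rightarrow> 'a::comm_ring_1 mseries) \<Rightarrow> 'a mseries" where
  "var_sum f m = (\<Sum>n | n \<in># m \<and> n \<ge> 1. f n (m - {#n#}))"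

lemma var_sum_eq: "finite A \<Longrightarrow> {n. n \<in># m \<and> n \<ge> 1} \<subseteq> A \<Longrightarrow> 0 \<notin> A \<Longrightarrow>
    var_sum f m = (\<Sum>n\<in>A. mul_var n (f n) m)"
  unfolding var_sum_def by (rule sum.mono_neutral_cong_left) (auto simp: mul_var_def Suc_le_eq intro!: gr0I)

text \<open>At submonomials of \<open>m\<close> only the indeterminates of \<open>m\<close> can
  occur, so the sum may be taken over the fixed finite set \<open>?A\<close>, and multiplication by
  \<open>Z\<close> passes through it.\<close>

lemma mtimes_var_sum: "mtimes Z (var_sum f) m = var_sum (\<lambda>n. mtimes Z (f n)) m"
proof -
  let ?A = "{n. n \<in># m \<and> n \<ge> 1}"
  have fin: "finite ?A" by simp
  have "mtimes Z (var_sum f) m = mtimes Z (\<lambda>m. \<Sum>n\<in>?A. mul_var n (f n) m) m"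
    by (intro mtimes_cong refl var_sum_eq) (auto dest: mset_subset_eqD)
  also have "\<dots> = (\<Sum>n\<in>?A. mul_var n (mtimes Z (f n)) m)"
    by (simp add: mtimes_sum_right mtimes_mul_var)
  also have "\<dots> = var_sum (\<lambda>n. mtimes Z (f n)) m"
    by (rule var_sum_eq[symmetric]) auto
  finally show ?thesis .
qed

section \<open>Coefficients of the exponentiated interaction\<close>

lemma mderiv_interaction:
  "mderiv k (interaction N M) m = (if k \<ge> 1 then of_nat N / of_nat k * mat_trace (M ^\<^sub>m k) else 0) * mone m"
proof (cases "m = {#}")
  case True
  thus ?thesis by (simp add: mderiv_def interaction_def mone_def)
next
  case False
  hence "add_mset k m \<noteq> {#n#}" for n by (auto simp: add_eq_conv_ex)
  thus ?thesis using False by (simp add: mderiv_def interaction_def mone_def)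
qed

lemma mderiv_mexp_interaction:
  "mderiv k (mexp (interaction N M)) m
    = (if k \<ge> 1 then of_nat N / of_nat k * mat_trace (M ^\<^sub>m k) else 0) * mexp (interaction N M) m"
proof -
  have "mderiv k (interaction N M) = (\<lambda>m. (if k \<ge> 1 then of_nat N / of_nat k * mat_trace (M ^\<^sub>m k) else 0) * mone m)"
    by (intro ext mderiv_interaction)
  thus ?thesis by (subst mderiv_mexp) (simp_all only: mtimes_scale_right mtimes_mone_right, simp add: interaction_def)
qed

text \<open>At the identity matrix of size one every trace is 1, so this isolates the combinatorial
  factor: the product over the indices n of \<open>(N/n)^c / c!\<close>, where c is the multiplicity
  of n. Matrix dependence then enters only as a product of traces.\<close>

definition wick_coeff :: "nat \<Rightarrow> nat multiset \<Rightarrow> complex" where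
  "wick_coeff N = mexp (interaction N (1\<^sub>m 1))"

lemma wick_coeff_empty [simp]: "wick_coeff N {#} = 1"
  by (simp add: wick_coeff_def)

lemma one_mat_trace: "mat_trace ((1\<^sub>m 1) ^\<^sub>m k) = 1"
proof -
  have "(1\<^sub>m 1 :: complex mat) ^\<^sub>m k = 1\<^sub>m 1" by (induction k) auto
  thus ?thesis by (simp add: mat_trace_def)
qed

lemma wick_coeff_add:
  "of_nat k * of_nat (count m k + 1) * wick_coeff N (add_mset k m) = (if k \<ge> 1 then of_nat N * wick_coeff N m else 0)"
  using mderiv_mexp_interaction[of k N "1\<^sub>m 1" m]
  unfolding mderiv_def one_mat_trace wick_coeff_def[symmetric]
  by (cases "k = 0") (simp_all add: field_simps del: One_nat_def)

lemma wick_coeff_zero: "0 \<in># m \<Longrightarrow> wick_coeff N m = 0"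
  using mderiv_mexp_interaction[of 0 N "1\<^sub>m 1" "m - {#0#}"]
  by (auto simp: mderiv_def wick_coeff_def dest: multi_member_split simp del: of_nat_Suc)

lemma mexp_interaction:
  "mexp (interaction N M) m = wick_coeff N m * (\<Prod>k\<in>#m. mat_trace (M ^\<^sub>m k))"
proof (induction m)
  case (add k m)
  have "mderiv k (mexp (interaction N M)) m
     = mderiv k (wick_coeff N) m * (mat_trace (M ^\<^sub>m k) * (\<Prod>k\<in>#m. mat_trace (M ^\<^sub>m k)))"
    unfolding wick_coeff_def mderiv_mexp_interaction one_mat_trace
    using add by (simp add: wick_coeff_def)
  thus ?case by (simp add: mderiv_def del: of_nat_Suc)
qed simp

section \<open>Loop equations for the partition function and its logarithm\<close>

context hermitian_integral
begin

definition T :: "nat multiset \<Rightarrow> complex" where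
  "T m = gint (Trs m) / gint (\<lambda>_. 1)"

abbreviation "Z \<equiv> partition_function N"
abbreviation "L \<equiv> mlog Z"

lemma Z_eq: "Z m = wick_coeff N m * T m"
proof -
  have "Z m = gint (\<lambda>x. wick_coeff N m * Trs m x) / gint (\<lambda>_. 1)"
    by (simp add: partition_function_def gaussian_mean_eq mexp_interaction Trs_def Tr_def)
  thus ?thesis by (simp add: gint_scale[OF gable_Trs] T_def)
qed

lemma Z_empty [simp]: "Z {#} = 1"
  using gint_one_nonzero by (simp add: Z_eq T_def Trs_def[abs_def])

lemma Z_zero: "0 \<in># m \<Longrightarrow> Z m = 0"
  by (simp add: Z_eq wick_coeff_zero)

lemma T_zero: "T (add_mset 0 m) = of_nat N * T m"
  using gint_scale[OF gable_Trs, of "of_nat N" m] by (simp add: T_def Tr_0 Trs_def[abs_def])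

text \<open>
  \<open>DZ k\<close> is \<open>k \<partial>/\<partial>a\<^sub>k\<close> applied to the partition function; with the convention \<open>DZ 0 = N\<^sup>2 Z\<close> it inserts
  \<open>N Tr M\<^sup>k\<close> into the Gaussian mean for every \<open>k\<close>.
\<close>

definition DZ :: "nat \<Rightarrow> nat multiset \<Rightarrow> complex" where
  "DZ k m = (if k = 0 then of_nat N ^ 2 * Z m else of_nat k * mderiv k Z m)"

definition DL :: "nat \<Rightarrow> nat multiset \<Rightarrow> complex" where
  "DL k m = (if k = 0 then of_nat N ^ 2 * mone m else of_nat k * mderiv k L m)"

text \<open>An index 0 gives zero because \<open>DL 0\<close> is the constant \<open>N^2\<close>,
  all of whose derivatives vanish. With this convention the formula for two inserted traces holds
  for all pairs of indices.\<close>

definition DDL :: "nat \<Rightarrow> nat \<Rightarrow> nat multiset \<Rightarrow> complex" where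
  "DDL r s m = (if r = 0 \<or> s = 0 then 0 else of_nat r * of_nat s * mderiv r (mderiv s L) m)"

lemma DZ_eq: "DZ k m = of_nat N * wick_coeff N m * T (add_mset k m)"
proof (cases "k = 0")
  case False
  have "DZ k m = (of_nat k * of_nat (count m k + 1) * wick_coeff N (add_mset k m)) * T (add_mset k m)"
    using False by (simp add: DZ_def mderiv_def Z_eq)
  thus ?thesis unfolding wick_coeff_add using False by simp
qed (simp add: DZ_def Z_eq T_zero power2_eq_square)

lemma DZ_DL: "DZ k = mtimes Z (DL k)"
proof
  fix m
  show "DZ k m = mtimes Z (DL k) m"
    by (cases "k = 0") (simp_all add: DZ_def DL_def[abs_def] mtimes_scale_right mderiv_mlog)
qed

text \<open>Two derivatives of Z = exp L give Z times the sum of the second derivative of L and the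
  product of its first derivatives. The cases with an index 0 are the trace of the identity, which
  is \<open>N\<close>.\<close>

lemma T_add_add:
  "of_nat N ^ 2 * wick_coeff N m * T (add_mset r (add_mset s m))
     = mtimes Z (\<lambda>m. DDL r s m + mtimes (DL r) (DL s) m) m"
proof -
  consider "r = 0" | "s = 0" | "r \<ge> 1" "s \<ge> 1" by linarith
  thus ?thesis
  proof cases
    case 1
    have "of_nat N ^ 2 * wick_coeff N m * T (add_mset r (add_mset s m)) = of_nat N ^ 2 * DZ s m"
      by (simp add: 1 T_zero DZ_eq power2_eq_square)
    thus ?thesis by (simp add: 1 DZ_DL DDL_def DL_def[of 0, abs_def] mtimes_scale_left mtimes_scale_right)
  next
    case 2
    have "of_nat N ^ 2 * wick_coeff N m * T (add_mset r (add_mset s m)) = of_nat N ^ 2 * DZ r m"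
      by (simp add: 2 T_zero DZ_eq power2_eq_square add_mset_commute)
    thus ?thesis by (simp add: 2 DZ_DL DDL_def DL_def[of 0, abs_def] mtimes_scale_right)
  next
    case 3
    have "of_nat r * mderiv r (DZ s) m
        = of_nat N * (of_nat r * of_nat (count m r + 1) * wick_coeff N (add_mset r m)) * T (add_mset s (add_mset r m))"
      by (simp add: mderiv_def DZ_eq)
    also have "\<dots> = of_nat N ^ 2 * wick_coeff N m * T (add_mset r (add_mset s m))"
      unfolding wick_coeff_add using 3 by (simp add: power2_eq_square add_mset_commute)
    finally have "of_nat N ^ 2 * wick_coeff N m * T (add_mset r (add_mset s m)) = of_nat r * mderiv r (DZ s) m" ..
    also have "\<dots> = of_nat r * (mtimes (mderiv r Z) (DL s) m + mtimes Z (mderiv r (DL s)) m)"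
      by (simp add: DZ_DL mderiv_mtimes)
    also have "\<dots> = mtimes (DZ r) (DL s) m + mtimes Z (DDL r s) m"
    proof -
      have "DZ r = (\<lambda>m. of_nat r * mderiv r Z m)" using 3 by (simp add: DZ_def[abs_def])
      moreover have "DDL r s = (\<lambda>m. of_nat r * mderiv r (DL s) m)"
        using 3 by (simp add: DDL_def[abs_def] DL_def[abs_def] mderiv_def algebra_simps)
      ultimately show ?thesis by (simp add: mtimes_scale_left mtimes_scale_right distrib_left)
    qed
    finally show ?thesis by (simp add: DZ_DL mtimes_assoc mtimes_add_right)
  qed
qed

lemma DZ_loop:
  "DZ (Suc k) m = (\<Sum>r<k. wick_coeff N m * T (add_mset r (add_mset (k - 1 - r) m)))
     + var_sum (\<lambda>n. DZ (k + n - 1)) m"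
proof -
  have "T (add_mset (Suc k) m) = 1 / of_nat N * ((\<Sum>r<k. T (add_mset r (add_mset (k - 1 - r) m)))
       + (\<Sum>n\<in>#m. of_nat n * T (add_mset (k + n - 1) (m - {#n#}))))"
  proof -
    have "(\<Sum>n\<in>#A. f n) / c = (\<Sum>n\<in>#A. f n / c)" for A and f :: "nat \<Rightarrow> complex" and c
      by (induction A) (simp_all add: add_divide_distrib)
    thus ?thesis
      unfolding T_def schwinger_dyson by (simp add: add_divide_distrib sum_divide_distrib mult.commute)
  qed
  note T_Suc = this
  have "DZ (Suc k) m = (\<Sum>r<k. wick_coeff N m * T (add_mset r (add_mset (k - 1 - r) m)))
       + wick_coeff N m * (\<Sum>n\<in>#m. of_nat n * T (add_mset (k + n - 1) (m - {#n#})))"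
  proof -
    have "of_nat N * w * (1 / of_nat N * c) = w * c" for w c :: complex using N_pos by simp
    thus ?thesis unfolding DZ_eq T_Suc by (simp only: distrib_left sum_distrib_left)
  qed
  also have "wick_coeff N m * (\<Sum>n\<in>#m. of_nat n * T (add_mset (k + n - 1) (m - {#n#})))
      = (\<Sum>n\<in>set_mset m. wick_coeff N m * (of_nat (count m n) * (of_nat n * T (add_mset (k + n - 1) (m - {#n#})))))"
    by (simp only: sum_mset_eq_sum_count sum_distrib_left)
  also have "\<dots> = (\<Sum>n | n \<in># m \<and> n \<ge> 1. wick_coeff N m * (of_nat (count m n) * (of_nat n * T (add_mset (k + n - 1) (m - {#n#})))))"
    by (rule sum.mono_neutral_right) auto
  also have "\<dots> = var_sum (\<lambda>n. DZ (k + n - 1)) m"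
    unfolding var_sum_def
  proof (intro sum.cong refl)
    fix n assume n: "n \<in> {n. n \<in># m \<and> n \<ge> 1}"
    then obtain m' where m': "m = add_mset n m'" by (auto dest: multi_member_split)
    \<comment> \<open>The factors \<open>n\<close> and \<open>count m n\<close> turn the
      combinatorial coefficient at \<open>m\<close> into \<open>N\<close> times the one at
      \<open>m - {#n#}\<close>, which is multiplication by the \<open>n\<close>-th
      indeterminate.\<close>
    show "wick_coeff N m * (of_nat (count m n) * (of_nat n * T (add_mset (k + n - 1) (m - {#n#})))) = DZ (k + n - 1) (m - {#n#})"
      using wick_coeff_add[of n m' N] n by (simp add: m' DZ_eq mult_ac del: of_nat_Suc)
  qed
  finally show ?thesis .
qed

text \<open>The equation for \<open>Z\<close> divided by \<open>Z\<close>. The products of two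
  traces are where the nonlinearity and the second derivatives come from; the sum over the
  indeterminates stays linear.\<close>

lemma DL_loop:
  "DL (Suc k) m = (\<Sum>r<k. (DDL r (k - 1 - r) m + mtimes (DL r) (DL (k - 1 - r)) m) / of_nat N ^ 2)
     + var_sum (\<lambda>n. DL (k + n - 1)) m"
proof -
  let ?R = "\<lambda>m. (\<Sum>r<k. 1 / of_nat N ^ 2 * (DDL r (k - 1 - r) m + mtimes (DL r) (DL (k - 1 - r)) m))
     + var_sum (\<lambda>n. DL (k + n - 1)) m"
  have "mtimes Z (DL (Suc k)) = mtimes Z ?R"
  proof
    fix m
    have "mtimes Z ?R m = (\<Sum>r<k. 1 / of_nat N ^ 2 * mtimes Z (\<lambda>m. DDL r (k - 1 - r) m + mtimes (DL r) (DL (k - 1 - r)) m) m)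
       + mtimes Z (var_sum (\<lambda>n. DL (k + n - 1))) m"
      by (simp only: mtimes_add_right mtimes_sum_right mtimes_scale_right)
    also have "\<dots> = DZ (Suc k) m"
      using N_pos by (simp add: T_add_add[symmetric] mtimes_var_sum DZ_DL[symmetric] DZ_loop)
    finally show "mtimes Z (DL (Suc k)) m = mtimes Z ?R m" by (simp add: DZ_DL)
  qed
  hence "DL (Suc k) = ?R" by (rule mtimes_cancel[rotated]) simp
  thus ?thesis by simp
qed

lemma L_zero: "0 \<in># m \<Longrightarrow> L m = 0"
proof -
  have "mtimes Z (mderiv 0 L) = mtimes Z (\<lambda>_. 0)"
    by (intro ext) (simp add: mderiv_mlog, simp add: mderiv_def Z_zero mtimes_def)
  hence "mderiv 0 L = (\<lambda>_. 0)" by (rule mtimes_cancel[rotated]) simp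
  hence *: "mderiv 0 L m' = 0" for m' by simp
  assume "0 \<in># m"
  then obtain m' where "m = add_mset 0 m'" by (auto dest: multi_member_split)
  thus ?thesis using *[of m'] by (simp add: mderiv_def del: of_nat_Suc)
qed

end

section \<open>Genus expansion\<close>

definition rpoly :: "rat poly \<Rightarrow> complex \<Rightarrow> complex" where
  "rpoly P x = poly (map_poly of_rat P) x"

lemma rpoly_0 [simp]: "rpoly 0 x = 0"
  by (simp add: rpoly_def)

lemma rpoly_pCons [simp]: "rpoly (pCons a P) x = of_rat a + x * rpoly P x"
  by (simp add: rpoly_def map_poly_pCons)

lemma rpoly_add: "rpoly (P + Q) x = rpoly P x + rpoly Q x"
proof (induction P arbitrary: Q)
  case (pCons a P)
  show ?case by (cases Q) (simp_all add: pCons.IH of_rat_add distrib_left)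
qed simp

lemma rpoly_smult: "rpoly (Polynomial.smult c P) x = of_rat c * rpoly P x"
  by (induction P) (simp_all add: of_rat_mult algebra_simps)

lemma rpoly_mult: "rpoly (P * Q) x = rpoly P x * rpoly Q x"
  by (induction P) (simp_all add: rpoly_add rpoly_smult algebra_simps)

lemma rpoly_altdef: "rpoly P x = (\<Sum>i | Polynomial.coeff P i \<noteq> 0. of_rat (Polynomial.coeff P i) * x ^ i)"
proof -
  have "rpoly P x = (\<Sum>i\<le>Polynomial.degree P. of_rat (Polynomial.coeff P i) * x ^ i)"
    by (simp add: rpoly_def poly_altdef coeff_map_poly degree_map_poly)
  also have "\<dots> = (\<Sum>i | Polynomial.coeff P i \<noteq> 0. of_rat (Polynomial.coeff P i) * x ^ i)"
    by (rule sum.mono_neutral_right) (auto simp: le_degree)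
  finally show ?thesis .
qed

text \<open>The points \<open>1 / N^2\<close> are infinitely many, so integer matrix sizes suffice
  to determine the polynomial. Uniqueness of the genus expansion rests on this.\<close>

lemma rpoly_eqD:
  assumes "\<And>N::nat. N \<ge> 1 \<Longrightarrow> rpoly P (1 / of_nat N ^ 2) = rpoly Q (1 / of_nat N ^ 2)"
  shows "P = Q"
proof -
  let ?R = "map_poly (of_rat :: rat \<Rightarrow> complex) (P - Q)"
  have "P = (P - Q) + Q" by simp
  hence "rpoly P x = rpoly (P - Q) x + rpoly Q x" for x by (metis rpoly_add)
  hence roots: "poly ?R (1 / of_nat N ^ 2) = 0" if "N \<ge> 1" for N :: nat
    using assms[OF that] by (simp add: rpoly_def)
  have "?R = 0"
  proof (rule ccontr)
    assume "?R \<noteq> 0"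
    hence "finite {x. poly ?R x = 0}" by (rule poly_roots_finite)
    moreover have "(\<lambda>N. 1 / of_nat (Suc N) ^ 2) ` UNIV \<subseteq> {x. poly ?R x = 0}"
      using roots by (auto simp del: of_nat_Suc)
    moreover have "inj (\<lambda>N. 1 / of_nat (Suc N) ^ 2 :: complex)"
    proof (rule injI)
      fix M N assume "1 / of_nat (Suc M) ^ 2 = (1 / of_nat (Suc N) ^ 2 :: complex)"
      hence "of_nat (Suc M ^ 2) = (of_nat (Suc N ^ 2) :: complex)"
        by (simp add: divide_simps del: of_nat_Suc)
      thus "M = N" by (simp only: of_nat_eq_iff) simp
    qed
    ultimately show False by (meson finite_imageD finite_subset infinite_UNIV_nat)
  qed
  hence "Polynomial.coeff (P - Q) i = 0" for i
    using coeff_map_poly[of "of_rat :: rat \<Rightarrow> complex" "P - Q" i] by simp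
  thus ?thesis by (simp add: poly_eq_iff)
qed

text \<open>The coefficient of \<open>P\<close> in degree \<open>g\<close> multiplies
  \<open>N^(2 - 2g)\<close>: one polynomial independent of \<open>N\<close> encodes a terminating
  genus expansion with rational coefficients.\<close>

definition genus_poly :: "(nat \<Rightarrow> complex) \<Rightarrow> rat poly \<Rightarrow> bool" where
  "genus_poly \<phi> P \<longleftrightarrow> (\<forall>N\<ge>1. \<phi> N = of_nat N ^ 2 * rpoly P (1 / of_nat N ^ 2))"

definition has_genus_poly :: "(nat \<Rightarrow> complex) \<Rightarrow> bool" where
  "has_genus_poly \<phi> \<longleftrightarrow> (\<exists>P. genus_poly \<phi> P)"

lemma has_genus_poly_0: "(\<And>N. N \<ge> 1 \<Longrightarrow> \<phi> N = 0) \<Longrightarrow> has_genus_poly \<phi>"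
  unfolding has_genus_poly_def genus_poly_def by (intro exI[of _ 0]) simp

lemma has_genus_poly_square: "has_genus_poly (\<lambda>N. of_nat N ^ 2)"
  unfolding has_genus_poly_def genus_poly_def by (intro exI[of _ "[:1:]"]) simp

lemma has_genus_poly_add:
  "has_genus_poly \<phi> \<Longrightarrow> has_genus_poly \<psi> \<Longrightarrow> has_genus_poly (\<lambda>N. \<phi> N + \<psi> N)"
  unfolding has_genus_poly_def genus_poly_def
proof (elim exE)
  fix P Q assume "\<forall>N\<ge>1. \<phi> N = of_nat N ^ 2 * rpoly P (1 / of_nat N ^ 2)"
    "\<forall>N\<ge>1. \<psi> N = of_nat N ^ 2 * rpoly Q (1 / of_nat N ^ 2)"
  thus "\<exists>P. \<forall>N\<ge>1. \<phi> N + \<psi> N = of_nat N ^ 2 * rpoly P (1 / of_nat N ^ 2)"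
    by (intro exI[of _ "P + Q"]) (simp add: rpoly_add distrib_left)
qed

lemma has_genus_poly_sum:
  "(\<And>i. i \<in> A \<Longrightarrow> has_genus_poly (\<phi> i)) \<Longrightarrow> has_genus_poly (\<lambda>N. \<Sum>i\<in>A. \<phi> i N)"
  by (induction A rule: infinite_finite_induct) (auto intro: has_genus_poly_0 has_genus_poly_add)

lemma has_genus_poly_scale:
  assumes "has_genus_poly \<phi>"
  shows "has_genus_poly (\<lambda>N. of_rat c * \<phi> N)"
proof -
  obtain P where "\<forall>N\<ge>1. \<phi> N = of_nat N ^ 2 * rpoly P (1 / of_nat N ^ 2)"
    using assms unfolding has_genus_poly_def genus_poly_def by blast
  thus ?thesis unfolding has_genus_poly_def genus_poly_def
    by (intro exI[of _ "Polynomial.smult c P"]) (simp add: rpoly_smult mult_ac)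
qed

text \<open>Each factor contributes a leading \<open>N^2\<close>, and the division removes one of
  them. The quadratic terms of \<open>DL_loop\<close> come with this normalization.\<close>

lemma has_genus_poly_mult:
  assumes "has_genus_poly \<phi>" "has_genus_poly \<psi>"
  shows "has_genus_poly (\<lambda>N. \<phi> N * \<psi> N / of_nat N ^ 2)"
proof -
  obtain P Q where P: "\<forall>N\<ge>1. \<phi> N = of_nat N ^ 2 * rpoly P (1 / of_nat N ^ 2)"
    and Q: "\<forall>N\<ge>1. \<psi> N = of_nat N ^ 2 * rpoly Q (1 / of_nat N ^ 2)"
    using assms unfolding has_genus_poly_def genus_poly_def by blast
  show ?thesis unfolding has_genus_poly_def genus_poly_def
  proof (intro exI[of _ "P * Q"] allI impI)
    fix N :: nat assume N: "N \<ge> 1"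
    show "\<phi> N * \<psi> N / of_nat N ^ 2 = of_nat N ^ 2 * rpoly (P * Q) (1 / of_nat N ^ 2)"
      unfolding P[rule_format, OF N] Q[rule_format, OF N] rpoly_mult using N by simp
  qed
qed

lemma has_genus_poly_div:
  assumes "has_genus_poly \<phi>"
  shows "has_genus_poly (\<lambda>N. \<phi> N / of_nat N ^ 2)"
proof -
  obtain P where P: "\<forall>N\<ge>1. \<phi> N = of_nat N ^ 2 * rpoly P (1 / of_nat N ^ 2)"
    using assms unfolding has_genus_poly_def genus_poly_def by blast
  show ?thesis unfolding has_genus_poly_def genus_poly_def
    by (intro exI[of _ "pCons 0 P"] allI impI) (simp add: P[rule_format])
qed

lemma genus_poly_limit:
  assumes "genus_poly \<phi> P"
  shows "(\<lambda>N. \<phi> N / of_nat N ^ 2) \<longlonglongrightarrow> of_rat (Polynomial.coeff P 0)"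
proof -
  have "(\<lambda>N. 1 / of_nat N ^ 2 :: complex) \<longlonglongrightarrow> 0"
    using tendsto_power[OF lim_1_over_n[where 'a = complex], of 2] by (simp add: power_divide)
  hence "(\<lambda>N. rpoly P (1 / of_nat N ^ 2)) \<longlonglongrightarrow> rpoly P 0"
    unfolding rpoly_def by (rule tendsto_poly)
  moreover have "rpoly P 0 = of_rat (Polynomial.coeff P 0)"
    by (simp add: rpoly_def poly_0_coeff_0 coeff_map_poly)
  moreover have "\<forall>\<^sub>F N in sequentially. rpoly P (1 / of_nat N ^ 2) = \<phi> N / of_nat N ^ 2"
    using eventually_ge_at_top[of "1 :: nat"] by eventually_elim (use assms in \<open>auto simp: genus_poly_def\<close>)
  ultimately show ?thesis by (simp add: tendsto_cong)
qed

abbreviation log_partition :: "nat \<Rightarrow> complex mseries" where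
  "log_partition N \<equiv> mlog (partition_function N)"

lemma has_genus_poly_cong:
  "(\<And>N. N \<ge> 1 \<Longrightarrow> \<phi> N = \<psi> N) \<Longrightarrow> has_genus_poly \<phi> \<longleftrightarrow> has_genus_poly \<psi>"
  by (simp add: has_genus_poly_def genus_poly_def)

lemma hermitian_integralI: "N \<ge> 1 \<Longrightarrow> hermitian_integral N"
  by unfold_locales

text \<open>Induction on the weight \<open>sum_mset m\<close>. For
  \<open>m = add_mset (Suc k) m'\<close> every term on the right of \<open>DL_loop\<close> has total
  weight \<open>sum_mset m - 2\<close>. The size would not do as a measure, since the second
  derivatives add an index. Monomials containing 0 are set aside, as the logarithm vanishes
  there.\<close>

lemma log_partition_has_genus_poly: "has_genus_poly (\<lambda>N. log_partition N m)"
proof (induction m rule: measure_induct_rule[of sum_mset])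
  case (less m)
  consider "m = {#}" | "0 \<in># m" | k m' where "m = add_mset (Suc k) m'"
    by (metis multiset_cases union_single_eq_member not0_implies_Suc)
  thus ?case
  proof cases
    case 1
    thus ?thesis by (intro has_genus_poly_0) simp
  next
    case 2
    thus ?thesis by (intro has_genus_poly_0 hermitian_integral.L_zero hermitian_integralI)
  next
    case (3 k m')
    have DL: "has_genus_poly (\<lambda>N. hermitian_integral.DL N r j)" if "r + sum_mset j < sum_mset m" for r j
    proof (cases "r = 0")
      case True
      have "has_genus_poly (\<lambda>N. of_rat (mone j) * of_nat N ^ 2)"
        by (intro has_genus_poly_scale has_genus_poly_square)
      thus ?thesis
        by (subst has_genus_poly_cong)
           (auto simp: True hermitian_integral.DL_def[OF hermitian_integralI] mone_def)
    next
      case False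
      have "has_genus_poly (\<lambda>N. of_rat (of_nat r * of_nat (count j r + 1)) * log_partition N (add_mset r j))"
        using that by (intro has_genus_poly_scale less.IH) simp
      thus ?thesis using False
        by (subst has_genus_poly_cong)
           (auto simp: hermitian_integral.DL_def[OF hermitian_integralI] mderiv_def of_rat_mult of_rat_add
              simp del: of_nat_Suc)
    qed
    have DDL: "has_genus_poly (\<lambda>N. hermitian_integral.DDL N r s m')" if "r + s + sum_mset m' < sum_mset m" for r s
    proof (cases "r = 0 \<or> s = 0")
      case True
      thus ?thesis by (intro has_genus_poly_0) (auto simp: hermitian_integral.DDL_def[OF hermitian_integralI])
    next
      case False
      have "has_genus_poly (\<lambda>N. of_rat (of_nat r * of_nat s * of_nat (count m' r + 1) * of_nat (count (add_mset r m') s + 1))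
          * log_partition N (add_mset s (add_mset r m')))"
        using that by (intro has_genus_poly_scale less.IH) simp
      thus ?thesis using False
        by (subst has_genus_poly_cong)
           (auto simp: hermitian_integral.DDL_def[OF hermitian_integralI] mderiv_def of_rat_mult of_rat_add
              simp del: of_nat_Suc)
    qed
    let ?A = "{n. n \<in># m' \<and> n \<ge> 1}"
    have a: "has_genus_poly (\<lambda>N. hermitian_integral.DDL N r (k - 1 - r) m' / of_nat N ^ 2)" if "r \<in> {..<k}" for r
      using that 3 by (intro has_genus_poly_div DDL) auto
    have b: "has_genus_poly (\<lambda>N. hermitian_integral.DL N r j * hermitian_integral.DL N (k - 1 - r) (m' - j) / of_nat N ^ 2)"
      if r: "r \<in> {..<k}" and j: "j \<in> {j. j \<subseteq># m'}" for r j
    proof -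
      have "sum_mset m' = sum_mset j + sum_mset (m' - j)"
        using j by (metis mem_Collect_eq subset_mset.add_diff_inverse sum_mset.union)
      thus ?thesis using r 3 by (intro has_genus_poly_mult DL) auto
    qed
    have c: "has_genus_poly (\<lambda>N. hermitian_integral.DL N (k + n - 1) (m' - {#n#}))" if "n \<in> ?A" for n
      using that 3 by (intro DL) (auto dest!: multi_member_split)
    have "has_genus_poly (\<lambda>N. (\<Sum>r<k. hermitian_integral.DDL N r (k - 1 - r) m' / of_nat N ^ 2
        + (\<Sum>j | j \<subseteq># m'. hermitian_integral.DL N r j * hermitian_integral.DL N (k - 1 - r) (m' - j) / of_nat N ^ 2))
        + (\<Sum>n\<in>?A. hermitian_integral.DL N (k + n - 1) (m' - {#n#})))"
      by (intro has_genus_poly_add has_genus_poly_sum a b c)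
    hence "has_genus_poly (\<lambda>N. hermitian_integral.DL N (Suc k) m')"
      by (subst has_genus_poly_cong)
         (auto simp: hermitian_integral.DL_loop[OF hermitian_integralI] mtimes_def var_sum_def
             sum_divide_distrib add_divide_distrib)
    \<comment> \<open>The coefficient of the logarithm at \<open>m\<close> is \<open>DL\<close>
      divided by a positive integer that is independent of \<open>N\<close>.\<close>
    hence "has_genus_poly (\<lambda>N. of_rat (1 / (of_nat (Suc k) * of_nat (count m' (Suc k) + 1)))
        * hermitian_integral.DL N (Suc k) m')"
      by (rule has_genus_poly_scale)
    thus ?thesis
      by (subst has_genus_poly_cong)
         (auto simp: hermitian_integral.DL_def[OF hermitian_integralI] mderiv_def of_rat_divide of_rat_mult of_rat_add 3
             simp del: of_nat_Suc)
  qed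
qed

section \<open>Existence and uniqueness of the genus expansion\<close>

lemma powi_genus:
  assumes "N \<ge> 1"
  shows "of_nat N powi (2 - 2 * int g) = (of_nat N ^ 2 * (1 / of_nat N ^ 2) ^ g :: complex)"
proof -
  have "of_nat N powi (2 - 2 * int g) = (of_nat N powi (int 2) / of_nat N powi (int (2 * g)) :: complex)"
    using assms by (subst power_int_diff) auto
  thus ?thesis by (simp only: power_int_of_nat power_mult power_divide) (simp add: power_divide)
qed

lemma genus_expansion_iff:
  assumes "finite {g. c g \<noteq> 0}"
  shows "(\<forall>N\<ge>1. \<phi> N = (\<Sum>g | c g \<noteq> 0. of_nat N powi (2 - 2 * int g) * of_rat (c g)))
     \<longleftrightarrow> (\<exists>P. genus_poly \<phi> P \<and> Polynomial.coeff P = c)"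
proof -
  have "\<exists>P. Polynomial.coeff P = c"
  proof -
    have "\<forall>\<^sub>F n in cofinite. c n = 0" using assms by (simp add: eventually_cofinite)
    thus ?thesis by (metis (mono_tags, lifting) MOST_coeff_eq_0 coeff_Abs_poly_If_le Abs_poly_inverse mem_Collect_eq)
  qed
  then obtain P where P: "Polynomial.coeff P = c" by blast
  have "(\<Sum>g | c g \<noteq> 0. of_nat N powi (2 - 2 * int g) * of_rat (c g)) = of_nat N ^ 2 * rpoly P (1 / of_nat N ^ 2)"
    if "N \<ge> 1" for N
    by (simp only: rpoly_altdef P powi_genus[OF that] sum_distrib_left) (simp add: mult_ac)
  hence "(\<forall>N\<ge>1. \<phi> N = (\<Sum>g | c g \<noteq> 0. of_nat N powi (2 - 2 * int g) * of_rat (c g))) \<longleftrightarrow> genus_poly \<phi> P"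
    by (simp add: genus_poly_def)
  thus ?thesis using P by (metis coeff_inject)
qed

definition free_energy_poly :: "nat multiset \<Rightarrow> rat poly" where
  "free_energy_poly m = (SOME P. genus_poly (\<lambda>N. log_partition N m) P)"

lemma genus_poly_free_energy: "genus_poly (\<lambda>N. log_partition N m) (free_energy_poly m)"
  unfolding free_energy_poly_def
  using log_partition_has_genus_poly[of m] unfolding has_genus_poly_def by (rule someI_ex)

lemma genus_poly_unique: "genus_poly \<phi> P \<Longrightarrow> genus_poly \<phi> Q \<Longrightarrow> P = Q"
  by (rule rpoly_eqD) (auto simp: genus_poly_def)

text \<open>Existence and uniqueness in one equivalence; it justifies the definite description in
  \<open>genus_free_energy\<close>.\<close>

lemma is_genus_expansion_iff:
  "is_genus_expansion F \<longleftrightarrow> F = (\<lambda>g m. Polynomial.coeff (free_energy_poly m) g)"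
proof
  assume F: "is_genus_expansion F"
  show "F = (\<lambda>g m. Polynomial.coeff (free_energy_poly m) g)"
  proof (intro ext)
    fix g m
    have "\<exists>P. genus_poly (\<lambda>N. log_partition N m) P \<and> Polynomial.coeff P = (\<lambda>g. F g m)"
      using F unfolding is_genus_expansion_def by (subst genus_expansion_iff[symmetric]) auto
    then obtain P where P: "genus_poly (\<lambda>N. log_partition N m) P" "Polynomial.coeff P = (\<lambda>g. F g m)" by blast
    thus "F g m = Polynomial.coeff (free_energy_poly m) g"
      using genus_poly_unique[OF P(1) genus_poly_free_energy] by metis
  qed
next
  assume F: "F = (\<lambda>g m. Polynomial.coeff (free_energy_poly m) g)"
  have fin: "finite {g. F g m \<noteq> 0}" for m
    unfolding F by (rule finite_subset[of _ "{..Polynomial.degree (free_energy_poly m)}"]) (auto simp: le_degree)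
  show "is_genus_expansion F"
    unfolding is_genus_expansion_def
  proof (intro conjI allI impI fin)
    fix N m assume "(1 :: nat) \<le> N"
    thus "log_partition N m = (\<Sum>g | F g m \<noteq> 0. of_nat N powi (2 - 2 * int g) * of_rat (F g m))"
      using genus_expansion_iff[of "\<lambda>g. F g m" "\<lambda>N. log_partition N m", OF fin] genus_poly_free_energy[of m] F by auto
  qed
qed

lemma formal_planar_limit_eq: "formal_planar_limit m = Polynomial.coeff (free_energy_poly m) 0"
  by (simp add: formal_planar_limit_def genus_free_energy_def is_genus_expansion_iff)

section \<open>The planar limit as a limit of large matrix size\<close>

lemma formal_planar_limit_tendsto:
  "(\<lambda>N. log_partition N m / of_nat N ^ 2) \<longlonglongrightarrow> of_rat (formal_planar_limit m)"
  unfolding formal_planar_limit_eq by (rule genus_poly_limit[OF genus_poly_free_energy])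

lemma formal_planar_limit_eq_0:
  assumes "\<And>N. N \<ge> 1 \<Longrightarrow> log_partition N m = 0"
  shows "formal_planar_limit m = 0"
proof -
  have "genus_poly (\<lambda>N. log_partition N m) 0" using assms by (simp add: genus_poly_def)
  thus ?thesis using genus_poly_unique[OF _ genus_poly_free_energy] by (metis coeff_0 formal_planar_limit_eq)
qed

lemma formal_planar_limit_empty: "formal_planar_limit {#} = 0"
  by (rule formal_planar_limit_eq_0) simp

lemma formal_planar_limit_zero: "0 \<in># m \<Longrightarrow> formal_planar_limit m = 0"
  by (intro formal_planar_limit_eq_0 hermitian_integral.L_zero hermitian_integralI)

text \<open>The generating series of planar moments: \<open>k \<partial>/\<partial>a\<^sub>k\<close> of the planar limit, and \<open>1\<close> for \<open>k = 0\<close>.\<close>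

definition planar_moment :: "nat \<Rightarrow> rat mseries" where
  "planar_moment k m = (if k = 0 then mone m else of_nat k * mderiv k formal_planar_limit m)"

lemma DL_tendsto:
  "(\<lambda>N. hermitian_integral.DL N k m / of_nat N ^ 2) \<longlonglongrightarrow> of_rat (planar_moment k m)"
proof -
  have ev: "\<forall>\<^sub>F N in sequentially. hermitian_integral.DL N k m / of_nat N ^ 2 =
      (if k = 0 then mone m else of_nat k * of_nat (count m k + 1) * (log_partition N (add_mset k m) / of_nat N ^ 2))"
    using eventually_ge_at_top[of "1 :: nat"]
    by eventually_elim (simp add: hermitian_integral.DL_def[OF hermitian_integralI] mderiv_def)
  have "(\<lambda>N. if k = 0 then mone m else of_nat k * of_nat (count m k + 1) * (log_partition N (add_mset k m) / of_nat N ^ 2))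
      \<longlonglongrightarrow> (if k = 0 then mone m else of_nat k * of_nat (count m k + 1) * of_rat (formal_planar_limit (add_mset k m)))"
    by (cases "k = 0") (simp, simp only: if_False, intro tendsto_intros formal_planar_limit_tendsto)
  also have "(if k = 0 then mone m else of_nat k * of_nat (count m k + 1) * of_rat (formal_planar_limit (add_mset k m)))
      = (of_rat (planar_moment k m) :: complex)"
    by (simp add: planar_moment_def mderiv_def mone_def of_rat_mult of_rat_add)
  finally show ?thesis by (subst tendsto_cong[OF ev])
qed

text \<open>Large-N factorization: a second derivative of the logarithm is of order
  \<open>N^2\<close>, like the logarithm itself, whereas a product of two first derivatives is of
  order \<open>N^4\<close>.\<close>

lemma DDL_tendsto: "(\<lambda>N. hermitian_integral.DDL N r s m / of_nat N ^ 2 / of_nat N ^ 2) \<longlonglongrightarrow> 0"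
proof -
  let ?c = "of_nat r * of_nat s * of_nat (count m r + 1) * of_nat (count (add_mset r m) s + 1) :: complex"
  have ev: "\<forall>\<^sub>F N in sequentially. hermitian_integral.DDL N r s m / of_nat N ^ 2 / of_nat N ^ 2 =
      ?c * (log_partition N (add_mset s (add_mset r m)) / of_nat N ^ 2) * (1 / of_nat N) ^ 2"
    using eventually_ge_at_top[of "1 :: nat"]
    by eventually_elim (auto simp add: hermitian_integral.DDL_def[OF hermitian_integralI] mderiv_def power_divide)
  have "(\<lambda>N. ?c * (log_partition N (add_mset s (add_mset r m)) / of_nat N ^ 2) * (1 / of_nat N) ^ 2)
     \<longlonglongrightarrow> ?c * of_rat (formal_planar_limit (add_mset s (add_mset r m))) * 0 ^ 2"
    by (intro tendsto_intros formal_planar_limit_tendsto lim_1_over_n)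
  thus ?thesis by (subst tendsto_cong[OF ev]) simp
qed

text \<open>The limit of \<open>DL_loop\<close> divided by \<open>N^2\<close>. Passing to limits
  replaces bookkeeping of genus-zero parts of polynomial products, and the result descends to
  rational numbers because their embedding is injective.\<close>

theorem planar_loop:
  "planar_moment (Suc k) m = (\<Sum>r<k. mtimes (planar_moment r) (planar_moment (k - 1 - r)) m)
     + var_sum (\<lambda>n. planar_moment (k + n - 1)) m"
proof -
  let ?D = "\<lambda>k m N. hermitian_integral.DL N k m / of_nat N ^ 2"
  have ev: "\<forall>\<^sub>F N in sequentially. ?D (Suc k) m N =
     (\<Sum>r<k. hermitian_integral.DDL N r (k - 1 - r) m / of_nat N ^ 2 / of_nat N ^ 2
        + (\<Sum>j | j \<subseteq># m. ?D r j N * ?D (k - 1 - r) (m - j) N))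
     + (\<Sum>n | n \<in># m \<and> n \<ge> 1. ?D (k + n - 1) (m - {#n#}) N)"
    using eventually_ge_at_top[of "1 :: nat"]
    by eventually_elim
       (simp add: hermitian_integral.DL_loop[OF hermitian_integralI] mtimes_def var_sum_def
          sum_divide_distrib add_divide_distrib)
  have "(\<lambda>N. (\<Sum>r<k. hermitian_integral.DDL N r (k - 1 - r) m / of_nat N ^ 2 / of_nat N ^ 2
        + (\<Sum>j | j \<subseteq># m. ?D r j N * ?D (k - 1 - r) (m - j) N))
     + (\<Sum>n | n \<in># m \<and> n \<ge> 1. ?D (k + n - 1) (m - {#n#}) N))
    \<longlonglongrightarrow> (\<Sum>r<k. 0 + (\<Sum>j | j \<subseteq># m. of_rat (planar_moment r j) * of_rat (planar_moment (k - 1 - r) (m - j))))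
     + (\<Sum>n | n \<in># m \<and> n \<ge> 1. of_rat (planar_moment (k + n - 1) (m - {#n#})))"
    by (intro tendsto_intros DL_tendsto DDL_tendsto)
  hence "?D (Suc k) m
    \<longlonglongrightarrow> of_rat ((\<Sum>r<k. mtimes (planar_moment r) (planar_moment (k - 1 - r)) m)
     + var_sum (\<lambda>n. planar_moment (k + n - 1)) m)"
    by (subst tendsto_cong[OF ev]) (simp add: mtimes_def var_sum_def of_rat_add of_rat_sum of_rat_mult)
  hence "(of_rat (planar_moment (Suc k) m) :: complex) = of_rat ((\<Sum>r<k. mtimes (planar_moment r) (planar_moment (k - 1 - r)) m)
     + var_sum (\<lambda>n. planar_moment (k + n - 1)) m)"
    by (rule LIMSEQ_unique[OF DL_tendsto])
  thus ?thesis by simp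
qed

section \<open>Planar moments as power series\<close>

text \<open>This reflects the symmetry M to -M, but is drawn from the planar recursion: a step
  lowers the total weight by two, so each product on the right has a factor of odd weight. For
  \<open>r = 0\<close> an odd weight excludes the empty monomial, the only one where
  \<open>planar_moment 0\<close> is nonzero.\<close>

lemma formal_planar_limit_odd: "odd (sum_mset m) \<Longrightarrow> formal_planar_limit m = 0"
proof (induction m rule: measure_induct_rule[of sum_mset])
  case (less m)
  have PM: "planar_moment r j = 0" if "r + sum_mset j < sum_mset m" "odd (r + sum_mset j)" for r j
  proof (cases "r = 0")
    case True
    hence "j \<noteq> {#}" using that by auto
    thus ?thesis by (simp add: planar_moment_def True mone_def)
  next
    case False
    thus ?thesis using less.IH[of "add_mset r j"] that by (simp add: planar_moment_def mderiv_def)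
  qed
  consider "m = {#}" | "0 \<in># m" | k m' where "m = add_mset (Suc k) m'"
    by (metis multiset_cases union_single_eq_member not0_implies_Suc)
  thus ?case
  proof cases
    case 3
    have "mtimes (planar_moment r) (planar_moment (k - 1 - r)) m' = 0" if "r < k" for r
      unfolding mtimes_def
    proof (intro sum.neutral ballI)
      fix j assume "j \<in> {j. j \<subseteq># m'}"
      hence s: "sum_mset m' = sum_mset j + sum_mset (m' - j)"
        by (metis mem_Collect_eq subset_mset.add_diff_inverse sum_mset.union)
      have w: "sum_mset m = Suc (Suc ((r + sum_mset j) + (k - 1 - r + sum_mset (m' - j))))"
        using s that 3 by simp
      hence "odd ((r + sum_mset j) + (k - 1 - r + sum_mset (m' - j)))" using less.prems by simp
      hence "odd (r + sum_mset j) \<or> odd (k - 1 - r + sum_mset (m' - j))" by (metis even_add)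
      moreover have "r + sum_mset j < sum_mset m" "k - 1 - r + sum_mset (m' - j) < sum_mset m"
        using w by linarith+
      ultimately show "planar_moment r j * planar_moment (k - 1 - r) (m' - j) = 0" using PM by (metis mult_zero_left mult_zero_right)
    qed
    moreover have "var_sum (\<lambda>n. planar_moment (k + n - 1)) m' = 0"
      unfolding var_sum_def
    proof (intro sum.neutral ballI)
      fix n assume n: "n \<in> {n. n \<in># m' \<and> n \<ge> 1}"
      then obtain m'' where m'': "m' = add_mset n m''" by (auto dest: multi_member_split)
      have "sum_mset m = Suc (Suc (k + n - 1 + sum_mset m''))" using n 3 m'' by simp
      thus "planar_moment (k + n - 1) (m' - {#n#}) = 0"
        using less.prems m'' by (intro PM) auto
    qed
    ultimately have "planar_moment (Suc k) m' = 0" by (simp add: planar_loop)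
    thus ?thesis by (simp add: planar_moment_def mderiv_def 3 del: of_nat_Suc)
  qed (simp_all add: formal_planar_limit_empty formal_planar_limit_zero)
qed

lemma planar_moment_odd: "odd (k + sum_mset m) \<Longrightarrow> planar_moment k m = 0"
  using formal_planar_limit_odd[of "add_mset k m"]
  by (cases "k = 0") (auto simp: planar_moment_def mderiv_def mone_def)

section \<open>Substitution of powers of s for the indeterminates\<close>

definition weight_set :: "nat set \<Rightarrow> nat \<Rightarrow> nat multiset set" where
  "weight_set S e = {m. set_mset m \<subseteq> S \<and> sum_mset m = e}"

lemma size_le_sum_mset: "0 \<notin># m \<Longrightarrow> size m \<le> sum_mset (m :: nat multiset)"
  by (induction m) auto

lemma member_le_sum_mset: "n \<in># m \<Longrightarrow> n \<le> sum_mset (m :: nat multiset)"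
  by (auto dest!: multi_member_split)

lemma finite_weight_set:
  assumes "0 \<notin> S"
  shows "finite (weight_set S e)"
proof -
  have "weight_set S e \<subseteq> mset ` {xs. set xs \<subseteq> {..e} \<and> length xs \<le> e}"
  proof
    fix m assume m: "m \<in> weight_set S e"
    obtain xs where xs: "m = mset xs" by (metis ex_mset)
    have "0 \<notin># m" using m assms by (auto simp: weight_set_def)
    hence "length xs \<le> e" "set xs \<subseteq> {..e}"
      using m size_le_sum_mset[of m] member_le_sum_mset[of _ m] by (auto simp: weight_set_def xs)
    thus "m \<in> mset ` {xs. set xs \<subseteq> {..e} \<and> length xs \<le> e}" using xs by blast
  qed
  thus ?thesis by (rule finite_subset) (intro finite_imageI finite_lists_length_le finite_atMost)
qed

lemma weight_set_0: "0 \<notin> S \<Longrightarrow> weight_set S 0 = {{#}}"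
proof -
  assume "0 \<notin> S"
  hence "m = {#}" if "set_mset m \<subseteq> S" "sum_mset m = 0" for m
    using that size_le_sum_mset[of m] by (metis bot_nat_0.extremum_unique size_eq_0_iff_empty subsetD)
  thus ?thesis by (auto simp: weight_set_def)
qed

text \<open>Summing over \<open>weight_set S e\<close> extracts the coefficient of
  \<open>s^e\<close> after substituting \<open>s^n\<close> for the indeterminates in
  \<open>S\<close> and 0 for the others. The identity says that this substitution is
  multiplicative.\<close>

lemma sum_weight_set_product:
  fixes f g :: "nat multiset \<Rightarrow> 'a::comm_ring_1"
  assumes "0 \<notin> S"
  shows "(\<Sum>m\<in>weight_set S e. mtimes f g m)
       = (\<Sum>i\<le>e. (\<Sum>m\<in>weight_set S i. f m) * (\<Sum>m\<in>weight_set S (e - i). g m))"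
proof -
  note fin = finite_weight_set[OF assms]
  have "(\<Sum>m\<in>weight_set S e. mtimes f g m)
      = (\<Sum>(m, j)\<in>(SIGMA m:weight_set S e. {j. j \<subseteq># m}). f j * g (m - j))"
    by (simp add: mtimes_def sum.Sigma fin finite_submultisets)
  also have "\<dots> = (\<Sum>(i, j, l)\<in>(SIGMA i:{..e}. weight_set S i \<times> weight_set S (e - i)). f j * g l)"
  proof (rule sum.reindex_bij_witness[where i = "\<lambda>(i, j, l). (j + l, j)" and j = "\<lambda>(m, j). (sum_mset j, j, m - j)"])
    fix x assume "x \<in> (SIGMA m:weight_set S e. {j. j \<subseteq># m})"
    then obtain m j where x: "x = (m, j)" "m \<in> weight_set S e" "j \<subseteq># m" by blast
    then obtain l where l: "m = j + l" by (metis subset_mset.add_diff_inverse)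
    show "(case case x of (m, j) \<Rightarrow> (sum_mset j, j, m - j) of (i, j, l) \<Rightarrow> (j + l, j)) = x"
      "(case x of (m, j) \<Rightarrow> (sum_mset j, j, m - j)) \<in> (SIGMA i:{..e}. weight_set S i \<times> weight_set S (e - i))"
      "(case case x of (m, j) \<Rightarrow> (sum_mset j, j, m - j) of (i, j, l) \<Rightarrow> f j * g l) = (case x of (m, j) \<Rightarrow> f j * g (m - j))"
      using x(2) by (auto simp: x(1) l weight_set_def)
  qed (auto simp: weight_set_def)
  also have "\<dots> = (\<Sum>i\<le>e. \<Sum>j\<in>weight_set S i. \<Sum>l\<in>weight_set S (e - i). f j * g l)"
  proof -
    have "(\<Sum>i\<le>e. \<Sum>x\<in>weight_set S i \<times> weight_set S (e - i). case x of (j, l) \<Rightarrow> f j * g l)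
        = (\<Sum>(i, j, l)\<in>(SIGMA i:{..e}. weight_set S i \<times> weight_set S (e - i)). f j * g l)"
      by (rule sum.Sigma) (auto intro: fin)
    thus ?thesis by (simp only: sum.cartesian_product)
  qed
  finally show ?thesis by (simp add: sum_product)
qed

text \<open>Under the same substitution, multiplication by the \<open>n\<close>-th indeterminate
  becomes multiplication by \<open>s^n\<close>, hence the shift from \<open>e\<close> to
  \<open>e - n\<close>.\<close>

lemma sum_weight_set_var:
  fixes f :: "nat \<Rightarrow> nat multiset \<Rightarrow> 'a::comm_ring_1"
  assumes "0 \<notin> S"
  shows "(\<Sum>m\<in>weight_set S e. \<Sum>n | n \<in># m. f n (m - {#n#}))
       = (\<Sum>n | n \<in> S \<and> n \<le> e. \<Sum>m\<in>weight_set S (e - n). f n m)"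
proof -
  note fin = finite_weight_set[OF assms]
  have fs: "finite {n. n \<in> S \<and> n \<le> e}" by (rule finite_subset[of _ "{..e}"]) auto
  have "(\<Sum>m\<in>weight_set S e. \<Sum>n | n \<in># m. f n (m - {#n#}))
      = (\<Sum>(m, n)\<in>(SIGMA m:weight_set S e. set_mset m). f n (m - {#n#}))"
    by (simp add: sum.Sigma fin)
  also have "\<dots> = (\<Sum>(n, m)\<in>(SIGMA n:{n. n \<in> S \<and> n \<le> e}. weight_set S (e - n)). f n m)"
  proof (rule sum.reindex_bij_witness[where i = "\<lambda>(n, m). (add_mset n m, n)" and j = "\<lambda>(m, n). (n, m - {#n#})"])
    fix x assume "x \<in> (SIGMA m:weight_set S e. set_mset m)"
    then obtain m n where x: "x = (m, n)" "m \<in> weight_set S e" "n \<in># m" by blast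
    then obtain m' where m': "m = add_mset n m'" by (auto dest: multi_member_split)
    show "(case case x of (m, n) \<Rightarrow> (n, m - {#n#}) of (n, m) \<Rightarrow> (add_mset n m, n)) = x"
      "(case x of (m, n) \<Rightarrow> (n, m - {#n#})) \<in> (SIGMA n:{n. n \<in> S \<and> n \<le> e}. weight_set S (e - n))"
      "(case case x of (m, n) \<Rightarrow> (n, m - {#n#}) of (n, m) \<Rightarrow> f n m) = (case x of (m, n) \<Rightarrow> f n (m - {#n#}))"
      using x(2) by (auto simp: x(1) m' weight_set_def)
  next
    fix y assume "y \<in> (SIGMA n:{n. n \<in> S \<and> n \<le> e}. weight_set S (e - n))"
    then obtain n m where "y = (n, m)" "n \<in> S" "n \<le> e" "m \<in> weight_set S (e - n)" by blast
    thus "(case case y of (n, m) \<Rightarrow> (add_mset n m, n) of (m, n) \<Rightarrow> (n, m - {#n#})) = y"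
      "(case y of (n, m) \<Rightarrow> (add_mset n m, n)) \<in> (SIGMA m:weight_set S e. set_mset m)"
      by (auto simp: weight_set_def)
  qed
  finally show ?thesis by (simp add: sum.Sigma fs fin)
qed

text \<open>
  The moment \<open>W\<^sub>k\<close> at \<open>a\<^sub>n = s\<^sup>n\<close> (\<open>n \<in> S\<close>), multiplied by \<open>s\<^sup>k\<close>: by parity this is a series in \<open>t = s\<^sup>2\<close>.
\<close>

definition moment_series :: "nat set \<Rightarrow> nat \<Rightarrow> rat fps" where
  "moment_series S k = Abs_fps (\<lambda>d. if k \<le> 2 * d then \<Sum>m\<in>weight_set S (2 * d - k). planar_moment k m else 0)"

lemma moment_series_eq_0: "k > 2 * d \<Longrightarrow> fps_nth (moment_series S k) d = 0"
  by (simp add: moment_series_def)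

lemma moment_series_0:
  assumes "0 \<notin> S"
  shows "moment_series S 0 = 1"
proof (rule fps_ext)
  fix d
  have "(\<Sum>m\<in>weight_set S (2 * d). planar_moment 0 m) = (if d = 0 then 1 else 0)"
  proof (cases "d = 0")
    case False
    hence "m \<noteq> {#}" if "m \<in> weight_set S (2 * d)" for m using that by (auto simp: weight_set_def)
    thus ?thesis using False by (auto simp: planar_moment_def mone_def intro!: sum.neutral)
  qed (simp add: weight_set_0[OF assms] planar_moment_def mone_def)
  thus "fps_nth (moment_series S 0) d = fps_nth 1 d" by (simp add: moment_series_def)
qed

lemma moment_series_odd:
  assumes "\<And>n. n \<in> S \<Longrightarrow> even n" "odd k"
  shows "moment_series S k = 0"
proof (rule fps_ext)
  fix d
  have "even (sum_mset m)" if "set_mset m \<subseteq> S" for m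
    using that by (induction m) (auto simp: assms(1))
  hence "planar_moment k m = 0" if "m \<in> weight_set S e" for m e
    using that assms(2) by (intro planar_moment_odd) (auto simp: weight_set_def)
  thus "fps_nth (moment_series S k) d = fps_nth 0 d"
    by (simp add: moment_series_def)
qed

text \<open>With the factors \<open>s^r\<close> and \<open>s^q\<close> restored, the coefficient of
  \<open>s^e\<close> sits at the power \<open>(e + r + q) / 2\<close> of t. By parity the
  half-integer powers vanish, and exponents \<open>i\<close> and \<open>d\<close> correspond by
  \<open>i = 2 * d - r\<close>.\<close>

lemma moment_series_product:
  assumes "0 \<notin> S"
  shows "(\<Sum>m\<in>weight_set S e. mtimes (planar_moment r) (planar_moment q) m)
       = (if even (e + r + q) then fps_nth (moment_series S r * moment_series S q) ((e + r + q) div 2) else 0)"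
proof -
  define u where "u k i = (\<Sum>m\<in>weight_set S i. planar_moment k m)" for k i
  have u_odd: "u k i = 0" if "odd (k + i)" for k i
    unfolding u_def using that by (intro sum.neutral ballI planar_moment_odd) (auto simp: weight_set_def)
  have ms: "fps_nth (moment_series S k) d = (if k \<le> 2 * d then u k (2 * d - k) else 0)" for k d
    by (simp add: moment_series_def u_def)
  have L: "(\<Sum>m\<in>weight_set S e. mtimes (planar_moment r) (planar_moment q) m) = (\<Sum>i\<le>e. u r i * u q (e - i))"
    by (simp add: sum_weight_set_product[OF assms] u_def)
  show ?thesis
  proof (cases "even (e + r + q)")
    case False
    hence "u r i * u q (e - i) = 0" if "i \<le> e" for i
      using that u_odd[of r i] u_odd[of q "e - i"] by (cases "odd (r + i)") auto
    hence "(\<Sum>i\<le>e. u r i * u q (e - i)) = 0" by (intro sum.neutral) blast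
    thus ?thesis using False L by simp
  next
    case True
    then obtain h where h: "e + r + q = 2 * h" by blast
    have "fps_nth (moment_series S r * moment_series S q) h
        = (\<Sum>d\<le>h. fps_nth (moment_series S r) d * fps_nth (moment_series S q) (h - d))"
      by (simp add: fps_mult_nth atLeast0AtMost)
    also have "\<dots> = (\<Sum>d\<in>{d. d \<le> h \<and> r \<le> 2 * d \<and> 2 * d \<le> r + e}. u r (2 * d - r) * u q (2 * (h - d) - q))"
    proof (rule sum.mono_neutral_cong_right)
      fix d assume "d \<in> {d. d \<le> h \<and> r \<le> 2 * d \<and> 2 * d \<le> r + e}"
      hence "r \<le> 2 * d" "q \<le> 2 * (h - d)" using h by auto
      thus "fps_nth (moment_series S r) d * fps_nth (moment_series S q) (h - d) = u r (2 * d - r) * u q (2 * (h - d) - q)"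
        by (simp add: ms)
    next
      show "\<forall>d\<in>{..h} - {d. d \<le> h \<and> r \<le> 2 * d \<and> 2 * d \<le> r + e}.
          fps_nth (moment_series S r) d * fps_nth (moment_series S q) (h - d) = 0"
      proof
        fix d assume "d \<in> {..h} - {d. d \<le> h \<and> r \<le> 2 * d \<and> 2 * d \<le> r + e}"
        hence "2 * d < r \<or> 2 * (h - d) < q" using h by auto
        thus "fps_nth (moment_series S r) d * fps_nth (moment_series S q) (h - d) = 0"
          by (auto simp: moment_series_eq_0)
      qed
    qed auto
    also have "\<dots> = (\<Sum>i\<in>{i. i \<le> e \<and> even (r + i)}. u r i * u q (e - i))"
    proof (rule sum.reindex_bij_witness[where i = "\<lambda>i. (r + i) div 2" and j = "\<lambda>d. 2 * d - r"])
      fix d assume d: "d \<in> {d. d \<le> h \<and> r \<le> 2 * d \<and> 2 * d \<le> r + e}"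
      hence "e - (2 * d - r) = 2 * (h - d) - q" using h by auto
      thus "u r (2 * d - r) * u q (e - (2 * d - r)) = u r (2 * d - r) * u q (2 * (h - d) - q)" by simp
      show "(r + (2 * d - r)) div 2 = d" "2 * d - r \<in> {i. i \<le> e \<and> even (r + i)}" using d by auto
    next
      fix i assume i: "i \<in> {i. i \<le> e \<and> even (r + i)}"
      then obtain g where "r + i = 2 * g" by blast
      thus "2 * ((r + i) div 2) - r = i" "(r + i) div 2 \<in> {d. d \<le> h \<and> r \<le> 2 * d \<and> 2 * d \<le> r + e}"
        using i h by auto
    qed
    also have "\<dots> = (\<Sum>i\<le>e. u r i * u q (e - i))"
    proof (rule sum.mono_neutral_left)
      show "\<forall>i\<in>{..e} - {i. i \<le> e \<and> even (r + i)}. u r i * u q (e - i) = 0"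
        using u_odd by simp
    qed auto
    finally show ?thesis using h L by simp
  qed
qed

text \<open>The planar equation multiplied by \<open>s^(k+1)\<close>. In a product the factors
  \<open>s^r\<close> and \<open>s^(k-1-r)\<close> use up all but \<open>s^2\<close>; the value
  \<open>s^n\<close> of an indeterminate together with the moment of index \<open>k + n - 1\<close>
  leaves \<open>s^2\<close> as well. So the right-hand side carries exactly one factor t, which is
  the shift from \<open>Suc d\<close> to \<open>d\<close>.\<close>

lemma moment_series_Suc:
  assumes "0 \<notin> S"
  shows "fps_nth (moment_series S (Suc k)) (Suc d)
     = fps_nth (\<Sum>r<k. moment_series S r * moment_series S (k - 1 - r)) d
       + (\<Sum>n | n \<in> S \<and> k + n - 1 \<le> 2 * d. fps_nth (moment_series S (k + n - 1)) d)"
proof (cases "k \<le> 2 * d + 1")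
  case False
  have "fps_nth (moment_series S r * moment_series S (k - 1 - r)) d = 0" if "r < k" for r
  proof -
    have "fps_nth (moment_series S r) i * fps_nth (moment_series S (k - 1 - r)) (d - i) = 0" if "i \<le> d" for i
      using that \<open>r < k\<close> False moment_series_eq_0[of i r S] moment_series_eq_0[of "d - i" "k - 1 - r" S]
      by (cases "r > 2 * i") auto
    hence "(\<Sum>i=0..d. fps_nth (moment_series S r) i * fps_nth (moment_series S (k - 1 - r)) (d - i)) = 0"
      by (intro sum.neutral) simp
    thus ?thesis by (simp only: fps_mult_nth)
  qed
  moreover have "fps_nth (moment_series S (Suc k)) (Suc d) = 0" using False by (intro moment_series_eq_0) auto
  moreover have "{n. n \<in> S \<and> k + n - 1 \<le> 2 * d} = {}" using False assms by auto
  ultimately show ?thesis by (simp only: fps_sum_nth sum.empty) simp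
next
  case True
  \<comment> \<open>The power of s left for the monomials,
    \<open>2 * (d + 1) - (k + 1)\<close>.\<close>
  define e where "e = 2 * d + 1 - k"
  have "fps_nth (moment_series S (Suc k)) (Suc d) = (\<Sum>m\<in>weight_set S e. planar_moment (Suc k) m)"
    using True by (simp add: moment_series_def e_def)
  also have "\<dots> = (\<Sum>r<k. \<Sum>m\<in>weight_set S e. mtimes (planar_moment r) (planar_moment (k - 1 - r)) m)
      + (\<Sum>m\<in>weight_set S e. var_sum (\<lambda>n. planar_moment (k + n - 1)) m)"
    unfolding planar_loop sum.distrib by (subst sum.swap) simp
  also have "(\<Sum>r<k. \<Sum>m\<in>weight_set S e. mtimes (planar_moment r) (planar_moment (k - 1 - r)) m)
      = fps_nth (\<Sum>r<k. moment_series S r * moment_series S (k - 1 - r)) d"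
    unfolding fps_sum_nth
  proof (intro sum.cong refl)
    fix r assume "r \<in> {..<k}"
    hence "e + r + (k - 1 - r) = 2 * d" using True by (auto simp: e_def)
    thus "(\<Sum>m\<in>weight_set S e. mtimes (planar_moment r) (planar_moment (k - 1 - r)) m)
        = fps_nth (moment_series S r * moment_series S (k - 1 - r)) d"
      by (simp add: moment_series_product[OF assms])
  qed
  also have "(\<Sum>m\<in>weight_set S e. var_sum (\<lambda>n. planar_moment (k + n - 1)) m)
      = (\<Sum>m\<in>weight_set S e. \<Sum>n | n \<in># m. planar_moment (k + n - 1) (m - {#n#}))"
    unfolding var_sum_def
  proof (intro sum.cong refl)
    fix m assume "m \<in> weight_set S e"
    hence "0 \<notin># m" using assms by (auto simp: weight_set_def)
    thus "{n. n \<in># m \<and> n \<ge> 1} = {n. n \<in># m}" by (auto intro!: Suc_leI gr0I)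
  qed
  also have "\<dots> = (\<Sum>n | n \<in> S \<and> n \<le> e. \<Sum>m\<in>weight_set S (e - n). planar_moment (k + n - 1) m)"
    by (rule sum_weight_set_var[OF assms])
  also have "\<dots> = (\<Sum>n | n \<in> S \<and> k + n - 1 \<le> 2 * d. fps_nth (moment_series S (k + n - 1)) d)"
  proof (intro sum.cong)
    have "n \<ge> 1" if "n \<in> S" for n using that assms by (cases n) auto
    hence *: "n \<in> S \<Longrightarrow> n \<le> e \<longleftrightarrow> k + n - 1 \<le> 2 * d" "n \<in> S \<Longrightarrow> n \<le> e \<Longrightarrow> e - n = 2 * d - (k + n - 1)" for n
      using True by (fastforce simp: e_def)+
    thus "{n. n \<in> S \<and> n \<le> e} = {n. n \<in> S \<and> k + n - 1 \<le> 2 * d}" by blast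
    fix n assume "n \<in> {n. n \<in> S \<and> k + n - 1 \<le> 2 * d}"
    thus "(\<Sum>m\<in>weight_set S (e - n). planar_moment (k + n - 1) m) = fps_nth (moment_series S (k + n - 1)) d"
      using * by (simp add: moment_series_def)
  qed
  finally show ?thesis .
qed

lemma moment_series_Suc_0: "fps_nth (moment_series S (Suc k)) 0 = 0"
  by (rule moment_series_eq_0) simp

text \<open>The description in \<open>planar_limit\<close> has a solution because odd powers of s
  vanish by parity, and only one because composition with \<open>fps_X ^ 2\<close> is
  injective.\<close>

lemma planar_limit_nth:
  assumes "0 \<notin> S" "\<And>n. a n = (if n \<in> S then fps_X ^ n else 0)"
  shows "fps_nth (planar_limit a) d = (\<Sum>m\<in>weight_set S (2 * d). formal_planar_limit m)"
proof -
  let ?F = "formal_planar_limit"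
  define f where "f = Abs_fps (\<lambda>d. \<Sum>m\<in>weight_set S (2 * d). ?F m)"
  have prod: "(\<Prod>n\<in>#m. a n) = (if set_mset m \<subseteq> S then fps_X ^ sum_mset m else 0)" for m
    by (induction m) (auto simp: assms(2) power_add)
  have sub: "fps_nth (msubst ?F a) e = (\<Sum>m\<in>weight_set S e. ?F m)" for e
  proof -
    have "{m. ?F m * fps_nth (\<Prod>n\<in>#m. a n) e \<noteq> 0} = {m \<in> weight_set S e. ?F m \<noteq> 0}"
      by (auto simp: prod weight_set_def fps_X_power_nth)
    moreover have "?F m * fps_nth (\<Prod>n\<in>#m. a n) e = ?F m" if "m \<in> weight_set S e" for m
      using that by (auto simp: prod weight_set_def fps_X_power_nth)
    ultimately have "fps_nth (msubst ?F a) e = (\<Sum>m\<in>{m \<in> weight_set S e. ?F m \<noteq> 0}. ?F m)"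
      unfolding msubst_def fps_nth_Abs_fps by (intro sum.cong) blast+
    also have "\<dots> = (\<Sum>m\<in>weight_set S e. ?F m)"
      by (rule sum.mono_neutral_left) (auto simp: finite_weight_set[OF assms(1)])
    finally show ?thesis .
  qed
  have comp: "fps_nth (fps_compose g (fps_X ^ 2)) e = (if even e then fps_nth g (e div 2) else 0)" for g :: "rat fps" and e
  proof -
    have "fps_nth (fps_compose g (fps_X ^ 2)) e = (\<Sum>i=0..e. if e = 2 * i then fps_nth g i else 0)"
      by (simp add: fps_compose_nth power_mult[symmetric] fps_X_power_nth if_distrib cong: if_cong)
    also have "\<dots> = (\<Sum>i\<in>{0..e}. if i = e div 2 then (if even e then fps_nth g i else 0) else 0)"
      by (intro sum.cong) auto
    finally show ?thesis by (simp add: sum.delta)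
  qed
  have "planar_limit a = f"
    unfolding planar_limit_def
  proof (rule the_equality)
    show "fps_compose f (fps_X ^ 2) = msubst ?F a"
    proof (rule fps_ext)
      fix e
      have "(\<Sum>m\<in>weight_set S e. ?F m) = 0" if "odd e"
        using that by (intro sum.neutral ballI formal_planar_limit_odd) (auto simp: weight_set_def)
      thus "fps_nth (fps_compose f (fps_X ^ 2)) e = fps_nth (msubst ?F a) e"
        by (auto simp: comp sub f_def elim!: evenE)
    qed
    fix g assume "fps_compose g (fps_X ^ 2) = msubst ?F a"
    hence "fps_nth g d = fps_nth f d" for d
      using comp[of g "2 * d"] sub[of "2 * d"] by (simp add: f_def)
    thus "g = f" by (rule fps_ext)
  qed
  thus ?thesis by (simp add: f_def)
qed

lemma planar_limit_nth_0:
  assumes "0 \<notin> S" "\<And>n. a n = (if n \<in> S then fps_X ^ n else 0)"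
  shows "fps_nth (planar_limit a) 0 = 0"
  by (simp add: planar_limit_nth[OF assms] weight_set_0[OF assms(1)] formal_planar_limit_empty)

text \<open>Euler's relation for the weight grading: multiplying a monomial by its weight is the
  operator that sums n times the indeterminate times its partial derivative. On series in
  \<open>t = s^2\<close> it acts as 2 t d/dt, whence the factor \<open>2 * d\<close>.\<close>

lemma planar_limit_moments:
  assumes "0 \<notin> S" "\<And>n. a n = (if n \<in> S then fps_X ^ n else 0)"
  shows "2 * of_nat d * fps_nth (planar_limit a) d = (\<Sum>n | n \<in> S \<and> n \<le> 2 * d. fps_nth (moment_series S n) d)"
proof -
  have "of_nat (sum_mset m) * formal_planar_limit m = (\<Sum>n | n \<in># m. planar_moment n (m - {#n#}))"
    if m: "m \<in> weight_set S (2 * d)" for m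
  proof -
    have "sum_mset m = (\<Sum>n\<in>set_mset m. count m n * n)"
      using sum_mset_eq_sum_count[of "\<lambda>n. n" m] by simp
    hence "of_nat (sum_mset m) * formal_planar_limit m
        = (\<Sum>n\<in>set_mset m. of_nat n * (of_nat (count m n) * formal_planar_limit m))"
      by (simp add: sum_distrib_right sum_distrib_left mult_ac)
    also have "\<dots> = (\<Sum>n | n \<in># m. planar_moment n (m - {#n#}))"
    proof (intro sum.cong refl)
      fix n assume "n \<in> {n. n \<in># m}"
      hence n: "n \<in> set_mset m" by simp
      hence "n \<in> S" using m by (auto simp: weight_set_def)
      hence "n \<noteq> 0" using assms(1) by metis
      thus "of_nat n * (of_nat (count m n) * formal_planar_limit m) = planar_moment n (m - {#n#})"
        using n by (auto simp: planar_moment_def mderiv_def dest!: multi_member_split)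
    qed simp
    finally show ?thesis .
  qed
  hence "2 * of_nat d * fps_nth (planar_limit a) d
      = (\<Sum>m\<in>weight_set S (2 * d). \<Sum>n | n \<in># m. planar_moment n (m - {#n#}))"
    unfolding planar_limit_nth[OF assms] sum_distrib_left
    by (intro sum.cong) (auto simp: weight_set_def)
  also have "\<dots> = (\<Sum>n | n \<in> S \<and> n \<le> 2 * d. \<Sum>m\<in>weight_set S (2 * d - n). planar_moment n m)"
    by (rule sum_weight_set_var[OF assms(1)])
  finally show ?thesis by (simp add: moment_series_def)
qed

section \<open>The quadratic method\<close>

definition fps_agree :: "nat \<Rightarrow> 'a::comm_ring_1 fps \<Rightarrow> 'a fps \<Rightarrow> bool" where
  "fps_agree n f g \<longleftrightarrow> (\<forall>i<n. fps_nth f i = fps_nth g i)"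

lemma fps_agree_refl [simp]: "fps_agree n f f"
  by (simp add: fps_agree_def)

lemma fps_agree_add: "fps_agree n f g \<Longrightarrow> fps_agree n f' g' \<Longrightarrow> fps_agree n (f + f') (g + g')"
  by (simp add: fps_agree_def)

lemma fps_agree_mult: "fps_agree n f g \<Longrightarrow> fps_agree n f' g' \<Longrightarrow> fps_agree n (f * f') (g * g')"
  by (auto simp: fps_agree_def fps_mult_nth intro!: sum.cong)

lemma fps_agree_power: "fps_agree n f g \<Longrightarrow> fps_agree n (f ^ k) (g ^ k)"
  by (induction k) (auto intro: fps_agree_mult)

lemma fps_agree_X_mult: "fps_agree n f g \<Longrightarrow> fps_agree (Suc n) (fps_X * f) (fps_X * g)"
  by (auto simp: fps_agree_def)

text \<open>The convergence is X-adic: in the \<open>n\<close>-th iterate starting from 0 the first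
  \<open>n\<close> coefficients are already final, and a diagonal choice among the iterates is a
  fixed point.\<close>

lemma fps_fixpoint:
  fixes \<Phi> :: "'a::comm_ring_1 fps \<Rightarrow> 'a fps"
  assumes contr: "\<And>n f g. fps_agree n f g \<Longrightarrow> fps_agree (Suc n) (\<Phi> f) (\<Phi> g)"
  shows "\<exists>Y. \<Phi> Y = Y"
proof -
  define y where "y n = (\<Phi> ^^ n) 0" for n
  have step: "fps_agree n (y n) (y (Suc n))" for n
  proof (induction n)
    case (Suc n)
    thus ?case using contr[OF Suc] by (simp add: y_def)
  qed (simp add: fps_agree_def)
  have stable: "fps_nth (y (n + k)) i = fps_nth (y n) i" if "i < n" for i n k
  proof (induction k)
    case (Suc k)
    thus ?case using step[of "n + k"] that by (simp add: fps_agree_def)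
  qed simp
  define Y where "Y = Abs_fps (\<lambda>i. fps_nth (y (Suc i)) i)"
  have Y: "fps_agree n Y (y n)" for n
    unfolding fps_agree_def
  proof (intro allI impI)
    fix i assume "i < n"
    then obtain k where "n = Suc i + k" using less_imp_Suc_add by auto
    thus "fps_nth Y i = fps_nth (y n) i" using stable[of i "Suc i" k] by (simp add: Y_def)
  qed
  have "fps_nth (\<Phi> Y) i = fps_nth Y i" for i
    using contr[OF Y[of i]] Y[of "Suc i"] by (simp add: fps_agree_def y_def)
  thus ?thesis by (intro exI[of _ Y] fps_ext)
qed

section \<open>Generating sums over the moment index\<close>

definition summable_fps :: "(nat \<Rightarrow> 'a::comm_ring_1 fps) \<Rightarrow> bool" where
  "summable_fps v \<longleftrightarrow> (\<forall>j d. 2 * d < j \<longrightarrow> fps_nth (v j) d = 0)"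

definition sum_fps :: "(nat \<Rightarrow> 'a::comm_ring_1 fps) \<Rightarrow> 'a fps" where
  "sum_fps v = Abs_fps (\<lambda>d. \<Sum>j\<le>2 * d. fps_nth (v j) d)"

lemma sum_fps_nth:
  assumes "summable_fps v" "2 * d \<le> n"
  shows "fps_nth (sum_fps v) d = (\<Sum>j\<le>n. fps_nth (v j) d)"
  unfolding sum_fps_def fps_nth_Abs_fps
  using assms by (intro sum.mono_neutral_left) (auto simp: summable_fps_def)

lemma sum_fps_add: "sum_fps (\<lambda>j. v j + w j) = sum_fps v + sum_fps w"
  by (rule fps_ext) (simp add: sum_fps_def sum.distrib)

lemma summable_fps_mult:
  assumes "summable_fps v"
  shows "summable_fps (\<lambda>j. g j * v j)"
  unfolding summable_fps_def fps_mult_nth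
proof (intro allI impI sum.neutral ballI)
  fix j d i :: nat assume "2 * d < j" "i \<in> {0..d}"
  hence "2 * (d - i) < j" by auto
  thus "fps_nth (g j) i * fps_nth (v j) (d - i) = 0" using assms by (simp add: summable_fps_def)
qed

lemma sum_fps_mult:
  assumes "summable_fps v"
  shows "sum_fps (\<lambda>j. c * v j) = c * sum_fps v"
proof (rule fps_ext)
  fix d
  have "fps_nth (sum_fps (\<lambda>j. c * v j)) d = (\<Sum>i=0..d. \<Sum>j\<le>2 * d. fps_nth c i * fps_nth (v j) (d - i))"
    unfolding sum_fps_def fps_nth_Abs_fps fps_mult_nth by (rule sum.swap)
  also have "\<dots> = (\<Sum>i=0..d. fps_nth c i * fps_nth (sum_fps v) (d - i))"
    by (simp add: sum_fps_nth[OF assms, where n = "2 * d"] sum_distrib_left)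
  finally show "fps_nth (sum_fps (\<lambda>j. c * v j)) d = fps_nth (c * sum_fps v) d"
    by (simp add: fps_mult_nth)
qed

lemma sum_fps_Suc:
  assumes "summable_fps v"
  shows "sum_fps (\<lambda>j. v (Suc j)) = sum_fps v - v 0"
proof (rule fps_ext)
  fix d
  have "fps_nth (sum_fps v) d = (\<Sum>j\<le>Suc (2 * d). fps_nth (v j) d)"
    by (rule sum_fps_nth[OF assms]) simp
  thus "fps_nth (sum_fps (\<lambda>j. v (Suc j))) d = fps_nth (sum_fps v - v 0) d"
    by (simp add: sum.atMost_Suc_shift sum_fps_def del: sum.atMost_Suc)
qed

lemma sum_fps_single: "sum_fps (\<lambda>j. if j = 0 then a else 0) = a"
  by (rule fps_ext) (simp add: sum_fps_def if_distrib[of "\<lambda>f. fps_nth f _"] cong: if_cong)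

definition conv :: "(nat \<Rightarrow> 'a::comm_ring_1) \<Rightarrow> (nat \<Rightarrow> 'a) \<Rightarrow> nat \<Rightarrow> 'a" where
  "conv v w k = (\<Sum>i\<le>k. v i * w (k - i))"

lemma
  assumes "summable_fps v" "summable_fps w"
  shows summable_fps_conv: "summable_fps (conv v w)"
    and sum_fps_conv: "sum_fps (conv v w) = sum_fps v * sum_fps w"
proof -
  have z: "fps_nth (v i * w j) d = 0" if "2 * d < i + j" for i j d
    unfolding fps_mult_nth
  proof (intro sum.neutral ballI)
    fix e assume "e \<in> {0..d}"
    hence "2 * e < i \<or> 2 * (d - e) < j" using that by auto
    thus "fps_nth (v i) e * fps_nth (w j) (d - e) = 0" using assms by (auto simp: summable_fps_def)
  qed
  show "summable_fps (conv v w)"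
    unfolding summable_fps_def conv_def fps_sum_nth by (intro allI impI sum.neutral ballI z) auto
  show "sum_fps (conv v w) = sum_fps v * sum_fps w"
  proof (rule fps_ext)
    fix d :: nat
    let ?n = "2 * d"
    have "fps_nth (sum_fps v * sum_fps w) d
        = (\<Sum>e=0..d. (\<Sum>i\<le>?n. fps_nth (v i) e) * (\<Sum>j\<le>?n. fps_nth (w j) (d - e)))"
      unfolding fps_mult_nth
      by (intro sum.cong refl arg_cong2[where f = "(*)"] sum_fps_nth assms) auto
    also have "\<dots> = (\<Sum>e=0..d. \<Sum>i\<le>?n. \<Sum>j\<le>?n. fps_nth (v i) e * fps_nth (w j) (d - e))"
      by (simp add: sum_product)
    also have "\<dots> = (\<Sum>i\<le>?n. \<Sum>e=0..d. \<Sum>j\<le>?n. fps_nth (v i) e * fps_nth (w j) (d - e))"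
      by (rule sum.swap)
    also have "\<dots> = (\<Sum>i\<le>?n. \<Sum>j\<le>?n. fps_nth (v i * w j) d)"
      unfolding fps_mult_nth by (intro sum.cong refl sum.swap)
    also have "\<dots> = (\<Sum>(i, j)\<in>{..?n} \<times> {..?n}. fps_nth (v i * w j) d)"
      by (simp add: sum.cartesian_product)
    \<comment> \<open>Pairs with \<open>i + j\<close> above \<open>2 * d\<close> contribute nothing
      in degree \<open>d\<close>, so the square of indices may be cut down to the triangle of a
      Cauchy product.\<close>
    also have "\<dots> = (\<Sum>(i, j)\<in>{(i, j). i + j \<le> ?n}. fps_nth (v i * w j) d)"
    proof (rule sum.mono_neutral_right)
      show "\<forall>x\<in>{..?n} \<times> {..?n} - {(i, j). i + j \<le> ?n}. (case x of (i, j) \<Rightarrow> fps_nth (v i * w j) d) = 0"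
        using z by (simp add: case_prod_unfold split_paired_all not_le)
    qed auto
    also have "{(i, j). i + j \<le> ?n} = (\<lambda>(k, i). (i, k - i)) ` (SIGMA k:{..?n}. {..k})"
      by (auto simp: image_iff Bex_def intro!: exI[of _ "_ + _"])
    also have "(\<Sum>(i, j)\<in>(\<lambda>(k, i). (i, k - i)) ` (SIGMA k:{..?n}. {..k}). fps_nth (v i * w j) d)
        = (\<Sum>(k, i)\<in>(SIGMA k:{..?n}. {..k}). fps_nth (v i * w (k - i)) d)"
      by (subst sum.reindex) (auto simp: inj_on_def case_prod_unfold)
    also have "\<dots> = fps_nth (sum_fps (conv v w)) d"
      by (simp add: sum_fps_def conv_def fps_sum_nth sum.Sigma)
    finally show "fps_nth (sum_fps (conv v w)) d = fps_nth (sum_fps v * sum_fps w) d" ..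
  qed
qed

text \<open>Members \<open>j\<close> of a summable family have order at least j/2, as the moment
  series do. A shift of the index by at most two is thus compensated by the factor
  \<open>fps_X\<close>; this is where \<open>p \<le> 2\<close> matters.\<close>

lemma
  assumes "summable_fps v" "p \<le> 2"
  shows summable_fps_shift: "summable_fps (\<lambda>k. if p \<le> k then fps_X * v (k - p) else 0)"
    and sum_fps_shift: "sum_fps (\<lambda>k. if p \<le> k then fps_X * v (k - p) else 0) = fps_X * sum_fps v"
proof -
  show s: "summable_fps (\<lambda>k. if p \<le> k then fps_X * v (k - p) else 0)"
    unfolding summable_fps_def
  proof (intro allI impI)
    fix j d :: nat assume "2 * d < j"
    hence "d \<noteq> 0 \<Longrightarrow> 2 * (d - 1) < j - p" using assms(2) by auto
    thus "fps_nth (if p \<le> j then fps_X * v (j - p) else 0) d = 0"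
      using assms(1) by (auto simp: summable_fps_def)
  qed
  show "sum_fps (\<lambda>k. if p \<le> k then fps_X * v (k - p) else 0) = fps_X * sum_fps v"
  proof (rule fps_ext)
    fix d
    show "fps_nth (sum_fps (\<lambda>k. if p \<le> k then fps_X * v (k - p) else 0)) d = fps_nth (fps_X * sum_fps v) d"
    proof (cases d)
      case 0
      show ?thesis unfolding 0 sum_fps_def by (auto intro!: sum.neutral)
    next
      case (Suc e)
      have "fps_nth (sum_fps (\<lambda>k. if p \<le> k then fps_X * v (k - p) else 0)) d
          = (\<Sum>k\<le>2 * e + p. fps_nth (if p \<le> k then fps_X * v (k - p) else 0) d) + 0"
      proof -
        have "(\<Sum>k\<le>2 * e + p. fps_nth (if p \<le> k then fps_X * v (k - p) else 0) d)
            = (\<Sum>k\<le>2 * d. fps_nth (if p \<le> k then fps_X * v (k - p) else 0) d)"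
        proof (rule sum.mono_neutral_left)
          have "fps_nth (v (i - p)) e = 0" if "2 * e + p < i" for i
            using assms(1) that by (simp add: summable_fps_def)
          thus "\<forall>i\<in>{..2 * d} - {..2 * e + p}. fps_nth (if p \<le> i then fps_X * v (i - p) else 0) d = 0"
            by (simp add: Suc not_le)
        qed (use assms(2) in \<open>auto simp: Suc\<close>)
        thus ?thesis by (simp add: sum_fps_def)
      qed
      also have "\<dots> = (\<Sum>k\<in>{p..2 * e + p}. fps_nth (v (k - p)) e)"
        by (simp, rule sum.mono_neutral_cong_right) (auto simp: Suc)
      also have "\<dots> = (\<Sum>k\<le>2 * e. fps_nth (v k) e)"
        by (rule sum.reindex_bij_witness[where i = "\<lambda>k. k + p" and j = "\<lambda>k. k - p"]) auto
      finally show ?thesis by (simp add: Suc sum_fps_def)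
    qed
  qed
qed

text \<open>
  The quadratic method for \<open>c u\<^sub>k = t \<Sum>\<^sub>i\<^sub>+\<^sub>j\<^sub>=\<^sub>k\<^sub>-\<^sub>p u\<^sub>i u\<^sub>j + t A\<^sub>k\<close>, \<open>A\<^sub>k = \<Sum>\<^sub>j\<^sub>\<ge>\<^sub>k u\<^sub>j\<close>: evaluate the
  generating function of the \<open>u\<^sub>k\<close> and its derivative at the point \<open>Y = 1 + z\<close> at which the
  derivative of the functional equation with respect to the unknown function vanishes.
\<close>

lemma kernel_method:
  fixes u A :: "nat \<Rightarrow> rat fps" and c :: "rat fps" and p :: nat
  assumes p: "1 \<le> p" "p \<le> 2" and c0: "fps_nth c 0 = 1"
    and u: "summable_fps u" "u 0 = 1"
    and A: "summable_fps A" "\<And>k. A k = u k + A (Suc k)"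
    and eq: "\<And>k. k \<ge> 1 \<Longrightarrow> c * u k = (if p \<le> k then fps_X * conv u u (k - p) else 0) + fps_X * A k"
  obtains z W where "fps_nth z 0 = 0" "fps_nth z 1 = 1"
    "c * z = fps_X * ((1 + z) + 2 * (1 + z) ^ p * z * W)"
    "c * (W - 1) = fps_X * (1 + z) ^ p * W\<^sup>2 * (1 + of_nat p * z)"
    "A 0 = W - of_nat p * (1 + z) ^ (p - 1) * z\<^sup>2 * W\<^sup>2"
proof -
  let ?t = "fps_X :: rat fps"
  define ev where "ev Y = sum_fps (\<lambda>k. Y ^ k * u k)" for Y
  have sm: "summable_fps (\<lambda>k. Y ^ k * u k)" for Y by (rule summable_fps_mult[OF u(1)])
  have ev_agree: "fps_agree n (ev Y) (ev Y')" if "fps_agree n Y Y'" for n Y Y'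
    unfolding fps_agree_def
  proof (intro allI impI)
    fix d assume "d < n"
    moreover have "fps_agree n (Y ^ k * u k) (Y' ^ k * u k)" for k
      by (intro fps_agree_mult fps_agree_power that fps_agree_refl)
    ultimately show "fps_nth (ev Y) d = fps_nth (ev Y') d"
      unfolding ev_def sum_fps_def fps_nth_Abs_fps by (intro sum.cong) (auto simp: fps_agree_def)
  qed
  \<comment> \<open>Fixed points satisfy
    \<open>c * (Y - 1) = t * (Y + 2 * Y^p * (Y - 1) * ev Y)\<close>, the vanishing of the derivative
    with the denominator \<open>Y - 1\<close> cleared. The unit constant term of \<open>c\<close>
    allows solving for \<open>Y\<close>, and the factor t in front makes the map a
    contraction.\<close>
  define \<Phi> where "\<Phi> Y = 1 + ?t * (inverse c * (Y + 2 * Y ^ p * (Y + - 1) * ev Y))" for Y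
  have "fps_agree (Suc n) (\<Phi> Y) (\<Phi> Y')" if "fps_agree n Y Y'" for n Y Y'
    unfolding \<Phi>_def using that
    by (intro fps_agree_add fps_agree_X_mult fps_agree_mult fps_agree_power ev_agree) simp_all
  then obtain Y where Y_fix: "\<Phi> Y = Y" using fps_fixpoint by metis
  define z where "z = Y - 1"
  define W where "W = ev Y"
  have Y: "Y = 1 + z" by (simp add: z_def)
  have z: "z = ?t * (inverse c * (Y + 2 * Y ^ p * z * W))"
    using Y_fix by (simp add: \<Phi>_def z_def W_def algebra_simps)
  have inv: "c * inverse c = 1" using c0 by (simp add: inverse_mult_eq_1')
  have K: "c * z = ?t * (Y + 2 * Y ^ p * z * W)"
  proof -
    have "c * z = (c * inverse c) * (?t * (Y + 2 * Y ^ p * z * W))"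
      by (subst z) (simp only: mult_ac)
    thus ?thesis by (simp only: inv mult_1)
  qed
  have z0: "fps_nth z 0 = 0" by (subst z) simp
  have z1: "fps_nth z 1 = 1"
  proof -
    have "fps_nth (c * z) 1 = fps_nth (Y + 2 * Y ^ p * z * W) 0" by (subst K) simp
    thus ?thesis using z0 c0 by (simp add: fps_mult_nth_1 Y)
  qed
  define v where "v = (\<lambda>k. Y ^ k * u k)"
  define a where "a = (\<lambda>k. Y ^ k * A k)"
  define B where "B = sum_fps a"
  \<comment> \<open>Weighting the \<open>k\<close>-th term by \<open>k\<close> is the Euler
    derivative Y d/dY, so the differentiated functional equation is obtained term by term.\<close>
  define D where "D = sum_fps (\<lambda>k. of_nat k * v k)"
  define E where "E = sum_fps (\<lambda>k. of_nat k * a k)"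
  have v: "summable_fps v" and a: "summable_fps a"
    unfolding v_def a_def by (intro summable_fps_mult u A)+
  have v': "summable_fps (\<lambda>k. of_nat k * v k)" and a': "summable_fps (\<lambda>k. of_nat k * a k)"
    by (intro summable_fps_mult v a)+
  have W: "W = sum_fps v" by (simp add: W_def ev_def v_def)
  have conv_v: "conv v v k = Y ^ k * conv u u k" for k
    unfolding conv_def sum_distrib_left
    by (intro sum.cong refl) (auto simp: v_def power_add[symmetric] mult_ac)
  have conv_v': "of_nat k * conv v v k = 2 * conv (\<lambda>k. of_nat k * v k) v k" for k
  proof -
    have "conv (\<lambda>k. of_nat k * v k) v k = (\<Sum>i\<le>k. of_nat (k - i) * v (k - i) * v i)"
      unfolding conv_def by (rule sum.reindex_bij_witness[where i = "\<lambda>i. k - i" and j = "\<lambda>i. k - i"]) auto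
    hence "2 * conv (\<lambda>k. of_nat k * v k) v k = (\<Sum>i\<le>k. of_nat i * v i * v (k - i) + of_nat (k - i) * v (k - i) * v i)"
      by (simp add: sum.distrib) (simp add: conv_def)
    also have "\<dots> = (\<Sum>i\<le>k. of_nat k * (v i * v (k - i)))"
      by (intro sum.cong refl) (simp add: of_nat_diff algebra_simps)
    finally show ?thesis by (simp add: conv_def sum_distrib_left)
  qed
  define s where "s k = (if p \<le> k then ?t * conv v v (k - p) else 0)" for k
  define s' where "s' k = (if p \<le> k then ?t * conv (\<lambda>k. of_nat k * v k) v (k - p) else 0)" for k
  have s: "summable_fps s" "sum_fps s = ?t * (W * W)"
    unfolding s_def by (simp_all add: summable_fps_shift sum_fps_shift summable_fps_conv sum_fps_conv v p W)
  have s': "summable_fps s'" "sum_fps s' = ?t * (D * W)"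
    unfolding s'_def by (simp_all add: summable_fps_shift sum_fps_shift summable_fps_conv sum_fps_conv v v' p W D_def)
  \<comment> \<open>The recursion starts at \<open>k = 1\<close>. At \<open>k = 0\<close> the
    correction term accounts for \<open>u 0 = 1\<close> and for the missing convolution, so that the
    sum over all \<open>k\<close> can be formed.\<close>
  have eq': "c * v k + (if k = 0 then ?t * A 0 - c else 0) = Y ^ p * s k + ?t * a k" for k
  proof (cases "k = 0")
    case True
    thus ?thesis using p u by (simp add: s_def v_def a_def)
  next
    case False
    have "c * v k = Y ^ k * (c * u k)" by (simp add: v_def mult_ac)
    also have "\<dots> = (if p \<le> k then ?t * (Y ^ k * conv u u (k - p)) else 0) + ?t * a k"
      using False by (simp add: eq a_def algebra_simps)
    also have "(if p \<le> k then ?t * (Y ^ k * conv u u (k - p)) else 0) = Y ^ p * s k"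
    proof (cases "p \<le> k")
      case True
      hence "Y ^ k = Y ^ p * Y ^ (k - p)" by (simp add: power_add[symmetric])
      thus ?thesis using True by (simp add: s_def conv_v mult_ac)
    qed (simp add: s_def)
    finally show ?thesis using False by simp
  qed
  have E1: "c * W + (?t * A 0 - c) = Y ^ p * (?t * (W * W)) + ?t * B"
  proof -
    have "sum_fps (\<lambda>k. c * v k + (if k = 0 then ?t * A 0 - c else 0)) = sum_fps (\<lambda>k. Y ^ p * s k + ?t * a k)"
      by (simp only: eq')
    thus ?thesis by (simp add: sum_fps_add sum_fps_mult v a s sum_fps_single W B_def)
  qed
  have "c * (of_nat k * v k) = of_nat p * Y ^ p * s k + 2 * Y ^ p * s' k + ?t * (of_nat k * a k)" for k
  proof -
    have "of_nat k * s k = of_nat p * s k + 2 * s' k"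
    proof (cases "p \<le> k")
      case True
      have "of_nat k * s k = ?t * (of_nat p * conv v v (k - p) + of_nat (k - p) * conv v v (k - p))"
        using True by (simp add: s_def of_nat_diff algebra_simps)
      thus ?thesis using True unfolding conv_v' by (simp add: s_def s'_def algebra_simps)
    qed (simp add: s_def s'_def)
    moreover have "c * (of_nat k * v k) = Y ^ p * (of_nat k * s k) + ?t * (of_nat k * a k)"
    proof -
      have "of_nat k * (c * v k) = of_nat k * (Y ^ p * s k + ?t * a k)"
        using eq'[of k] by (cases "k = 0") auto
      thus ?thesis by (simp add: algebra_simps)
    qed
    ultimately show ?thesis by (simp add: algebra_simps)
  qed
  hence "sum_fps (\<lambda>k. c * (of_nat k * v k))
      = sum_fps (\<lambda>k. of_nat p * Y ^ p * s k + 2 * Y ^ p * s' k + ?t * (of_nat k * a k))"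
    by (simp only:)
  hence E2: "c * D = of_nat p * Y ^ p * (?t * (W * W)) + 2 * Y ^ p * (?t * (D * W)) + ?t * E"
    by (simp add: sum_fps_add sum_fps_mult v' a' s s' D_def E_def)
  have shift: "Y * a k = Y * v k + a (Suc k)" for k
  proof -
    have "Y * a k = Y ^ Suc k * A k" by (simp add: a_def)
    also have "\<dots> = Y ^ Suc k * (u k + A (Suc k))" by (subst A(2)) simp
    finally show ?thesis by (simp add: a_def v_def algebra_simps)
  qed
  have "sum_fps (\<lambda>k. Y * a k) = sum_fps (\<lambda>k. Y * v k + a (Suc k))" by (simp only: shift)
  hence E3: "Y * B = Y * W + (B - A 0)"
    by (simp add: sum_fps_add sum_fps_mult a v sum_fps_Suc B_def W) (simp add: a_def)
  have "Y * (of_nat k * a k) + Y * a k = Y * (of_nat k * v k) + Y * v k + of_nat (Suc k) * a (Suc k)" for k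
    using arg_cong[OF shift[of k], of "\<lambda>x. of_nat (Suc k) * x"] by (simp add: algebra_simps)
  hence "sum_fps (\<lambda>k. Y * (of_nat k * a k) + Y * a k)
      = sum_fps (\<lambda>k. Y * (of_nat k * v k) + Y * v k + of_nat (Suc k) * a (Suc k))" by (simp only:)
  hence E4: "Y * E + Y * B = Y * D + Y * W + E"
    using sum_fps_Suc[OF a'] by (simp add: sum_fps_add sum_fps_mult a a' v v' B_def W D_def E_def)
  have z_nz: "z \<noteq> 0" using z1 by auto
  have Y_nz: "Y \<noteq> 0" using z0 by (auto simp: Y fps_eq_iff dest: spec[of _ 0])
  have X_nz: "?t \<noteq> 0" by simp
  have B: "z * B = Y * W - A 0" using E3 by (simp add: Y algebra_simps)
  have E: "z * E = Y * (D + W - B)" using E4 by (simp add: Y algebra_simps)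
  have "(?t * Y) * (of_nat p * Y ^ (p - 1) * z\<^sup>2 * W\<^sup>2) = (?t * Y) * (W - A 0)"
  proof -
    have Yp: "Y ^ p = Y * Y ^ (p - 1)" using p by (cases p) auto
    have "z * (c * D) = z * (of_nat p * Y ^ p * (?t * (W * W)) + 2 * Y ^ p * (?t * (D * W)) + ?t * E)"
      by (simp only: E2)
    \<comment> \<open>By the choice of \<open>Y\<close>, relation \<open>K\<close> cancels all terms
      containing \<open>D\<close>; what remains involves only \<open>W\<close>, \<open>B\<close> and
      \<open>z\<close>.\<close>
    hence "D * (c * z) = ?t * (of_nat p * Y ^ p * z * W\<^sup>2 + 2 * Y ^ p * z * W * D + z * E)"
      by (simp add: algebra_simps power2_eq_square)
    hence "0 = ?t * (of_nat p * Y ^ p * z * W\<^sup>2 + Y * (W - B))"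
      unfolding K E by (simp add: algebra_simps)
    hence "0 = z * (?t * (of_nat p * Y ^ p * z * W\<^sup>2 + Y * (W - B)))" by simp
    hence "0 = ?t * (of_nat p * Y ^ p * z\<^sup>2 * W\<^sup>2 + Y * (z * W - z * B))"
      by (simp add: algebra_simps power2_eq_square)
    thus ?thesis unfolding B Yp by (simp add: Y algebra_simps)
  qed
  hence II: "of_nat p * Y ^ (p - 1) * z\<^sup>2 * W\<^sup>2 = W - A 0" using X_nz Y_nz by simp
  have "z * (c * (W - 1)) = z * (?t * Y ^ p * W\<^sup>2 * (1 + of_nat p * z))"
  proof -
    have Yp: "Y ^ p = Y * Y ^ (p - 1)" using p by (cases p) auto
    have "c * (W - 1) = Y ^ p * (?t * (W * W)) + ?t * B - ?t * A 0"
      using E1 by (simp add: algebra_simps)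
    hence "z * (c * (W - 1)) = z * (Y ^ p * (?t * (W * W)) + ?t * B - ?t * A 0)" by simp
    also have "\<dots> = ?t * (Y ^ p * z * W\<^sup>2) + ?t * (z * B - z * A 0)"
      by (simp add: algebra_simps power2_eq_square)
    also have "z * B - z * A 0 = Y * (W - A 0)" unfolding B by (simp add: Y algebra_simps)
    also have "W - A 0 = of_nat p * Y ^ (p - 1) * z\<^sup>2 * W\<^sup>2" using II ..
    finally show ?thesis unfolding Yp by (simp add: algebra_simps power2_eq_square)
  qed
  hence I: "c * (W - 1) = ?t * Y ^ p * W\<^sup>2 * (1 + of_nat p * z)" using z_nz by (simp add: mult.assoc)
  show thesis
    by (rule that[of z W]) (use z0 z1 K I II in \<open>simp_all add: Y\<close>)
qed

text \<open>
  The curves below have genus \<open>0\<close>; \<open>z\<close> is a rational parameter, and the quadratic equation for \<open>G\<close>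
  becomes an identity of polynomials in \<open>z\<close> after clearing denominators.
\<close>

lemma quadratic1_param:
  fixes t z G A0 u1 :: "rat fps"
  assumes "t * (1 + z)^2 = (1 + t) * z * (1 - z)" "A0 * (1 - z)^2 = 1 - z - z^2"
    "2 * t * G = A0 - 1 - u1" "(1 + t) * u1 = t * A0"
    and nz: "z \<noteq> 0" "1 - z \<noteq> 0" "1 + z \<noteq> 0" "1 + z + 2 * z^2 \<noteq> 0"
  shows "- 2*t + 13*t^2 + 16*t^3 + 2*(1 - 9*t + 3*t^2 + 45*t^3 + 32*t^4) * G + 64*t^3*(1 + t)^2 * G^2 = 0"
proof -
  \<comment> \<open>The first assumption gives \<open>t * d1 = z * (1 - z)\<close>, so
    \<open>d1\<close> is the denominator of t in the parameter z; \<open>d2\<close> is the remaining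
    denominator of \<open>G\<close>.\<close>
  define d1 where "d1 = 1 + z + 2 * z^2"
  define d2 where "d2 = 2 * (1 - z)^3 * (1 + z)^2"
  have t: "t * d1 = z * (1 - z)" and t1: "(1 + t) * d1 = (1 + z)^2"
    using assms(1) unfolding d1_def by (simp_all add: algebra_simps power2_eq_square)
  have "u1 * (1 + z)^2 = ((1 + t) * u1) * d1" unfolding t1[symmetric] by (simp only: mult_ac)
  also have "\<dots> = A0 * (t * d1)" unfolding assms(4) by (simp only: mult_ac)
  finally have u1: "u1 * (1 + z)^2 = A0 * (z * (1 - z))" unfolding t .
  have "z * (G * d2) = (2 * (t * d1) * G) * ((1 - z)^2 * (1 + z)^2)"
    unfolding t d2_def by Groebner_Basis.algebra
  also have "\<dots> = (2 * t * G) * (d1 * ((1 - z)^2 * (1 + z)^2))" by (simp only: mult_ac)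
  also have "\<dots> = d1 * ((A0 * (1 - z)^2) * (1 + z)^2 - (1 - z)^2 * (1 + z)^2 - (u1 * (1 + z)^2) * (1 - z)^2)"
    unfolding assms(3) by Groebner_Basis.algebra
  also have "\<dots> = d1 * ((A0 * (1 - z)^2) * (1 + z)^2 - (1 - z)^2 * (1 + z)^2 - (A0 * (1 - z)^2) * (z * (1 - z)))"
    unfolding u1 by Groebner_Basis.algebra
  also have "\<dots> = z * (d1 * (z * (2 - 3 * z - 3 * z^2)))"
    unfolding assms(2) by Groebner_Basis.algebra
  finally have "z * (G * d2) = z * (d1 * (z * (2 - 3 * z - 3 * z^2)))" .
  hence G: "G * d2 = d1 * (z * (2 - 3 * z - 3 * z^2))" using nz by simp
  \<comment> \<open>The highest degrees are five in t and two in \<open>G\<close>, so the factor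
    \<open>d1^5 * d2^2\<close> clears all denominators.\<close>
  have "(- 2*t + 13*t^2 + 16*t^3 + 2*(1 - 9*t + 3*t^2 + 45*t^3 + 32*t^4) * G + 64*t^3*(1 + t)^2 * G^2) * (d1^5 * d2^2)
     = (- 2*(t*d1)*d1^3 + 13*(t*d1)^2*d1^2 + 16*(t*d1)^3*d1)*d2^2*d1
      + 2*(d1^4 - 9*(t*d1)*d1^3 + 3*(t*d1)^2*d1^2 + 45*(t*d1)^3*d1 + 32*(t*d1)^4) * (G*d2)*d2*d1
      + 64*(t*d1)^3*((1 + t)*d1)^2 * (G*d2)^2"
    by Groebner_Basis.algebra
  also have "\<dots> = 0" unfolding t t1 G unfolding d1_def d2_def by Groebner_Basis.algebra
  finally show ?thesis using nz by (simp add: d1_def d2_def)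
qed

lemma quadratic2_param:
  fixes t z G A0 :: "rat fps"
  assumes t: "t * (1 + z) = z * (1 - 2 * z)" and "A0 * ((1 - 2 * z)^2 * (1 + z)) = 1 - 2 * z - 2 * z^2"
    "2 * t * G = (1 - t) * (A0 - 1)"
    and nz: "z \<noteq> 0" "1 - 2 * z \<noteq> 0" "1 + z \<noteq> 0"
  shows "1 - 13*t + 22*t^2 - 9*t^3 - t^4 + (- 2 + 32*t - 108*t^2 + 76*t^3 + 2*t^4) * G - 108*t^3 * G^2 = 0"
proof -
  define d1 where "d1 = 1 + z"
  define d2 where "d2 = 2 * (1 - 2 * z)^3 * (1 + z)"
  have t': "t * d1 = z * (1 - 2 * z)" "(1 - t) * d1 = 1 + 2 * z^2"
    using t unfolding d1_def by (simp_all add: algebra_simps power2_eq_square)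
  have "z * (G * d2) = (2 * (t * d1) * G) * ((1 - 2 * z)^2 * (1 + z))"
    unfolding t' d2_def by Groebner_Basis.algebra
  also have "\<dots> = (2 * t * G) * (d1 * ((1 - 2 * z)^2 * (1 + z)))" by (simp only: mult_ac)
  also have "\<dots> = ((1 - t) * d1) * (A0 * ((1 - 2 * z)^2 * (1 + z)) - (1 - 2 * z)^2 * (1 + z))"
    unfolding assms(3) by Groebner_Basis.algebra
  also have "\<dots> = z * ((1 + 2 * z^2) * (1 - 2 * z - 4 * z^2))"
    unfolding t' assms(2) by Groebner_Basis.algebra
  finally have "z * (G * d2) = z * ((1 + 2 * z^2) * (1 - 2 * z - 4 * z^2))" .
  hence G: "G * d2 = (1 + 2 * z^2) * (1 - 2 * z - 4 * z^2)" using nz by simp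
  have "(1 - 13*t + 22*t^2 - 9*t^3 - t^4 + (- 2 + 32*t - 108*t^2 + 76*t^3 + 2*t^4) * G - 108*t^3 * G^2) * (d1^4 * d2^2)
     = (d1^4 - 13*(t*d1)*d1^3 + 22*(t*d1)^2*d1^2 - 9*(t*d1)^3*d1 - (t*d1)^4)*d2^2
      + (- 2*d1^4 + 32*(t*d1)*d1^3 - 108*(t*d1)^2*d1^2 + 76*(t*d1)^3*d1 + 2*(t*d1)^4) * (G*d2) * d2
      - 108*(t*d1)^3*d1 * (G*d2)^2"
    by Groebner_Basis.algebra
  also have "\<dots> = 0" unfolding t' G unfolding d1_def d2_def by Groebner_Basis.algebra
  finally show ?thesis using nz by (simp add: d1_def d2_def)
qed

lemma quadratic3_param:
  fixes t z G A0 u1 u2 :: "rat fps"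
  assumes "t * (1 + z) = (1 + t) * z * (1 - 2 * z)" "A0 * ((1 - 2 * z)^2 * (1 + z)) = 1 - 2 * z - 2 * z^2"
    "2 * t * G = A0 - 1 - u1 - u2" "(1 + t) * u1 = t * (A0 - 1)" "(1 + t) * u2 = t + t * (A0 - 1 - u1)"
    and nz: "z \<noteq> 0" "1 - 2 * z \<noteq> 0" "1 + z \<noteq> 0" "1 + 2 * z^2 \<noteq> 0"
  shows "- 2*t + 11*t^2 + 65*t^3 + 107*t^4 + 81*t^5 + 27*t^6
       + (2 - 20*t - 22*t^2 + 184*t^3 + 560*t^4 + 700*t^5 + 432*t^6 + 108*t^7) * G
       + (108*t^3 + 540*t^4 + 1080*t^5 + 1080*t^6 + 540*t^7 + 108*t^8) * G^2 = 0"
proof -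
  define d1 where "d1 = 1 + 2 * z^2"
  \<comment> \<open>\<open>A0\<close> has one factor \<open>1 + z\<close> in its denominator;
    \<open>u1\<close> and \<open>u2\<close> each add another, through division by
    \<open>(1 + t) * d1 = 1 + z\<close>. Division by t raises the exponent of
    \<open>1 - 2 * z\<close> to three.\<close>
  define d2 where "d2 = 2 * (1 - 2 * z)^3 * (1 + z)^3"
  define n1 where "n1 = z * (1 - 2 * z)"
  have t: "t * d1 = n1" and t1: "(1 + t) * d1 = 1 + z"
    using assms(1) unfolding d1_def n1_def by (simp_all add: algebra_simps power2_eq_square)
  have "u1 * (1 + z) = ((1 + t) * u1) * d1" unfolding t1[symmetric] by (simp only: mult_ac)
  also have "\<dots> = (t * d1) * (A0 - 1)" unfolding assms(4) by (simp only: mult_ac)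
  finally have u1: "u1 * (1 + z) = n1 * (A0 - 1)" unfolding t .
  have "u2 * (1 + z) = ((1 + t) * u2) * d1" unfolding t1[symmetric] by (simp only: mult_ac)
  also have "\<dots> = (t * d1) * (A0 - u1)" unfolding assms(5) by (simp add: algebra_simps)
  finally have "u2 * (1 + z) = n1 * (A0 - u1)" unfolding t .
  hence "u2 * (1 + z) * (1 + z) = n1 * (A0 - u1) * (1 + z)" by simp
  also have "\<dots> = n1 * (A0 * (1 + z) - u1 * (1 + z))" by (simp add: algebra_simps)
  finally have u2: "u2 * (1 + z) * (1 + z) = n1 * (A0 * (1 + z) - n1 * (A0 - 1))" unfolding u1 .
  define M where "M = (1 - 2 * z)^2 * (1 + z)"
  have A0: "A0 * M = 1 - 2 * z - 2 * z^2" using assms(2) by (simp add: M_def)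
  have "z * (G * d2) = (2 * (t * d1) * G) * (M * (1 + z)^2)"
    unfolding t d2_def n1_def M_def by Groebner_Basis.algebra
  also have "\<dots> = (2 * t * G) * (d1 * (M * (1 + z)^2))" by (simp only: mult_ac)
  also have "\<dots> = d1 * ((A0 * M - M) * (1 + z)^2 - (u1 * (1 + z)) * (1 + z) * M - (u2 * (1 + z) * (1 + z)) * M)"
    unfolding assms(3) by Groebner_Basis.algebra
  also have "\<dots> = d1 * ((A0 * M - M) * (1 + z)^2 - n1 * (A0 * M - M) * (1 + z) - n1 * (A0 * M * (1 + z) - n1 * (A0 * M - M)))"
    unfolding u1 u2 by Groebner_Basis.algebra
  also have "\<dots> = z * (d1 * (z * (2 - z - 18 * z^2 - 8 * z^3 - 16 * z^5)))"
    unfolding A0 unfolding M_def n1_def by Groebner_Basis.algebra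
  finally have "z * (G * d2) = z * (d1 * (z * (2 - z - 18 * z^2 - 8 * z^3 - 16 * z^5)))" .
  hence G: "G * d2 = d1 * (z * (2 - z - 18 * z^2 - 8 * z^3 - 16 * z^5))" using nz by simp
  have "(- 2*t + 11*t^2 + 65*t^3 + 107*t^4 + 81*t^5 + 27*t^6
       + (2 - 20*t - 22*t^2 + 184*t^3 + 560*t^4 + 700*t^5 + 432*t^6 + 108*t^7) * G
       + (108*t^3 + 540*t^4 + 1080*t^5 + 1080*t^6 + 540*t^7 + 108*t^8) * G^2) * (d1^8 * d2^2)
     = (- 2*(t*d1)*d1^7 + 11*(t*d1)^2*d1^6 + 65*(t*d1)^3*d1^5 + 107*(t*d1)^4*d1^4 + 81*(t*d1)^5*d1^3 + 27*(t*d1)^6*d1^2)*d2^2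
      + (2*d1^8 - 20*(t*d1)*d1^7 - 22*(t*d1)^2*d1^6 + 184*(t*d1)^3*d1^5 + 560*(t*d1)^4*d1^4 + 700*(t*d1)^5*d1^3
         + 432*(t*d1)^6*d1^2 + 108*(t*d1)^7*d1) * (G*d2) * d2
      + 108*(t*d1)^3*((1+t)*d1)^5 * (G*d2)^2"
    by Groebner_Basis.algebra
  also have "\<dots> = 0" unfolding t1 unfolding t G unfolding d1_def d2_def n1_def by Groebner_Basis.algebra
  finally show ?thesis using nz by (simp add: d1_def d2_def)
qed

text \<open>\<open>K\<close> is linear in \<open>W\<close>, so \<open>W\<close> can be eliminated
  from \<open>I\<close>. The result factors in terms of \<open>c * z\<close> and
  \<open>t * (1 + z)\<close>: one factor is excluded by the last nonvanishing hypothesis, the other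
  is the parametrization of t. Then \<open>W * (1 - z) = 1\<close>, and the boundary value
  follows.\<close>

lemma kernel_elim1:
  fixes t c z W A0 :: "rat fps"
  assumes K: "c * z = t * ((1 + z) + 2 * (1 + z) * z * W)"
    and I: "c * (W - 1) = t * (1 + z) * W\<^sup>2 * (1 + z)"
    and A: "A0 = W - z\<^sup>2 * W\<^sup>2"
    and nz: "z \<noteq> 0" "t \<noteq> 0" "1 + z \<noteq> 0" "c * z + t * (1 + z) \<noteq> 0"
  shows "t * (1 + z)^2 = c * z * (1 - z)" "A0 * (1 - z)^2 = 1 - z - z^2"
proof -
  define C where "C = c * z"
  define T where "T = t * (1 + z)"
  have Q: "2 * T * z * W = C - T" using K by (simp add: C_def T_def algebra_simps)
  have "4 * T * z^2 * (c * (W - 1)) = 4 * T * z^2 * (t * (1 + z) * W\<^sup>2 * (1 + z))" by (simp only: I)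
  hence "2 * C * (2 * T * z * W) - 4 * C * T * z = (2 * T * z * W)^2 * (1 + z)"
    unfolding C_def T_def by (simp add: algebra_simps power2_eq_square)
  hence "(C + T) * (T * (1 + z) - C * (1 - z)) = 0"
    unfolding Q by (simp add: algebra_simps power2_eq_square)
  hence 1: "T * (1 + z) = C * (1 - z)" using nz by (simp add: C_def T_def)
  thus "t * (1 + z)^2 = c * z * (1 - z)" by (simp add: C_def T_def power2_eq_square mult_ac)
  have "(2 * T * z * (1 + z)) * (W * (1 - z)) = (2 * T * z * W) * (1 + z) * (1 - z)" by (simp only: mult_ac)
  also have "\<dots> = (C * (1 + z) - T * (1 + z)) * (1 - z)" unfolding Q by (simp add: algebra_simps)
  also have "\<dots> = 2 * z * (C * (1 - z))" unfolding 1 by (simp add: algebra_simps)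
  also have "\<dots> = (2 * T * z * (1 + z)) * 1" unfolding 1[symmetric] by (simp add: algebra_simps)
  finally have "W * (1 - z) = 1" unfolding mult_cancel_left using nz by (simp add: T_def)
  thus "A0 * (1 - z)^2 = 1 - z - z^2" unfolding A by Groebner_Basis.algebra
qed

lemma kernel_elim2:
  fixes t c z W A0 :: "rat fps"
  assumes K: "c * z = t * ((1 + z) + 2 * (1 + z)\<^sup>2 * z * W)"
    and I: "c * (W - 1) = t * (1 + z)\<^sup>2 * W\<^sup>2 * (1 + 2 * z)"
    and A: "A0 = W - 2 * (1 + z) * z\<^sup>2 * W\<^sup>2"
    and nz: "z \<noteq> 0" "t \<noteq> 0" "1 + z \<noteq> 0" "c * z + (1 + 2 * z) * (t * (1 + z)) \<noteq> 0"
  shows "t * (1 + z) = c * z * (1 - 2 * z)" "A0 * ((1 - 2 * z)^2 * (1 + z)) = 1 - 2 * z - 2 * z^2"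
proof -
  define C where "C = c * z"
  define T where "T = t * (1 + z)"
  have Q: "2 * T * (1 + z) * z * W = C - T"
    using K by (simp add: C_def T_def algebra_simps power2_eq_square)
  have "4 * T * (1 + z) * z^2 * (c * (W - 1)) = 4 * T * (1 + z) * z^2 * (t * (1 + z)\<^sup>2 * W\<^sup>2 * (1 + 2 * z))"
    by (simp only: I)
  hence "2 * C * (2 * T * (1 + z) * z * W) - 4 * C * T * (1 + z) * z = (2 * T * (1 + z) * z * W)^2 * (1 + 2 * z)"
    unfolding C_def T_def by (simp add: algebra_simps power2_eq_square)
  hence "(C + (1 + 2 * z) * T) * (T - C * (1 - 2 * z)) = 0"
    unfolding Q by (simp add: algebra_simps power2_eq_square)
  hence 1: "T = C * (1 - 2 * z)" using nz by (simp add: C_def T_def)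
  thus "t * (1 + z) = c * z * (1 - 2 * z)" by (simp add: C_def T_def)
  have "(2 * T * z) * (W * (1 - 2 * z) * (1 + z)) = (2 * T * (1 + z) * z * W) * (1 - 2 * z)" by (simp only: mult_ac)
  also have "\<dots> = C * (1 - 2 * z) - T * (1 - 2 * z)" unfolding Q by (simp add: algebra_simps)
  also have "\<dots> = (2 * T * z) * 1" unfolding 1[symmetric] by (simp add: algebra_simps)
  finally have "W * (1 - 2 * z) * (1 + z) = 1" unfolding mult_cancel_left using nz by (simp add: T_def)
  thus "A0 * ((1 - 2 * z)^2 * (1 + z)) = 1 - 2 * z - 2 * z^2" unfolding A by Groebner_Basis.algebra
qed

section \<open>Algebraic equations\<close>

text \<open>For a summable family the cutoff \<open>2 * d\<close> is exact in degree
  \<open>d\<close>, so this is the sum of all members from \<open>k\<close> on.\<close>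

definition tail_fps :: "(nat \<Rightarrow> rat fps) \<Rightarrow> nat \<Rightarrow> rat fps" where
  "tail_fps u k = Abs_fps (\<lambda>d. \<Sum>j=k..2 * d. fps_nth (u j) d)"

lemma summable_tail_fps: "summable_fps (tail_fps u)"
  by (simp add: summable_fps_def tail_fps_def)

lemma tail_fps_Suc:
  assumes "summable_fps u"
  shows "tail_fps u k = u k + tail_fps u (Suc k)"
proof (rule fps_ext)
  fix d
  show "fps_nth (tail_fps u k) d = fps_nth (u k + tail_fps u (Suc k)) d"
  proof (cases "k \<le> 2 * d")
    case True
    thus ?thesis by (simp add: tail_fps_def sum.atLeast_Suc_atMost)
  next
    case False
    thus ?thesis using assms by (simp add: tail_fps_def summable_fps_def)
  qed
qed

lemma summable_moment_series: "summable_fps (moment_series S)"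
  by (simp add: summable_fps_def moment_series_eq_0)

lemma coeffs1_eq: "coeffs1 n = (if n \<in> {n. even n \<and> n \<ge> 4} then fps_X ^ n else 0)"
  by (simp add: coeffs1_def)

lemma coeffs2_eq: "coeffs2 n = (if n \<in> {n. n \<ge> 2} then fps_X ^ n else 0)"
  by (simp add: coeffs2_def)

lemma coeffs3_eq: "coeffs3 n = (if n \<in> {n. n \<ge> 3} then fps_X ^ n else 0)"
  by (simp add: coeffs3_def)

lemma X_fps_deriv_nth: "fps_nth (2 * fps_X * fps_deriv F) d = 2 * of_nat d * fps_nth F d" for F :: "rat fps"
  by (cases d) (simp_all add: mult.assoc numeral_fps_const)

lemma fps_nz: "fps_nth f n \<noteq> 0 \<Longrightarrow> f \<noteq> 0" for f :: "rat fps"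
  by auto

lemma moment_series_Suc_fps:
  assumes "0 \<notin> S" "\<And>d. (\<Sum>n | n \<in> S \<and> k + n - 1 \<le> 2 * d. fps_nth (moment_series S (k + n - 1)) d) = fps_nth R d"
  shows "moment_series S (Suc k)
       = (if 2 \<le> Suc k then fps_X * conv (moment_series S) (moment_series S) (Suc k - 2) else 0) + fps_X * R"
proof (rule fps_ext)
  fix d
  have c: "(if 2 \<le> Suc k then fps_X * conv (moment_series S) (moment_series S) (Suc k - 2) else 0)
      = fps_X * (\<Sum>r<k. moment_series S r * moment_series S (k - 1 - r))"
    by (cases k) (auto simp: conv_def lessThan_Suc_atMost)
  show "fps_nth (moment_series S (Suc k)) d = fps_nth ((if 2 \<le> Suc k then fps_X * conv (moment_series S) (moment_series S) (Suc k - 2) else 0) + fps_X * R) d"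
    unfolding c
    by (cases d) (simp_all add: moment_series_Suc_0 moment_series_Suc[OF assms(1)] assms(2)[unfolded One_nat_def])
qed

text \<open>For the indices \<open>n \<ge> 2\<close> the moments of index \<open>k + n - 1\<close>
  run through the whole tail from \<open>Suc k\<close>, so \<open>kernel_method\<close> applies with
  \<open>c = 1\<close> and \<open>p = 2\<close>. Euler's relation makes \<open>2 * t * G\<close> the
  tail from 2, and the recursion at index 1 reduces it to \<open>A 0\<close>.\<close>

lemma planar_quadratic2:
  defines "t \<equiv> fps_X :: rat fps" and "G \<equiv> fps_deriv (planar_limit coeffs2)"
  shows "1 - 13*t + 22*t^2 - 9*t^3 - t^4 + (- 2 + 32*t - 108*t^2 + 76*t^3 + 2*t^4) * G - 108*t^3 * G^2 = 0"
proof -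
  let ?S = "{n::nat. n \<ge> 2}"
  have S: "0 \<notin> ?S" by simp
  define u where "u = moment_series ?S"
  define A where "A = tail_fps u"
  have u: "summable_fps u" "u 0 = 1"
    by (simp_all add: u_def summable_moment_series moment_series_0)
  have A_Suc: "A k = u k + A (Suc k)" for k
    unfolding A_def by (rule tail_fps_Suc[OF u(1)])
  have loop: "u (Suc k) = (if 2 \<le> Suc k then fps_X * conv u u (Suc k - 2) else 0) + fps_X * A (Suc k)" for k
    unfolding u_def
  proof (rule moment_series_Suc_fps[OF S])
    fix d
    show "(\<Sum>n | n \<in> ?S \<and> k + n - 1 \<le> 2 * d. fps_nth (moment_series ?S (k + n - 1)) d) = fps_nth (A (Suc k)) d"
      unfolding A_def tail_fps_def u_def fps_nth_Abs_fps
      by (rule sum.reindex_bij_witness[where i = "\<lambda>j. j + 1 - k" and j = "\<lambda>n. k + n - 1"]) auto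
  qed
  have "2 * of_nat d * fps_nth (planar_limit coeffs2) d = fps_nth (A 2) d" for d
    unfolding planar_limit_moments[OF S coeffs2_eq] A_def tail_fps_def u_def fps_nth_Abs_fps
    by (intro sum.cong) auto
  hence "2 * t * G = A 2"
    unfolding t_def G_def by (intro fps_ext) (simp only: X_fps_deriv_nth)
  also have "A 2 = A 0 - 1 - u 1" using A_Suc[of 0] A_Suc[of 1] u(2) by (simp add: numeral_2_eq_2)
  also have "u 1 = t * (A 0 - 1)" using loop[of 0] A_Suc[of 0] u(2) by (simp add: t_def)
  finally have G: "2 * t * G = (1 - t) * (A 0 - 1)" by (simp add: algebra_simps)
  have eq: "1 * u k = (if 2 \<le> k then fps_X * conv u u (k - 2) else 0) + fps_X * A k" if "k \<ge> 1" for k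
    using loop[of "k - 1"] that by simp
  obtain z W where z: "fps_nth z 0 = 0" "fps_nth z 1 = 1"
    and K: "1 * z = fps_X * ((1 + z) + 2 * (1 + z) ^ 2 * z * W)"
    "1 * (W - 1) = fps_X * (1 + z) ^ 2 * W\<^sup>2 * (1 + of_nat 2 * z)"
    "A 0 = W - of_nat 2 * (1 + z) ^ (2 - 1) * z\<^sup>2 * W\<^sup>2"
    by (rule kernel_method[OF _ _ _ u summable_tail_fps[of u, folded A_def] A_Suc eq]) auto
  note z0 = z z(2)[unfolded One_nat_def]
  \<comment> \<open>Since z begins with t, each nonvanishing claim is visible in a coefficient of
    order at most one.\<close>
  have nz1: "z \<noteq> 0"
    by (rule fps_nz[of _ 1]) (simp add: z0 t_def fps_mult_nth_1 numeral_fps_const power2_eq_square)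
  have nz2: "1 + z \<noteq> 0"
    by (rule fps_nz[of _ 0]) (simp add: z0 t_def fps_mult_nth_1 numeral_fps_const power2_eq_square)
  have nz3: "1 - 2 * z \<noteq> 0"
    by (rule fps_nz[of _ 0]) (simp add: z0 t_def fps_mult_nth_1 numeral_fps_const power2_eq_square)
  have nz4: "t \<noteq> 0"
    by (rule fps_nz[of _ 1]) (simp add: z0 t_def fps_mult_nth_1 numeral_fps_const power2_eq_square)
  have nz5: "1 * z + (1 + 2 * z) * (t * (1 + z)) \<noteq> 0"
    by (rule fps_nz[of _ 1]) (simp add: z0 t_def fps_mult_nth_1 numeral_fps_const power2_eq_square)
  note nz = nz1 nz2 nz3 nz4 nz5
  have E: "t * (1 + z) = 1 * z * (1 - 2 * z)" "A 0 * ((1 - 2 * z)^2 * (1 + z)) = 1 - 2 * z - 2 * z^2"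
    by (rule kernel_elim2[of 1 z t W "A 0"]; use K nz in \<open>simp add: t_def\<close>)+
  show ?thesis
    by (rule quadratic2_param[of t z "A 0" G]) (use E G nz in simp_all)
qed

text \<open>Dropping \<open>n = 2\<close> shortens the tail by its first member. Moving that member
  to the left-hand side restores the tail from \<open>k\<close> and changes the coefficient
  \<open>c\<close> to \<open>1 + t\<close>. Euler's relation now starts at 3, so \<open>u 1\<close>
  and \<open>u 2\<close> both have to be expressed through \<open>A 0\<close>.\<close>

lemma planar_quadratic3:
  defines "t \<equiv> fps_X :: rat fps" and "G \<equiv> fps_deriv (planar_limit coeffs3)"
  shows "- 2*t + 11*t^2 + 65*t^3 + 107*t^4 + 81*t^5 + 27*t^6
       + (2 - 20*t - 22*t^2 + 184*t^3 + 560*t^4 + 700*t^5 + 432*t^6 + 108*t^7) * G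
       + (108*t^3 + 540*t^4 + 1080*t^5 + 1080*t^6 + 540*t^7 + 108*t^8) * G^2 = 0"
proof -
  let ?S = "{n::nat. n \<ge> 3}"
  have S: "0 \<notin> ?S" by simp
  define u where "u = moment_series ?S"
  define A where "A = tail_fps u"
  have u: "summable_fps u" "u 0 = 1"
    by (simp_all add: u_def summable_moment_series moment_series_0)
  have A_Suc: "A k = u k + A (Suc k)" for k
    unfolding A_def by (rule tail_fps_Suc[OF u(1)])
  have loop: "u (Suc k) = (if 2 \<le> Suc k then fps_X * conv u u (Suc k - 2) else 0) + fps_X * A (Suc (Suc k))" for k
    unfolding u_def
  proof (rule moment_series_Suc_fps[OF S])
    fix d
    show "(\<Sum>n | n \<in> ?S \<and> k + n - 1 \<le> 2 * d. fps_nth (moment_series ?S (k + n - 1)) d) = fps_nth (A (Suc (Suc k))) d"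
      unfolding A_def tail_fps_def u_def fps_nth_Abs_fps
      by (rule sum.reindex_bij_witness[where i = "\<lambda>j. j + 1 - k" and j = "\<lambda>n. k + n - 1"]) auto
  qed
  have "2 * of_nat d * fps_nth (planar_limit coeffs3) d = fps_nth (A 3) d" for d
    unfolding planar_limit_moments[OF S coeffs3_eq] A_def tail_fps_def u_def fps_nth_Abs_fps
    by (intro sum.cong) auto
  hence "2 * t * G = A 3"
    unfolding t_def G_def by (intro fps_ext) (simp only: X_fps_deriv_nth)
  also have "A 3 = A 0 - 1 - u 1 - u 2"
    using A_Suc[of 0] A_Suc[of 1] A_Suc[of 2] u(2) by (simp add: eval_nat_numeral)
  finally have G: "2 * t * G = A 0 - 1 - u 1 - u 2" .
  have eq: "(1 + t) * u k = (if 2 \<le> k then fps_X * conv u u (k - 2) else 0) + fps_X * A k" if "k \<ge> 1" for k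
    using loop[of "k - 1"] A_Suc[of k] that by (simp add: algebra_simps t_def)
  have u1: "(1 + t) * u 1 = t * (A 0 - 1)" using eq[of 1] A_Suc[of 0] u(2) by (simp add: t_def)
  have u2: "(1 + t) * u 2 = t + t * (A 0 - 1 - u 1)"
    using eq[of 2] A_Suc[of 0] A_Suc[of 1] u(2) by (simp add: t_def conv_def eval_nat_numeral)
  have c0: "fps_nth (1 + t) 0 = 1" by (simp add: t_def)
  obtain z W where z: "fps_nth z 0 = 0" "fps_nth z 1 = 1"
    and K: "(1 + t) * z = fps_X * ((1 + z) + 2 * (1 + z) ^ 2 * z * W)"
    "(1 + t) * (W - 1) = fps_X * (1 + z) ^ 2 * W\<^sup>2 * (1 + of_nat 2 * z)"
    "A 0 = W - of_nat 2 * (1 + z) ^ (2 - 1) * z\<^sup>2 * W\<^sup>2"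
    by (rule kernel_method[where p = 2 and c = "1 + t", OF _ _ c0 u summable_tail_fps[of u, folded A_def] A_Suc eq]) auto
  note z0 = z z(2)[unfolded One_nat_def]
  have nz1: "z \<noteq> 0"
    by (rule fps_nz[of _ 1]) (simp add: z0 t_def fps_mult_nth_1 numeral_fps_const power2_eq_square)
  have nz2: "1 + z \<noteq> 0"
    by (rule fps_nz[of _ 0]) (simp add: z0 t_def fps_mult_nth_1 numeral_fps_const power2_eq_square)
  have nz3: "1 - 2 * z \<noteq> 0"
    by (rule fps_nz[of _ 0]) (simp add: z0 t_def fps_mult_nth_1 numeral_fps_const power2_eq_square)
  have nz4: "1 + 2 * z^2 \<noteq> 0"
    by (rule fps_nz[of _ 0]) (simp add: z0 t_def fps_mult_nth_1 numeral_fps_const power2_eq_square)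
  have nz5: "t \<noteq> 0"
    by (rule fps_nz[of _ 1]) (simp add: z0 t_def fps_mult_nth_1 numeral_fps_const power2_eq_square)
  have nz6: "(1 + t) * z + (1 + 2 * z) * (t * (1 + z)) \<noteq> 0"
    by (rule fps_nz[of _ 1]) (simp add: z0 t_def fps_mult_nth_1 numeral_fps_const power2_eq_square)
  note nz = nz1 nz2 nz3 nz4 nz5 nz6
  have E: "t * (1 + z) = (1 + t) * z * (1 - 2 * z)" "A 0 * ((1 - 2 * z)^2 * (1 + z)) = 1 - 2 * z - 2 * z^2"
    by (rule kernel_elim2[of "1 + t" z t W "A 0"]; use K nz in \<open>simp add: t_def\<close>)+
  show ?thesis
    by (rule quadratic3_param[of t z "A 0" G "u 1" "u 2"]) (use E G nz u1 u2 in simp_all)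
qed

text \<open>Only even indices occur, so odd moments vanish and the index is halved. The convolution
  shift 2 becomes \<open>p = 1\<close>, and the missing quadratic term again yields
  \<open>c = 1 + t\<close>. The halved indices give Euler's relation the tail from 2.\<close>

lemma planar_quadratic1:
  defines "t \<equiv> fps_X :: rat fps" and "G \<equiv> fps_deriv (planar_limit coeffs1)"
  shows "- 2*t + 13*t^2 + 16*t^3 + 2*(1 - 9*t + 3*t^2 + 45*t^3 + 32*t^4) * G + 64*t^3*(1 + t)^2 * G^2 = 0"
proof -
  let ?S = "{n::nat. even n \<and> n \<ge> 4}"
  let ?m = "moment_series ?S"
  have S: "0 \<notin> ?S" by simp
  define u where "u k = ?m (2 * k)" for k
  define A where "A = tail_fps u"
  have u: "summable_fps u" "u 0 = 1"
    by (simp_all add: u_def[abs_def] moment_series_0 summable_fps_def moment_series_eq_0)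
  have u_eq_0: "fps_nth (u k) d = 0" if "d < k" for k d
    using that by (simp add: u_def moment_series_eq_0)
  have tail: "fps_nth (A k) d = (\<Sum>j=k..d. fps_nth (u j) d)" for k d
    unfolding A_def tail_fps_def fps_nth_Abs_fps
    by (rule sum.mono_neutral_right) (auto simp: u_eq_0)
  have A_Suc: "A k = u k + A (Suc k)" for k
    unfolding A_def by (rule tail_fps_Suc[OF u(1)])
  have odd: "?m j = 0" if "odd j" for j
    using that by (intro moment_series_odd) auto
  have loop: "u (Suc k) = fps_X * conv u u k + fps_X * A (Suc (Suc k))" for k
  proof -
    have "?m (Suc (Suc (2 * k))) = (if 2 \<le> Suc (Suc (2 * k)) then fps_X * conv ?m ?m (Suc (Suc (2 * k)) - 2) else 0)
        + fps_X * A (Suc (Suc k))"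
    proof (rule moment_series_Suc_fps[OF S])
      fix d
      show "(\<Sum>n | n \<in> ?S \<and> Suc (2 * k) + n - 1 \<le> 2 * d. fps_nth (?m (Suc (2 * k) + n - 1)) d) = fps_nth (A (Suc (Suc k))) d"
        unfolding tail u_def
        by (rule sum.reindex_bij_witness[where i = "\<lambda>j. 2 * j - 2 * k" and j = "\<lambda>n. k + n div 2"]) auto
    qed
    moreover have "conv ?m ?m (2 * k) = conv u u k"
    proof -
      have "conv ?m ?m (2 * k) = (\<Sum>i\<in>{i. i \<le> 2 * k \<and> even i}. ?m i * ?m (2 * k - i))"
        unfolding conv_def by (rule sum.mono_neutral_right) (auto simp: odd)
      also have "\<dots> = conv u u k"
        unfolding conv_def u_def
        by (rule sum.reindex_bij_witness[where i = "\<lambda>i. 2 * i" and j = "\<lambda>i. i div 2"]) (auto simp: algebra_simps)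
      finally show ?thesis .
    qed
    ultimately show ?thesis by (simp add: u_def)
  qed
  have "2 * of_nat d * fps_nth (planar_limit coeffs1) d = fps_nth (A 2) d" for d
    unfolding planar_limit_moments[OF S coeffs1_eq] tail u_def
    by (rule sum.reindex_bij_witness[where i = "\<lambda>j. 2 * j" and j = "\<lambda>n. n div 2"]) auto
  hence "2 * t * G = A 2"
    unfolding t_def G_def by (intro fps_ext) (simp only: X_fps_deriv_nth)
  also have "A 2 = A 0 - 1 - u 1" using A_Suc[of 0] A_Suc[of 1] u(2) by (simp add: numeral_2_eq_2)
  finally have G: "2 * t * G = A 0 - 1 - u 1" .
  have eq: "(1 + t) * u k = (if 1 \<le> k then fps_X * conv u u (k - 1) else 0) + fps_X * A k" if "k \<ge> 1" for k
    using loop[of "k - 1"] A_Suc[of k] that by (simp add: algebra_simps t_def)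
  have u1: "(1 + t) * u 1 = t * A 0"
    using eq[of 1] A_Suc[of 0] u(2) by (simp add: t_def conv_def algebra_simps)
  have c0: "fps_nth (1 + t) 0 = 1" by (simp add: t_def)
  obtain z W where z: "fps_nth z 0 = 0" "fps_nth z 1 = 1"
    and K: "(1 + t) * z = fps_X * ((1 + z) + 2 * (1 + z) ^ 1 * z * W)"
    "(1 + t) * (W - 1) = fps_X * (1 + z) ^ 1 * W\<^sup>2 * (1 + of_nat 1 * z)"
    "A 0 = W - of_nat 1 * (1 + z) ^ (1 - 1) * z\<^sup>2 * W\<^sup>2"
    by (rule kernel_method[where p = 1 and c = "1 + t", OF _ _ c0 u summable_tail_fps[of u, folded A_def] A_Suc eq]) auto
  note z0 = z z(2)[unfolded One_nat_def]
  have nz1: "z \<noteq> 0"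
    by (rule fps_nz[of _ 1]) (simp add: z0 t_def fps_mult_nth_1 numeral_fps_const power2_eq_square)
  have nz2: "1 + z \<noteq> 0"
    by (rule fps_nz[of _ 0]) (simp add: z0 t_def fps_mult_nth_1 numeral_fps_const power2_eq_square)
  have nz3: "1 - z \<noteq> 0"
    by (rule fps_nz[of _ 0]) (simp add: z0 t_def fps_mult_nth_1 numeral_fps_const power2_eq_square)
  have nz4: "1 + z + 2 * z^2 \<noteq> 0"
    by (rule fps_nz[of _ 0]) (simp add: z0 t_def fps_mult_nth_1 numeral_fps_const power2_eq_square)
  have nz5: "t \<noteq> 0"
    by (rule fps_nz[of _ 1]) (simp add: z0 t_def fps_mult_nth_1 numeral_fps_const power2_eq_square)
  have nz6: "(1 + t) * z + t * (1 + z) \<noteq> 0"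
    by (rule fps_nz[of _ 1]) (simp add: z0 t_def fps_mult_nth_1 numeral_fps_const power2_eq_square)
  note nz = nz1 nz2 nz3 nz4 nz5 nz6
  have E: "t * (1 + z)^2 = (1 + t) * z * (1 - z)" "A 0 * (1 - z)^2 = 1 - z - z^2"
    by (rule kernel_elim1[of "1 + t" z t W "A 0"]; use K nz in \<open>simp add: t_def\<close>)+
  show ?thesis
    by (rule quadratic1_param[of t z "A 0" G "u 1"]) (use E G nz u1 in simp_all)
qed

section \<open>Differential equations and recursions\<close>

text \<open>A square root has half the logarithmic derivative; cancelling \<open>H\<close> takes the
  place of dividing by it.\<close>

lemma sqrt_ode:
  fixes H \<delta> P R :: "rat fps"
  assumes "H * H = \<delta>" "P * fps_deriv \<delta> = R * \<delta>" "\<delta> \<noteq> 0"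
  shows "2 * P * fps_deriv H = R * H"
proof -
  have "fps_deriv \<delta> = 2 * H * fps_deriv H" unfolding assms(1)[symmetric] by simp
  hence "H * (2 * P * fps_deriv H) = H * (R * H)"
    using assms(2) unfolding assms(1)[symmetric] by (simp add: mult_ac)
  thus ?thesis using assms(1,3) by auto
qed

text \<open>Completing the square: the quadratic is multiplied by four times its leading
  coefficient, and what remains is the discriminant. The cube of \<open>1 - 7*t\<close> in it is the
  source of the exponent 3/2 and of the growth rate 7.\<close>

lemma discriminant1:
  fixes t G :: "rat fps"
  assumes "- 2*t + 13*t^2 + 16*t^3 + 2*(1 - 9*t + 3*t^2 + 45*t^3 + 32*t^4) * G + 64*t^3*(1 + t)^2 * G^2 = 0"
  shows "(128*t^3*(1 + t)^2 * G + 2*(1 - 9*t + 3*t^2 + 45*t^3 + 32*t^4))^2 = 4 * (1 - 7*t)^3 * (1 + t)^3"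
proof -
  have "(128*t^3*(1 + t)^2 * G + 2*(1 - 9*t + 3*t^2 + 45*t^3 + 32*t^4))^2
    = 256*t^3*(1 + t)^2 * (- 2*t + 13*t^2 + 16*t^3 + 2*(1 - 9*t + 3*t^2 + 45*t^3 + 32*t^4) * G + 64*t^3*(1 + t)^2 * G^2)
      + 4 * (1 - 7*t)^3 * (1 + t)^3"
    by Groebner_Basis.algebra
  thus ?thesis unfolding assms by simp
qed

lemma discriminant2:
  fixes t G :: "rat fps"
  assumes "1 - 13*t + 22*t^2 - 9*t^3 - t^4 + (- 2 + 32*t - 108*t^2 + 76*t^3 + 2*t^4) * G - 108*t^3 * G^2 = 0"
  shows "(- 216*t^3 * G + (- 2 + 32*t - 108*t^2 + 76*t^3 + 2*t^4))^2 = 4 * (1 - 10*t + t^2)^3 * (1 - t)^2"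
proof -
  have "(- 216*t^3 * G + (- 2 + 32*t - 108*t^2 + 76*t^3 + 2*t^4))^2
    = - 432*t^3 * (1 - 13*t + 22*t^2 - 9*t^3 - t^4 + (- 2 + 32*t - 108*t^2 + 76*t^3 + 2*t^4) * G - 108*t^3 * G^2)
      + 4 * (1 - 10*t + t^2)^3 * (1 - t)^2"
    by Groebner_Basis.algebra
  thus ?thesis unfolding assms by simp
qed

lemma discriminant3:
  fixes t G :: "rat fps"
  assumes "- 2*t + 11*t^2 + 65*t^3 + 107*t^4 + 81*t^5 + 27*t^6
       + (2 - 20*t - 22*t^2 + 184*t^3 + 560*t^4 + 700*t^5 + 432*t^6 + 108*t^7) * G
       + (108*t^3 + 540*t^4 + 1080*t^5 + 1080*t^6 + 540*t^7 + 108*t^8) * G^2 = 0"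
  shows "(216*t^3*(1 + t)^5 * G + (2 - 20*t - 22*t^2 + 184*t^3 + 560*t^4 + 700*t^5 + 432*t^6 + 108*t^7))^2
     = 4 * (1 - 8*t - 8*t^2)^3 * (1 + t)^4"
proof -
  have "(216*t^3*(1 + t)^5 * G + (2 - 20*t - 22*t^2 + 184*t^3 + 560*t^4 + 700*t^5 + 432*t^6 + 108*t^7))^2
    = 432*t^3*(1 + t)^5 * (- 2*t + 11*t^2 + 65*t^3 + 107*t^4 + 81*t^5 + 27*t^6
       + (2 - 20*t - 22*t^2 + 184*t^3 + 560*t^4 + 700*t^5 + 432*t^6 + 108*t^7) * G
       + (108*t^3 + 540*t^4 + 1080*t^5 + 1080*t^6 + 540*t^7 + 108*t^8) * G^2)
      + 4 * (1 - 8*t - 8*t^2)^3 * (1 + t)^4"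
    by Groebner_Basis.algebra
  thus ?thesis unfolding assms by simp
qed

lemma fps_nonzero_at_0: "fps_nth f 0 \<noteq> 0 \<Longrightarrow> f \<noteq> 0"
  by auto

lemma ode1:
  defines "t \<equiv> fps_X :: rat fps"
  assumes "- 2*t + 13*t^2 + 16*t^3 + 2*(1 - 9*t + 3*t^2 + 45*t^3 + 32*t^4) * G + 64*t^3*(1 + t)^2 * G^2 = 0"
  shows "t*(8 + 7*t) - 2*(3 - 4*t - 21*t^2 - 14*t^3) * G - 2*t*(1 - 5*t - 13*t^2 - 7*t^3) * fps_deriv G = 0"
proof -
  define H where "H = 128*t^3*(1 + t)^2 * G + 2*(1 - 9*t + 3*t^2 + 45*t^3 + 32*t^4)"
  define \<delta> where "\<delta> = 4 * (1 - 7*t)^3 * (1 + t)^3"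
  have dt: "fps_deriv t = 1" by (simp add: t_def)
  have H2: "H * H = \<delta>" using discriminant1[OF assms(2)] by (simp add: H_def \<delta>_def power2_eq_square)
  have d\<delta>: "fps_deriv \<delta> = 4 * (3 * (1 - 7*t)^2 * (- 7) * (1 + t)^3 + (1 - 7*t)^3 * (3 * (1 + t)^2))"
    by (simp add: \<delta>_def fps_deriv_power dt numeral_fps_const[symmetric] fps_const_neg[symmetric] del: fps_const_neg)
  \<comment> \<open>The factor of \<open>H\<close> is \<open>(1 - 7*t) * (1 + t)\<close> times the
    logarithmic derivative of \<delta>, that is
    \<open>- 21 * (1 + t) + 3 * (1 - 7*t)\<close>.\<close>
  have "2 * ((1 - 7*t) * (1 + t)) * fps_deriv H = (- 18 - 42*t) * H"
  proof (rule sqrt_ode[OF H2])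
    show "(1 - 7*t) * (1 + t) * fps_deriv \<delta> = (- 18 - 42*t) * \<delta>"
      unfolding d\<delta> unfolding \<delta>_def by Groebner_Basis.algebra
    show "\<delta> \<noteq> 0" by (rule fps_nonzero_at_0) (simp add: \<delta>_def t_def fps_power_zeroth numeral_fps_const)
  qed
  moreover have "fps_deriv H = 128 * (3*t^2*(1 + t)^2 + t^3 * (2 * (1 + t))) * G + 128*t^3*(1 + t)^2 * fps_deriv G
      + 2 * (- 9 + 6*t + 135*t^2 + 128*t^3)"
    by (simp add: H_def fps_deriv_power dt numeral_fps_const[symmetric] algebra_simps power2_eq_square power3_eq_cube)
  ultimately have "2 * ((1 - 7*t) * (1 + t)) * (128 * (3*t^2*(1 + t)^2 + t^3 * (2 * (1 + t))) * G + 128*t^3*(1 + t)^2 * fps_deriv G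
      + 2 * (- 9 + 6*t + 135*t^2 + 128*t^3)) - (- 18 - 42*t) * H = 0" by simp
  \<comment> \<open>Written out in \<open>G\<close>, the equation for \<open>H\<close> is the
    claimed one times a nonzero polynomial, which cancels in the integral domain of power
    series.\<close>
  moreover have "2 * ((1 - 7*t) * (1 + t)) * (128 * (3*t^2*(1 + t)^2 + t^3 * (2 * (1 + t))) * G + 128*t^3*(1 + t)^2 * fps_deriv G
      + 2 * (- 9 + 6*t + 135*t^2 + 128*t^3)) - (- 18 - 42*t) * H
    = (- 128 * t^2 * (1 + t)) * (t*(8 + 7*t) - 2*(3 - 4*t - 21*t^2 - 14*t^3) * G - 2*t*(1 - 5*t - 13*t^2 - 7*t^3) * fps_deriv G)"
    unfolding H_def by Groebner_Basis.algebra
  moreover have "t \<noteq> 0" "1 + t \<noteq> 0" "(128 :: rat fps) \<noteq> 0"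
    by (simp add: t_def, rule fps_nonzero_at_0, simp add: t_def, rule fps_nonzero_at_0, simp add: numeral_fps_const)
  ultimately show ?thesis by simp
qed

lemma ode2:
  defines "t \<equiv> fps_X :: rat fps"
  assumes "1 - 13*t + 22*t^2 - 9*t^3 - t^4 + (- 2 + 32*t - 108*t^2 + 76*t^3 + 2*t^4) * G - 108*t^3 * G^2 = 0"
  shows "3 - 5*t + t^2 + t^3 - 2*(3 - 17*t + 5*t^2 + t^3) * G - 2*t*(1 - 11*t + 11*t^2 - t^3) * fps_deriv G = 0"
proof -
  define H where "H = - 216*t^3 * G + (- 2 + 32*t - 108*t^2 + 76*t^3 + 2*t^4)"
  define \<delta> where "\<delta> = 4 * (1 - 10*t + t^2)^3 * (1 - t)^2"
  have dt: "fps_deriv t = 1" by (simp add: t_def)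
  have H2: "H * H = \<delta>" using discriminant2[OF assms(2)] by (simp add: H_def \<delta>_def power2_eq_square)
  have d\<delta>: "fps_deriv \<delta> = 4 * (3 * (1 - 10*t + t^2)^2 * (- 10 + 2*t) * (1 - t)^2 - (1 - 10*t + t^2)^3 * (2 * (1 - t)))"
    by (simp add: \<delta>_def fps_deriv_power dt numeral_fps_const[symmetric] fps_const_neg[symmetric] del: fps_const_neg) (simp add: algebra_simps)
  have "2 * ((1 - 10*t + t^2) * (1 - t)) * fps_deriv H = (3 * (- 10 + 2*t) * (1 - t) - 2 * (1 - 10*t + t^2)) * H"
  proof (rule sqrt_ode[OF H2])
    show "(1 - 10*t + t^2) * (1 - t) * fps_deriv \<delta> = (3 * (- 10 + 2*t) * (1 - t) - 2 * (1 - 10*t + t^2)) * \<delta>"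
      unfolding d\<delta> unfolding \<delta>_def by Groebner_Basis.algebra
    show "\<delta> \<noteq> 0" by (rule fps_nonzero_at_0) (simp add: \<delta>_def t_def fps_power_zeroth numeral_fps_const)
  qed
  moreover have "fps_deriv H = - 216 * (3*t^2) * G - 216*t^3 * fps_deriv G + (32 - 216*t + 228*t^2 + 8*t^3)"
    by (simp add: H_def fps_deriv_power dt numeral_fps_const[symmetric] algebra_simps power2_eq_square power3_eq_cube)
  ultimately have "2 * ((1 - 10*t + t^2) * (1 - t)) * (- 216 * (3*t^2) * G - 216*t^3 * fps_deriv G + (32 - 216*t + 228*t^2 + 8*t^3))
      - (3 * (- 10 + 2*t) * (1 - t) - 2 * (1 - 10*t + t^2)) * H = 0" by simp
  moreover have "2 * ((1 - 10*t + t^2) * (1 - t)) * (- 216 * (3*t^2) * G - 216*t^3 * fps_deriv G + (32 - 216*t + 228*t^2 + 8*t^3))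
      - (3 * (- 10 + 2*t) * (1 - t) - 2 * (1 - 10*t + t^2)) * H
    = (216 * t^2) * (3 - 5*t + t^2 + t^3 - 2*(3 - 17*t + 5*t^2 + t^3) * G - 2*t*(1 - 11*t + 11*t^2 - t^3) * fps_deriv G)"
    unfolding H_def by Groebner_Basis.algebra
  moreover have "t \<noteq> 0" "(216 :: rat fps) \<noteq> 0"
    by (simp add: t_def, rule fps_nonzero_at_0, simp add: numeral_fps_const)
  ultimately show ?thesis by simp
qed

lemma ode3:
  defines "t \<equiv> fps_X :: rat fps"
  assumes "- 2*t + 11*t^2 + 65*t^3 + 107*t^4 + 81*t^5 + 27*t^6
       + (2 - 20*t - 22*t^2 + 184*t^3 + 560*t^4 + 700*t^5 + 432*t^6 + 108*t^7) * G
       + (108*t^3 + 540*t^4 + 1080*t^5 + 1080*t^6 + 540*t^7 + 108*t^8) * G^2 = 0"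
  shows "- 8*t - 35*t^2 - 44*t^3 - 16*t^4 - 6*(- 1 + 15*t^2 + 34*t^3 + 28*t^4 + 8*t^5) * G
       - 2*(- t + 5*t^2 + 29*t^3 + 47*t^4 + 32*t^5 + 8*t^6) * fps_deriv G = 0"
proof -
  define b where "b = 2 - 20*t - 22*t^2 + 184*t^3 + 560*t^4 + 700*t^5 + 432*t^6 + 108*t^7"
  define b' where "b' = - 20 - 44*t + 552*t^2 + 2240*t^3 + 3500*t^4 + 2592*t^5 + 756*t^6"
  define H where "H = 216*t^3*(1 + t)^5 * G + b"
  define \<delta> where "\<delta> = 4 * (1 - 8*t - 8*t^2)^3 * (1 + t)^4"
  have dt: "fps_deriv t = 1" by (simp add: t_def)
  have H2: "H * H = \<delta>" using discriminant3[OF assms(2)] by (simp add: H_def b_def \<delta>_def power2_eq_square)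
  have d\<delta>: "fps_deriv \<delta> = 4 * (3 * (1 - 8*t - 8*t^2)^2 * (- 8 - 16*t) * (1 + t)^4 + (1 - 8*t - 8*t^2)^3 * (4 * (1 + t)^3))"
    by (simp add: \<delta>_def fps_deriv_power dt numeral_fps_const[symmetric] fps_const_neg[symmetric] del: fps_const_neg)
  have "2 * ((1 - 8*t - 8*t^2) * (1 + t)) * fps_deriv H = (3 * (- 8 - 16*t) * (1 + t) + 4 * (1 - 8*t - 8*t^2)) * H"
  proof (rule sqrt_ode[OF H2])
    show "(1 - 8*t - 8*t^2) * (1 + t) * fps_deriv \<delta> = (3 * (- 8 - 16*t) * (1 + t) + 4 * (1 - 8*t - 8*t^2)) * \<delta>"
      unfolding d\<delta> unfolding \<delta>_def by Groebner_Basis.algebra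
    show "\<delta> \<noteq> 0" by (rule fps_nonzero_at_0) (simp add: \<delta>_def t_def fps_power_zeroth numeral_fps_const)
  qed
  moreover have "fps_deriv b = b'"
    by (simp add: b_def b'_def fps_deriv_power dt numeral_fps_const[symmetric])
  hence "fps_deriv H = 216 * (3*t^2*(1 + t)^5 + t^3 * (5 * (1 + t)^4)) * G + 216*t^3*(1 + t)^5 * fps_deriv G + b'"
    by (simp add: H_def fps_deriv_power dt numeral_fps_const[symmetric] algebra_simps)
  ultimately have "2 * ((1 - 8*t - 8*t^2) * (1 + t)) * (216 * (3*t^2*(1 + t)^5 + t^3 * (5 * (1 + t)^4)) * G + 216*t^3*(1 + t)^5 * fps_deriv G + b')
      - (3 * (- 8 - 16*t) * (1 + t) + 4 * (1 - 8*t - 8*t^2)) * H = 0" by simp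
  moreover have "2 * ((1 - 8*t - 8*t^2) * (1 + t)) * (216 * (3*t^2*(1 + t)^5 + t^3 * (5 * (1 + t)^4)) * G + 216*t^3*(1 + t)^5 * fps_deriv G + b')
      - (3 * (- 8 - 16*t) * (1 + t) + 4 * (1 - 8*t - 8*t^2)) * H
    = (216 * t^2 * (1 + t)^3) * (- 8*t - 35*t^2 - 44*t^3 - 16*t^4 - 6*(- 1 + 15*t^2 + 34*t^3 + 28*t^4 + 8*t^5) * G
       - 2*(- t + 5*t^2 + 29*t^3 + 47*t^4 + 32*t^5 + 8*t^6) * fps_deriv G)"
    unfolding H_def b_def b'_def by Groebner_Basis.algebra
  moreover have "t \<noteq> 0" "1 + t \<noteq> 0" "(216 :: rat fps) \<noteq> 0"
    by (simp add: t_def, rule fps_nonzero_at_0, simp add: t_def, rule fps_nonzero_at_0, simp add: numeral_fps_const)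
  ultimately show ?thesis by simp
qed

section \<open>Extraction of coefficients from the differential equations\<close>

lemma fps_nth_X_power_mult: "n = m + j \<Longrightarrow> fps_nth (fps_X ^ j * f) n = fps_nth (f :: rat fps) m"
  by (simp add: fps_X_power_mult_nth)

lemma fps_nth_X_power_deriv:
  "Suc n = m + j \<Longrightarrow> j \<ge> 1 \<Longrightarrow> fps_nth (fps_X ^ j * fps_deriv f) n = of_nat m * fps_nth (f :: rat fps) m"
  by (cases m) (auto simp: fps_X_power_mult_nth)

lemma fps_nth_numeral_mult: "fps_nth (numeral k * f) n = numeral k * fps_nth (f :: rat fps) n"
  by (simp add: numeral_fps_const)

lemma fps_nth_neg_numeral_mult: "fps_nth (- numeral k * f) n = - numeral k * fps_nth (f :: rat fps) n"
  by (simp add: fps_nth_numeral_mult)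

lemma fps_nth_numeral: "fps_nth (numeral k :: rat fps) n = (if n = 0 then numeral k else 0)"
  by (simp add: numeral_fps_const)

text \<open>All terms are brought to the form of a power of \<open>fps_X\<close> times
  \<open>G\<close> or its derivative, for which taking a coefficient is an index shift.\<close>

lemma ode1_expand:
  fixes G :: "rat fps"
  assumes "fps_X*(8 + 7*fps_X) - 2*(3 - 4*fps_X - 21*fps_X^2 - 14*fps_X^3) * G - 2*fps_X*(1 - 5*fps_X - 13*fps_X^2 - 7*fps_X^3) * fps_deriv G = 0"
  shows "8 * (fps_X ^ 1) + 7 * (fps_X ^ 2)
    = 2 * (3 * (fps_X ^ 0 * G) - 4 * (fps_X ^ 1 * G) - 21 * (fps_X ^ 2 * G) - 14 * (fps_X ^ 3 * G) + (fps_X ^ 1 * fps_deriv G - 5 * (fps_X ^ 2 * fps_deriv G) - 13 * (fps_X ^ 3 * fps_deriv G) - 7 * (fps_X ^ 4 * fps_deriv G)))"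
proof -
  have "(8 * (fps_X ^ 1) + 7 * (fps_X ^ 2)) - (2 * (3 * (fps_X ^ 0 * G) - 4 * (fps_X ^ 1 * G) - 21 * (fps_X ^ 2 * G) - 14 * (fps_X ^ 3 * G) + (fps_X ^ 1 * fps_deriv G - 5 * (fps_X ^ 2 * fps_deriv G) - 13 * (fps_X ^ 3 * fps_deriv G) - 7 * (fps_X ^ 4 * fps_deriv G))))
      = fps_X*(8 + 7*fps_X) - 2*(3 - 4*fps_X - 21*fps_X^2 - 14*fps_X^3) * G - 2*fps_X*(1 - 5*fps_X - 13*fps_X^2 - 7*fps_X^3) * fps_deriv G"
    by Groebner_Basis.algebra
  thus ?thesis unfolding assms by simp
qed

lemma ode1_coeff:
  fixes G :: "rat fps"
  assumes "fps_X*(8 + 7*fps_X) - 2*(3 - 4*fps_X - 21*fps_X^2 - 14*fps_X^3) * G - 2*fps_X*(1 - 5*fps_X - 13*fps_X^2 - 7*fps_X^3) * fps_deriv G = 0"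
  shows "(3 + 1 * (of_nat m + 3)) * fps_nth G (m + 3) + (-4 + -5 * (of_nat m + 2)) * fps_nth G (m + 2) + (-21 + -13 * (of_nat m + 1)) * fps_nth G (m + 1) + (-14 + -7 * (of_nat m + 0)) * fps_nth G (m) = 0"
proof -
  note expand = arg_cong[OF ode1_expand[OF assms], of "\<lambda>f. fps_nth f (m + 3)"]
  have g0: "fps_nth (fps_X ^ 0 * G) (m + 3) = fps_nth G (m + 3)" by (rule fps_nth_X_power_mult) simp
  have g1: "fps_nth (fps_X ^ 1 * G) (m + 3) = fps_nth G (m + 2)" by (rule fps_nth_X_power_mult) simp
  have g2: "fps_nth (fps_X ^ 2 * G) (m + 3) = fps_nth G (m + 1)" by (rule fps_nth_X_power_mult) simp
  have g3: "fps_nth (fps_X ^ 3 * G) (m + 3) = fps_nth G (m)" by (rule fps_nth_X_power_mult) simp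
  have d0: "fps_nth (fps_X ^ 1 * fps_deriv G) (m + 3) = of_nat (m + 3) * fps_nth G (m + 3)" by (rule fps_nth_X_power_deriv) simp_all
  have d1: "fps_nth (fps_X ^ 2 * fps_deriv G) (m + 3) = of_nat (m + 2) * fps_nth G (m + 2)" by (rule fps_nth_X_power_deriv) simp_all
  have d2: "fps_nth (fps_X ^ 3 * fps_deriv G) (m + 3) = of_nat (m + 1) * fps_nth G (m + 1)" by (rule fps_nth_X_power_deriv) simp_all
  have d3: "fps_nth (fps_X ^ 4 * fps_deriv G) (m + 3) = of_nat (m) * fps_nth G (m)" by (rule fps_nth_X_power_deriv) simp_all
  show ?thesis
    using expand unfolding fps_nth_numeral_mult fps_nth_neg_numeral_mult fps_add_nth fps_sub_nth fps_neg_nth g0 g1 g2 g3 d0 d1 d2 d3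
    by (simp add: fps_X_power_nth algebra_simps split: if_splits)
qed

lemma ode1_initial:
  fixes G :: "rat fps"
  assumes "fps_X*(8 + 7*fps_X) - 2*(3 - 4*fps_X - 21*fps_X^2 - 14*fps_X^3) * G - 2*fps_X*(1 - 5*fps_X - 13*fps_X^2 - 7*fps_X^3) * fps_deriv G = 0"
  shows "fps_nth G 0 = 0" "fps_nth G 1 = 1" "fps_nth G 2 = 5 / 2"
proof -
  note c = fps_nth_numeral fps_nth_numeral_mult fps_nth_neg_numeral_mult fps_X_power_mult_nth fps_X_power_nth fps_deriv_nth
  note expand = ode1_expand[OF assms]
  have v0: "fps_nth G 0 = 0"
    using arg_cong[OF expand, of "\<lambda>f. fps_nth f 0"]
    by (simp add: c eval_nat_numeral del: power_Suc)
  have v1: "fps_nth G 1 = 1"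
    using v0 arg_cong[OF expand, of "\<lambda>f. fps_nth f 1"]
    by (simp add: c eval_nat_numeral del: power_Suc)
  have v2: "fps_nth G 2 = 5 / 2"
    using v0 v1 arg_cong[OF expand, of "\<lambda>f. fps_nth f 2"]
    by (simp add: c eval_nat_numeral del: power_Suc)
  show "fps_nth G 0 = 0" "fps_nth G 1 = 1" "fps_nth G 2 = 5 / 2"
    by (fact v0 v1 v2)+
qed

lemma ode2_expand:
  fixes G :: "rat fps"
  assumes "3 - 5*fps_X + fps_X^2 + fps_X^3 - 2*(3 - 17*fps_X + 5*fps_X^2 + fps_X^3) * G - 2*fps_X*(1 - 11*fps_X + 11*fps_X^2 - fps_X^3) * fps_deriv G = 0"
  shows "3 * (fps_X ^ 0) - 5 * (fps_X ^ 1) + fps_X ^ 2 + fps_X ^ 3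
    = 2 * (3 * (fps_X ^ 0 * G) - 17 * (fps_X ^ 1 * G) + 5 * (fps_X ^ 2 * G) + fps_X ^ 3 * G + (fps_X ^ 1 * fps_deriv G - 11 * (fps_X ^ 2 * fps_deriv G) + 11 * (fps_X ^ 3 * fps_deriv G) - fps_X ^ 4 * fps_deriv G))"
proof -
  have "(3 * (fps_X ^ 0) - 5 * (fps_X ^ 1) + fps_X ^ 2 + fps_X ^ 3) - (2 * (3 * (fps_X ^ 0 * G) - 17 * (fps_X ^ 1 * G) + 5 * (fps_X ^ 2 * G) + fps_X ^ 3 * G + (fps_X ^ 1 * fps_deriv G - 11 * (fps_X ^ 2 * fps_deriv G) + 11 * (fps_X ^ 3 * fps_deriv G) - fps_X ^ 4 * fps_deriv G)))
      = 3 - 5*fps_X + fps_X^2 + fps_X^3 - 2*(3 - 17*fps_X + 5*fps_X^2 + fps_X^3) * G - 2*fps_X*(1 - 11*fps_X + 11*fps_X^2 - fps_X^3) * fps_deriv G"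
    by Groebner_Basis.algebra
  thus ?thesis unfolding assms by simp
qed

text \<open>At \<open>m + 3\<close> all shifted indices are natural numbers for the first time. The
  inhomogeneous part has degree three, so it is still felt at \<open>m = 0\<close>.\<close>

lemma ode2_coeff:
  fixes G :: "rat fps"
  assumes "3 - 5*fps_X + fps_X^2 + fps_X^3 - 2*(3 - 17*fps_X + 5*fps_X^2 + fps_X^3) * G - 2*fps_X*(1 - 11*fps_X + 11*fps_X^2 - fps_X^3) * fps_deriv G = 0"
  shows "(3 + 1 * (of_nat m + 3)) * fps_nth G (m + 3) + (-17 + -11 * (of_nat m + 2)) * fps_nth G (m + 2) + (5 + 11 * (of_nat m + 1)) * fps_nth G (m + 1) + (1 + -1 * (of_nat m + 0)) * fps_nth G (m) = (if m = 0 then 1 / 2 else 0)"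
proof -
  note expand = arg_cong[OF ode2_expand[OF assms], of "\<lambda>f. fps_nth f (m + 3)"]
  have g0: "fps_nth (fps_X ^ 0 * G) (m + 3) = fps_nth G (m + 3)" by (rule fps_nth_X_power_mult) simp
  have g1: "fps_nth (fps_X ^ 1 * G) (m + 3) = fps_nth G (m + 2)" by (rule fps_nth_X_power_mult) simp
  have g2: "fps_nth (fps_X ^ 2 * G) (m + 3) = fps_nth G (m + 1)" by (rule fps_nth_X_power_mult) simp
  have g3: "fps_nth (fps_X ^ 3 * G) (m + 3) = fps_nth G (m)" by (rule fps_nth_X_power_mult) simp
  have d0: "fps_nth (fps_X ^ 1 * fps_deriv G) (m + 3) = of_nat (m + 3) * fps_nth G (m + 3)" by (rule fps_nth_X_power_deriv) simp_all
  have d1: "fps_nth (fps_X ^ 2 * fps_deriv G) (m + 3) = of_nat (m + 2) * fps_nth G (m + 2)" by (rule fps_nth_X_power_deriv) simp_all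
  have d2: "fps_nth (fps_X ^ 3 * fps_deriv G) (m + 3) = of_nat (m + 1) * fps_nth G (m + 1)" by (rule fps_nth_X_power_deriv) simp_all
  have d3: "fps_nth (fps_X ^ 4 * fps_deriv G) (m + 3) = of_nat (m) * fps_nth G (m)" by (rule fps_nth_X_power_deriv) simp_all
  show ?thesis
    using expand unfolding fps_nth_numeral_mult fps_nth_neg_numeral_mult fps_add_nth fps_sub_nth fps_neg_nth g0 g1 g2 g3 d0 d1 d2 d3
    by (simp add: fps_X_power_nth algebra_simps split: if_splits)
qed

lemma ode2_initial:
  fixes G :: "rat fps"
  assumes "3 - 5*fps_X + fps_X^2 + fps_X^3 - 2*(3 - 17*fps_X + 5*fps_X^2 + fps_X^3) * G - 2*fps_X*(1 - 11*fps_X + 11*fps_X^2 - fps_X^3) * fps_deriv G = 0"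
  shows "fps_nth G 0 = 1 / 2" "fps_nth G 1 = 3 / 2" "fps_nth G 2 = 8" "fps_nth G 3 = 48" "fps_nth G 4 = 312" "fps_nth G 5 = 2152"
proof -
  note c = fps_nth_numeral fps_nth_numeral_mult fps_nth_neg_numeral_mult fps_X_power_mult_nth fps_X_power_nth fps_deriv_nth
  note expand = ode2_expand[OF assms]
  have v0: "fps_nth G 0 = 1 / 2"
    using arg_cong[OF expand, of "\<lambda>f. fps_nth f 0"]
    by (simp add: c eval_nat_numeral del: power_Suc)
  have v1: "fps_nth G 1 = 3 / 2"
    using v0 arg_cong[OF expand, of "\<lambda>f. fps_nth f 1"]
    by (simp add: c eval_nat_numeral del: power_Suc)
  have v2: "fps_nth G 2 = 8"
    using v0 v1 arg_cong[OF expand, of "\<lambda>f. fps_nth f 2"]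
    by (simp add: c eval_nat_numeral del: power_Suc)
  have v3: "fps_nth G 3 = 48"
    using v0 v1 v2 ode2_coeff[OF assms, of 0] by (simp add: eval_nat_numeral)
  have v4: "fps_nth G 4 = 312"
    using v0 v1 v2 v3 ode2_coeff[OF assms, of 1] by (simp add: eval_nat_numeral)
  have v5: "fps_nth G 5 = 2152"
    using v0 v1 v2 v3 v4 ode2_coeff[OF assms, of 2] by (simp add: eval_nat_numeral)
  show "fps_nth G 0 = 1 / 2" "fps_nth G 1 = 3 / 2" "fps_nth G 2 = 8" "fps_nth G 3 = 48" "fps_nth G 4 = 312" "fps_nth G 5 = 2152"
    by (fact v0 v1 v2 v3 v4 v5)+
qed

lemma ode3_expand:
  fixes G :: "rat fps"
  assumes "- 8*fps_X - 35*fps_X^2 - 44*fps_X^3 - 16*fps_X^4 - 6*(- 1 + 15*fps_X^2 + 34*fps_X^3 + 28*fps_X^4 + 8*fps_X^5) * G - 2*(- fps_X + 5*fps_X^2 + 29*fps_X^3 + 47*fps_X^4 + 32*fps_X^5 + 8*fps_X^6) * fps_deriv G = 0"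
  shows "- 8 * (fps_X ^ 1) - 35 * (fps_X ^ 2) - 44 * (fps_X ^ 3) - 16 * (fps_X ^ 4)
    = 2 * (- 3 * (fps_X ^ 0 * G) + 45 * (fps_X ^ 2 * G) + 102 * (fps_X ^ 3 * G) + 84 * (fps_X ^ 4 * G) + 24 * (fps_X ^ 5 * G) + (- (fps_X ^ 1 * fps_deriv G) + 5 * (fps_X ^ 2 * fps_deriv G) + 29 * (fps_X ^ 3 * fps_deriv G) + 47 * (fps_X ^ 4 * fps_deriv G) + 32 * (fps_X ^ 5 * fps_deriv G) + 8 * (fps_X ^ 6 * fps_deriv G)))"
proof -
  have "(- 8 * (fps_X ^ 1) - 35 * (fps_X ^ 2) - 44 * (fps_X ^ 3) - 16 * (fps_X ^ 4)) - (2 * (- 3 * (fps_X ^ 0 * G) + 45 * (fps_X ^ 2 * G) + 102 * (fps_X ^ 3 * G) + 84 * (fps_X ^ 4 * G) + 24 * (fps_X ^ 5 * G) + (- (fps_X ^ 1 * fps_deriv G) + 5 * (fps_X ^ 2 * fps_deriv G) + 29 * (fps_X ^ 3 * fps_deriv G) + 47 * (fps_X ^ 4 * fps_deriv G) + 32 * (fps_X ^ 5 * fps_deriv G) + 8 * (fps_X ^ 6 * fps_deriv G))))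
      = - 8*fps_X - 35*fps_X^2 - 44*fps_X^3 - 16*fps_X^4 - 6*(- 1 + 15*fps_X^2 + 34*fps_X^3 + 28*fps_X^4 + 8*fps_X^5) * G - 2*(- fps_X + 5*fps_X^2 + 29*fps_X^3 + 47*fps_X^4 + 32*fps_X^5 + 8*fps_X^6) * fps_deriv G"
    by Groebner_Basis.algebra
  thus ?thesis unfolding assms by simp
qed

lemma ode3_coeff:
  fixes G :: "rat fps"
  assumes "- 8*fps_X - 35*fps_X^2 - 44*fps_X^3 - 16*fps_X^4 - 6*(- 1 + 15*fps_X^2 + 34*fps_X^3 + 28*fps_X^4 + 8*fps_X^5) * G - 2*(- fps_X + 5*fps_X^2 + 29*fps_X^3 + 47*fps_X^4 + 32*fps_X^5 + 8*fps_X^6) * fps_deriv G = 0"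
  shows "(-3 + -1 * (of_nat m + 5)) * fps_nth G (m + 5) + (0 + 5 * (of_nat m + 4)) * fps_nth G (m + 4) + (45 + 29 * (of_nat m + 3)) * fps_nth G (m + 3) + (102 + 47 * (of_nat m + 2)) * fps_nth G (m + 2) + (84 + 32 * (of_nat m + 1)) * fps_nth G (m + 1) + (24 + 8 * (of_nat m + 0)) * fps_nth G (m) = 0"
proof -
  note expand = arg_cong[OF ode3_expand[OF assms], of "\<lambda>f. fps_nth f (m + 5)"]
  have g0: "fps_nth (fps_X ^ 0 * G) (m + 5) = fps_nth G (m + 5)" by (rule fps_nth_X_power_mult) simp
  have g2: "fps_nth (fps_X ^ 2 * G) (m + 5) = fps_nth G (m + 3)" by (rule fps_nth_X_power_mult) simp
  have g3: "fps_nth (fps_X ^ 3 * G) (m + 5) = fps_nth G (m + 2)" by (rule fps_nth_X_power_mult) simp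
  have g4: "fps_nth (fps_X ^ 4 * G) (m + 5) = fps_nth G (m + 1)" by (rule fps_nth_X_power_mult) simp
  have g5: "fps_nth (fps_X ^ 5 * G) (m + 5) = fps_nth G (m)" by (rule fps_nth_X_power_mult) simp
  have d0: "fps_nth (fps_X ^ 1 * fps_deriv G) (m + 5) = of_nat (m + 5) * fps_nth G (m + 5)" by (rule fps_nth_X_power_deriv) simp_all
  have d1: "fps_nth (fps_X ^ 2 * fps_deriv G) (m + 5) = of_nat (m + 4) * fps_nth G (m + 4)" by (rule fps_nth_X_power_deriv) simp_all
  have d2: "fps_nth (fps_X ^ 3 * fps_deriv G) (m + 5) = of_nat (m + 3) * fps_nth G (m + 3)" by (rule fps_nth_X_power_deriv) simp_all
  have d3: "fps_nth (fps_X ^ 4 * fps_deriv G) (m + 5) = of_nat (m + 2) * fps_nth G (m + 2)" by (rule fps_nth_X_power_deriv) simp_all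
  have d4: "fps_nth (fps_X ^ 5 * fps_deriv G) (m + 5) = of_nat (m + 1) * fps_nth G (m + 1)" by (rule fps_nth_X_power_deriv) simp_all
  have d5: "fps_nth (fps_X ^ 6 * fps_deriv G) (m + 5) = of_nat (m) * fps_nth G (m)" by (rule fps_nth_X_power_deriv) simp_all
  show ?thesis
    using expand unfolding fps_nth_numeral_mult fps_nth_neg_numeral_mult fps_add_nth fps_sub_nth fps_neg_nth g0 g2 g3 g4 g5 d0 d1 d2 d3 d4 d5
    by (simp add: fps_X_power_nth algebra_simps split: if_splits)
qed

lemma ode3_initial:
  fixes G :: "rat fps"
  assumes "- 8*fps_X - 35*fps_X^2 - 44*fps_X^3 - 16*fps_X^4 - 6*(- 1 + 15*fps_X^2 + 34*fps_X^3 + 28*fps_X^4 + 8*fps_X^5) * G - 2*(- fps_X + 5*fps_X^2 + 29*fps_X^3 + 47*fps_X^4 + 32*fps_X^5 + 8*fps_X^6) * fps_deriv G = 0"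
  shows "fps_nth G 0 = 0" "fps_nth G 1 = 1" "fps_nth G 2 = 9 / 2" "fps_nth G 3 = 47 / 2" "fps_nth G 4 = 139" "fps_nth G 5 = 860" "fps_nth G 6 = 11175 / 2"
proof -
  note c = fps_nth_numeral fps_nth_numeral_mult fps_nth_neg_numeral_mult fps_X_power_mult_nth fps_X_power_nth fps_deriv_nth
  note expand = ode3_expand[OF assms]
  have v0: "fps_nth G 0 = 0"
    using arg_cong[OF expand, of "\<lambda>f. fps_nth f 0"]
    by (simp add: c eval_nat_numeral del: power_Suc)
  have v1: "fps_nth G 1 = 1"
    using v0 arg_cong[OF expand, of "\<lambda>f. fps_nth f 1"]
    by (simp add: c eval_nat_numeral del: power_Suc)
  have v2: "fps_nth G 2 = 9 / 2"
    using v0 v1 arg_cong[OF expand, of "\<lambda>f. fps_nth f 2"]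
    by (simp add: c eval_nat_numeral del: power_Suc)
  have v3: "fps_nth G 3 = 47 / 2"
    using v0 v1 v2 arg_cong[OF expand, of "\<lambda>f. fps_nth f 3"]
    by (simp add: c eval_nat_numeral del: power_Suc)
  have v4: "fps_nth G 4 = 139"
    using v0 v1 v2 v3 arg_cong[OF expand, of "\<lambda>f. fps_nth f 4"]
    by (simp add: c eval_nat_numeral del: power_Suc)
  have v5: "fps_nth G 5 = 860"
    using v0 v1 v2 v3 v4 ode3_coeff[OF assms, of 0] by (simp add: eval_nat_numeral)
  have v6: "fps_nth G 6 = 11175 / 2"
    using v0 v1 v2 v3 v4 v5 ode3_coeff[OF assms, of 1] by (simp add: eval_nat_numeral)
  show "fps_nth G 0 = 0" "fps_nth G 1 = 1" "fps_nth G 2 = 9 / 2" "fps_nth G 3 = 47 / 2" "fps_nth G 4 = 139" "fps_nth G 5 = 860" "fps_nth G 6 = 11175 / 2"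
    by (fact v0 v1 v2 v3 v4 v5 v6)+
qed

text \<open>The differential equation has an inhomogeneous term q. Applying the operator q d/dt -
  q', which annihilates q, makes it homogeneous of third order in F; its coefficient recursion is
  the one claimed. For \<open>q = t * (8 + 7*t)\<close> this combines two consecutive coefficient
  relations with multipliers proportional to \<open>8 * (n + 2)\<close> and \<open>7 * n\<close>.
  The multipliers of the other two recursions arise in the same way.\<close>

lemma ode1_recurrence:
  fixes F :: "rat fps" and k :: nat
  defines "f \<equiv> fps_nth F" and "n \<equiv> of_nat k :: rat" and "G \<equiv> fps_deriv F"
  assumes "fps_X*(8 + 7*fps_X) - 2*(3 - 4*fps_X - 21*fps_X^2 - 14*fps_X^3) * G - 2*fps_X*(1 - 5*fps_X - 13*fps_X^2 - 7*fps_X^3) * fps_deriv G = 0"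
  shows "49*n^2*(1 + n) * f k
        + 7*(1 + n)^2*(32 + 21*n) * f (k+1)
        + (2 + n)*(544 + 543*n + 139*n^2) * f (k+2)
        + (3 + n)*(224 + 157*n + 33*n^2) * f (k+3)
        - 8*(2 + n)*(4 + n)*(6 + n) * f (k+4) = 0"
proof -
  have G: "fps_nth G i = (of_nat i + 1) * f (i + 1)" for i by (simp add: G_def f_def)
  note R = ode1_coeff[OF assms(4)]
  show ?thesis
  proof (cases k)
    case 0
    \<comment> \<open>The multiplier of the lower relation vanishes at \<open>n = 0\<close>, so one
      relation is enough.\<close>
    show ?thesis using R[of 0] by (simp add: 0 n_def G eval_nat_numeral)
  next
    case (Suc m)
    have n: "n = of_nat m + 1" by (simp add: n_def Suc)
    have r0: "(3 + 1 * (of_nat (m + 1) + 3)) * ((of_nat (m + 4) + 1) * f (m + 5)) + (-4 + -5 * (of_nat (m + 1) + 2)) * ((of_nat (m + 3) + 1) * f (m + 4)) + (-21 + -13 * (of_nat (m + 1) + 1)) * ((of_nat (m + 2) + 1) * f (m + 3)) + (-14 + -7 * (of_nat (m + 1) + 0)) * ((of_nat (m + 1) + 1) * f (m + 2)) = 0"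
      using R[of "m + 1"] unfolding G by (simp add: eval_nat_numeral algebra_simps)
    have r1: "(3 + 1 * (of_nat (m + 0) + 3)) * ((of_nat (m + 3) + 1) * f (m + 4)) + (-4 + -5 * (of_nat (m + 0) + 2)) * ((of_nat (m + 2) + 1) * f (m + 3)) + (-21 + -13 * (of_nat (m + 0) + 1)) * ((of_nat (m + 1) + 1) * f (m + 2)) + (-14 + -7 * (of_nat (m + 0) + 0)) * ((of_nat (m + 0) + 1) * f (m + 1)) = 0"
      using R[of "m + 0"] unfolding G by (simp add: eval_nat_numeral algebra_simps)
    have "49*(of_nat m + 1)^2*(1 + (of_nat m + 1)) * f (m + 1)
        + 7*(1 + (of_nat m + 1))^2*(32 + 21*(of_nat m + 1)) * f (m + 2)
        + (2 + (of_nat m + 1))*(544 + 543*(of_nat m + 1) + 139*(of_nat m + 1)^2) * f (m + 3)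
        + (3 + (of_nat m + 1))*(224 + 157*(of_nat m + 1) + 33*(of_nat m + 1)^2) * f (m + 4)
        - 8*(2 + (of_nat m + 1))*(4 + (of_nat m + 1))*(6 + (of_nat m + 1)) * f (m + 5)
      = (- 8 * ((of_nat m + 1) + 2)) * ((3 + 1 * (of_nat (m + 1) + 3)) * ((of_nat (m + 4) + 1) * f (m + 5)) + (-4 + -5 * (of_nat (m + 1) + 2)) * ((of_nat (m + 3) + 1) * f (m + 4)) + (-21 + -13 * (of_nat (m + 1) + 1)) * ((of_nat (m + 2) + 1) * f (m + 3)) + (-14 + -7 * (of_nat (m + 1) + 0)) * ((of_nat (m + 1) + 1) * f (m + 2))) + (- 7 * (of_nat m + 1)) * ((3 + 1 * (of_nat (m + 0) + 3)) * ((of_nat (m + 3) + 1) * f (m + 4)) + (-4 + -5 * (of_nat (m + 0) + 2)) * ((of_nat (m + 2) + 1) * f (m + 3)) + (-21 + -13 * (of_nat (m + 0) + 1)) * ((of_nat (m + 1) + 1) * f (m + 2)) + (-14 + -7 * (of_nat (m + 0) + 0)) * ((of_nat (m + 0) + 1) * f (m + 1)))"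
      by (simp only: of_nat_add of_nat_numeral of_nat_1 of_nat_0, Groebner_Basis.algebra)
    also have "\<dots> = 0" unfolding r0 r1 by simp
    finally show ?thesis unfolding n Suc by (simp add: eval_nat_numeral algebra_simps)
  qed
qed

lemma ode2_recurrence:
  fixes F :: "rat fps" and k :: nat
  defines "f \<equiv> fps_nth F" and "n \<equiv> of_nat k :: rat" and "G \<equiv> fps_deriv F"
  assumes "3 - 5*fps_X + fps_X^2 + fps_X^3 - 2*(3 - 17*fps_X + 5*fps_X^2 + fps_X^3) * G - 2*fps_X*(1 - 11*fps_X + 11*fps_X^2 - fps_X^3) * fps_deriv G = 0"
  shows "(n - 2)*(n - 1)*n * f k
        - 2*(n - 1)*(n + 1)*(2 + 5*n) * f (k+1)
        - (2 + n)*(44 + 25*n + 5*n^2) * f (k+2)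
        + 4*(3 + n)*(116 + 91*n + 17*n^2) * f (k+3)
        - (4 + n)*(1326 + 701*n + 89*n^2) * f (k+4)
        + 2*(5 + n)*(6 + n)*(85 + 19*n) * f (k+5)
        - 3*(5 + n)*(6 + n)*(8 + n) * f (k+6) = 0"
proof -
  have G: "fps_nth G i = (of_nat i + 1) * f (i + 1)" for i by (simp add: G_def f_def)
  note R = ode2_coeff[OF assms(4)]
  show ?thesis
  proof (cases k)
    case 0
    \<comment> \<open>At \<open>k = 0\<close> the lowest of the four relations would have a negative
      index, so the initial values are inserted instead.\<close>
    have "f 1 = 1 / 2" "2 * f 2 = 3 / 2" "3 * f 3 = 8" "4 * f 4 = 48" "5 * f 5 = 312" "6 * f 6 = 2152"
      using ode2_initial[OF assms(4)] unfolding G by (simp_all add: eval_nat_numeral)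
    thus ?thesis by (simp add: 0 n_def eval_nat_numeral)
  next
    case (Suc m)
    have n: "n = of_nat m + 1" by (simp add: n_def Suc)
    have r0: "(3 + 1 * (of_nat (m + 3) + 3)) * ((of_nat (m + 6) + 1) * f (m + 7)) + (-17 + -11 * (of_nat (m + 3) + 2)) * ((of_nat (m + 5) + 1) * f (m + 6)) + (5 + 11 * (of_nat (m + 3) + 1)) * ((of_nat (m + 4) + 1) * f (m + 5)) + (1 + -1 * (of_nat (m + 3) + 0)) * ((of_nat (m + 3) + 1) * f (m + 4)) = 0"
      using R[of "m + 3"] unfolding G by (simp add: eval_nat_numeral algebra_simps)
    have r1: "(3 + 1 * (of_nat (m + 2) + 3)) * ((of_nat (m + 5) + 1) * f (m + 6)) + (-17 + -11 * (of_nat (m + 2) + 2)) * ((of_nat (m + 4) + 1) * f (m + 5)) + (5 + 11 * (of_nat (m + 2) + 1)) * ((of_nat (m + 3) + 1) * f (m + 4)) + (1 + -1 * (of_nat (m + 2) + 0)) * ((of_nat (m + 2) + 1) * f (m + 3)) = 0"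
      using R[of "m + 2"] unfolding G by (simp add: eval_nat_numeral algebra_simps)
    have r2: "(3 + 1 * (of_nat (m + 1) + 3)) * ((of_nat (m + 4) + 1) * f (m + 5)) + (-17 + -11 * (of_nat (m + 1) + 2)) * ((of_nat (m + 3) + 1) * f (m + 4)) + (5 + 11 * (of_nat (m + 1) + 1)) * ((of_nat (m + 2) + 1) * f (m + 3)) + (1 + -1 * (of_nat (m + 1) + 0)) * ((of_nat (m + 1) + 1) * f (m + 2)) = 0"
      using R[of "m + 1"] unfolding G by (simp add: eval_nat_numeral algebra_simps)
    \<comment> \<open>The exceptional value at \<open>m = 0\<close> will be multiplied by
      \<open>n - 1\<close>, which is then zero.\<close>
    have r3: "(3 + 1 * (of_nat (m + 0) + 3)) * ((of_nat (m + 3) + 1) * f (m + 4)) + (-17 + -11 * (of_nat (m + 0) + 2)) * ((of_nat (m + 2) + 1) * f (m + 3)) + (5 + 11 * (of_nat (m + 0) + 1)) * ((of_nat (m + 1) + 1) * f (m + 2)) + (1 + -1 * (of_nat (m + 0) + 0)) * ((of_nat (m + 0) + 1) * f (m + 1)) = (if m = 0 then 1 / 2 else 0)"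
      using R[of "m + 0"] unfolding G by (simp add: eval_nat_numeral algebra_simps)
    have "((of_nat m + 1) - 2)*((of_nat m + 1) - 1)*(of_nat m + 1) * f (m + 1)
        - 2*((of_nat m + 1) - 1)*((of_nat m + 1) + 1)*(2 + 5*(of_nat m + 1)) * f (m + 2)
        - (2 + (of_nat m + 1))*(44 + 25*(of_nat m + 1) + 5*(of_nat m + 1)^2) * f (m + 3)
        + 4*(3 + (of_nat m + 1))*(116 + 91*(of_nat m + 1) + 17*(of_nat m + 1)^2) * f (m + 4)
        - (4 + (of_nat m + 1))*(1326 + 701*(of_nat m + 1) + 89*(of_nat m + 1)^2) * f (m + 5)
        + 2*(5 + (of_nat m + 1))*(6 + (of_nat m + 1))*(85 + 19*(of_nat m + 1)) * f (m + 6)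
        - 3*(5 + (of_nat m + 1))*(6 + (of_nat m + 1))*(8 + (of_nat m + 1)) * f (m + 7)
      = (- 3 * ((of_nat m + 1) + 5)) * ((3 + 1 * (of_nat (m + 3) + 3)) * ((of_nat (m + 6) + 1) * f (m + 7)) + (-17 + -11 * (of_nat (m + 3) + 2)) * ((of_nat (m + 5) + 1) * f (m + 6)) + (5 + 11 * (of_nat (m + 3) + 1)) * ((of_nat (m + 4) + 1) * f (m + 5)) + (1 + -1 * (of_nat (m + 3) + 0)) * ((of_nat (m + 3) + 1) * f (m + 4))) + (5 * ((of_nat m + 1) + 3)) * ((3 + 1 * (of_nat (m + 2) + 3)) * ((of_nat (m + 5) + 1) * f (m + 6)) + (-17 + -11 * (of_nat (m + 2) + 2)) * ((of_nat (m + 4) + 1) * f (m + 5)) + (5 + 11 * (of_nat (m + 2) + 1)) * ((of_nat (m + 3) + 1) * f (m + 4)) + (1 + -1 * (of_nat (m + 2) + 0)) * ((of_nat (m + 2) + 1) * f (m + 3))) + (- ((of_nat m + 1) + 1)) * ((3 + 1 * (of_nat (m + 1) + 3)) * ((of_nat (m + 4) + 1) * f (m + 5)) + (-17 + -11 * (of_nat (m + 1) + 2)) * ((of_nat (m + 3) + 1) * f (m + 4)) + (5 + 11 * (of_nat (m + 1) + 1)) * ((of_nat (m + 2) + 1) * f (m + 3)) + (1 + -1 * (of_nat (m + 1) + 0)) * ((of_nat (m + 1) + 1) * f (m + 2))) + (- ((of_nat m + 1) - 1)) * ((3 + 1 * (of_nat (m + 0) + 3)) * ((of_nat (m + 3)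 + 1) * f (m + 4)) + (-17 + -11 * (of_nat (m + 0) + 2)) * ((of_nat (m + 2) + 1) * f (m + 3)) + (5 + 11 * (of_nat (m + 0) + 1)) * ((of_nat (m + 1) + 1) * f (m + 2)) + (1 + -1 * (of_nat (m + 0) + 0)) * ((of_nat (m + 0) + 1) * f (m + 1)))"
      by (simp only: of_nat_add of_nat_numeral of_nat_1 of_nat_0, Groebner_Basis.algebra)
    also have "\<dots> = 0" unfolding r0 r1 r2 r3 by simp
    finally show ?thesis unfolding n Suc by (simp add: eval_nat_numeral algebra_simps)
  qed
qed

lemma ode3_recurrence:
  fixes F :: "rat fps" and k :: nat
  defines "f \<equiv> fps_nth F" and "n \<equiv> of_nat k :: rat" and "G \<equiv> fps_deriv F"
  assumes "- 8*fps_X - 35*fps_X^2 - 44*fps_X^3 - 16*fps_X^4 - 6*(- 1 + 15*fps_X^2 + 34*fps_X^3 + 28*fps_X^4 + 8*fps_X^5) * G - 2*(- fps_X + 5*fps_X^2 + 29*fps_X^3 + 47*fps_X^4 + 32*fps_X^5 + 8*fps_X^6) * fps_deriv G = 0"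
  shows "128*n^2*(2 + n) * f k
        + 32*(1 + n)*(66 + 97*n + 27*n^2) * f (k+1)
        + 8*(2 + n)*(1836 + 1568*n + 305*n^2) * f (k+2)
        + 4*(3 + n)*(9972 + 6193*n + 929*n^2) * f (k+3)
        + (4 + n)*(54276 + 26661*n + 3257*n^2) * f (k+4)
        + (5 + n)*(38220 + 15479*n + 1595*n^2) * f (k+5)
        + 3*(6 + n)*(3972 + 1349*n + 121*n^2) * f (k+6)
        + 5*(7 + n)*(36 + 5*n + n^2) * f (k+7)
        - 8*(6 + n)*(8 + n)*(10 + n) * f (k+8) = 0"
proof -
  have G: "fps_nth G i = (of_nat i + 1) * f (i + 1)" for i by (simp add: G_def f_def)
  note R = ode3_coeff[OF assms(4)]
  show ?thesis
  proof (cases k)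
    case 0
    show ?thesis using R[of 2] R[of 1] R[of 0] by (simp add: 0 n_def G eval_nat_numeral)
  next
    case (Suc m)
    have n: "n = of_nat m + 1" by (simp add: n_def Suc)
    have r0: "(-3 + -1 * (of_nat (m + 3) + 5)) * ((of_nat (m + 8) + 1) * f (m + 9)) + (0 + 5 * (of_nat (m + 3) + 4)) * ((of_nat (m + 7) + 1) * f (m + 8)) + (45 + 29 * (of_nat (m + 3) + 3)) * ((of_nat (m + 6) + 1) * f (m + 7)) + (102 + 47 * (of_nat (m + 3) + 2)) * ((of_nat (m + 5) + 1) * f (m + 6)) + (84 + 32 * (of_nat (m + 3) + 1)) * ((of_nat (m + 4) + 1) * f (m + 5)) + (24 + 8 * (of_nat (m + 3) + 0)) * ((of_nat (m + 3) + 1) * f (m + 4)) = 0"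
      using R[of "m + 3"] unfolding G by (simp add: eval_nat_numeral algebra_simps)
    have r1: "(-3 + -1 * (of_nat (m + 2) + 5)) * ((of_nat (m + 7) + 1) * f (m + 8)) + (0 + 5 * (of_nat (m + 2) + 4)) * ((of_nat (m + 6) + 1) * f (m + 7)) + (45 + 29 * (of_nat (m + 2) + 3)) * ((of_nat (m + 5) + 1) * f (m + 6)) + (102 + 47 * (of_nat (m + 2) + 2)) * ((of_nat (m + 4) + 1) * f (m + 5)) + (84 + 32 * (of_nat (m + 2) + 1)) * ((of_nat (m + 3) + 1) * f (m + 4)) + (24 + 8 * (of_nat (m + 2) + 0)) * ((of_nat (m + 2) + 1) * f (m + 3)) = 0"
      using R[of "m + 2"] unfolding G by (simp add: eval_nat_numeral algebra_simps)
    have r2: "(-3 + -1 * (of_nat (m + 1) + 5)) * ((of_nat (m + 6) + 1) * f (m + 7)) + (0 + 5 * (of_nat (m + 1) + 4)) * ((of_nat (m + 5) + 1) * f (m + 6)) + (45 + 29 * (of_nat (m + 1) + 3)) * ((of_nat (m + 4) + 1) * f (m + 5)) + (102 + 47 * (of_nat (m + 1) + 2)) * ((of_nat (m + 3) + 1) * f (m + 4)) + (84 + 32 * (of_nat (m + 1) + 1)) * ((of_nat (m + 2) + 1) * f (m + 3)) + (24 + 8 * (of_nat (m + 1) + 0)) * ((of_nat (m + 1) + 1) * f (m + 2)) = 0"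
      using R[of "m + 1"] unfolding G by (simp add: eval_nat_numeral algebra_simps)
    have r3: "(-3 + -1 * (of_nat (m + 0) + 5)) * ((of_nat (m + 5) + 1) * f (m + 6)) + (0 + 5 * (of_nat (m + 0) + 4)) * ((of_nat (m + 4) + 1) * f (m + 5)) + (45 + 29 * (of_nat (m + 0) + 3)) * ((of_nat (m + 3) + 1) * f (m + 4)) + (102 + 47 * (of_nat (m + 0) + 2)) * ((of_nat (m + 2) + 1) * f (m + 3)) + (84 + 32 * (of_nat (m + 0) + 1)) * ((of_nat (m + 1) + 1) * f (m + 2)) + (24 + 8 * (of_nat (m + 0) + 0)) * ((of_nat (m + 0) + 1) * f (m + 1)) = 0"
      using R[of "m + 0"] unfolding G by (simp add: eval_nat_numeral algebra_simps)
    have "128*(of_nat m + 1)^2*(2 + (of_nat m + 1)) * f (m + 1)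
        + 32*(1 + (of_nat m + 1))*(66 + 97*(of_nat m + 1) + 27*(of_nat m + 1)^2) * f (m + 2)
        + 8*(2 + (of_nat m + 1))*(1836 + 1568*(of_nat m + 1) + 305*(of_nat m + 1)^2) * f (m + 3)
        + 4*(3 + (of_nat m + 1))*(9972 + 6193*(of_nat m + 1) + 929*(of_nat m + 1)^2) * f (m + 4)
        + (4 + (of_nat m + 1))*(54276 + 26661*(of_nat m + 1) + 3257*(of_nat m + 1)^2) * f (m + 5)
        + (5 + (of_nat m + 1))*(38220 + 15479*(of_nat m + 1) + 1595*(of_nat m + 1)^2) * f (m + 6)
        + 3*(6 + (of_nat m + 1))*(3972 + 1349*(of_nat m + 1) + 121*(of_nat m + 1)^2) * f (m + 7)
        + 5*(7 + (of_nat m + 1))*(36 + 5*(of_nat m + 1) + (of_nat m + 1)^2) * f (m + 8)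
        - 8*(6 + (of_nat m + 1))*(8 + (of_nat m + 1))*(10 + (of_nat m + 1)) * f (m + 9)
      = (8 * ((of_nat m + 1) + 6)) * ((-3 + -1 * (of_nat (m + 3) + 5)) * ((of_nat (m + 8) + 1) * f (m + 9)) + (0 + 5 * (of_nat (m + 3) + 4)) * ((of_nat (m + 7) + 1) * f (m + 8)) + (45 + 29 * (of_nat (m + 3) + 3)) * ((of_nat (m + 6) + 1) * f (m + 7)) + (102 + 47 * (of_nat (m + 3) + 2)) * ((of_nat (m + 5) + 1) * f (m + 6)) + (84 + 32 * (of_nat (m + 3) + 1)) * ((of_nat (m + 4) + 1) * f (m + 5)) + (24 + 8 * (of_nat (m + 3) + 0)) * ((of_nat (m + 3) + 1) * f (m + 4))) + (35 * ((of_nat m + 1) + 4)) * ((-3 + -1 * (of_nat (m + 2) + 5)) * ((of_nat (m + 7) + 1) * f (m + 8)) + (0 + 5 * (of_nat (m + 2) + 4)) * ((of_nat (m + 6) + 1) * f (m + 7)) + (45 + 29 * (of_nat (m + 2) + 3)) * ((of_nat (m + 5) + 1) * f (m + 6)) + (102 + 47 * (of_nat (m + 2) + 2)) * ((of_nat (m + 4) + 1) * f (m + 5)) + (84 + 32 * (of_nat (m + 2) + 1)) * ((of_nat (m + 3) + 1) * f (m + 4)) + (24 + 8 * (of_nat (m + 2) + 0)) * ((of_nat (m + 2) + 1) * f (m + 3))) + (44 * ((of_nat m + 1) + 2)) * ((-3 + -1 * (of_nat (m + 1) + 5)) * ((of_nat (m + 6) + 1) * f (m + 7)) + (0 + 5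 * (of_nat (m + 1) + 4)) * ((of_nat (m + 5) + 1) * f (m + 6)) + (45 + 29 * (of_nat (m + 1) + 3)) * ((of_nat (m + 4) + 1) * f (m + 5)) + (102 + 47 * (of_nat (m + 1) + 2)) * ((of_nat (m + 3) + 1) * f (m + 4)) + (84 + 32 * (of_nat (m + 1) + 1)) * ((of_nat (m + 2) + 1) * f (m + 3)) + (24 + 8 * (of_nat (m + 1) + 0)) * ((of_nat (m + 1) + 1) * f (m + 2))) + (16 * (of_nat m + 1)) * ((-3 + -1 * (of_nat (m + 0) + 5)) * ((of_nat (m + 5) + 1) * f (m + 6)) + (0 + 5 * (of_nat (m + 0) + 4)) * ((of_nat (m + 4) + 1) * f (m + 5)) + (45 + 29 * (of_nat (m + 0) + 3)) * ((of_nat (m + 3) + 1) * f (m + 4)) + (102 + 47 * (of_nat (m + 0) + 2)) * ((of_nat (m + 2) + 1) * f (m + 3)) + (84 + 32 * (of_nat (m + 0) + 1)) * ((of_nat (m + 1) + 1) * f (m + 2)) + (24 + 8 * (of_nat (m + 0) + 0)) * ((of_nat (m + 0) + 1) * f (m + 1)))"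
      by (simp only: of_nat_add of_nat_numeral of_nat_1 of_nat_0, Groebner_Basis.algebra)
    also have "\<dots> = 0" unfolding r0 r1 r2 r3 by simp
    finally show ?thesis unfolding n Suc by (simp add: eval_nat_numeral algebra_simps)
  qed
qed

section \<open>Potentials in closed form\<close>

lemma fps_ln_1_nth: "fps_nth (fps_ln 1) n = (if n = 0 then 0 else (- 1) ^ (n - 1) / of_nat n :: 'a::field_char_0)"
  by (simp add: fps_ln_def)

lemma fps_compose_neg_linear_nth:
  fixes c :: "'a::field_char_0"
  shows "fps_nth (fps_compose f (- (fps_const c * fps_X))) n = (- c) ^ n * fps_nth f n"
proof -
  have "- (fps_const c * fps_X) = fps_const (- c) * fps_X" by simp
  thus ?thesis by (simp only: fps_compose_linear) simp
qed

lemma fps_compose_neg_square_nth: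
  fixes c :: "'a::field_char_0"
  shows "fps_nth (fps_compose f (- (fps_const c * fps_X ^ 2))) n
    = (if even n then (- c) ^ (n div 2) * fps_nth f (n div 2) else 0)"
proof -
  have "fps_nth (fps_compose f (- (fps_const c * fps_X ^ 2))) n
      = (\<Sum>i=0..n. fps_nth f i * fps_nth (fps_const ((- c) ^ i) * fps_X ^ (2 * i)) n)"
  proof -
    have "(- (fps_const c * fps_X ^ 2)) ^ i = (fps_const ((- c) ^ i) * fps_X ^ (2 * i) :: 'a fps)" for i
    proof -
      have "- (fps_const c * fps_X ^ 2) = (fps_const (- c) * fps_X ^ 2 :: 'a fps)" by simp
      thus ?thesis by (simp only: power_mult_distrib fps_const_power power_mult)
    qed
    thus ?thesis by (simp only: fps_compose_nth)
  qed
  also have "\<dots> = (\<Sum>i\<in>{0..n}. if i = n div 2 then (if even n then (- c) ^ i * fps_nth f i else 0) else 0)"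
    by (intro sum.cong) (auto simp: fps_X_power_nth)
  finally show ?thesis by (simp add: sum.delta)
qed

lemma fps_ln_term:
  assumes "n \<ge> 1"
  shows "(- c) ^ n * ((- 1) ^ (n - 1) / of_nat n) = - (c ^ n / of_nat n :: 'a::field_char_0)"
proof -
  obtain k where n: "n = Suc k" using assms by (cases n) auto
  have "(- c) ^ n * (- 1) ^ k = - (c ^ n * ((- 1) ^ k * (- 1) ^ k))"
    by (simp add: n power_minus[of c])
  also have "(- 1) ^ k * (- 1) ^ k = (1 :: 'a)" by (simp flip: power_add)
  finally show ?thesis by (simp add: n del: of_nat_Suc power_Suc)
qed

lemma formal_potential_nth:
  "fps_nth (formal_potential a) n = (if n = 2 then 1 / 2 else 0) - (if n = 0 then 0 else fps_to_fls (a n) / of_nat n)"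
  by (simp add: formal_potential_def fps_X_power_nth)

text \<open>The logarithm contributes all positive even powers of x; its quadratic term is cancelled
  by the extra t x^2 / 2 in front, so the interaction starts at the fourth power.\<close>

lemma formal_potential1: "formal_potential coeffs1 = potential1"
proof (rule fps_ext)
  fix n
  show "fps_nth (formal_potential coeffs1) n = fps_nth potential1 n"
  proof (cases "even n \<and> n \<noteq> 0")
    case False
    thus ?thesis by (auto simp: formal_potential_nth potential1_def Let_def coeffs1_def
        fps_compose_neg_square_nth fps_ln_1_nth fps_X_power_nth)
  next
    case True
    then obtain k where n: "n = 2 * k" and k: "k \<ge> 1" by (auto elim!: evenE)
    have "fps_nth potential1 n = (if n = 2 then (1 + fls_X ^ 2) / 2 else 0) - 1 / 2 * ((fls_X ^ 2) ^ k / of_nat k)"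
      using k fps_ln_term[OF k, of "fls_X ^ 2 :: rat fls"]
      by (simp add: potential1_def Let_def n fps_compose_neg_square_nth fps_ln_1_nth fps_X_power_nth)
    also have "\<dots> = fps_nth (formal_potential coeffs1) n"
      using k by (auto simp: formal_potential_nth coeffs1_def n fps_to_fls_power power_mult add_divide_distrib)
    finally show ?thesis ..
  qed
qed

lemma formal_potential2: "formal_potential coeffs2 = potential2"
proof (rule fps_ext)
  fix n
  show "fps_nth (formal_potential coeffs2) n = fps_nth potential2 n"
  proof (cases "n = 0")
    case True
    thus ?thesis by (simp add: formal_potential_nth potential2_def Let_def
        fps_compose_neg_linear_nth fps_ln_1_nth fps_X_power_nth)
  next
    case False
    hence "fps_nth potential2 n = (if n = 2 then 1 / 2 else 0) + (if n = 1 then fls_X else 0) - fls_X ^ n / of_nat n"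
      using fps_ln_term[of n "fls_X :: rat fls"]
      by (simp add: potential2_def Let_def fps_compose_neg_linear_nth fps_ln_1_nth fps_X_power_nth)
    also have "\<dots> = fps_nth (formal_potential coeffs2) n"
      using False by (auto simp: formal_potential_nth coeffs2_def fps_to_fls_power)
    finally show ?thesis ..
  qed
qed

lemma formal_potential3: "formal_potential coeffs3 = potential3"
proof (rule fps_ext)
  fix n
  show "fps_nth (formal_potential coeffs3) n = fps_nth potential3 n"
  proof (cases "n = 0")
    case True
    thus ?thesis by (simp add: formal_potential_nth potential3_def Let_def
        fps_compose_neg_linear_nth fps_ln_1_nth fps_X_power_nth)
  next
    case False
    hence "fps_nth potential3 n = (if n = 2 then (1 + fls_X ^ 2) / 2 else 0) + (if n = 1 then fls_X else 0) - fls_X ^ n / of_nat n"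
      using fps_ln_term[of n "fls_X :: rat fls"]
      by (simp add: potential3_def Let_def fps_compose_neg_linear_nth fps_ln_1_nth fps_X_power_nth)
    also have "\<dots> = fps_nth (formal_potential coeffs3) n"
      using False by (auto simp: formal_potential_nth coeffs3_def fps_to_fls_power add_divide_distrib)
    finally show ?thesis ..
  qed
qed

section \<open>Coefficient asymptotics\<close>

text \<open>Convergence in a disc of radius larger than one, equivalently exponential decay of the
  coefficients (\<open>edec_bound\<close>, \<open>edecI\<close>). After rescaling, the cofactor of
  the singular power is of this kind, and so are additive terms that are negligible against every
  power of n.\<close>

definition edec :: "real fps \<Rightarrow> bool" where
  "edec h \<longleftrightarrow> fps_conv_radius h > 1"

lemma edec_bound:
  assumes "edec h"
  obtains C q where "0 < q" "q < 1" "\<And>n. \<bar>fps_nth h n\<bar> \<le> C * q ^ n"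
proof -
  obtain r where r: "1 < ereal r" "ereal r < fps_conv_radius h"
    using assms ereal_dense2[of 1 "fps_conv_radius h"] by (auto simp: edec_def)
  hence r1: "r > 1" by simp
  have sm: "summable (\<lambda>n. norm (fps_nth h n * r ^ n))"
    by (rule norm_summable_fps) (use r r1 in auto)
  show thesis
  proof (rule that[of "1 / r" "\<Sum>n. norm (fps_nth h n * r ^ n)"])
    fix n
    have "norm (fps_nth h n * r ^ n) \<le> (\<Sum>n. norm (fps_nth h n * r ^ n))"
      using sum_le_suminf[OF sm, of "{n}"] by simp
    thus "\<bar>fps_nth h n\<bar> \<le> (\<Sum>n. norm (fps_nth h n * r ^ n)) * (1 / r) ^ n"
      using r1 by (simp add: abs_mult field_simps)
  qed (use r1 in auto)
qed

lemma edecI: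
  assumes "0 < q" "q < 1" "\<And>n. \<bar>fps_nth h n\<bar> \<le> C * q ^ n"
  shows "edec h"
proof -
  obtain s where s: "q < s" "s < 1" using assms(2) dense by blast
  have "summable (\<lambda>n. fps_nth h n * (1 / s) ^ n)"
  proof (rule summable_comparison_test')
    show "summable (\<lambda>n. C * (q / s) ^ n)"
      using s assms by (intro summable_mult summable_geometric) auto
    fix n
    have "\<bar>fps_nth h n\<bar> * (1 / s) ^ n \<le> C * q ^ n * (1 / s) ^ n"
      using s assms by (intro mult_right_mono) auto
    thus "norm (fps_nth h n * (1 / s) ^ n) \<le> C * (q / s) ^ n"
      using s assms by (simp add: abs_mult power_divide)
  qed
  hence "fps_conv_radius h \<ge> norm (1 / s)"
    unfolding fps_conv_radius_def by (rule conv_radius_geI)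
  moreover have "ereal 1 < ereal (norm (1 / s))" using s assms by simp
  ultimately show ?thesis unfolding edec_def one_ereal_def by (rule less_le_trans[rotated])
qed

lemma edec_add: "edec f \<Longrightarrow> edec g \<Longrightarrow> edec (f + g)"
  unfolding edec_def using fps_conv_radius_add[of f g] by (metis less_le_trans min_less_iff_conj)

lemma edec_diff: "edec f \<Longrightarrow> edec g \<Longrightarrow> edec (f - g)"
  unfolding edec_def using fps_conv_radius_diff[of f g] by (metis less_le_trans min_less_iff_conj)

lemma edec_mult: "edec f \<Longrightarrow> edec g \<Longrightarrow> edec (f * g)"
  unfolding edec_def using fps_conv_radius_mult[of f g] by (metis less_le_trans min_less_iff_conj)

lemma edec_power: "edec f \<Longrightarrow> edec (f ^ k)"
  unfolding edec_def using fps_conv_radius_power[of f k] by (metis less_le_trans)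

lemma edec_deriv: "edec f \<Longrightarrow> edec (fps_deriv f)"
  unfolding edec_def using fps_conv_radius_deriv[of f] by (metis less_le_trans)

lemma edec_const [simp]: "edec (fps_const c)" "edec 0" "edec 1" "edec (numeral k)" "edec fps_X"
  by (simp_all add: edec_def)

definition ev :: "real fps \<Rightarrow> real" where
  "ev h = eval_fps h 1"

lemma ev_sums: "edec h \<Longrightarrow> fps_nth h sums ev h"
  using sums_eval_fps[of 1 h] by (simp add: edec_def ev_def one_ereal_def)

lemma ev_add: "edec f \<Longrightarrow> edec g \<Longrightarrow> ev (f + g) = ev f + ev g"
  by (simp add: edec_def ev_def one_ereal_def eval_fps_add)

lemma ev_diff: "edec f \<Longrightarrow> edec g \<Longrightarrow> ev (f - g) = ev f - ev g"
  by (simp add: edec_def ev_def one_ereal_def eval_fps_diff)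

lemma ev_mult: "edec f \<Longrightarrow> edec g \<Longrightarrow> ev (f * g) = ev f * ev g"
  by (simp add: edec_def ev_def one_ereal_def eval_fps_mult)

lemma ev_const [simp]: "ev (fps_const c) = c" "ev 0 = 0" "ev 1 = 1" "ev (numeral k) = numeral k" "ev fps_X = 1"
  by (simp_all add: ev_def)

text \<open>The difference quotient (h(1) - h(x)) / (1 - x): its coefficients are the tails of the
  series for h(1).\<close>

definition tail_sum :: "real fps \<Rightarrow> real fps" where
  "tail_sum h = Abs_fps (\<lambda>l. \<Sum>j. fps_nth h (j + Suc l))"

lemma edec_summable: "edec h \<Longrightarrow> summable (fps_nth h)"
  using ev_sums sums_summable by blast

lemma edec_tail_sum:
  assumes "edec h"
  shows "edec (tail_sum h)"
proof -
  obtain C q where q: "0 < q" "q < 1" "\<And>n. \<bar>fps_nth h n\<bar> \<le> C * q ^ n"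
    using edec_bound[OF assms] by blast
  show ?thesis
  proof (rule edecI[OF q(1,2)])
    fix l
    have g: "(\<lambda>j. C * q ^ Suc l * q ^ j) sums (C * q ^ Suc l * (1 / (1 - q)))"
      using q by (intro sums_mult geometric_sums) simp
    have b: "norm (fps_nth h (j + Suc l)) \<le> C * q ^ Suc l * q ^ j" for j
      using q(3)[of "j + Suc l"] by (simp add: power_add mult_ac)
    have "norm (\<Sum>j. fps_nth h (j + Suc l)) \<le> (\<Sum>j. C * q ^ Suc l * q ^ j)"
      by (rule norm_suminf_le[OF b sums_summable[OF g]])
    thus "\<bar>fps_nth (tail_sum h) l\<bar> \<le> C * q / (1 - q) * q ^ l"
      using g by (simp add: tail_sum_def sums_iff)
  qed
qed

lemma tail_sum_decomp:
  assumes "edec h"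
  shows "h = fps_const (ev h) - (1 - fps_X) * tail_sum h"
proof (rule fps_ext)
  fix n
  have s: "summable (\<lambda>j. fps_nth h (j + k))" for k
    using edec_summable[OF assms] by (simp only: summable_iff_shift)
  have ev: "ev h = (\<Sum>j. fps_nth h j)" using ev_sums[OF assms] by (simp add: sums_iff)
  have step: "(\<Sum>j. fps_nth h (j + k)) = fps_nth h k + (\<Sum>j. fps_nth h (j + Suc k))" for k
    using suminf_split_head[OF s[of k]] by simp
  show "fps_nth h n = fps_nth (fps_const (ev h) - (1 - fps_X) * tail_sum h) n"
  proof (cases n)
    case 0
    thus ?thesis using step[of 0] by (simp add: ev tail_sum_def)
  next
    case (Suc k)
    thus ?thesis using step[of "Suc k"] by (simp add: tail_sum_def left_diff_distrib)
  qed
qed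

text \<open>Iterated difference quotients at 1 take the Taylor coefficients at 1 as values, without
  re-expanding the series there. After differentiating
  \<open>h = h(1) - (1 - x) * tail_sum h\<close>, the term that keeps the factor 1 - x vanishes at
  1.\<close>

lemma ev_deriv_tail_sum:
  assumes "edec h"
  shows "ev ((fps_deriv ^^ i) h) = fact i * ev ((tail_sum ^^ i) h)"
  using assms
proof (induction i arbitrary: h)
  case (Suc i)
  have d: "edec ((fps_deriv ^^ k) h)" if "edec h" for k h
    using that by (induction k) (auto intro: edec_deriv)
  have "(fps_deriv ^^ Suc i) h = of_nat (Suc i) * (fps_deriv ^^ i) (tail_sum h)
      - (1 - fps_X) * (fps_deriv ^^ Suc i) (tail_sum h)"
  proof (induction i)
    case 0
    show ?case by (subst tail_sum_decomp[OF Suc.prems]) (simp add: algebra_simps)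
  next
    case (Suc i)
    show ?case by (subst funpow.simps, subst comp_apply, subst Suc.IH) (simp add: algebra_simps)
  qed
  hence "ev ((fps_deriv ^^ Suc i) h) = ev (of_nat (Suc i) * (fps_deriv ^^ i) (tail_sum h)
      - (1 - fps_X) * (fps_deriv ^^ Suc i) (tail_sum h))" by (rule arg_cong)
  also have "\<dots> = of_nat (Suc i) * ev ((fps_deriv ^^ i) (tail_sum h))"
    using d[OF edec_tail_sum[OF Suc.prems]]
    by (simp add: ev_diff ev_mult edec_mult edec_diff fps_of_nat[symmetric] del: funpow.simps of_nat_Suc)
  also have "\<dots> = fact (Suc i) * ev ((tail_sum ^^ i) (tail_sum h))"
    by (simp add: Suc.IH[OF edec_tail_sum[OF Suc.prems]])
  finally show ?case by (simp add: funpow_swap1)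
qed simp

section \<open>The binomial series (1 - k x)^a\<close>

definition bin :: "real \<Rightarrow> real \<Rightarrow> real fps" where
  "bin k a = Abs_fps (\<lambda>n. (- k) ^ n * (a gchoose n))"

lemma bin_compose: "bin k a = fps_compose (fps_binomial a) (fps_const (- k) * fps_X)"
  by (rule fps_ext) (simp only: fps_compose_linear, simp add: bin_def)

lemma bin_add: "bin k (a + b) = bin k a * bin k b"
  unfolding bin_compose fps_binomial_add_mult by (rule fps_compose_mult_distrib) simp

lemma bin_0 [simp]: "bin k 0 = 1"
  by (simp add: bin_compose)

lemma bin_1: "bin k 1 = 1 - fps_const k * fps_X"
proof -
  have "bin k 1 = fps_compose (1 + fps_X) (fps_const (- k) * fps_X)" by (simp add: bin_compose fps_binomial_1)
  also have "\<dots> = 1 - fps_const k * fps_X" by (simp only: fps_compose_add_distrib fps_compose_1 fps_X_fps_compose_startby0) simp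
  finally show ?thesis .
qed

lemma bin_nth_0 [simp]: "fps_nth (bin k a) 0 = 1"
  by (simp add: bin_def)

lemma bin_of_nat: "bin k (of_nat n) = (1 - fps_const k * fps_X) ^ n"
  by (induction n) (simp_all add: bin_add bin_1)

lemma bin_deriv: "fps_deriv (bin k a) = fps_const (- k * a) * bin k (a - 1)"
proof (rule fps_ext)
  fix n
  have "of_nat (Suc n) * (a gchoose Suc n) = a * ((a - 1) gchoose n)"
    by (rule gbinomial_absorption)
  hence "(- k) ^ Suc n * (of_nat (Suc n) * (a gchoose Suc n)) = (- k) ^ Suc n * (a * ((a - 1) gchoose n))" by simp
  thus "fps_nth (fps_deriv (bin k a)) n = fps_nth (fps_const (- k * a) * bin k (a - 1)) n"
    by (simp add: bin_def mult_ac del: of_nat_Suc)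
qed

lemma bin_edec_ev:
  assumes "\<bar>k\<bar> < 1"
  shows "edec (bin k a)" "ev (bin k a) = (1 - k) powr a"
proof -
  have sm: "(\<lambda>n. fps_nth (bin k a) n * z ^ n) sums (1 + - k * z) powr a" if "\<bar>k * z\<bar> < 1" for z
  proof -
    have "fps_nth (bin k a) n * z ^ n = (a gchoose n) * (- k * z) ^ n" for n
      by (simp only: bin_def fps_nth_Abs_fps power_mult_distrib mult_ac)
    thus ?thesis using gen_binomial_real[of "- k * z" a] that by simp
  qed
  show e: "edec (bin k a)"
  proof -
    obtain s where s: "\<bar>k\<bar> < s" "s < 1" using assms dense by blast
    have "\<bar>k * (1 / s)\<bar> < 1" using s by (simp add: abs_mult)
    hence "fps_conv_radius (bin k a) \<ge> norm (1 / s)"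
      unfolding fps_conv_radius_def using sm[of "1 / s"] by (intro conv_radius_geI) (auto simp: sums_iff)
    moreover have "ereal 1 < ereal (norm (1 / s))" using s by simp
    ultimately show ?thesis unfolding edec_def one_ereal_def by (rule less_le_trans[rotated])
  qed
  show "ev (bin k a) = (1 - k) powr a"
    using sums_unique2[OF ev_sums[OF e]] sm[of 1] assms by simp
qed

lemma bin_1_Suc: "(1 - fps_X) * bin 1 a = bin 1 (a + 1)"
  by (simp add: bin_add bin_1 mult.commute)

lemma bin_expansion_step:
  assumes "edec h"
  shows "h * bin 1 a = fps_const (ev h) * bin 1 a - tail_sum h * bin 1 (a + 1)"
proof -
  have "h * bin 1 a = (fps_const (ev h) - (1 - fps_X) * tail_sum h) * bin 1 a"
    using tail_sum_decomp[OF assms] by simp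
  also have "\<dots> = fps_const (ev h) * bin 1 a - tail_sum h * ((1 - fps_X) * bin 1 a)"
    by (simp add: algebra_simps)
  finally show ?thesis by (simp only: bin_1_Suc)
qed

text \<open>Taylor expansion of the cofactor at the singularity, with the remainder as an exact
  product. For a = 3/2 the remainder has exponent 11/2 and coefficients of order
  \<open>n^(-13/2)\<close>, four powers of n below the leading term.\<close>

lemma bin_expansion:
  assumes "edec h"
  shows "h * bin 1 a = fps_const (ev h) * bin 1 a - fps_const (ev (tail_sum h)) * bin 1 (a + 1)
     + fps_const (ev (tail_sum (tail_sum h))) * bin 1 (a + 2)
     - fps_const (ev (tail_sum (tail_sum (tail_sum h)))) * bin 1 (a + 3)
     + tail_sum (tail_sum (tail_sum (tail_sum h))) * bin 1 (a + 4)"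
  using bin_expansion_step[OF assms, of a] bin_expansion_step[OF edec_tail_sum[OF assms], of "a + 1"]
    bin_expansion_step[OF edec_tail_sum[OF edec_tail_sum[OF assms]], of "a + 2"]
    bin_expansion_step[OF edec_tail_sum[OF edec_tail_sum[OF edec_tail_sum[OF assms]]], of "a + 3"]
  by (simp add: add.assoc)

text \<open>Raising the exponent by one changes the coefficient by a rational function of
  \<open>n\<close>, which reduces all half-integer exponents to -1/2.\<close>

lemma bin_nth_add_1: "(a + 1 - of_nat n) * fps_nth (bin 1 (a + 1)) n = (a + 1) * fps_nth (bin 1 a) n"
  using gbinomial_absorb_comp[of "a + 1" n] by (simp add: bin_def algebra_simps)

section \<open>Central binomial coefficients divided by 4^n, and Wallis' product\<close>

definition wallis_coeff :: "nat \<Rightarrow> real" where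
  "wallis_coeff n = fps_nth (bin 1 (- 1 / 2)) n"

lemma wallis_coeff_0: "wallis_coeff 0 = 1"
  by (simp add: wallis_coeff_def)

lemma wallis_coeff_Suc: "wallis_coeff (Suc n) = (2 * real n + 1) / (2 * real n + 2) * wallis_coeff n"
proof -
  have "(- 1 / 2 gchoose Suc n) * of_nat (Suc n) = (- 1 / 2 gchoose n) * (- 1 / 2 - real n)"
    using gbinomial_mult_1[of "- 1 / 2 :: real" n] by (simp add: algebra_simps)
  hence e: "(- 1 / 2 gchoose Suc n) = (- 1 / 2 gchoose n) * (- 1 / 2 - real n) / of_nat (Suc n)"
    by (simp add: eq_divide_eq del: of_nat_Suc)
  have "(- 1 / 2 - real n) / of_nat (Suc n) = - ((2 * real n + 1) / (2 * real n + 2))"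
    by (simp add: divide_simps) (simp add: algebra_simps)
  hence "(- 1) ^ Suc n * (- 1 / 2 gchoose Suc n) = (2 * real n + 1) / (2 * real n + 2) * ((- 1) ^ n * (- 1 / 2 gchoose n))"
    unfolding e times_divide_eq_right[symmetric] by simp
  thus ?thesis by (simp add: wallis_coeff_def bin_def)
qed

lemma wallis_coeff_pos: "wallis_coeff n > 0"
  by (induction n) (simp_all add: wallis_coeff_0 wallis_coeff_Suc zero_less_mult_iff add_pos_pos add_nonneg_pos)

lemma wallis_coeff_square:
  "wallis_coeff n ^ 2 * (2 * real n + 1) = 1 / (\<Prod>k=1..n. (4 * real k ^ 2) / (4 * real k ^ 2 - 1))"
proof (induction n)
  case (Suc n)
  define P where "P = (\<Prod>k=1..n. (4 * real k ^ 2) / (4 * real k ^ 2 - 1))"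
  have nz: "4 * real (Suc n) ^ 2 - 1 = (2 * real n + 1) * (2 * real n + 3)"
    by (simp add: power2_eq_square algebra_simps)
  have "(\<Prod>k=1..Suc n. (4 * real k ^ 2) / (4 * real k ^ 2 - 1)) = P * (4 * real (Suc n) ^ 2 / ((2 * real n + 1) * (2 * real n + 3)))"
    unfolding nz[symmetric] by (simp add: P_def)
  hence "1 / (\<Prod>k=1..Suc n. (4 * real k ^ 2) / (4 * real k ^ 2 - 1))
      = (1 / P) * (((2 * real n + 1) * (2 * real n + 3)) / (4 * real (Suc n) ^ 2))" by simp
  also have "1 / P = wallis_coeff n ^ 2 * (2 * real n + 1)" by (simp add: P_def Suc.IH)
  also have "\<dots> * (((2 * real n + 1) * (2 * real n + 3)) / (4 * real (Suc n) ^ 2))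
      = wallis_coeff (Suc n) ^ 2 * (2 * real (Suc n) + 1)"
  proof -
    have "4 * real (Suc n) ^ 2 = (2 * real n + 2) ^ 2" by (simp add: power2_eq_square algebra_simps)
    thus ?thesis unfolding wallis_coeff_Suc by (simp add: power_mult_distrib power_divide power2_eq_square)
  qed
  finally show ?case ..
qed (simp add: wallis_coeff_0)

lemma wallis_coeff_limit: "(\<lambda>n. wallis_coeff n * sqrt (pi * real n)) \<longlonglongrightarrow> 1"
proof -
  have "(\<lambda>n. wallis_coeff n ^ 2 * (2 * real n + 1)) \<longlonglongrightarrow> 1 / (pi / 2)"
    unfolding wallis_coeff_square by (intro tendsto_divide tendsto_const wallis) simp
  moreover have "(\<lambda>n. pi * real n / (2 * real n + 1)) \<longlonglongrightarrow> pi / 2"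
    by real_asymp
  ultimately have "(\<lambda>n. wallis_coeff n ^ 2 * (2 * real n + 1) * (pi * real n / (2 * real n + 1))) \<longlonglongrightarrow> 1 / (pi / 2) * (pi / 2)"
    by (rule tendsto_mult)
  hence "(\<lambda>n. sqrt (wallis_coeff n ^ 2 * (2 * real n + 1) * (pi * real n / (2 * real n + 1)))) \<longlonglongrightarrow> sqrt 1"
    by (intro tendsto_real_sqrt) simp
  moreover have "sqrt (wallis_coeff n ^ 2 * (2 * real n + 1) * (pi * real n / (2 * real n + 1))) = wallis_coeff n * sqrt (pi * real n)" for n
  proof -
    have "wallis_coeff n ^ 2 * (2 * real n + 1) * (pi * real n / (2 * real n + 1)) = wallis_coeff n ^ 2 * (pi * real n)"
      by (simp add: add_pos_nonneg less_imp_neq[symmetric])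
    thus ?thesis using wallis_coeff_pos[of n] by (simp add: real_sqrt_mult)
  qed
  ultimately show ?thesis by simp
qed

text \<open>The beginning of the asymptotic series of the central binomial coefficient times
  \<open>sqrt(pi n) / 4^n\<close>, cut off at the accuracy of the final expansions.\<close>

definition wallis_approx :: "real \<Rightarrow> real" where
  "wallis_approx x = 1 - 1 / (8 * x) + 1 / (128 * x ^ 2) + 5 / (1024 * x ^ 3)"

text \<open>A null sequence is minus the sum of its later increments, and \<open>1/n^5\<close> is
  comparable to the telescoping difference of \<open>1/n^4\<close>.\<close>

lemma bigo_from_increments:
  fixes a :: "nat \<Rightarrow> real"
  assumes lim: "a \<longlonglongrightarrow> 0" and inc: "(\<lambda>n. a (Suc n) - a n) \<in> O(\<lambda>n. 1 / real n ^ 5)"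
  shows "a \<in> O(\<lambda>n. 1 / real n ^ 4)"
proof -
  have "(\<lambda>n. 1 / real n ^ 5) \<in> O(\<lambda>n. 1 / real n ^ 4 - 1 / real (Suc n) ^ 4)" by real_asymp
  hence "(\<lambda>n. a (Suc n) - a n) \<in> O(\<lambda>n. 1 / real n ^ 4 - 1 / real (Suc n) ^ 4)"
    using inc landau_o.big_trans by blast
  then obtain c where c: "c > 0" "\<forall>\<^sub>F n in sequentially. norm (a (Suc n) - a n) \<le> c * norm (1 / real n ^ 4 - 1 / real (Suc n) ^ 4)"
    by (elim landau_o.bigE)
  obtain n0 where n0: "\<And>n. n \<ge> n0 \<Longrightarrow> norm (a (Suc n) - a n) \<le> c * norm (1 / real n ^ 4 - 1 / real (Suc n) ^ 4)" "n0 \<ge> 1"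
    using c(2) unfolding eventually_sequentially by (metis le_trans nat_le_linear)
  have step: "\<bar>a (Suc n) - a n\<bar> \<le> c * (1 / real n ^ 4) - c * (1 / real (Suc n) ^ 4)" if "n \<ge> n0" for n
  proof -
    have "1 / real (Suc n) ^ 4 \<le> 1 / real n ^ 4"
      using that n0(2) by (intro divide_left_mono power_mono) auto
    thus ?thesis using n0(1)[OF that] by (simp add: right_diff_distrib)
  qed
  have z: "(\<lambda>n. c * (1 / real n ^ 4)) \<longlonglongrightarrow> 0"
    by (rule tendsto_mult_right_zero) real_asymp
  have "\<bar>a n\<bar> \<le> c * (1 / real n ^ 4)" if "n \<ge> n0" for n
  proof -
    \<comment> \<open>For either sign \<open>s\<close>, the majorant minus \<open>s * a\<close>
      decreases to 0 and is therefore nonnegative; the two signs give the absolute value.\<close>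
    have "decseq (\<lambda>k. c * (1 / real (n + k) ^ 4) - s * a (n + k))" if "\<bar>s\<bar> = 1" for s
    proof (rule decseq_SucI)
      fix k
      have "s * a (n + k) - s * a (n + Suc k) \<le> \<bar>a (Suc (n + k)) - a (n + k)\<bar>"
        using that by (simp add: right_diff_distrib[symmetric] abs_mult flip: abs_minus_commute[of "a (n + k)"])
           (metis abs_ge_self abs_mult mult_1 abs_minus_commute)
      thus "c * (1 / real (n + Suc k) ^ 4) - s * a (n + Suc k) \<le> c * (1 / real (n + k) ^ 4) - s * a (n + k)"
        using step[of "n + k"] \<open>n \<ge> n0\<close> by simp
    qed
    moreover have "(\<lambda>k. c * (1 / real (n + k) ^ 4) - s * a (n + k)) \<longlonglongrightarrow> 0 - s * 0" for s
      using LIMSEQ_ignore_initial_segment[OF z, of n] LIMSEQ_ignore_initial_segment[OF lim, of n]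
      by (intro tendsto_diff tendsto_mult tendsto_const) (simp_all add: add.commute)
    ultimately have "c * (1 / real (n + 0) ^ 4) - s * a (n + 0) \<ge> 0" if "\<bar>s\<bar> = 1" for s
      using decseq_ge[of "\<lambda>k. c * (1 / real (n + k) ^ 4) - s * a (n + k)" 0 0] that by simp
    from this[of 1] this[of "-1"] show ?thesis by simp
  qed
  thus ?thesis
    by (intro landau_o.bigI[of c] c(1) eventually_sequentiallyI[of n0]) (simp add: abs_if)
qed

text \<open>Quotients of consecutive terms are elementary functions of \<open>n\<close>, so the
  increments of the logarithm of the ratio \<open>D\<close> can be expanded directly. Wallis'
  product fixes the limit of \<open>D\<close>, and with it the constant that increments leave
  open.\<close>

lemma wallis_coeff_asymp:
  "(\<lambda>n. wallis_coeff n * sqrt (pi * real n) - wallis_approx (real n)) \<in> O(\<lambda>n. 1 / real n ^ 4)"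
proof -
  define D where "D n = wallis_coeff n * sqrt (pi * real n) / wallis_approx (real n)" for n
  define a where "a n = ln (D n)" for n
  have T1: "(\<lambda>n::nat. wallis_approx (real n)) \<longlonglongrightarrow> 1"
    unfolding wallis_approx_def by real_asymp
  have D1: "D \<longlonglongrightarrow> 1"
    using tendsto_divide[OF wallis_coeff_limit T1] unfolding D_def by simp
  have a0: "a \<longlonglongrightarrow> 0" unfolding a_def using tendsto_ln[OF D1] by simp
  have Tpos: "\<forall>\<^sub>F n in sequentially. wallis_approx (real n) > 0"
    using order_tendstoD(1)[OF T1, of 0] by simp
  hence Tpos': "\<forall>\<^sub>F n in sequentially. wallis_approx (real (Suc n)) > 0"
    by (subst eventually_sequentially_Suc)
  have ev: "\<forall>\<^sub>F n in sequentially. a (Suc n) - a n = ln ((2 * real n + 1) / (2 * real n + 2) * sqrt ((real n + 1) / real n)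
      * wallis_approx (real n) / wallis_approx (real n + 1))"
    using Tpos Tpos' eventually_gt_at_top[of 0]
  proof eventually_elim
    case (elim n)
    have s: "sqrt (pi * real (Suc n)) / sqrt (pi * real n) = sqrt ((real n + 1) / real n)"
      using elim by (simp add: real_sqrt_divide[symmetric] add.commute)
    have "D (Suc n) / D n = (2 * real n + 1) / (2 * real n + 2) * (sqrt (pi * real (Suc n)) / sqrt (pi * real n))
        * wallis_approx (real n) / wallis_approx (real n + 1)"
      using wallis_coeff_pos[of n] elim by (simp add: D_def wallis_coeff_Suc add.commute mult_ac)
    moreover have "D n > 0" "D (Suc n) > 0"
      using elim wallis_coeff_pos by (simp_all add: D_def)
    hence "a (Suc n) - a n = ln (D (Suc n) / D n)" by (simp add: a_def ln_div)
    ultimately show ?case by (simp only: s)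
  qed
  moreover have "(\<lambda>n. ln ((2 * real n + 1) / (2 * real n + 2) * sqrt ((real n + 1) / real n)
      * wallis_approx (real n) / wallis_approx (real n + 1))) \<in> O(\<lambda>n. 1 / real n ^ 5)"
    unfolding wallis_approx_def by real_asymp
  ultimately have "(\<lambda>n. a (Suc n) - a n) \<in> O(\<lambda>n. 1 / real n ^ 5)"
    using landau_o.big.in_cong[OF ev] by blast
  hence a: "a \<in> O(\<lambda>n. 1 / real n ^ 4)" by (rule bigo_from_increments[OF a0])
  have "\<forall>\<^sub>F n in sequentially. norm (exp (a n) - 1) \<le> 2 * norm (a n)"
  proof -
    have "\<forall>\<^sub>F n in sequentially. \<bar>a n\<bar> < 1 / 2"
      using tendstoD[OF a0, of "1 / 2"] by (simp add: dist_real_def)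
    thus ?thesis
    proof eventually_elim
      case (elim n)
      have "exp (a n) - 1 \<le> 2 * \<bar>a n\<bar>"
        using exp_bound_lemma[of "a n"] elim by simp
      moreover have "exp (a n) - 1 \<ge> a n" using exp_ge_add_one_self[of "a n"] by linarith
      ultimately show ?case unfolding real_norm_def by linarith
    qed
  qed
  hence "(\<lambda>n. exp (a n) - 1) \<in> O(a)" by (rule bigoI)
  hence e: "(\<lambda>n. exp (a n) - 1) \<in> O(\<lambda>n. 1 / real n ^ 4)" using a landau_o.big_trans by blast
  have ev': "\<forall>\<^sub>F n in sequentially. wallis_coeff n * sqrt (pi * real n) - wallis_approx (real n) = wallis_approx (real n) * (exp (a n) - 1)"
    using Tpos eventually_gt_at_top[of 0]
  proof eventually_elim
    case (elim n)
    have "D n > 0" using elim wallis_coeff_pos by (simp add: D_def)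
    thus ?case using elim by (simp add: a_def D_def right_diff_distrib)
  qed
  moreover have "(\<lambda>n. wallis_approx (real n) * (exp (a n) - 1)) \<in> O(\<lambda>n. 1 * (1 / real n ^ 4))"
    by (intro landau_o.big.mult e) (unfold wallis_approx_def, real_asymp)
  ultimately show ?thesis using landau_o.big.in_cong[OF ev'] by simp
qed

section \<open>Half-integer exponents and convolution with analytic factors\<close>

lemma bin_3_2_nth:
  "fps_nth (bin 1 (3 / 2)) n = 3 * wallis_coeff n / ((2 * real n - 1) * (2 * real n - 3))"
  "fps_nth (bin 1 (5 / 2)) n = - 15 * wallis_coeff n / ((2 * real n - 1) * (2 * real n - 3) * (2 * real n - 5))"
  "fps_nth (bin 1 (7 / 2)) n = 105 * wallis_coeff n / ((2 * real n - 1) * (2 * real n - 3) * (2 * real n - 5) * (2 * real n - 7))"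
  "fps_nth (bin 1 (9 / 2)) n = - 945 * wallis_coeff n / ((2 * real n - 1) * (2 * real n - 3) * (2 * real n - 5) * (2 * real n - 7) * (2 * real n - 9))"
  "fps_nth (bin 1 (11 / 2)) n = 10395 * wallis_coeff n /
     ((2 * real n - 1) * (2 * real n - 3) * (2 * real n - 5) * (2 * real n - 7) * (2 * real n - 9) * (2 * real n - 11))"
proof -
  have nz: "2 * real n - 1 \<noteq> 0" "2 * real n - 3 \<noteq> 0" "2 * real n - 5 \<noteq> 0" "2 * real n - 7 \<noteq> 0" "2 * real n - 9 \<noteq> 0" "2 * real n - 11 \<noteq> 0"
  proof -
    have *: "2 * real n \<noteq> real k" if "odd k" for k
    proof
      assume "2 * real n = real k"
      hence "real (2 * n) = real k" by simp
      hence "2 * n = k" by (simp only: of_nat_eq_iff)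
      thus False using that by auto
    qed
    show "2 * real n - 1 \<noteq> 0" "2 * real n - 3 \<noteq> 0" "2 * real n - 5 \<noteq> 0" "2 * real n - 7 \<noteq> 0" "2 * real n - 9 \<noteq> 0" "2 * real n - 11 \<noteq> 0"
      using *[of 1] *[of 3] *[of 5] *[of 7] *[of 9] *[of 11] by simp_all
  qed
  define A where "A a = fps_nth (bin 1 a) n" for a
  have w: "A (- (1 / 2)) = wallis_coeff n" by (simp add: A_def wallis_coeff_def)
  have step: "A (a + 1) = - (2 * a + 2) * A a / (2 * real n - (2 * a + 2))" if "2 * real n - (2 * a + 2) \<noteq> 0" for a
  proof -
    have "(2 * real n - (2 * a + 2)) * A (a + 1) = - (2 * a + 2) * A a"
      using bin_nth_add_1[of a n] unfolding A_def by (simp add: algebra_simps)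
    thus ?thesis using that by (simp add: eq_divide_eq mult.commute)
  qed
  have "A (1 / 2) = - wallis_coeff n / (2 * real n - 1)"
    using step[of "- (1 / 2)"] nz by (simp add: w)
  hence 1: "A (3 / 2) = 3 * wallis_coeff n / ((2 * real n - 1) * (2 * real n - 3))"
    using step[of "1 / 2"] nz by simp
  show "fps_nth (bin 1 (3 / 2)) n = 3 * wallis_coeff n / ((2 * real n - 1) * (2 * real n - 3))"
    using 1 by (simp add: A_def)
  have 2: "A (5 / 2) = - 15 * wallis_coeff n / ((2 * real n - 1) * (2 * real n - 3) * (2 * real n - 5))"
    using step[of "3 / 2"] nz by (simp add: 1)
  thus "fps_nth (bin 1 (5 / 2)) n = - 15 * wallis_coeff n / ((2 * real n - 1) * (2 * real n - 3) * (2 * real n - 5))"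
    by (simp add: A_def)
  have 3: "A (7 / 2) = 105 * wallis_coeff n / ((2 * real n - 1) * (2 * real n - 3) * (2 * real n - 5) * (2 * real n - 7))"
    using step[of "5 / 2"] nz by (simp add: 2)
  thus "fps_nth (bin 1 (7 / 2)) n = 105 * wallis_coeff n / ((2 * real n - 1) * (2 * real n - 3) * (2 * real n - 5) * (2 * real n - 7))"
    by (simp add: A_def)
  have 4: "A (9 / 2) = - 945 * wallis_coeff n / ((2 * real n - 1) * (2 * real n - 3) * (2 * real n - 5) * (2 * real n - 7) * (2 * real n - 9))"
    using step[of "7 / 2"] nz by (simp add: 3)
  thus "fps_nth (bin 1 (9 / 2)) n = - 945 * wallis_coeff n / ((2 * real n - 1) * (2 * real n - 3) * (2 * real n - 5) * (2 * real n - 7) * (2 * real n - 9))"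
    by (simp add: A_def)
  have "A (11 / 2) = 10395 * wallis_coeff n /
     ((2 * real n - 1) * (2 * real n - 3) * (2 * real n - 5) * (2 * real n - 7) * (2 * real n - 9) * (2 * real n - 11))"
    using step[of "9 / 2"] nz by (simp add: 4)
  thus "fps_nth (bin 1 (11 / 2)) n = 10395 * wallis_coeff n /
     ((2 * real n - 1) * (2 * real n - 3) * (2 * real n - 5) * (2 * real n - 7) * (2 * real n - 9) * (2 * real n - 11))"
    by (simp add: A_def)
qed

lemma wallis_coeff_bigo: "wallis_coeff \<in> O(\<lambda>n. 1 / sqrt (real n))"
proof -
  have "(\<lambda>n. wallis_coeff n * sqrt (pi * real n)) \<in> O(\<lambda>_. 1)"
    using wallis_coeff_limit by (intro bigoI_tendsto[where c = 1]) simp_all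
  hence "(\<lambda>n. wallis_coeff n * sqrt (pi * real n) * (1 / sqrt (pi * real n))) \<in> O(\<lambda>n. 1 * (1 / sqrt (pi * real n)))"
    by (intro landau_o.big.mult) simp_all
  moreover have ev: "\<forall>\<^sub>F n in sequentially. wallis_coeff n * sqrt (pi * real n) * (1 / sqrt (pi * real n)) = wallis_coeff n"
    using eventually_gt_at_top[of 0] by eventually_elim simp
  ultimately have "wallis_coeff \<in> O(\<lambda>n. 1 * (1 / sqrt (pi * real n)))"
    using landau_o.big.in_cong[OF ev] by blast
  also have "(\<lambda>n. 1 * (1 / sqrt (pi * real n))) \<in> O(\<lambda>n. 1 / sqrt (real n))" by real_asymp
  finally show ?thesis .
qed

text \<open>The convolution estimate needs a bound at every index, hence \<open>n + 1\<close> in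
  place of \<open>n\<close>; finitely many initial coefficients go into the constant.\<close>

lemma bin_11_2_bound:
  obtains C where "\<And>n. \<bar>fps_nth (bin 1 (11 / 2)) n\<bar> \<le> C * (1 / (sqrt (real n + 1) * (real n + 1) ^ 6))"
proof -
  have "(\<lambda>n. wallis_coeff n * (10395 / ((2 * real n - 1) * (2 * real n - 3) * (2 * real n - 5) * (2 * real n - 7) * (2 * real n - 9) * (2 * real n - 11))))
      \<in> O(\<lambda>n. 1 / sqrt (real n) * (1 / real n ^ 6))"
    by (intro landau_o.big.mult wallis_coeff_bigo) real_asymp
  also have "(\<lambda>n. 1 / sqrt (real n) * (1 / real n ^ 6)) \<in> O(\<lambda>n. 1 / (sqrt (real n + 1) * (real n + 1) ^ 6))"
    by real_asymp
  finally have "fps_nth (bin 1 (11 / 2)) \<in> O(\<lambda>n. 1 / (sqrt (real n + 1) * (real n + 1) ^ 6))"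
    by (simp add: bin_3_2_nth(5)[abs_def] mult.commute)
  then obtain c n0 where c: "\<And>n. n \<ge> n0 \<Longrightarrow> \<bar>fps_nth (bin 1 (11 / 2)) n\<bar> \<le> c * (1 / (sqrt (real n + 1) * (real n + 1) ^ 6))"
    by (elim landau_o.bigE) (auto simp: eventually_sequentially)
  define d where "d n = \<bar>fps_nth (bin 1 (11 / 2)) n\<bar> * (sqrt (real n + 1) * (real n + 1) ^ 6)" for n
  show thesis
  proof (rule that[of "\<bar>c\<bar> + (\<Sum>n<n0. d n)"])
    fix n
    have d0: "d n \<ge> 0" for n by (simp add: d_def)
    have "d n \<le> \<bar>c\<bar> + (\<Sum>n<n0. d n)"
    proof (cases "n < n0")
      case True
      hence "d n \<le> (\<Sum>n<n0. d n)" using d0 by (intro member_le_sum) auto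
      thus ?thesis by simp
    next
      case False
      have "d n \<le> c * (1 / (sqrt (real n + 1) * (real n + 1) ^ 6)) * (sqrt (real n + 1) * (real n + 1) ^ 6)"
        unfolding d_def using False by (intro mult_right_mono c) auto
      also have "\<dots> = c" by (simp add: add_nonneg_eq_0_iff)
      finally show ?thesis using sum_nonneg[of "{..<n0}" d] d0 by auto
    qed
    thus "\<bar>fps_nth (bin 1 (11 / 2)) n\<bar> \<le> (\<bar>c\<bar> + (\<Sum>n<n0. d n)) * (1 / (sqrt (real n + 1) * (real n + 1) ^ 6))"
      by (simp add: d_def le_divide_eq add_nonneg_eq_0_iff add_nonneg_pos)
  qed
qed

lemma edec_weighted_summable:
  assumes "edec g"
  shows "summable (\<lambda>l. \<bar>fps_nth g l\<bar> * (real l + 1) ^ k)"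
proof -
  obtain C q where q: "0 < q" "q < 1" "\<And>n. \<bar>fps_nth g n\<bar> \<le> C * q ^ n"
    using edec_bound[OF assms] by blast
  define D where "D = (\<lambda>f :: real fps. fps_deriv (fps_X * f))"
  have "edec (Abs_fps (\<lambda>n. \<bar>fps_nth g n\<bar>))" by (rule edecI[OF q(1,2), of _ C]) (simp add: q(3))
  moreover have "edec f \<Longrightarrow> edec (D f)" for f
    unfolding D_def by (intro edec_deriv edec_mult edec_const)
  ultimately have "edec ((D ^^ k) (Abs_fps (\<lambda>n. \<bar>fps_nth g n\<bar>)))"
    by (induction k) simp_all
  moreover have "fps_nth (D f) n = fps_nth f n * (real n + 1)" for f n
    by (simp add: D_def algebra_simps)
  hence "fps_nth ((D ^^ k) f) n = fps_nth f n * (real n + 1) ^ k" for f n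
    by (induction k) (simp_all add: mult_ac)
  hence "(D ^^ k) (Abs_fps (\<lambda>n. \<bar>fps_nth g n\<bar>)) = Abs_fps (\<lambda>n. \<bar>fps_nth g n\<bar> * (real n + 1) ^ k)"
    by (intro fps_ext) simp
  ultimately have "edec (Abs_fps (\<lambda>n. \<bar>fps_nth g n\<bar> * (real n + 1) ^ k))" by simp
  from edec_summable[OF this] show ?thesis by (simp add: Abs_fps_inverse)
qed

text \<open>Since \<open>n + 1 \<le> (n - l + 1) * (l + 1)\<close>, shifting the index by
  \<open>l\<close> costs at most a factor \<open>(l + 1)^7\<close> in the decay of order 13/2, and
  the exponentially small coefficients of \<open>g\<close> sum such factors.\<close>

lemma bin_11_2_convolution:
  assumes "edec g"
  shows "fps_nth (g * bin 1 (11 / 2)) \<in> O(\<lambda>n. 1 / (sqrt (real n + 1) * (real n + 1) ^ 6))"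
proof -
  obtain C where C: "\<And>n. \<bar>fps_nth (bin 1 (11 / 2)) n\<bar> \<le> C * (1 / (sqrt (real n + 1) * (real n + 1) ^ 6))"
    using bin_11_2_bound by blast
  define p where "p x = 1 / (sqrt x * x ^ 6)" for x :: real
  have C0: "C \<ge> 0" using C[of 0] by simp
  define s where "s = (\<lambda>l. \<bar>fps_nth g l\<bar> * (real l + 1) ^ 7)"
  have s: "summable s" unfolding s_def by (rule edec_weighted_summable[OF assms])
  have p: "p (real (n - l) + 1) \<le> p (real n + 1) * (real l + 1) ^ 7" if "l \<le> n" for l n
  proof -
    have pos: "real (n - l) + 1 > 0" "real n + 1 > 0" "real l + 1 > 0" by linarith+
    have "real n + 1 \<le> (real (n - l) + 1) * (real l + 1)"
      using that by (simp add: of_nat_diff algebra_simps) (metis mult_nonneg_nonneg of_nat_0_le_iff of_nat_diff right_diff_distrib diff_ge_0_iff_ge)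
    hence "sqrt (real n + 1) * (real n + 1) ^ 6 \<le> sqrt ((real (n - l) + 1) * (real l + 1)) * ((real (n - l) + 1) * (real l + 1)) ^ 6"
      using pos by (intro mult_mono power_mono real_sqrt_le_mono) auto
    also have "\<dots> = (sqrt (real (n - l) + 1) * (real (n - l) + 1) ^ 6) * (sqrt (real l + 1) * (real l + 1) ^ 6)"
      by (simp add: real_sqrt_mult power_mult_distrib mult_ac)
    also have "\<dots> \<le> (sqrt (real (n - l) + 1) * (real (n - l) + 1) ^ 6) * ((real l + 1) * (real l + 1) ^ 6)"
      using pos by (intro mult_left_mono mult_right_mono) (auto intro!: real_le_lsqrt simp: power2_eq_square)
    finally have "sqrt (real n + 1) * (real n + 1) ^ 6 \<le> (sqrt (real (n - l) + 1) * (real (n - l) + 1) ^ 6) * (real l + 1) ^ 7"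
      by (simp add: eval_nat_numeral)
    thus ?thesis using pos by (simp add: p_def field_simps)
  qed
  have "\<bar>fps_nth (g * bin 1 (11 / 2)) n\<bar> \<le> C * suminf s * p (real n + 1)" for n
  proof -
    have "\<bar>fps_nth (g * bin 1 (11 / 2)) n\<bar> \<le> (\<Sum>l=0..n. \<bar>fps_nth g l\<bar> * \<bar>fps_nth (bin 1 (11 / 2)) (n - l)\<bar>)"
      unfolding fps_mult_nth abs_mult[symmetric] by (rule sum_abs)
    also have "\<dots> \<le> (\<Sum>l=0..n. C * p (real n + 1) * s l)"
    proof (rule sum_mono)
      fix l assume l: "l \<in> {0..n}"
      have "\<bar>fps_nth (bin 1 (11 / 2)) (n - l)\<bar> \<le> C * p (real (n - l) + 1)" using C[of "n - l"] by (simp only: p_def)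
      also have "\<dots> \<le> C * (p (real n + 1) * (real l + 1) ^ 7)" using l by (intro mult_left_mono p C0) auto
      finally have "\<bar>fps_nth g l\<bar> * \<bar>fps_nth (bin 1 (11 / 2)) (n - l)\<bar>
          \<le> \<bar>fps_nth g l\<bar> * (C * (p (real n + 1) * (real l + 1) ^ 7))"
        by (intro mult_left_mono) auto
      thus "\<bar>fps_nth g l\<bar> * \<bar>fps_nth (bin 1 (11 / 2)) (n - l)\<bar> \<le> C * p (real n + 1) * s l"
        by (simp add: s_def mult_ac)
    qed
    also have "\<dots> = C * p (real n + 1) * sum s {0..n}" by (simp add: sum_distrib_left)
    also have "\<dots> \<le> C * p (real n + 1) * suminf s"
      by (intro mult_left_mono sum_le_suminf s mult_nonneg_nonneg C0) (auto simp: s_def p_def)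
    finally show ?thesis by (simp add: mult_ac)
  qed
  thus ?thesis
    by (intro bigoI[of _ "C * suminf s"] always_eventually allI) (simp add: p_def)
qed

text \<open>The rational constants are the expansions in 1/n of the exact coefficients of the first
  four singular powers, multiplied by \<open>sqrt(pi) * n^(5/2)\<close>. The index
  \<open>n + 2\<close> is the one at which \<open>fps_X ^ 3\<close> times the derivative of a series
  f has the coefficient \<open>n * f_n\<close>.\<close>

lemma bin_3_2_convolution_asymp:
  assumes h: "edec h"
  defines "E \<equiv> (\<lambda>i. ev ((fps_deriv ^^ i) h) / fact i)"
  shows "(\<lambda>n. sqrt pi * (real n ^ 2 * sqrt (real n)) * fps_nth (h * bin 1 (3 / 2)) (n + 2)
     - (E 0 * (3 / 4 - 75 / (32 * real n) + 2835 / (512 * real n ^ 2) - 48825 / (4096 * real n ^ 3))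
      + E 1 * (15 / (8 * real n) - 315 / (64 * real n ^ 2) + 11655 / (1024 * real n ^ 3))
      + E 2 * (105 / (16 * real n ^ 2) - 945 / (128 * real n ^ 3))
      + E 3 * (945 / (32 * real n ^ 3)))) \<in> O(\<lambda>n. 1 / real n ^ 4)"
proof -
  have E: "E i = ev ((tail_sum ^^ i) h)" for i
    unfolding E_def ev_deriv_tail_sum[OF h] by simp
  \<comment> \<open>\<open>P0\<close> to \<open>P3\<close> are the coefficients of the powers 3/2 to
    9/2 of 1 - x at \<open>n + 2\<close>, relative to \<open>wallis_coeff (n + 2)\<close>; the
    alternating signs of \<open>bin_expansion\<close> are absorbed.\<close>
  define P0 where "P0 x = 3 / ((2 * x + 3) * (2 * x + 1))" for x :: real
  define P1 where "P1 x = 15 / ((2 * x + 3) * (2 * x + 1) * (2 * x - 1))" for x :: real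
  define P2 where "P2 x = 105 / ((2 * x + 3) * (2 * x + 1) * (2 * x - 1) * (2 * x - 3))" for x :: real
  define P3 where "P3 x = 945 / ((2 * x + 3) * (2 * x + 1) * (2 * x - 1) * (2 * x - 3) * (2 * x - 5))" for x :: real
  define P where "P x = E 0 * P0 x + E 1 * P1 x + E 2 * P2 x + E 3 * P3 x" for x
  define g where "g = tail_sum (tail_sum (tail_sum (tail_sum h)))"
  have g: "edec g" unfolding g_def by (intro edec_tail_sum h)
  have "fps_nth (h * bin 1 (3 / 2)) (n + 2) = wallis_coeff (n + 2) * P (real n) + fps_nth (g * bin 1 (11 / 2)) (n + 2)" for n
  proof -
    have "2 * real (n + 2) - 1 = 2 * real n + 3" "2 * real (n + 2) - 3 = 2 * real n + 1" "2 * real (n + 2) - 5 = 2 * real n - 1"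
      "2 * real (n + 2) - 7 = 2 * real n - 3" "2 * real (n + 2) - 9 = 2 * real n - 5" by simp_all
    note s = this
    have "h * bin 1 (3 / 2) = fps_const (E 0) * bin 1 (3 / 2) - fps_const (E 1) * bin 1 (5 / 2)
        + fps_const (E 2) * bin 1 (7 / 2) - fps_const (E 3) * bin 1 (9 / 2) + g * bin 1 (11 / 2)"
      using bin_expansion[OF h, of "3 / 2"] by (simp add: E g_def eval_nat_numeral)
    hence "fps_nth (h * bin 1 (3 / 2)) (n + 2) = E 0 * fps_nth (bin 1 (3 / 2)) (n + 2) - E 1 * fps_nth (bin 1 (5 / 2)) (n + 2)
        + E 2 * fps_nth (bin 1 (7 / 2)) (n + 2) - E 3 * fps_nth (bin 1 (9 / 2)) (n + 2) + fps_nth (g * bin 1 (11 / 2)) (n + 2)"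
      by (simp only: fps_add_nth fps_sub_nth fps_mult_left_const_nth)
    also have "\<dots> = wallis_coeff (n + 2) * P (real n) + fps_nth (g * bin 1 (11 / 2)) (n + 2)"
    proof -
      have "e0 * (3 * w / (a * b)) - e1 * (- 15 * w / (a * b * c)) + e2 * (105 * w / (a * b * c * d)) - e3 * (- 945 * w / (a * b * c * d * e)) + r
          = w * (e0 * (3 / (a * b)) + e1 * (15 / (a * b * c)) + e2 * (105 / (a * b * c * d)) + e3 * (945 / (a * b * c * d * e))) + r"
        for a b c d e w e0 e1 e2 e3 r :: real
        by (simp add: distrib_left mult_ac)
      thus ?thesis unfolding bin_3_2_nth s P_def P0_def P1_def P2_def P3_def .
    qed
    finally show ?thesis .
  qed
  note split = this
  define y where "y n = real n ^ 2 * sqrt (real n)" for n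
  define W where "W n = wallis_coeff (n + 2) * sqrt (pi * real (n + 2)) - wallis_approx (real (n + 2))" for n
  define R where "R n = y n / sqrt (real (n + 2)) * W n * P (real n) + sqrt pi * y n * fps_nth (g * bin 1 (11 / 2)) (n + 2)" for n
  have "sqrt pi * y n * fps_nth (h * bin 1 (3 / 2)) (n + 2)
      = y n / sqrt (real (n + 2)) * wallis_approx (real (n + 2)) * P (real n) + R n" for n
  proof -
    have "sqrt pi * wallis_coeff (n + 2) = (W n + wallis_approx (real (n + 2))) / sqrt (real (n + 2))"
      by (simp add: W_def real_sqrt_mult)
    hence "sqrt pi * y n * (wallis_coeff (n + 2) * P (real n))
       = y n * P (real n) * ((W n + wallis_approx (real (n + 2))) / sqrt (real (n + 2)))"
      by (metis mult.commute mult.left_commute)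
    thus ?thesis unfolding split R_def by (simp add: distrib_left add_divide_distrib mult_ac)
  qed
  note main = this
  have W: "W \<in> O(\<lambda>n. 1 / real n ^ 4)"
  proof -
    have "W \<in> O(\<lambda>n. 1 / real (n + 2) ^ 4)"
      unfolding W_def using landau_o.big.compose[OF wallis_coeff_asymp filterlim_add_const_nat_at_top[of 2]] by simp
    also have "(\<lambda>n. 1 / real (n + 2) ^ 4) \<in> O(\<lambda>n. 1 / real n ^ 4)" by real_asymp
    finally show ?thesis .
  qed
  have P': "(\<lambda>n. P (real n)) \<in> O(\<lambda>n. 1 / real n ^ 2)"
    unfolding P_def
    by (intro sum_in_bigo landau_o.big.cmult_in_iff' landau_o.big.mult_in_1 landau_o.big.cmult)
       (simp_all add: P0_def P1_def P2_def P3_def, real_asymp+)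
  have R: "R \<in> O(\<lambda>n. 1 / real n ^ 4)"
    unfolding R_def
  proof (rule sum_in_bigo)
    have "(\<lambda>n. y n / sqrt (real (n + 2)) * W n * P (real n)) \<in> O(\<lambda>n. real n ^ 2 * (1 / real n ^ 4) * (1 / real n ^ 2))"
      by (intro landau_o.big.mult W P') (unfold y_def, real_asymp)
    also have "(\<lambda>n. real n ^ 2 * (1 / real n ^ 4) * (1 / real n ^ 2)) \<in> O(\<lambda>n. 1 / real n ^ 4)" by real_asymp
    finally show "(\<lambda>n. y n / sqrt (real (n + 2)) * W n * P (real n)) \<in> O(\<lambda>n. 1 / real n ^ 4)" .
    have "(\<lambda>n. fps_nth (g * bin 1 (11 / 2)) (n + 2)) \<in> O(\<lambda>n. 1 / (sqrt (real (n + 2) + 1) * (real (n + 2) + 1) ^ 6))"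
      using landau_o.big.compose[OF bin_11_2_convolution[OF g] filterlim_add_const_nat_at_top[of 2]] by simp
    hence "(\<lambda>n. sqrt pi * y n * fps_nth (g * bin 1 (11 / 2)) (n + 2))
        \<in> O(\<lambda>n. y n * (1 / (sqrt (real (n + 2) + 1) * (real (n + 2) + 1) ^ 6)))"
      by (intro landau_o.big.mult) simp_all
    also have "(\<lambda>n. y n * (1 / (sqrt (real (n + 2) + 1) * (real (n + 2) + 1) ^ 6))) \<in> O(\<lambda>n. 1 / real n ^ 4)"
      unfolding y_def by real_asymp
    finally show "(\<lambda>n. sqrt pi * y n * fps_nth (g * bin 1 (11 / 2)) (n + 2)) \<in> O(\<lambda>n. 1 / real n ^ 4)" .
  qed
  define B where "B n = y n / sqrt (real (n + 2)) * wallis_approx (real (n + 2))" for n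
  have b0: "(\<lambda>n. B n * P0 (real n) - (3 / 4 - 75 / (32 * real n) + 2835 / (512 * real n ^ 2) - 48825 / (4096 * real n ^ 3))) \<in> O(\<lambda>n. 1 / real n ^ 4)"
    unfolding B_def y_def P0_def wallis_approx_def by real_asymp
  have b1: "(\<lambda>n. B n * P1 (real n) - (15 / (8 * real n) - 315 / (64 * real n ^ 2) + 11655 / (1024 * real n ^ 3))) \<in> O(\<lambda>n. 1 / real n ^ 4)"
    unfolding B_def y_def P1_def wallis_approx_def by real_asymp
  have b2: "(\<lambda>n. B n * P2 (real n) - (105 / (16 * real n ^ 2) - 945 / (128 * real n ^ 3))) \<in> O(\<lambda>n. 1 / real n ^ 4)"
    unfolding B_def y_def P2_def wallis_approx_def by real_asymp
  have b3: "(\<lambda>n. B n * P3 (real n) - 945 / (32 * real n ^ 3)) \<in> O(\<lambda>n. 1 / real n ^ 4)"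
    unfolding B_def y_def P3_def wallis_approx_def by real_asymp
  have c: "(\<lambda>n. a * f n) \<in> O(\<lambda>n. 1 / real n ^ 4)" if "f \<in> O(\<lambda>n. 1 / real n ^ 4)" for a :: real and f
    using that by (cases "a = 0") simp_all
  have "(\<lambda>n. E 0 * (B n * P0 (real n) - (3 / 4 - 75 / (32 * real n) + 2835 / (512 * real n ^ 2) - 48825 / (4096 * real n ^ 3)))
     + E 1 * (B n * P1 (real n) - (15 / (8 * real n) - 315 / (64 * real n ^ 2) + 11655 / (1024 * real n ^ 3)))
     + E 2 * (B n * P2 (real n) - (105 / (16 * real n ^ 2) - 945 / (128 * real n ^ 3)))
     + E 3 * (B n * P3 (real n) - 945 / (32 * real n ^ 3)) + R n) \<in> O(\<lambda>n. 1 / real n ^ 4)"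
    by (intro sum_in_bigo c b0 b1 b2 b3 R)
  moreover have "sqrt pi * (real n ^ 2 * sqrt (real n)) * fps_nth (h * bin 1 (3 / 2)) (n + 2)
      = B n * (E 0 * P0 (real n) + E 1 * P1 (real n) + E 2 * P2 (real n) + E 3 * P3 (real n)) + R n" for n
    using main[of n] by (simp add: y_def B_def P_def)
  ultimately show ?thesis by (simp add: algebra_simps)
qed

text \<open>This is F(x/\<rho>) over the reals. With \<rho> the growth rate of the coefficients, the
  singularity moves from 1/\<rho> to 1, and for nonzero \<rho> algebraic identities are carried
  along by a ring homomorphism.\<close>

definition rescale :: "real \<Rightarrow> rat fps \<Rightarrow> real fps" where
  "rescale \<rho> F = Abs_fps (\<lambda>n. real_of_rat (fps_nth F n) / \<rho> ^ n)"

lemma rescale_add: "rescale \<rho> (F + G) = rescale \<rho> F + rescale \<rho> G"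
  by (rule fps_ext) (simp add: rescale_def of_rat_add add_divide_distrib)

lemma rescale_diff: "rescale \<rho> (F - G) = rescale \<rho> F - rescale \<rho> G"
  by (rule fps_ext) (simp add: rescale_def of_rat_diff diff_divide_distrib)

lemma rescale_uminus: "rescale \<rho> (- F) = - rescale \<rho> F"
  by (rule fps_ext) (simp add: rescale_def of_rat_minus)

lemma rescale_mult:
  assumes "\<rho> \<noteq> 0"
  shows "rescale \<rho> (F * G) = rescale \<rho> F * rescale \<rho> G"
proof (rule fps_ext)
  fix n
  have "real_of_rat (fps_nth F i * fps_nth G (n - i)) / \<rho> ^ n
      = real_of_rat (fps_nth F i) / \<rho> ^ i * (real_of_rat (fps_nth G (n - i)) / \<rho> ^ (n - i))" if "i \<le> n" for i
  proof -
    have "\<rho> ^ n = \<rho> ^ i * \<rho> ^ (n - i)" using that by (simp flip: power_add)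
    thus ?thesis by (simp add: of_rat_mult)
  qed
  thus "fps_nth (rescale \<rho> (F * G)) n = fps_nth (rescale \<rho> F * rescale \<rho> G) n"
    by (simp add: rescale_def fps_mult_nth of_rat_sum sum_divide_distrib)
qed

lemma rescale_const: "rescale \<rho> (fps_const c) = fps_const (real_of_rat c)"
  by (rule fps_ext) (simp add: rescale_def)

lemma rescale_numeral: "rescale \<rho> (numeral k) = numeral k"
  using rescale_const[of \<rho> "numeral k"] by (simp add: numeral_fps_const)

lemma rescale_1: "rescale \<rho> 1 = 1"
  using rescale_const[of \<rho> 1] by simp

lemma rescale_power: "\<rho> \<noteq> 0 \<Longrightarrow> rescale \<rho> (F ^ k) = rescale \<rho> F ^ k"
  by (induction k) (simp_all add: rescale_1 rescale_mult)

lemma rescale_X: "rescale \<rho> fps_X = fps_const (1 / \<rho>) * fps_X"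
  by (rule fps_ext) (simp add: rescale_def fps_X_def)

lemmas rescale_simps = rescale_add rescale_diff rescale_uminus rescale_mult rescale_numeral rescale_1 rescale_power

lemma rescale_nth_0: "fps_nth (rescale \<rho> F) 0 = real_of_rat (fps_nth F 0)"
  by (simp add: rescale_def)

lemma edec_uminus: "edec f \<Longrightarrow> edec (- f)"
  using edec_diff[of 0 f] by simp

text \<open>Two square roots in an integral domain differ by a sign, which the nonzero constant term
  decides.\<close>

lemma fps_sqrt_unique:
  fixes A B :: "real fps"
  assumes "A\<^sup>2 = B\<^sup>2" "fps_nth A 0 = fps_nth B 0" "fps_nth A 0 \<noteq> 0"
  shows "A = B"
  using assms by (auto simp: power2_eq_iff)

lemma bin_3_2_square: "(bin k (3 / 2))\<^sup>2 = (1 - fps_const k * fps_X) ^ 3"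
  using bin_of_nat[of k 3] bin_add[of k "3 / 2" "3 / 2"] by (simp add: power2_eq_square)

lemma ev_bin_product:
  fixes a b k l :: real
  assumes k: "\<bar>k\<bar> < 1" and l: "\<bar>l\<bar> < 1"
  defines "h \<equiv> bin k a * bin l b" and "e \<equiv> (1 - k) powr a * (1 - l) powr b"
    and "u \<equiv> - k / (1 - k)" and "v \<equiv> - l / (1 - l)"
  shows "edec h" "ev h = e"
    and "ev (fps_deriv h) = e * (a * u + b * v)"
    and "ev (fps_deriv (fps_deriv h)) = e * (a * (a - 1) * u\<^sup>2 + 2 * a * b * (u * v) + b * (b - 1) * v\<^sup>2)"
    and "ev (fps_deriv (fps_deriv (fps_deriv h))) = e * (a * (a - 1) * (a - 2) * u ^ 3
      + 3 * a * (a - 1) * b * (u\<^sup>2 * v) + 3 * a * b * (b - 1) * (u * v\<^sup>2) + b * (b - 1) * (b - 2) * v ^ 3)"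
proof -
  \<comment> \<open>A derivative of such a product is a sum of two products of the same kind, so
    repeated differentiation is repeated rewriting, and evaluation at 1 only sees lowered
    exponents.\<close>
  have c: "fps_deriv (fps_const c * bin k a * bin l b)
      = fps_const (c * a * - k) * bin k (a - 1) * bin l b + fps_const (c * b * - l) * bin k a * bin l (b - 1)" for a b c
  proof -
    have "fps_const (c * a * - k) = fps_const c * fps_const (- k * a)" "fps_const (c * b * - l) = fps_const c * fps_const (- l * b)"
      by simp_all
    thus ?thesis by (simp only: fps_deriv_mult fps_deriv_const bin_deriv) (simp only: algebra_simps mult_zero_left mult_zero_right add_0_left add_0_right)
  qed
  have E: "edec (fps_const c * bin k a * bin l b)" for a b c
    by (intro edec_mult edec_const bin_edec_ev k l)
  define p where "p = 1 / (1 - k)"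
  define q where "q = 1 / (1 - l)"
  have V: "ev (fps_const c * bin k (a - real i) * bin l (b - real j)) = c * e * p ^ i * q ^ j" for c i j
    using k l by (simp add: ev_mult edec_mult bin_edec_ev e_def powr_diff powr_realpow p_def q_def power_divide)
  note V' = V[of _ 0 0, simplified] V[of _ 1 0, simplified] V[of _ 0 1, simplified] V[of _ 1 1, simplified]
    V[of _ 2 0, simplified] V[of _ 0 2, simplified] V[of _ 2 1, simplified] V[of _ 1 2, simplified]
    V[of _ 3 0, simplified] V[of _ 0 3, simplified]
  have h: "h = fps_const 1 * bin k a * bin l b" by (simp add: h_def)
  show "edec h" unfolding h by (rule E)
  show "ev h = e" unfolding h V' by simp
  have d: "a - 1 - 1 = a - 2" "a - 2 - 1 = a - 3" for a :: real by simp_all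
  have uv: "u = - k * p" "v = - l * q" by (simp_all add: u_def v_def p_def q_def)
  note simps = ev_add edec_add E V' uv
  show "ev (fps_deriv h) = e * (a * u + b * v)"
    unfolding h c by (simp only: simps) (simp add: algebra_simps)
  show "ev (fps_deriv (fps_deriv h)) = e * (a * (a - 1) * u\<^sup>2 + 2 * a * b * (u * v) + b * (b - 1) * v\<^sup>2)"
    unfolding h c fps_deriv_add d
    by (simp only: simps) (simp add: algebra_simps power2_eq_square)
  show "ev (fps_deriv (fps_deriv (fps_deriv h))) = e * (a * (a - 1) * (a - 2) * u ^ 3
      + 3 * a * (a - 1) * b * (u\<^sup>2 * v) + 3 * a * b * (b - 1) * (u * v\<^sup>2) + b * (b - 1) * (b - 2) * v ^ 3)"
    unfolding h c fps_deriv_add d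
    by (simp only: simps) (simp add: algebra_simps power2_eq_square power3_eq_cube)
qed

lemma edec_bigo:
  assumes "edec e"
  shows "(\<lambda>n. real n ^ 2 * sqrt (real n) * fps_nth e (n + 2)) \<in> O(\<lambda>n. 1 / real n ^ 4)"
proof -
  obtain C q where q: "0 < q" "q < 1" "\<And>n. \<bar>fps_nth e n\<bar> \<le> C * q ^ n"
    using edec_bound[OF assms] by blast
  have "(\<lambda>n. fps_nth e (n + 2)) \<in> O(\<lambda>n. q ^ n)"
  proof (intro bigoI always_eventually allI)
    fix n
    show "norm (fps_nth e (n + 2)) \<le> (C * q\<^sup>2) * norm (q ^ n)"
      using q(3)[of "n + 2"] q(1) by (simp add: power_add mult_ac power2_eq_square)
  qed
  hence "(\<lambda>n. real n ^ 2 * sqrt (real n) * fps_nth e (n + 2)) \<in> O(\<lambda>n. real n ^ 2 * sqrt (real n) * q ^ n)"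
    by (intro landau_o.big.mult) simp_all
  also have "(\<lambda>n. real n ^ 2 * sqrt (real n) * q ^ n) \<in> O(\<lambda>n. 1 / real n ^ 4)"
    using q(1,2) by real_asymp
  finally show ?thesis .
qed

text \<open>
  The variable is scaled so that the dominant singularity is at \<open>1\<close>. With \<open>h = (1 - kx)\<^sup>a (1 - lx)\<^sup>b\<close>, the
  numbers \<open>1, ra, rb, rc\<close> are the Taylor coefficients at \<open>x = 1\<close> of \<open>h(x) / h(1)\<close>, and \<open>u\<close>, \<open>v\<close> are the
  logarithmic derivatives of \<open>1 - kx\<close> and \<open>1 - lx\<close> there.
\<close>

lemma coefficient_asymp:
  fixes F :: "rat fps" and \<rho> c K a b k l :: real
  assumes pos: "\<rho> > 0" "c > 0" "K > 0" and k: "\<bar>k\<bar> < 1" and l: "\<bar>l\<bar> < 1" and e: "edec e"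
    and eq: "fps_const c * fps_X ^ 3 * rescale \<rho> (fps_deriv F) = 2 * (bin k a * bin l b * bin 1 (3 / 2)) + e"
    and K: "K * (2 * \<rho> * c * sqrt pi) = 3 * ((1 - k) powr a * (1 - l) powr b)"
    and u: "u * (1 - k) = - k" and v: "v * (1 - l) = - l"
    and ra: "ra = a * u + b * v"
    and rb: "2 * rb = a * (a - 1) * u\<^sup>2 + 2 * a * b * (u * v) + b * (b - 1) * v\<^sup>2"
    and rc: "6 * rc = a * (a - 1) * (a - 2) * u ^ 3
      + 3 * a * (a - 1) * b * (u\<^sup>2 * v) + 3 * a * b * (b - 1) * (u * v\<^sup>2) + b * (b - 1) * (b - 2) * v ^ 3"
    and A: "- 25 / 8 + 5 / 2 * ra = A1" "945 / 128 - 105 / 16 * ra + 35 / 4 * rb = A2"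
      "- 16275 / 1024 + 3885 / 256 * ra - 315 / 32 * rb + 315 / 8 * rc = A3"
  shows "(\<lambda>n. real_of_rat (fps_nth F n) / (K * (\<rho> ^ n / real n powr (7 / 2)))
      - (1 + A1 / real n + A2 / real n ^ 2 + A3 / real n ^ 3)) \<in> O(\<lambda>n. 1 / real n ^ 4)"
proof -
  define h where "h = bin k a * bin l b"
  define E0 where "E0 = (1 - k) powr a * (1 - l) powr b"
  define E where "E i = ev ((fps_deriv ^^ i) h) / fact i" for i
  have uv: "u = - k / (1 - k)" "v = - l / (1 - l)" using u v k l by (subst nonzero_eq_divide_eq; simp)+
  note evb = ev_bin_product[OF k l, of a b, folded h_def E0_def uv]
  have E': "E 0 = E0" "E 1 = E0 * ra" "E 2 = E0 * rb" "E 3 = E0 * rc"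
  proof -
    show "E 0 = E0" "E 1 = E0 * ra" by (simp_all add: E_def evb ra)
    have "E 2 = E0 * (2 * rb) / 2" unfolding E_def rb by (simp add: evb eval_nat_numeral)
    thus "E 2 = E0 * rb" by simp
    have "E 3 = E0 * (6 * rc) / 6" unfolding E_def rc by (simp add: evb eval_nat_numeral)
    thus "E 3 = E0 * rc" by simp
  qed
  have E0: "E0 > 0" using k l by (simp add: E0_def)
  define y where "y n = real n ^ 2 * sqrt (real n)" for n
  define T where "T n = E 0 * (3 / 4 - 75 / (32 * real n) + 2835 / (512 * real n ^ 2) - 48825 / (4096 * real n ^ 3))
      + E 1 * (15 / (8 * real n) - 315 / (64 * real n ^ 2) + 11655 / (1024 * real n ^ 3))
      + E 2 * (105 / (16 * real n ^ 2) - 945 / (128 * real n ^ 3))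
      + E 3 * (945 / (32 * real n ^ 3))" for n
  have M: "(\<lambda>n. sqrt pi * y n * fps_nth (h * bin 1 (3 / 2)) (n + 2) - T n) \<in> O(\<lambda>n. 1 / real n ^ 4)"
    using bin_3_2_convolution_asymp[OF evb(1)] unfolding E_def T_def y_def .
  have c: "(\<lambda>n. d * f n) \<in> O(\<lambda>n. 1 / real n ^ 4)" if "f \<in> O(\<lambda>n. 1 / real n ^ 4)" for d :: real and f
    using that by (cases "d = 0") simp_all
  have main: "(\<lambda>n. 4 / (3 * E0) * (sqrt pi * y n * fps_nth (h * bin 1 (3 / 2)) (n + 2) - T n)
      + 2 * sqrt pi / (3 * E0) * (y n * fps_nth e (n + 2))) \<in> O(\<lambda>n. 1 / real n ^ 4)"
    using edec_bigo[OF e] by (intro sum_in_bigo c M) (simp add: y_def)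
  have "\<forall>\<^sub>F n in sequentially. real_of_rat (fps_nth F n) / (K * (\<rho> ^ n / real n powr (7 / 2)))
      - (1 + A1 / real n + A2 / real n ^ 2 + A3 / real n ^ 3)
    = 4 / (3 * E0) * (sqrt pi * y n * fps_nth (h * bin 1 (3 / 2)) (n + 2) - T n)
      + 2 * sqrt pi / (3 * E0) * (y n * fps_nth e (n + 2))"
    using eventually_gt_at_top[of 0]
  proof eventually_elim
    case (elim n)
    then obtain m where m: "n = Suc m" by (cases n) auto
    have n0: "real n > 0" using elim by simp
    have pw: "real n powr (7 / 2) = real n * y n"
    proof -
      have "real n powr (7 / 2) = real n powr (3 + 1 / 2)" by simp
      also have "\<dots> = real n ^ 3 * sqrt (real n)"
        unfolding powr_add using n0 by (simp add: powr_half_sqrt)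
      finally show ?thesis by (simp add: y_def power2_eq_square power3_eq_cube)
    qed
    have "fps_nth (fps_const c * fps_X ^ 3 * rescale \<rho> (fps_deriv F)) (n + 2)
        = c * (real_of_rat (fps_nth F n) * real n / \<rho> ^ m)"
      unfolding mult.assoc fps_mult_left_const_nth fps_X_power_mult_nth
      by (simp add: m rescale_def of_rat_mult of_rat_add mult.commute)
    hence "c * (real_of_rat (fps_nth F n) * real n / \<rho> ^ m)
        = 2 * fps_nth (h * bin 1 (3 / 2)) (n + 2) + fps_nth e (n + 2)"
      unfolding eq h_def by (simp add: numeral_fps_const)
    hence f: "real_of_rat (fps_nth F n) / \<rho> ^ n * real n
        = (2 * fps_nth (h * bin 1 (3 / 2)) (n + 2) + fps_nth e (n + 2)) / (c * \<rho>)"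
      using pos by (simp add: m field_simps)
    \<comment> \<open>The leading coefficient of the power 3/2 is
      \<open>3 / (4 * sqrt(pi) * n^(5/2))\<close>. Times \<open>2 * E0\<close> and divided by
      \<open>c * \<rho>\<close>, this gives the constant \<open>K\<close>.\<close>
    have K': "1 / K = 2 * \<rho> * c * sqrt pi / (3 * E0)"
      using K[folded E0_def] pos E0 by (simp add: field_simps)
    have "real_of_rat (fps_nth F n) / (K * (\<rho> ^ n / real n powr (7 / 2)))
        = (1 / K) * (real_of_rat (fps_nth F n) / \<rho> ^ n * real n) * y n"
      using pos n0 by (simp add: pw)
    also have "\<dots> = 2 * sqrt pi / (3 * E0) * y n * (2 * fps_nth (h * bin 1 (3 / 2)) (n + 2) + fps_nth e (n + 2))"
      unfolding f K' using pos E0 by (simp add: field_simps)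
    finally have L: "real_of_rat (fps_nth F n) / (K * (\<rho> ^ n / real n powr (7 / 2)))
      = 2 * sqrt pi / (3 * E0) * y n * (2 * fps_nth (h * bin 1 (3 / 2)) (n + 2) + fps_nth e (n + 2))" .
    have "4 / (3 * E0) * T n = 1 + A1 / real n + A2 / real n ^ 2 + A3 / real n ^ 3"
    proof -
      have "4 / (3 * E0) * T n = 4 / 3 * ((3 / 4 - 75 / (32 * real n) + 2835 / (512 * real n ^ 2) - 48825 / (4096 * real n ^ 3))
        + ra * (15 / (8 * real n) - 315 / (64 * real n ^ 2) + 11655 / (1024 * real n ^ 3))
        + rb * (105 / (16 * real n ^ 2) - 945 / (128 * real n ^ 3)) + rc * (945 / (32 * real n ^ 3)))" (is "_ = 4 / 3 * ?R")
      proof -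
        have "T n = E0 * ?R" unfolding T_def E' by (simp only: distrib_left mult.assoc)
        thus ?thesis using E0 by simp
      qed
      also have "\<dots> = 1 + (- 25 / 8 + 5 / 2 * ra) / real n + (945 / 128 - 105 / 16 * ra + 35 / 4 * rb) / real n ^ 2
         + (- 16275 / 1024 + 3885 / 256 * ra - 315 / 32 * rb + 315 / 8 * rc) / real n ^ 3"
      proof -
        define i where "i = 1 / real n"
        have i: "d / (d' * real n) = d / d' * i" "d / (d' * real n ^ 2) = d / d' * i ^ 2" "d / (d' * real n ^ 3) = d / d' * i ^ 3"
          "d / real n = d * i" "d / real n ^ 2 = d * i ^ 2" "d / real n ^ 3 = d * i ^ 3" for d d'
          by (simp_all add: i_def power_divide)
        show ?thesis unfolding i by Groebner_Basis.algebra
      qed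
      finally show ?thesis unfolding A .
    qed
    note T = this[symmetric]
    define w where "w = 1 / (3 * E0)"
    have d: "d / (3 * E0) = d * w" for d by (simp add: w_def)
    have id: "2 * s * w * y' * (2 * U + e') - 4 * w * T' = 4 * w * (s * y' * U - T') + 2 * s * w * (y' * e')"
      for s y' U T' e' :: real by (simp add: algebra_simps)
    show ?case unfolding L T d by (rule id)
  qed
  from landau_o.big.in_cong[OF this] main show ?thesis by simp
qed

section \<open>The three coefficient expansions\<close>

lemma powr_3_2_square: "x > 0 \<Longrightarrow> (x powr (3 / 2)) ^ 2 = x ^ 3" for x :: real
  by (simp add: powr_power)

text \<open>In the scaled variable the discriminant is 4 (1 - x)^3 (1 + x/7)^3. Its square root
  divided by the factor (1 + x/7)^2 accompanying \<open>G\<close> leaves the cofactor (1 +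
  x/7)^(-1/2), so the second binomial factor is trivial. The polynomial part, after the same
  division, goes into \<open>e\<close>.\<close>

lemma coefficient_asymp1:
  fixes F :: "rat fps"
  defines "t \<equiv> fps_X" and "G \<equiv> fps_deriv F"
  assumes H: "(128*t^3*(1 + t)^2*G + 2*(1 - 9*t + 3*t^2 + 45*t^3 + 32*t^4))^2 = 4*(1 - 7*t)^3*(1 + t)^3"
  shows "(\<lambda>n. real_of_rat (fps_nth F n) / (147/512 * sqrt (7 / (2*pi)) * (7 ^ n / real n powr (7/2)))
          - (1 - 105 / (32 * real n) + 16065 / (2048 * real n ^ 2) - 1109115 / (65536 * real n ^ 3)))
       \<in> O(\<lambda>n. 1 / real n ^ 4)"
proof -
  define B where "B = 2*(1 - 9*t + 3*t^2 + 45*t^3 + 32*t^4)"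
  define x where "x = rescale 7 t"
  define g where "g = rescale 7 G"
  have x: "x = fps_const (1 / 7) * fps_X" by (simp add: x_def t_def rescale_X)
  have x7: "7 * x = fps_X" by (simp add: x numeral_fps_const flip: mult.assoc)
  have x1: "1 + x = bin (- 1 / 7) 1" by (simp add: bin_1 x)
  have B': "rescale 7 B = 2*(1 - 9*x + 3*x^2 + 45*x^3 + 32*x^4)"
    by (simp add: B_def rescale_simps x_def)
  have "(rescale 7 (128*t^3*(1 + t)^2*G + B))\<^sup>2 = 4*(1 - 7*x)^3*(1 + x)^3"
    using arg_cong[OF H, of "rescale 7"] by (simp add: rescale_simps x_def B_def)
  also have "\<dots> = (2 * bin 1 (3 / 2) * bin (- 1 / 7) (3 / 2))\<^sup>2"
    unfolding power_mult_distrib bin_3_2_square by (simp add: x7 x1 bin_1)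
  finally have "rescale 7 (128*t^3*(1 + t)^2*G + B) = 2 * bin 1 (3 / 2) * bin (- 1 / 7) (3 / 2)"
    by (rule fps_sqrt_unique) (simp_all add: rescale_nth_0 B_def t_def numeral_fps_const)
  hence "128 * x ^ 3 * bin (- 1 / 7) 2 * g = 2 * bin 1 (3 / 2) * bin (- 1 / 7) (3 / 2) - rescale 7 B"
    using bin_of_nat[of "- 1 / 7" 2]
    by (simp add: rescale_add[of _ _ B] rescale_simps x_def[symmetric] g_def x1 bin_1 eq_diff_eq)
  hence "128 * x ^ 3 * bin (- 1 / 7) 2 * g * bin (- 1 / 7) (- 2)
      = (2 * bin 1 (3 / 2) * bin (- 1 / 7) (3 / 2) - rescale 7 B) * bin (- 1 / 7) (- 2)" by (rule arg_cong)
  moreover have "bin (- 1 / 7) 2 * bin (- 1 / 7) (- 2) = 1" "bin (- 1 / 7) (3 / 2) * bin (- 1 / 7) (- 2) = bin (- 1 / 7) (- 1 / 2)"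
    by (simp_all flip: bin_add)
  ultimately have eq0: "128 * x ^ 3 * g = 2 * (bin (- 1 / 7) (- 1 / 2) * bin 1 (3 / 2)) - rescale 7 B * bin (- 1 / 7) (- 2)"
    by Groebner_Basis.algebra
  have c: "128 * x ^ 3 = fps_const (128 / 343) * fps_X ^ 3"
    by (simp add: x power_mult_distrib fps_const_power numeral_fps_const power_divide flip: mult.assoc)
  have "(\<lambda>n. real_of_rat (fps_nth F n) / (147/512 * sqrt (7 / (2*pi)) * (7 ^ n / real n powr (7/2)))
          - (1 + (- 105 / 32) / real n + (16065 / 2048) / real n ^ 2 + (- 1109115 / 65536) / real n ^ 3))
       \<in> O(\<lambda>n. 1 / real n ^ 4)"
  proof (rule coefficient_asymp[where c = "128 / 343" and k = "- 1 / 7" and l = 0 and a = "- 1 / 2" and b = 0 and u = "1 / 8" and v = 0 and ra = "- 1 / 16" and rb = "3 / 512" and rc = "- 5 / 8192"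
        and e = "- (rescale 7 B * bin (- 1 / 7) (- 2))"])
    show "edec (- (rescale 7 B * bin (- 1 / 7) (- 2)))"
      unfolding B' x by (intro edec_uminus edec_mult edec_add edec_diff edec_power edec_const bin_edec_ev) simp
    show "fps_const (128 / 343) * fps_X ^ 3 * rescale 7 (fps_deriv F) =
      2 * (bin (- 1 / 7) (- 1 / 2) * bin 0 0 * bin 1 (3 / 2)) + - (rescale 7 B * bin (- 1 / 7) (- 2))"
      using eq0 by (simp only: c g_def G_def bin_0) simp
    have "sqrt (7 / (2 * pi)) * sqrt pi = sqrt (7 / 2)" by (simp flip: real_sqrt_mult)
    moreover have "sqrt (7 / 2) = 2 * (8 / 7) powr (- 1 / 2)"
    proof (rule real_sqrt_unique)
      show "(2 * (8 / 7 :: real) powr (- 1 / 2))\<^sup>2 = 7 / 2"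
        by (simp add: power_mult_distrib powr_power)
    qed simp
    ultimately show "147 / 512 * sqrt (7 / (2 * pi)) * (2 * 7 * (128 / 343) * sqrt pi)
        = 3 * ((1 - - 1 / 7) powr (- 1 / 2) * (1 - 0) powr 0)" by simp
  qed (simp_all add: power2_eq_square power3_eq_cube)
  thus ?thesis by (simp add: algebra_simps)
qed

lemma sqrt6_bounds: "sqrt 6 > 2.449" "sqrt 6 < 2.4495"
  by (rule real_less_rsqrt real_less_lsqrt; simp add: power2_eq_square)+

text \<open>The zeros of \<open>1 - 10*t + t^2\<close> are inverse to each other, so in the scaled
  variable it becomes (1 - x)(1 - \<mu>^2 x) with \<mu> = 1/\<rho>, while \<open>1 - t\<close>
  becomes 1 - \<mu> x. The constant term -2 selects the negative square root. The values given for
  \<open>u\<close> and \<open>v\<close> are - \<mu>^2 / (1 - \<mu>^2) and - \<mu> / (1 - \<mu>),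
  written in the basis 1, sqrt 6.\<close>

lemma coefficient_asymp2:
  fixes F :: "rat fps"
  defines "t \<equiv> fps_X" and "G \<equiv> fps_deriv F"
  assumes H: "(- 216*t^3*G + (- 2 + 32*t - 108*t^2 + 76*t^3 + 2*t^4))^2 = 4*(1 - 10*t + t^2)^3*(1 - t)^2"
  shows "(\<lambda>n. real_of_rat (fps_nth F n)
            / (2 / (3 * sqrt pi) * root 4 (2/3) * ((5 + 2 * sqrt 6) ^ n / real n powr (7/2)))
          - (1 - 45 * sqrt 6 / (32 * real n) + 8435 / (1024 * real n ^ 2) - 238805 * sqrt 6 / (32768 * real n ^ 3)))
       \<in> O(\<lambda>n. 1 / real n ^ 4)"
proof -
  define r where "r = sqrt (6 :: real)"
  have r: "r * r = 6" "r > 2.449" "r < 2.4495" unfolding r_def using sqrt6_bounds by simp_all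
  have r': "r * (r * d) = 6 * d" for d using r(1) by (simp flip: mult.assoc)
  define \<rho> where "\<rho> = 5 + 2 * r"
  define \<mu> where "\<mu> = 5 - 2 * r"
  have \<rho>: "\<rho> > 0" "\<rho> \<noteq> 0" using r by (simp_all add: \<rho>_def)
  have \<mu>: "1 / \<rho> = \<mu>" using r \<rho> by (simp add: \<rho>_def \<mu>_def field_simps)
  define B where "B = - 2 + 32*t - 108*t^2 + 76*t^3 + 2*t^4"
  define x where "x = rescale \<rho> t"
  define g where "g = rescale \<rho> G"
  have x: "x = fps_const \<mu> * fps_X" by (simp add: x_def t_def rescale_X \<mu>)
  have x1: "1 - x = bin \<mu> 1" by (simp add: bin_1 x)
  have "fps_const (10 * \<mu>) = 1 + fps_const (\<mu> * \<mu>)"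
    using r by (simp add: fps_eq_iff \<mu>_def algebra_simps)
  hence "10 * x = (1 + fps_const (\<mu> * \<mu>)) * fps_X" unfolding x by (simp add: numeral_fps_const flip: mult.assoc)
  moreover have "x ^ 2 = fps_const (\<mu> * \<mu>) * fps_X ^ 2" by (simp add: x power2_eq_square mult_ac)
  ultimately have x2: "1 - 10 * x + x ^ 2 = (1 - fps_const 1 * fps_X) * (1 - fps_const (\<mu> * \<mu>) * fps_X)"
    unfolding fps_const_1_eq_1 by Groebner_Basis.algebra
  have B': "rescale \<rho> B = - 2 + 32*x - 108*x^2 + 76*x^3 + 2*x^4"
    using \<rho> by (simp add: B_def rescale_simps x_def)
  have "(rescale \<rho> (- 216*t^3*G + B))\<^sup>2 = 4*(1 - 10*x + x^2)^3*(1 - x)^2"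
    using arg_cong[OF H, of "rescale \<rho>"] \<rho> by (simp add: rescale_simps x_def B_def)
  also have "\<dots> = (- 2 * bin 1 (3 / 2) * bin (\<mu> * \<mu>) (3 / 2) * bin \<mu> 1)\<^sup>2"
    unfolding power_mult_distrib bin_3_2_square x2 x1 by (simp add: mult_ac)
  finally have "rescale \<rho> (- 216*t^3*G + B) = - 2 * bin 1 (3 / 2) * bin (\<mu> * \<mu>) (3 / 2) * bin \<mu> 1"
    by (rule fps_sqrt_unique) (simp_all add: rescale_nth_0 B_def t_def numeral_fps_const)
  moreover have "rescale \<rho> (- 216*t^3*G + B) = - 216 * x ^ 3 * g + rescale \<rho> B"
    using \<rho> unfolding rescale_add[of _ _ B] by (simp add: rescale_simps x_def g_def)
  ultimately have eq0: "216 * x ^ 3 * g = 2 * (bin (\<mu> * \<mu>) (3 / 2) * bin \<mu> 1 * bin 1 (3 / 2)) + rescale \<rho> B"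
    by Groebner_Basis.algebra
  have c: "216 * x ^ 3 = fps_const (216 * \<mu> ^ 3) * fps_X ^ 3"
    by (simp add: x power_mult_distrib fps_const_power numeral_fps_const flip: mult.assoc)
  have m2: "\<mu> * \<mu> = 49 - 20 * r" using r by (simp add: \<mu>_def algebra_simps)
  \<comment> \<open>Multiplication in the field generated by sqrt 6; products are kept in the basis
    1, \<open>r\<close>, which makes the final comparisons linear.\<close>
  have mul: "(a + b * r) * (c + d * r) = (a * c + 6 * (b * d)) + (a * d + b * c) * r" for a b c d
    using r' by (simp add: algebra_simps)
  have uv2: "(1 / 2 + (-5 / 24) * r)\<^sup>2 = 49 / 96 + (-5 / 24) * r" "(1 / 2 + (-5 / 24) * r) * (1 / 2 + (-1 / 4) * r) = 9 / 16 + (-11 / 48) * r" "(1 / 2 + (-1 / 4) * r)\<^sup>2 = 5 / 8 + (-1 / 4) * r"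
    unfolding power2_eq_square mul by simp_all
  have uv3: "(1 / 2 + (-5 / 24) * r) ^ 3 = 33 / 64 + (-485 / 2304) * r" "(1 / 2 + (-5 / 24) * r)\<^sup>2 * (1 / 2 + (-1 / 4) * r) = 109 / 192 + (-89 / 384) * r"
    "(1 / 2 + (-5 / 24) * r) * (1 / 2 + (-1 / 4) * r)\<^sup>2 = 5 / 8 + (-49 / 192) * r" "(1 / 2 + (-1 / 4) * r) ^ 3 = 11 / 16 + (-9 / 32) * r"
    unfolding power3_eq_cube power2_eq_square mul mult.assoc[symmetric] by simp_all
  have "(\<lambda>n. real_of_rat (fps_nth F n) / (2 / (3 * sqrt pi) * root 4 (2/3) * (\<rho> ^ n / real n powr (7/2)))
          - (1 + (- 45 * r / 32) / real n + (8435 / 1024) / real n ^ 2 + (- 238805 * r / 32768) / real n ^ 3))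
       \<in> O(\<lambda>n. 1 / real n ^ 4)"
  proof (rule coefficient_asymp[where c = "216 * \<mu> ^ 3" and k = "\<mu> * \<mu>" and l = \<mu> and a = "3 / 2" and b = 1
        and u = "1 / 2 + (-5 / 24) * r" and v = "1 / 2 + (-1 / 4) * r"
        and ra = "5 / 4 - 9 * r / 16" and rb = "265 / 256 - 27 * r / 64" and rc = "185 / 1024 - 2719 * r / 36864" and e = "rescale \<rho> B"])
    show "\<rho> > 0" by fact
    show "216 * \<mu> ^ 3 > 0" using r by (simp add: \<mu>_def)
    show "2 / (3 * sqrt pi) * root 4 (2 / 3) > 0" by simp
    show "\<bar>\<mu> * \<mu>\<bar> < 1" "\<bar>\<mu>\<bar> < 1" using r unfolding m2 by (simp_all add: \<mu>_def abs_if)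
    show "edec (rescale \<rho> B)"
      unfolding B' x by (intro edec_uminus edec_mult edec_add edec_diff edec_power edec_const)
    show "fps_const (216 * \<mu> ^ 3) * fps_X ^ 3 * rescale \<rho> (fps_deriv F) =
      2 * (bin (\<mu> * \<mu>) (3 / 2) * bin \<mu> 1 * bin 1 (3 / 2)) + rescale \<rho> B"
      using eq0 by (simp only: c g_def G_def)
    define p where "p = (1 - \<mu> * \<mu>) powr (3 / 2)"
    have p0: "p > 0" using r by (simp add: p_def m2)
    have p2: "p ^ 2 = (20 * r - 48) ^ 3" unfolding p_def using r by (subst powr_3_2_square) (simp_all add: m2)
    \<comment> \<open>Both sides are nonnegative, and \<open>p^2\<close> lies in the field generated
      by \<open>r\<close>, so comparing fourth powers turns the claim into arithmetic there.\<close>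
    have root: "root 4 (2 / 3) = p * (1 - \<mu>) * \<rho> ^ 2 / 96"
    proof (rule real_root_pos_unique)
      have "\<rho> ^ 2 = 49 + 20 * r" "1 - \<mu> = 2 * r - 4" using r by (simp_all add: \<mu>_def \<rho>_def power2_eq_square algebra_simps)
      hence "(1 - \<mu>) * \<rho> ^ 2 = (2 * r - 4) * (49 + 20 * r)" by simp
      also have "\<dots> = 18 * r + 44" using r by (simp add: algebra_simps)
      finally have q: "(1 - \<mu>) * \<rho> ^ 2 = 18 * r + 44" .
      have r2: "r ^ 2 = 6" using r by (simp add: power2_eq_square)
      have "(p * (1 - \<mu>) * \<rho> ^ 2 / 96) ^ 4 = (p ^ 2) ^ 2 * ((1 - \<mu>) * \<rho> ^ 2) ^ 4 / 96 ^ 4"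
        by (simp add: power_mult_distrib power_divide flip: power_mult)
      also have "\<dots> = ((20 * r - 48) ^ 3) ^ 2 * (18 * r + 44) ^ 4 / 96 ^ 4" by (simp only: p2 q)
      also have "((20 * r - 48) ^ 3) ^ 2 * (18 * r + 44) ^ 4 = ((20 * r - 48) * (18 * r + 44)) ^ 4 * (20 * r - 48) ^ 2"
        by (simp add: power_mult_distrib flip: power_mult power_add)
      also have "(20 * r - 48) * (18 * r + 44) = 16 * (r + 3)" using r by (simp add: algebra_simps)
      also have "(20 * r - 48) ^ 2 = 96 * (49 - 20 * r)" using r by (simp add: algebra_simps power2_eq_square)
      also have "(16 * (r + 3)) ^ 4 = 65536 * ((r + 3) ^ 2) ^ 2" unfolding power_mult_distrib by (simp flip: power_mult)
      also have "(r + 3) ^ 2 = 15 + 6 * r" using r by (simp add: algebra_simps power2_eq_square)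
      also have "65536 * (15 + 6 * r) ^ 2 * (96 * (49 - 20 * r)) = 56623104 * (49 + 20 * r) * (49 - 20 * r)"
        by (simp add: algebra_simps power2_eq_square r')
      also have "\<dots> = 56623104" by (simp add: algebra_simps r')
      finally show "(p * (1 - \<mu>) * \<rho> ^ 2 / 96) ^ 4 = 2 / 3" by simp
      show "0 \<le> p * (1 - \<mu>) * \<rho> ^ 2 / 96" using p0 r by (simp add: \<mu>_def)
    qed simp
    have "\<mu> * \<rho> = 1" using \<mu> \<rho> by (simp add: field_simps)
    hence "2 / 3 * root 4 (2 / 3) * (2 * \<rho> * (216 * \<mu> ^ 3)) = 3 * (p * (1 - \<mu>))"
      unfolding root by Groebner_Basis.algebra
    thus "2 / (3 * sqrt pi) * root 4 (2 / 3) * (2 * \<rho> * (216 * \<mu> ^ 3) * sqrt pi)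
        = 3 * ((1 - \<mu> * \<mu>) powr (3 / 2) * (1 - \<mu>) powr 1)"
      using r by (simp add: p_def \<mu>_def)
    show "(1 / 2 + (-5 / 24) * r) * (1 - \<mu> * \<mu>) = - (\<mu> * \<mu>)" "(1 / 2 + (-1 / 4) * r) * (1 - \<mu>) = - \<mu>"
      unfolding m2 unfolding \<mu>_def using r(1) by (simp_all add: algebra_simps)
  qed ((simp only: uv3)?, (simp only: uv2)?, (linarith | simp add: algebra_simps r(1) r' add_divide_distrib diff_divide_distrib))+
  thus ?thesis by (simp add: \<rho>_def r_def algebra_simps)
qed

text \<open>\<open>1 - 8*t - 8*t^2\<close> has the factors 1 - \<rho> t and 1 - (4 - 2 sqrt 6) t; in
  the scaled variable the second becomes 1 - \<kappa> x, where \<kappa> is the quotient of the two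
  rates. The square root contributes (1 + t)^2, and division by the factor (1 + t)^5 of
  \<open>G\<close> leaves the exponent -3.\<close>

lemma coefficient_asymp3:
  fixes F :: "rat fps"
  defines "t \<equiv> fps_X" and "G \<equiv> fps_deriv F"
  assumes H: "(216*t^3*(1 + t)^5*G + (2 - 20*t - 22*t^2 + 184*t^3 + 560*t^4 + 700*t^5 + 432*t^6 + 108*t^7))^2
    = 4*(1 - 8*t - 8*t^2)^3*(1 + t)^4"
  shows "(\<lambda>n. real_of_rat (fps_nth F n)
            / (32 / (3 * sqrt ((267 + 109 * sqrt 6) * pi)) * ((4 + 2 * sqrt 6) ^ n / real n powr (7/2)))
          - (1 - 5 * (62 - 23 * sqrt 6) / (8 * real n) + 35 * (4567 - 1858 * sqrt 6) / (64 * real n ^ 2)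
               - 35 * (2608410 - 1064767 * sqrt 6) / (512 * real n ^ 3)))
       \<in> O(\<lambda>n. 1 / real n ^ 4)"
proof -
  define r where "r = sqrt (6 :: real)"
  have r: "r * r = 6" "r > 2.449" "r < 2.4495" unfolding r_def using sqrt6_bounds by simp_all
  have r': "r * (r * d) = 6 * d" for d using r(1) by (simp flip: mult.assoc)
  have r2: "r ^ 2 = 6" using r by (simp add: power2_eq_square)
  define \<rho> where "\<rho> = 4 + 2 * r"
  define \<mu> where "\<mu> = (r - 2) / 4"
  have \<rho>: "\<rho> > 0" "\<rho> \<noteq> 0" using r by (simp_all add: \<rho>_def)
  have \<mu>: "1 / \<rho> = \<mu>" using r \<rho> by (simp add: \<rho>_def \<mu>_def field_simps)
  define \<kappa> where "\<kappa> = 2 * r - 5"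
  define B where "B = 2 - 20*t - 22*t^2 + 184*t^3 + 560*t^4 + 700*t^5 + 432*t^6 + 108*t^7"
  define x where "x = rescale \<rho> t"
  define g where "g = rescale \<rho> G"
  have x: "x = fps_const \<mu> * fps_X" by (simp add: x_def t_def rescale_X \<mu>)
  have x1: "1 + x = bin (- \<mu>) 1" by (simp add: bin_1 x)
  have "8 * \<mu> = 1 + \<kappa>"
    by (simp add: \<mu>_def \<kappa>_def)
  moreover have "16 * \<mu> ^ 2 = (r - 2) ^ 2" by (simp add: \<mu>_def power_divide)
  hence "8 * \<mu> ^ 2 = - \<kappa>"
    using r by (simp add: \<kappa>_def power2_eq_square algebra_simps)
  ultimately have "fps_const (8 * \<mu>) = 1 + fps_const \<kappa>" "fps_const (8 * \<mu> ^ 2) = - fps_const \<kappa>"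
    by (simp_all add: fps_eq_iff)
  hence "8 * x = (1 + fps_const \<kappa>) * fps_X" "8 * x ^ 2 = - fps_const \<kappa> * fps_X ^ 2"
    unfolding x power_mult_distrib fps_const_power by (simp_all add: numeral_fps_const flip: mult.assoc)
  hence x2: "1 - 8 * x - 8 * x ^ 2 = (1 - fps_const 1 * fps_X) * (1 - fps_const \<kappa> * fps_X)"
    unfolding fps_const_1_eq_1 by Groebner_Basis.algebra
  have B': "rescale \<rho> B = 2 - 20*x - 22*x^2 + 184*x^3 + 560*x^4 + 700*x^5 + 432*x^6 + 108*x^7"
    using \<rho> by (simp add: B_def rescale_simps x_def)
  have "(rescale \<rho> (216*t^3*(1 + t)^5*G + B))\<^sup>2 = 4*(1 - 8*x - 8*x^2)^3*(1 + x)^4"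
    using arg_cong[OF H, of "rescale \<rho>"] \<rho> by (simp add: rescale_simps x_def B_def)
  also have "\<dots> = (2 * bin 1 (3 / 2) * bin \<kappa> (3 / 2) * bin (- \<mu>) 2)\<^sup>2"
  proof -
    have "(bin (- \<mu>) 2)\<^sup>2 = (bin (- \<mu>) 1) ^ 4"
      using bin_of_nat[of "- \<mu>" 2] by (simp add: bin_1 flip: power_mult)
    thus ?thesis unfolding power_mult_distrib bin_3_2_square x2 x1 by (simp add: mult_ac)
  qed
  finally have "rescale \<rho> (216*t^3*(1 + t)^5*G + B) = 2 * bin 1 (3 / 2) * bin \<kappa> (3 / 2) * bin (- \<mu>) 2"
    by (rule fps_sqrt_unique) (simp_all add: rescale_nth_0 B_def t_def numeral_fps_const)
  moreover have "rescale \<rho> (216*t^3*(1 + t)^5*G + B) = 216 * x ^ 3 * (1 + x) ^ 5 * g + rescale \<rho> B"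
    using \<rho> unfolding rescale_add[of _ _ B] by (simp add: rescale_simps x_def g_def)
  moreover have "(1 + x) ^ 5 * bin (- \<mu>) (- 5) = 1" "bin (- \<mu>) 2 * bin (- \<mu>) (- 5) = bin (- \<mu>) (- 3)"
    using bin_of_nat[of "- \<mu>" 5] bin_add[of "- \<mu>" 5 "- 5"] bin_add[of "- \<mu>" 2 "- 5"] by (simp_all add: x1 bin_1)
  ultimately have eq0: "216 * x ^ 3 * g = 2 * (bin \<kappa> (3 / 2) * bin (- \<mu>) (- 3) * bin 1 (3 / 2)) + - (rescale \<rho> B * bin (- \<mu>) (- 5))"
    by Groebner_Basis.algebra
  have c: "216 * x ^ 3 = fps_const (216 * \<mu> ^ 3) * fps_X ^ 3"
    by (simp add: x power_mult_distrib fps_const_power numeral_fps_const flip: mult.assoc)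
  have mul: "(a + b * r) * (c + d * r) = (a * c + 6 * (b * d)) + (a * d + b * c) * r" for a b c d
    using r' by (simp add: algebra_simps)
  have uv2: "(1 / 2 + (-1 / 6) * r)\<^sup>2 = 5 / 12 + (-1 / 6) * r" "(1 / 2 + (-1 / 6) * r) * (5 + (-2) * r) = 9 / 2 + (-11 / 6) * r" "(5 + (-2) * r)\<^sup>2 = 49 + (-20) * r"
    unfolding power2_eq_square mul by simp_all
  have uv3: "(1 / 2 + (-1 / 6) * r) ^ 3 = 3 / 8 + (-11 / 72) * r" "(1 / 2 + (-1 / 6) * r)\<^sup>2 * (5 + (-2) * r) = 49 / 12 + (-5 / 3) * r"
    "(1 / 2 + (-1 / 6) * r) * (5 + (-2) * r)\<^sup>2 = 89 / 2 + (-109 / 6) * r" "(5 + (-2) * r) ^ 3 = 485 + (-198) * r"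
    unfolding power3_eq_cube power2_eq_square mul mult.assoc[symmetric] by simp_all
  have "(\<lambda>n. real_of_rat (fps_nth F n) / (32 / (3 * sqrt ((267 + 109 * r) * pi)) * (\<rho> ^ n / real n powr (7/2)))
          - (1 + (- (5 * (62 - 23 * r)) / 8) / real n + (35 * (4567 - 1858 * r) / 64) / real n ^ 2
             + (- (35 * (2608410 - 1064767 * r)) / 512) / real n ^ 3))
       \<in> O(\<lambda>n. 1 / real n ^ 4)"
  proof (rule coefficient_asymp[where c = "216 * \<mu> ^ 3" and k = \<kappa> and l = "- \<mu>" and a = "3 / 2" and b = "- 3"
        and u = "1 / 2 + (-1 / 6) * r" and v = "5 + (-2) * r"
        and ra = "23 * r / 4 - 57 / 4" and rb = "8765 / 32 - 1789 * r / 16" and rc = "2094779 * r / 1152 - 570127 / 128" and e = "- (rescale \<rho> B * bin (- \<mu>) (- 5))"])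
    show "\<rho> > 0" by fact
    show "216 * \<mu> ^ 3 > 0" using r by (simp add: \<mu>_def)
    show "32 / (3 * sqrt ((267 + 109 * r) * pi)) > 0" using r by simp
    show "\<bar>\<kappa>\<bar> < 1" and l: "\<bar>- \<mu>\<bar> < 1" using r by (simp_all add: \<kappa>_def \<mu>_def abs_if)
    show "edec (- (rescale \<rho> B * bin (- \<mu>) (- 5)))"
      unfolding B' x by (intro edec_uminus edec_mult edec_add edec_diff edec_power edec_const bin_edec_ev l)
    show "fps_const (216 * \<mu> ^ 3) * fps_X ^ 3 * rescale \<rho> (fps_deriv F) =
      2 * (bin \<kappa> (3 / 2) * bin (- \<mu>) (- 3) * bin 1 (3 / 2)) + - (rescale \<rho> B * bin (- \<mu>) (- 5))"
      using eq0 by (simp only: c g_def G_def)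
    define p where "p = (1 - \<kappa>) powr (3 / 2)"
    have p0: "p > 0" using r by (simp add: p_def \<kappa>_def)
    have p2: "p ^ 2 = (6 - 2 * r) ^ 3" unfolding p_def using r by (subst powr_3_2_square) (simp_all add: \<kappa>_def)
    have m: "\<mu> * \<rho> = 1" using \<mu> \<rho> by (simp add: field_simps)
    have m1: "(1 + \<mu>) * (2 * (r - 2)) = 1"
    proof -
      have "(1 + \<mu>) * (2 * (r - 2)) = (r * r - 4) / 2" by (simp add: \<mu>_def field_simps)
      thus ?thesis using r by simp
    qed
    have pos: "1 + \<mu> > 0" using r by (simp add: \<mu>_def field_simps)
    \<comment> \<open>The square root and \<open>p\<close> leave the field generated by
      \<open>r\<close>, but their squares lie in it, so the identity between nonnegative numbers is
      checked after squaring.\<close>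
    have s: "sqrt (267 + 109 * r) * (p * (2 * (r - 2)) ^ 3 * \<rho> ^ 2) = 1536"
    proof (rule power2_eq_imp_eq)
      have "(2 * (r - 2)) ^ 3 = 8 * (r - 2) * (10 - 4 * r)"
        by (simp add: power3_eq_cube algebra_simps r(1) r')
      moreover have "\<rho> ^ 2 = 4 * (10 + 4 * r)" by (simp add: \<rho>_def power2_eq_square algebra_simps r(1) r')
      ultimately have q: "(2 * (r - 2)) ^ 3 * \<rho> ^ 2 = 128 * (r - 2)"
        by (simp only:) (simp add: algebra_simps r(1) r')
      have "(sqrt (267 + 109 * r) * (p * (2 * (r - 2)) ^ 3 * \<rho> ^ 2)) ^ 2
          = (267 + 109 * r) * ((6 - 2 * r) ^ 3 * ((2 * (r - 2)) ^ 3 * \<rho> ^ 2) ^ 2)"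
        using r by (simp add: power_mult_distrib p2)
      also have "(6 - 2 * r) ^ 3 = 24 * (27 - 11 * r)" by (simp add: power3_eq_cube algebra_simps r(1) r')
      also have "(267 + 109 * r) * (24 * (27 - 11 * r) * ((2 * (r - 2)) ^ 3 * \<rho> ^ 2) ^ 2) = 1536 ^ 2"
        unfolding q by (simp add: power2_eq_square algebra_simps r(1) r')
      finally show "(sqrt (267 + 109 * r) * (p * (2 * (r - 2)) ^ 3 * \<rho> ^ 2)) ^ 2 = 1536 ^ 2" .
      show "0 \<le> sqrt (267 + 109 * r) * (p * (2 * (r - 2)) ^ 3 * \<rho> ^ 2)" using p0 r by simp
    qed simp
    have "(1 - - \<mu>) powr (- 3) = (2 * (r - 2)) ^ 3"
    proof -
      have "(1 - - \<mu>) powr (- 3) = inverse ((1 + \<mu>) ^ 3)"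
        using pos powr_neg_numeral[of "1 + \<mu>" "num.One"] by (simp add: powr_minus)
      also have "\<dots> = (2 * (r - 2)) ^ 3"
        using m1 pos by (intro inverse_unique) (simp flip: power_mult_distrib)
      finally show ?thesis .
    qed
    moreover have "32 / (3 * sqrt ((267 + 109 * r) * pi)) * (2 * \<rho> * (216 * \<mu> ^ 3) * sqrt pi) = 3 * (p * (2 * (r - 2)) ^ 3)"
    proof -
      define S where "S = sqrt (267 + 109 * r)"
      have S: "S \<noteq> 0" using r by (simp add: S_def)
      have "32 / (3 * sqrt ((267 + 109 * r) * pi)) * (2 * \<rho> * (216 * \<mu> ^ 3) * sqrt pi) = 4608 * \<rho> * \<mu> ^ 3 / S"
        by (simp add: real_sqrt_mult S_def)
      also have "4608 * \<rho> * \<mu> ^ 3 = S * (3 * (p * (2 * (r - 2)) ^ 3))"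
      proof -
        have "4608 * \<rho> * \<mu> ^ 3 = S * (3 * (p * q))" if "S * (p * q * \<rho> ^ 2) = 1536" for q
        proof -
          have "4608 * \<rho> * \<mu> ^ 3 = 3 * (S * (p * q * \<rho> ^ 2)) * \<rho> * \<mu> ^ 3" unfolding that by simp
          also have "\<dots> = S * (3 * (p * q)) * (\<mu> * \<rho>) ^ 3"
            by (simp only: power2_eq_square power3_eq_cube mult_ac)
          finally show ?thesis unfolding m by simp
        qed
        thus ?thesis using s unfolding S_def .
      qed
      finally show ?thesis using S by simp
    qed
    ultimately show "32 / (3 * sqrt ((267 + 109 * r) * pi)) * (2 * \<rho> * (216 * \<mu> ^ 3) * sqrt pi)
        = 3 * ((1 - \<kappa>) powr (3 / 2) * (1 - - \<mu>) powr (- 3))"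
      by (simp add: p_def)
    show "(1 / 2 + (-1 / 6) * r) * (1 - \<kappa>) = - \<kappa>"
      unfolding \<kappa>_def by (simp add: algebra_simps r(1) r')
    have "(5 + (-2) * r) * (r + 2) = r - 2" by (simp add: algebra_simps r(1) r')
    moreover have "1 - - \<mu> = (r + 2) / 4" by (simp add: \<mu>_def field_simps)
    ultimately show "(5 + (-2) * r) * (1 - - \<mu>) = - (- \<mu>)"
      by (simp only: times_divide_eq_right minus_minus) (simp add: \<mu>_def)
  qed ((simp only: uv3)?, (simp only: uv2)?, (linarith | simp add: algebra_simps r(1) r' add_divide_distrib diff_divide_distrib))+
  moreover have "1 + (- A / 8) / x + (B / 64) / x ^ 2 + (- C / 512) / x ^ 3 = 1 - A / (8 * x) + B / (64 * x ^ 2) - C / (512 * x ^ 3)"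
    for A B C x :: real by simp
  ultimately show ?thesis by (simp only: \<rho>_def r_def)
qed

theorem proposition8p5:
  shows
  "(let t = fps_X :: rat fps; F = planar_limit coeffs1; G = fps_deriv F; f = fps_nth F in
     formal_potential coeffs1 = potential1 \<and>
     - 2*t + 13*t^2 + 16*t^3 + 2*(1 - 9*t + 3*t^2 + 45*t^3 + 32*t^4) * G
       + 64*t^3*(1 + t)^2 * G^2 = 0 \<and>
     t*(8 + 7*t) - 2*(3 - 4*t - 21*t^2 - 14*t^3) * fps_deriv F
       - 2*t*(1 - 5*t - 13*t^2 - 7*t^3) * fps_deriv (fps_deriv F) = 0 \<and>
     fps_nth F 0 = 0 \<and> fps_nth (fps_deriv F) 0 = 0 \<and>
     (\<forall>k. let n = of_nat k :: rat in
        49*n^2*(1 + n) * f k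
        + 7*(1 + n)^2*(32 + 21*n) * f (k+1)
        + (2 + n)*(544 + 543*n + 139*n^2) * f (k+2)
        + (3 + n)*(224 + 157*n + 33*n^2) * f (k+3)
        - 8*(2 + n)*(4 + n)*(6 + n) * f (k+4) = 0) \<and>
     f 0 = 0 \<and> f 1 = 0 \<and> f 2 = 1/2 \<and> f 3 = 5/6 \<and>
     (\<lambda>n. real_of_rat (f n)
            / (147/512 * sqrt (7 / (2*pi)) * (7 ^ n / real n powr (7/2)))
          - (1 - 105 / (32 * real n) + 16065 / (2048 * real n ^ 2)
               - 1109115 / (65536 * real n ^ 3)))
       \<in> O(\<lambda>n. 1 / real n ^ 4))
   \<and>
   (let t = fps_X :: rat fps; F = planar_limit coeffs2; G = fps_deriv F; f = fps_nth F in
     formal_potential coeffs2 = potential2 \<and>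
     1 - 13*t + 22*t^2 - 9*t^3 - t^4 + (- 2 + 32*t - 108*t^2 + 76*t^3 + 2*t^4) * G
       - 108*t^3 * G^2 = 0 \<and>
     3 - 5*t + t^2 + t^3 - 2*(3 - 17*t + 5*t^2 + t^3) * fps_deriv F
       - 2*t*(1 - 11*t + 11*t^2 - t^3) * fps_deriv (fps_deriv F) = 0 \<and>
     fps_nth F 0 = 0 \<and> fps_nth (fps_deriv F) 0 = 1/2 \<and>
     (\<forall>k. let n = of_nat k :: rat in
        (n - 2)*(n - 1)*n * f k
        - 2*(n - 1)*(n + 1)*(2 + 5*n) * f (k+1)
        - (2 + n)*(44 + 25*n + 5*n^2) * f (k+2)
        + 4*(3 + n)*(116 + 91*n + 17*n^2) * f (k+3)
        - (4 + n)*(1326 + 701*n + 89*n^2) * f (k+4)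
        + 2*(5 + n)*(6 + n)*(85 + 19*n) * f (k+5)
        - 3*(5 + n)*(6 + n)*(8 + n) * f (k+6) = 0) \<and>
     f 0 = 0 \<and> f 1 = 1/2 \<and> f 2 = 3/4 \<and> f 3 = 8/3 \<and> f 4 = 12 \<and> f 5 = 312/5 \<and>
     (\<lambda>n. real_of_rat (f n)
            / (2 / (3 * sqrt pi) * root 4 (2/3)
                * ((5 + 2 * sqrt 6) ^ n / real n powr (7/2)))
          - (1 - 45 * sqrt 6 / (32 * real n) + 8435 / (1024 * real n ^ 2)
               - 238805 * sqrt 6 / (32768 * real n ^ 3)))
       \<in> O(\<lambda>n. 1 / real n ^ 4))
   \<and>
   (let t = fps_X :: rat fps; F = planar_limit coeffs3; G = fps_deriv F; f = fps_nth F in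
     formal_potential coeffs3 = potential3 \<and>
     - 2*t + 11*t^2 + 65*t^3 + 107*t^4 + 81*t^5 + 27*t^6
       + (2 - 20*t - 22*t^2 + 184*t^3 + 560*t^4 + 700*t^5 + 432*t^6 + 108*t^7) * G
       + (108*t^3 + 540*t^4 + 1080*t^5 + 1080*t^6 + 540*t^7 + 108*t^8) * G^2 = 0 \<and>
     - 8*t - 35*t^2 - 44*t^3 - 16*t^4
       - 6*(- 1 + 15*t^2 + 34*t^3 + 28*t^4 + 8*t^5) * fps_deriv F
       - 2*(- t + 5*t^2 + 29*t^3 + 47*t^4 + 32*t^5 + 8*t^6) * fps_deriv (fps_deriv F) = 0 \<and>
     fps_nth F 0 = 0 \<and> fps_nth (fps_deriv F) 0 = 0 \<and>
     (\<forall>k. let n = of_nat k :: rat in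
        128*n^2*(2 + n) * f k
        + 32*(1 + n)*(66 + 97*n + 27*n^2) * f (k+1)
        + 8*(2 + n)*(1836 + 1568*n + 305*n^2) * f (k+2)
        + 4*(3 + n)*(9972 + 6193*n + 929*n^2) * f (k+3)
        + (4 + n)*(54276 + 26661*n + 3257*n^2) * f (k+4)
        + (5 + n)*(38220 + 15479*n + 1595*n^2) * f (k+5)
        + 3*(6 + n)*(3972 + 1349*n + 121*n^2) * f (k+6)
        + 5*(7 + n)*(36 + 5*n + n^2) * f (k+7)
        - 8*(6 + n)*(8 + n)*(10 + n) * f (k+8) = 0) \<and>
     f 0 = 0 \<and> f 1 = 0 \<and> f 2 = 1/2 \<and> f 3 = 3/2 \<and> f 4 = 47/8 \<and> f 5 = 139/5 \<and>
     f 6 = 430/3 \<and> f 7 = 11175/14 \<and>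
     (\<lambda>n. real_of_rat (f n)
            / (32 / (3 * sqrt ((267 + 109 * sqrt 6) * pi))
                * ((4 + 2 * sqrt 6) ^ n / real n powr (7/2)))
          - (1 - 5 * (62 - 23 * sqrt 6) / (8 * real n)
               + 35 * (4567 - 1858 * sqrt 6) / (64 * real n ^ 2)
               - 35 * (2608410 - 1064767 * sqrt 6) / (512 * real n ^ 3)))
       \<in> O(\<lambda>n. 1 / real n ^ 4))"
proof -
  have nth: "fps_nth F (Suc m) = fps_nth (fps_deriv F) m / of_nat (Suc m)" for F :: "rat fps" and m
    by (simp add: fps_deriv_nth field_simps del: of_nat_Suc)
  have 1: "(let t = fps_X :: rat fps; F = planar_limit coeffs1; G = fps_deriv F; f = fps_nth F in
     formal_potential coeffs1 = potential1 \<and>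
     - 2*t + 13*t^2 + 16*t^3 + 2*(1 - 9*t + 3*t^2 + 45*t^3 + 32*t^4) * G
       + 64*t^3*(1 + t)^2 * G^2 = 0 \<and>
     t*(8 + 7*t) - 2*(3 - 4*t - 21*t^2 - 14*t^3) * fps_deriv F
       - 2*t*(1 - 5*t - 13*t^2 - 7*t^3) * fps_deriv (fps_deriv F) = 0 \<and>
     fps_nth F 0 = 0 \<and> fps_nth (fps_deriv F) 0 = 0 \<and>
     (\<forall>k. let n = of_nat k :: rat in
        49*n^2*(1 + n) * f k
        + 7*(1 + n)^2*(32 + 21*n) * f (k+1)
        + (2 + n)*(544 + 543*n + 139*n^2) * f (k+2)
        + (3 + n)*(224 + 157*n + 33*n^2) * f (k+3)
        - 8*(2 + n)*(4 + n)*(6 + n) * f (k+4) = 0) \<and>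
     f 0 = 0 \<and> f 1 = 0 \<and> f 2 = 1/2 \<and> f 3 = 5/6 \<and>
     (\<lambda>n. real_of_rat (f n)
            / (147/512 * sqrt (7 / (2*pi)) * (7 ^ n / real n powr (7/2)))
          - (1 - 105 / (32 * real n) + 16065 / (2048 * real n ^ 2)
               - 1109115 / (65536 * real n ^ 3)))
       \<in> O(\<lambda>n. 1 / real n ^ 4))"
  proof -
    define F where "F = planar_limit coeffs1"
    note quad = planar_quadratic1[folded F_def]
    note ode = ode1[OF quad]
    note init = ode1_initial[OF ode]
    have f0: "fps_nth F 0 = 0" unfolding F_def by (rule planar_limit_nth_0[OF _ coeffs1_eq]) simp
    have f: "fps_nth F 1 = 0" "fps_nth F 2 = 1/2" "fps_nth F 3 = 5/6"
      using nth[of F 0] nth[of F 1] nth[of F 2] init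
      by (simp_all add: eval_nat_numeral)
    show ?thesis
      unfolding Let_def F_def[symmetric]
      by (intro conjI allI formal_potential1 quad ode f0 init(1) ode1_recurrence[OF ode] f coefficient_asymp1[OF discriminant1[OF quad]])
  qed
  have 2: "(let t = fps_X :: rat fps; F = planar_limit coeffs2; G = fps_deriv F; f = fps_nth F in
     formal_potential coeffs2 = potential2 \<and>
     1 - 13*t + 22*t^2 - 9*t^3 - t^4 + (- 2 + 32*t - 108*t^2 + 76*t^3 + 2*t^4) * G
       - 108*t^3 * G^2 = 0 \<and>
     3 - 5*t + t^2 + t^3 - 2*(3 - 17*t + 5*t^2 + t^3) * fps_deriv F
       - 2*t*(1 - 11*t + 11*t^2 - t^3) * fps_deriv (fps_deriv F) = 0 \<and>
     fps_nth F 0 = 0 \<and> fps_nth (fps_deriv F) 0 = 1/2 \<and>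
     (\<forall>k. let n = of_nat k :: rat in
        (n - 2)*(n - 1)*n * f k
        - 2*(n - 1)*(n + 1)*(2 + 5*n) * f (k+1)
        - (2 + n)*(44 + 25*n + 5*n^2) * f (k+2)
        + 4*(3 + n)*(116 + 91*n + 17*n^2) * f (k+3)
        - (4 + n)*(1326 + 701*n + 89*n^2) * f (k+4)
        + 2*(5 + n)*(6 + n)*(85 + 19*n) * f (k+5)
        - 3*(5 + n)*(6 + n)*(8 + n) * f (k+6) = 0) \<and>
     f 0 = 0 \<and> f 1 = 1/2 \<and> f 2 = 3/4 \<and> f 3 = 8/3 \<and> f 4 = 12 \<and> f 5 = 312/5 \<and>
     (\<lambda>n. real_of_rat (f n)
            / (2 / (3 * sqrt pi) * root 4 (2/3)
                * ((5 + 2 * sqrt 6) ^ n / real n powr (7/2)))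
          - (1 - 45 * sqrt 6 / (32 * real n) + 8435 / (1024 * real n ^ 2)
               - 238805 * sqrt 6 / (32768 * real n ^ 3)))
       \<in> O(\<lambda>n. 1 / real n ^ 4))"
  proof -
    define F where "F = planar_limit coeffs2"
    note quad = planar_quadratic2[folded F_def]
    note ode = ode2[OF quad]
    note init = ode2_initial[OF ode]
    have f0: "fps_nth F 0 = 0" unfolding F_def by (rule planar_limit_nth_0[OF _ coeffs2_eq]) simp
    have f: "fps_nth F 1 = 1/2" "fps_nth F 2 = 3/4" "fps_nth F 3 = 8/3" "fps_nth F 4 = 12" "fps_nth F 5 = 312/5"
      using nth[of F 0] nth[of F 1] nth[of F 2] nth[of F 3] nth[of F 4] init
      by (simp_all add: eval_nat_numeral)
    show ?thesis
      unfolding Let_def F_def[symmetric]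
      by (intro conjI allI formal_potential2 quad ode f0 init(1) ode2_recurrence[OF ode] f coefficient_asymp2[OF discriminant2[OF quad]])
  qed
  have 3: "(let t = fps_X :: rat fps; F = planar_limit coeffs3; G = fps_deriv F; f = fps_nth F in
     formal_potential coeffs3 = potential3 \<and>
     - 2*t + 11*t^2 + 65*t^3 + 107*t^4 + 81*t^5 + 27*t^6
       + (2 - 20*t - 22*t^2 + 184*t^3 + 560*t^4 + 700*t^5 + 432*t^6 + 108*t^7) * G
       + (108*t^3 + 540*t^4 + 1080*t^5 + 1080*t^6 + 540*t^7 + 108*t^8) * G^2 = 0 \<and>
     - 8*t - 35*t^2 - 44*t^3 - 16*t^4
       - 6*(- 1 + 15*t^2 + 34*t^3 + 28*t^4 + 8*t^5) * fps_deriv F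
       - 2*(- t + 5*t^2 + 29*t^3 + 47*t^4 + 32*t^5 + 8*t^6) * fps_deriv (fps_deriv F) = 0 \<and>
     fps_nth F 0 = 0 \<and> fps_nth (fps_deriv F) 0 = 0 \<and>
     (\<forall>k. let n = of_nat k :: rat in
        128*n^2*(2 + n) * f k
        + 32*(1 + n)*(66 + 97*n + 27*n^2) * f (k+1)
        + 8*(2 + n)*(1836 + 1568*n + 305*n^2) * f (k+2)
        + 4*(3 + n)*(9972 + 6193*n + 929*n^2) * f (k+3)
        + (4 + n)*(54276 + 26661*n + 3257*n^2) * f (k+4)
        + (5 + n)*(38220 + 15479*n + 1595*n^2) * f (k+5)
        + 3*(6 + n)*(3972 + 1349*n + 121*n^2) * f (k+6)
        + 5*(7 + n)*(36 + 5*n + n^2) * f (k+7)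
        - 8*(6 + n)*(8 + n)*(10 + n) * f (k+8) = 0) \<and>
     f 0 = 0 \<and> f 1 = 0 \<and> f 2 = 1/2 \<and> f 3 = 3/2 \<and> f 4 = 47/8 \<and> f 5 = 139/5 \<and>
     f 6 = 430/3 \<and> f 7 = 11175/14 \<and>
     (\<lambda>n. real_of_rat (f n)
            / (32 / (3 * sqrt ((267 + 109 * sqrt 6) * pi))
                * ((4 + 2 * sqrt 6) ^ n / real n powr (7/2)))
          - (1 - 5 * (62 - 23 * sqrt 6) / (8 * real n)
               + 35 * (4567 - 1858 * sqrt 6) / (64 * real n ^ 2)
               - 35 * (2608410 - 1064767 * sqrt 6) / (512 * real n ^ 3)))
       \<in> O(\<lambda>n. 1 / real n ^ 4))"
  proof -
    define F where "F = planar_limit coeffs3"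
    note quad = planar_quadratic3[folded F_def]
    note ode = ode3[OF quad]
    note init = ode3_initial[OF ode]
    have f0: "fps_nth F 0 = 0" unfolding F_def by (rule planar_limit_nth_0[OF _ coeffs3_eq]) simp
    have f: "fps_nth F 1 = 0" "fps_nth F 2 = 1/2" "fps_nth F 3 = 3/2" "fps_nth F 4 = 47/8" "fps_nth F 5 = 139/5" "fps_nth F 6 = 430/3" "fps_nth F 7 = 11175/14"
      using nth[of F 0] nth[of F 1] nth[of F 2] nth[of F 3] nth[of F 4] nth[of F 5] nth[of F 6] init
      by (simp_all add: eval_nat_numeral)
    show ?thesis
      unfolding Let_def F_def[symmetric]
      by (intro conjI allI formal_potential3 quad ode f0 init(1) ode3_recurrence[OF ode] f coefficient_asymp3[OF discriminant3[OF quad]])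
  qed
  show ?thesis by (intro conjI 1 2 3)
qed

end
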